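(* Let $(Q_{h,\Delta t},r_{h,\Delta t})$ be the piecewise constant interpolations (defined in the context) of the approximations computed by the finite difference scheme described in the context. Then for every sequence $(h_m,\Delta t_m)$ of admissible mesh sizes with $h_m,\Delta t_m\to0$ there is a subsequence (not relabeled) and a weak solution $(Q,r)$ of the reformulated system on $[0,T]\times\Omega$, $\Omega=[0,1]^3$, in the sense defined in the context, such that $Q_{h_m,\Delta t_m}\to Q$ in $L^2([0,T]\times\Omega)$ and $r_{h_m,\Delta t_m}\overset{*}{\rightharpoonup}r$ in $L^\infty(0,T;L^2(\Omega))$.
   Context: Parameters: $a,b\in\mathbb{R}$, $c,L_1,L_2,L_3,M>0$, and $A_0>0$ such that $\inf\{\frac a2\operatorname{tr}(Q^2)-\frac b3\operatorname{tr}(Q^3)+\frac c4(\operatorname{tr}(Q^2))^2+A_0:\ Q\in\mathbb{R}^{3\times3}\text{ symmetric}\}>0$. For symmetric $Q\in\mathbb{R}^{3\times3}$ let $r(Q)=\sqrt{2(\frac a2\operatorname{tr}(Q^2)-\frac b3\operatorname{tr}(Q^3)+\frac c4(\operatorname{tr}(Q^2))^2+A_0)}$, $S(Q)=aQ-b\big(Q^2-\frac13\operatorname{tr}(Q^2)I\big)+c\operatorname{tr}(Q^2)Q$, $P(Q)=S(Q)/r(Q)$. For matrices, $A:B=\sum_{i,j}A_{ij}B_{ij}$, $|A|_F=\sqrt{A:A}$. Grid: $N\in\mathbb{N}$, $h=1/(N+1)$, grid points $x_{ijk}=(ih,jh,kh)$. A grid function is a family $f=(f_{ijk})_{(i,j,k)\in\mathbb{Z}^3}$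 of scalars or real $3\times3$ matrices; it satisfies the boundary conditions if $f_{ijk}=0$ whenever $(i,j,k)\notin\{1,\dots,N\}^3$. Difference operators: $D^\pm_1f_{ijk}=\pm(f_{i\pm1,j,k}-f_{ijk})/h$, $D^c_1f_{ijk}=(f_{i+1,j,k}-f_{i-1,j,k})/(2h)$, analogously $D^\pm_2,D^c_2$ (shifting $j$), $D^\pm_3,D^c_3$ (shifting $k$). $\Delta_hf=\sum_{\alpha=1}^3D^-_\alpha D^+_\alpha f$, and $\alpha_h(Q)_{ws}=\sum_{\beta=1}^3\big[D^c_wD^c_\beta Q_{s\beta}+D^c_sD^c_\beta Q_{w\beta}\big]-\frac23\sum_{\beta,\gamma=1}^3D^c_\beta D^c_\gamma Q_{\beta\gamma}\delta_{ws}$. Scheme: $Q_0\in H^1(\Omega)^{3\times3}$ has zero boundary trace and takes values in symmetric trace-free matrices; $r_0=r(Q_0)$; $T>0$, $N_T\in\mathbb{N}$, $\Delta t=T/N_T$ (admissible mesh sizes are such pairs $h=1/(N+1)$, $\Delta t=T/N_T$). Let $C_{ijk}=[x_i-\frac h2,x_i+\frac h2)\times[y_j-\frac h2,y_j+\frac h2)\times[z_k-\frac h2,z_k+\frac h2)$, $x_{ijk}=(x_i,y_j,z_k)$. Initial data: $Q^0_{ijk}=h^{-3}\int_{C_{ijk}}Q_0$, $r^0_{ijk}=h^{-3}\int_{C_{ijk}}r(Q_0)$ for $(i,j,k)\in\{1,\dots,N\}^3$, zero otherwise; $Q^{-1}:=Q^0$. For $n\ge0$ let $\overline P^{n+\frac12}_{ijk}=\frac32P(Q^n_{ijk})-\frac12P(Q^{n-1}_{ijk})$,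 $f^{n+\frac12}=\frac12(f^{n+1}+f^n)$, and let $(Q^{n+1},r^{n+1})$ be the (unique) pair of grid functions satisfying the boundary conditions with, for all $(i,j,k)\in\{1,\dots,N\}^3$, $\frac{Q^{n+1}_{ijk}-Q^n_{ijk}}{\Delta t}=M\Big(L_1\Delta_hQ^{n+\frac12}_{ijk}-r^{n+\frac12}_{ijk}\overline P^{n+\frac12}_{ijk}+\frac{L_2+L_3}{2}\cdot\frac{\alpha_h(Q^{n+1})_{ijk}+\alpha_h(Q^n)_{ijk}}{2}\Big)$ and $r^{n+1}_{ijk}-r^n_{ijk}=\overline P^{n+\frac12}_{ijk}:(Q^{n+1}_{ijk}-Q^n_{ijk})$. Interpolations: $Q_{h,\Delta t}(t,x)=Q^n_{ijk}$ and $r_{h,\Delta t}(t,x)=r^n_{ijk}$ for $x\in C_{ijk}$, $t\in[n\Delta t,(n+1)\Delta t)$, $0\le n\le N_T-1$. Weak solution of the reformulated system: a pair $(Q,r)$, $Q:[0,T]\times\Omega\to\mathbb{R}^{3\times3}$ with symmetric trace-free values, $r:[0,T]\times\Omega\to\mathbb{R}$, $Q\in L^\infty(0,T;H^1(\Omega))$, $\partial_tQ\in L^2([0,T]\times\Omega)$, $r\in L^\infty(0,T;L^2(\Omega))$, such that for all smooth $\varphi:[0,T]\times\Omega\to\mathbb{R}^{3\times3}$ and $\phi:[0,T]\times\Omega\to\mathbb{R}$ compactly supported in $\Omega$ for every $t$: (i) $\int_0^T\!\!\int_\Omega Q:\partial_t\varphi-\int_\Omega Q(T):\varphi(T)+\int_\Omega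 Q_0:\varphi(0)=M\int_0^T\!\!\int_\Omega\Big(L_1\sum_{i,j}\nabla Q_{ij}\cdot\nabla\varphi_{ij}+\frac{L_2+L_3}{2}\sum_{i,j,k}\big(\partial_kQ_{jk}\partial_i\varphi_{ij}+\partial_kQ_{ik}\partial_j\varphi_{ij}-\frac23\partial_iQ_{ki}\partial_k\varphi_{jj}\big)\Big)+M\int_0^T\!\!\int_\Omega rP(Q):\varphi$; (ii) $\int_0^T\!\!\int_\Omega r\,\partial_t\phi-\int_\Omega r(T)\phi(T)+\int_\Omega r_0\phi(0)=-\int_0^T\!\!\int_\Omega P(Q):\partial_tQ\,\phi$; (iii) for a.e. $t\in[0,T]$: $\frac12\int_\Omega L_1|\nabla Q(t)|^2+(L_2+L_3)|\operatorname{div}Q(t)|^2+|r(t)|^2\le\frac12\int_\Omega L_1|\nabla Q_0|^2+(L_2+L_3)|\operatorname{div}Q_0|^2+|r_0|^2-M\int_0^t\!\!\int_\Omega|H|^2$, where $(\operatorname{div}Q)_j=\sum_i\partial_iQ_{ij}$, $|\nabla Q|^2=\sum_m|\partial_mQ|_F^2$, and $H=M^{-1}\partial_tQ$ (the distributional value of $L_1\Delta Q+\frac{L_2+L_3}{2}\alpha(Q)-rP(Q)$). *)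

theory Defs
  imports "HOL-Analysis.Analysis"
begin

type_synonym mat3 = "real^3^3"
type_synonym pt = "real^3"
type_synonym idx = "int^3"

definition frob :: "mat3 \<Rightarrow> mat3 \<Rightarrow> real" where
  "frob A B = (\<Sum>i\<in>UNIV. \<Sum>j\<in>UNIV. A$i$j * B$i$j)"

definition fnorm :: "mat3 \<Rightarrow> real" where
  "fnorm A = sqrt (frob A A)"

definition sym_tf :: "mat3 \<Rightarrow> bool" where
  "sym_tf Q \<longleftrightarrow> transpose Q = Q \<and> trace Q = 0"

definition bulk :: "real \<Rightarrow> real \<Rightarrow> real \<Rightarrow> real \<Rightarrow> mat3 \<Rightarrow> real" where
  "bulk a b c A0 Q = a/2 * trace (Q ** Q) - b/3 * trace (Q ** Q ** Q)
     + c/4 * (trace (Q ** Q))^2 + A0"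

definition rfun :: "real \<Rightarrow> real \<Rightarrow> real \<Rightarrow> real \<Rightarrow> mat3 \<Rightarrow> real" where
  "rfun a b c A0 Q = sqrt (2 * bulk a b c A0 Q)"

definition Sfun :: "real \<Rightarrow> real \<Rightarrow> real \<Rightarrow> mat3 \<Rightarrow> mat3" where
  "Sfun a b c Q = a *\<^sub>R Q - b *\<^sub>R (Q ** Q - (trace (Q ** Q) / 3) *\<^sub>R mat 1)
     + (c * trace (Q ** Q)) *\<^sub>R Q"

definition Pfun :: "real \<Rightarrow> real \<Rightarrow> real \<Rightarrow> real \<Rightarrow> mat3 \<Rightarrow> mat3" where
  "Pfun a b c A0 Q = (1 / rfun a b c A0 Q) *\<^sub>R Sfun a b c Q"

definition mesh :: "nat \<Rightarrow> real" where
  "mesh N = 1 / (real N + 1)"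

definition in_grid :: "nat \<Rightarrow> idx \<Rightarrow> bool" where
  "in_grid N k \<longleftrightarrow> (\<forall>\<alpha>. 1 \<le> k$\<alpha> \<and> k$\<alpha> \<le> int N)"

definition bc :: "nat \<Rightarrow> (idx \<Rightarrow> 'a::zero) \<Rightarrow> bool" where
  "bc N f \<longleftrightarrow> (\<forall>k. \<not> in_grid N k \<longrightarrow> f k = 0)"

definition Dplus :: "real \<Rightarrow> 3 \<Rightarrow> (idx \<Rightarrow> 'a::real_vector) \<Rightarrow> idx \<Rightarrow> 'a" where
  "Dplus h \<alpha> f = (\<lambda>k. (1/h) *\<^sub>R (f (k + axis \<alpha> 1) - f k))"

definition Dminus :: "real \<Rightarrow> 3 \<Rightarrow> (idx \<Rightarrow> 'a::real_vector) \<Rightarrow> idx \<Rightarrow> 'a" where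
  "Dminus h \<alpha> f = (\<lambda>k. (1/h) *\<^sub>R (f k - f (k - axis \<alpha> 1)))"

definition Dcent :: "real \<Rightarrow> 3 \<Rightarrow> (idx \<Rightarrow> 'a::real_vector) \<Rightarrow> idx \<Rightarrow> 'a" where
  "Dcent h \<alpha> f = (\<lambda>k. (1/(2*h)) *\<^sub>R (f (k + axis \<alpha> 1) - f (k - axis \<alpha> 1)))"

definition lap_h :: "real \<Rightarrow> (idx \<Rightarrow> 'a::real_vector) \<Rightarrow> idx \<Rightarrow> 'a" where
  "lap_h h f = (\<lambda>k. \<Sum>\<alpha>\<in>UNIV. Dminus h \<alpha> (Dplus h \<alpha> f) k)"

definition alpha_h :: "real \<Rightarrow> (idx \<Rightarrow> mat3) \<Rightarrow> idx \<Rightarrow> mat3" where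
  "alpha_h h Q = (\<lambda>k. \<chi> w s.
      (\<Sum>\<beta>\<in>UNIV. Dcent h w (Dcent h \<beta> (\<lambda>l. Q l $ s $ \<beta>)) k
                 + Dcent h s (Dcent h \<beta> (\<lambda>l. Q l $ w $ \<beta>)) k)
      - 2/3 * (\<Sum>\<beta>\<in>UNIV. \<Sum>\<gamma>\<in>UNIV. Dcent h \<beta> (Dcent h \<gamma> (\<lambda>l. Q l $ \<beta> $ \<gamma>)) k)
            * (if w = s then 1 else 0))"

definition Omega :: "pt set" where
  "Omega = cbox 0 1"

definition cell :: "real \<Rightarrow> idx \<Rightarrow> pt set" where
  "cell h k = {x. \<forall>\<alpha>. real_of_int (k$\<alpha>) * h - h/2 \<le> x$\<alpha> \<and> x$\<alpha> < real_of_int (k$\<alpha>) * h + h/2}"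

definition cell_index :: "real \<Rightarrow> pt \<Rightarrow> idx" where
  "cell_index h x = (\<chi> \<alpha>. \<lfloor>x$\<alpha> / h + 1/2\<rfloor>)"

definition Q_init :: "nat \<Rightarrow> (pt \<Rightarrow> mat3) \<Rightarrow> idx \<Rightarrow> mat3" where
  "Q_init N Q0 = (\<lambda>k. if in_grid N k
      then (1 / mesh N ^ 3) *\<^sub>R set_lebesgue_integral lborel (cell (mesh N) k) Q0 else 0)"

definition r_init :: "real \<Rightarrow> real \<Rightarrow> real \<Rightarrow> real \<Rightarrow> nat \<Rightarrow> (pt \<Rightarrow> mat3) \<Rightarrow> idx \<Rightarrow> real" where
  "r_init a b c A0 N Q0 = (\<lambda>k. if in_grid N k
      then (1 / mesh N ^ 3) * (LINT x:cell (mesh N) k|lborel. rfun a b c A0 (Q0 x)) else 0)"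

text \<open>One time step: (Qn, rn) is the new pair, computed from Qp = Q^(n-1), Qc = Q^n, rc = r^n.\<close>
definition step_eq ::
  "real \<Rightarrow> real \<Rightarrow> real \<Rightarrow> real \<Rightarrow> real \<Rightarrow> real \<Rightarrow> real \<Rightarrow> real \<Rightarrow> nat \<Rightarrow> real \<Rightarrow>
   (idx \<Rightarrow> mat3) \<Rightarrow> (idx \<Rightarrow> mat3) \<Rightarrow> (idx \<Rightarrow> real) \<Rightarrow> (idx \<Rightarrow> mat3) \<Rightarrow> (idx \<Rightarrow> real) \<Rightarrow> bool" where
  "step_eq a b c A0 L1 L2 L3 M N dt Qp Qc rc Qn rn \<longleftrightarrow>
     bc N Qn \<and> bc N rn \<and>
     (\<forall>k. in_grid N k \<longrightarrow>
        (let h = mesh N;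
             Pbar = (3/2) *\<^sub>R Pfun a b c A0 (Qc k) - (1/2) *\<^sub>R Pfun a b c A0 (Qp k)
         in (1/dt) *\<^sub>R (Qn k - Qc k) =
              M *\<^sub>R (L1 *\<^sub>R lap_h h (\<lambda>l. (1/2) *\<^sub>R (Qn l + Qc l)) k
                     - ((rn k + rc k) / 2) *\<^sub>R Pbar
                     + ((L2 + L3) / 2) *\<^sub>R ((1/2) *\<^sub>R (alpha_h h Qn k + alpha_h h Qc k)))
            \<and> rn k - rc k = frob Pbar (Qn k - Qc k)))"

text \<open>State after n steps: (Q^(n-1), Q^n, r^n), with Q^(-1) = Q^0.\<close>
primrec scheme_state ::
  "real \<Rightarrow> real \<Rightarrow> real \<Rightarrow> real \<Rightarrow> real \<Rightarrow> real \<Rightarrow> real \<Rightarrow> real \<Rightarrow> real \<Rightarrow> (pt \<Rightarrow> mat3) \<Rightarrow>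
   nat \<Rightarrow> nat \<Rightarrow> nat \<Rightarrow> (idx \<Rightarrow> mat3) \<times> (idx \<Rightarrow> mat3) \<times> (idx \<Rightarrow> real)" where
  "scheme_state a b c A0 L1 L2 L3 M T Q0 N NT 0 =
     (Q_init N Q0, Q_init N Q0, r_init a b c A0 N Q0)"
| "scheme_state a b c A0 L1 L2 L3 M T Q0 N NT (Suc n) =
     (case scheme_state a b c A0 L1 L2 L3 M T Q0 N NT n of (Qp, Qc, rc) \<Rightarrow>
        (let p = (THE p. step_eq a b c A0 L1 L2 L3 M N (T / real NT) Qp Qc rc (fst p) (snd p))
         in (Qc, fst p, snd p)))"

definition Q_seq where
  "Q_seq a b c A0 L1 L2 L3 M T Q0 N NT n = fst (snd (scheme_state a b c A0 L1 L2 L3 M T Q0 N NT n))"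

definition r_seq where
  "r_seq a b c A0 L1 L2 L3 M T Q0 N NT n = snd (snd (scheme_state a b c A0 L1 L2 L3 M T Q0 N NT n))"

definition Q_interp ::
  "real \<Rightarrow> real \<Rightarrow> real \<Rightarrow> real \<Rightarrow> real \<Rightarrow> real \<Rightarrow> real \<Rightarrow> real \<Rightarrow> real \<Rightarrow> (pt \<Rightarrow> mat3) \<Rightarrow>
   nat \<Rightarrow> nat \<Rightarrow> real \<Rightarrow> pt \<Rightarrow> mat3" where
  "Q_interp a b c A0 L1 L2 L3 M T Q0 N NT t x =
     Q_seq a b c A0 L1 L2 L3 M T Q0 N NT (nat \<lfloor>t / (T / real NT)\<rfloor>) (cell_index (mesh N) x)"

definition r_interp ::
  "real \<Rightarrow> real \<Rightarrow> real \<Rightarrow> real \<Rightarrow> real \<Rightarrow> real \<Rightarrow> real \<Rightarrow> real \<Rightarrow> real \<Rightarrow> (pt \<Rightarrow> mat3) \<Rightarrow>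
   nat \<Rightarrow> nat \<Rightarrow> real \<Rightarrow> pt \<Rightarrow> real" where
  "r_interp a b c A0 L1 L2 L3 M T Q0 N NT t x =
     r_seq a b c A0 L1 L2 L3 M T Q0 N NT (nat \<lfloor>t / (T / real NT)\<rfloor>) (cell_index (mesh N) x)"

fun Ck :: "nat \<Rightarrow> ('a::euclidean_space \<Rightarrow> 'b::real_normed_vector) \<Rightarrow> bool" where
  "Ck 0 f = continuous_on UNIV f"
| "Ck (Suc k) f = ((\<forall>x. f differentiable (at x)) \<and>
                    (\<forall>v\<in>Basis. Ck k (\<lambda>x. frechet_derivative f (at x) v)))"

definition smooth :: "('a::euclidean_space \<Rightarrow> 'b::real_normed_vector) \<Rightarrow> bool" where
  "smooth f \<longleftrightarrow> (\<forall>k. Ck k f)"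

definition pd_t :: "(real \<times> pt \<Rightarrow> 'b::real_normed_vector) \<Rightarrow> real \<times> pt \<Rightarrow> 'b" where
  "pd_t f z = frechet_derivative f (at z) (1, 0)"

definition pd_x :: "3 \<Rightarrow> (real \<times> pt \<Rightarrow> 'b::real_normed_vector) \<Rightarrow> real \<times> pt \<Rightarrow> 'b" where
  "pd_x \<alpha> f z = frechet_derivative f (at z) (0, axis \<alpha> 1)"

definition pd :: "3 \<Rightarrow> (pt \<Rightarrow> 'b::real_normed_vector) \<Rightarrow> pt \<Rightarrow> 'b" where
  "pd \<alpha> f x = frechet_derivative f (at x) (axis \<alpha> 1)"

abbreviation ST :: "(real \<times> pt) measure" where
  "ST \<equiv> lborel \<Otimes>\<^sub>M lborel"

definition test_fun :: "real \<Rightarrow> (real \<times> pt \<Rightarrow> 'b::real_normed_vector) \<Rightarrow> bool" where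
  "test_fun T \<phi> \<longleftrightarrow> smooth \<phi> \<and>
     (\<forall>t\<in>{0..T}. \<exists>K. compact K \<and> K \<subseteq> box 0 1 \<and> (\<forall>x. x \<notin> K \<longrightarrow> \<phi> (t, x) = 0))"

definition cc_test_ST :: "real \<Rightarrow> (real \<times> pt \<Rightarrow> real) \<Rightarrow> bool" where
  "cc_test_ST T \<psi> \<longleftrightarrow> smooth \<psi> \<and>
     (\<exists>K. compact K \<and> K \<subseteq> {0<..<T} \<times> box 0 1 \<and> (\<forall>z. z \<notin> K \<longrightarrow> \<psi> z = 0))"

definition cc_test :: "(pt \<Rightarrow> 'b::real_normed_vector) \<Rightarrow> bool" where
  "cc_test \<psi> \<longleftrightarrow> smooth \<psi> \<and>
     (\<exists>K. compact K \<and> K \<subseteq> box 0 1 \<and> (\<forall>x. x \<notin> K \<longrightarrow> \<psi> x = 0))"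

definition weak_dx :: "real \<Rightarrow> (real \<times> pt \<Rightarrow> mat3) \<Rightarrow> 3 \<Rightarrow> (real \<times> pt \<Rightarrow> mat3) \<Rightarrow> bool" where
  "weak_dx T Q \<alpha> G \<longleftrightarrow> (\<forall>\<psi>. cc_test_ST T \<psi> \<longrightarrow>
     set_lebesgue_integral ST ({0<..<T} \<times> box 0 1) (\<lambda>z. pd_x \<alpha> \<psi> z *\<^sub>R Q z)
     = - set_lebesgue_integral ST ({0<..<T} \<times> box 0 1) (\<lambda>z. \<psi> z *\<^sub>R G z))"

definition weak_dt :: "real \<Rightarrow> (real \<times> pt \<Rightarrow> mat3) \<Rightarrow> (real \<times> pt \<Rightarrow> mat3) \<Rightarrow> bool" where
  "weak_dt T Q G \<longleftrightarrow> (\<forall>\<psi>. cc_test_ST T \<psi> \<longrightarrow>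
     set_lebesgue_integral ST ({0<..<T} \<times> box 0 1) (\<lambda>z. pd_t \<psi> z *\<^sub>R Q z)
     = - set_lebesgue_integral ST ({0<..<T} \<times> box 0 1) (\<lambda>z. \<psi> z *\<^sub>R G z))"

definition weak_d :: "(pt \<Rightarrow> mat3) \<Rightarrow> 3 \<Rightarrow> (pt \<Rightarrow> mat3) \<Rightarrow> bool" where
  "weak_d f \<alpha> g \<longleftrightarrow> (\<forall>\<psi>::pt \<Rightarrow> real. cc_test \<psi> \<longrightarrow>
     set_lebesgue_integral lborel (box 0 1) (\<lambda>x. pd \<alpha> \<psi> x *\<^sub>R f x)
     = - set_lebesgue_integral lborel (box 0 1) (\<lambda>x. \<psi> x *\<^sub>R g x))"

definition H1 :: "(pt \<Rightarrow> mat3) \<Rightarrow> (3 \<Rightarrow> pt \<Rightarrow> mat3) \<Rightarrow> bool" where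
  "H1 f Df \<longleftrightarrow> set_borel_measurable lborel Omega f \<and>
     (\<integral>\<^sup>+x\<in>Omega. ennreal ((fnorm (f x))^2) \<partial>lborel) < \<infinity> \<and>
     (\<forall>\<alpha>. set_borel_measurable lborel Omega (Df \<alpha>) \<and>
          (\<integral>\<^sup>+x\<in>Omega. ennreal ((fnorm (Df \<alpha> x))^2) \<partial>lborel) < \<infinity> \<and>
          weak_d f \<alpha> (Df \<alpha>))"

text \<open>H^1 with zero boundary trace = H^1_0 = closure of C_c^infinity(interior Omega) in H^1.\<close>
definition H1_0 :: "(pt \<Rightarrow> mat3) \<Rightarrow> bool" where
  "H1_0 f \<longleftrightarrow> (\<exists>Df. H1 f Df \<and>
     (\<exists>\<psi>s::nat \<Rightarrow> pt \<Rightarrow> mat3. (\<forall>n. cc_test (\<psi>s n)) \<and>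
        (\<lambda>n. \<integral>\<^sup>+x\<in>Omega. ennreal ((fnorm (f x - \<psi>s n x))^2
              + (\<Sum>\<alpha>\<in>UNIV. (fnorm (Df \<alpha> x - pd \<alpha> (\<psi>s n) x))^2)) \<partial>lborel) \<longlonglongrightarrow> 0))"

definition Linf_L2 :: "real \<Rightarrow> (real \<times> pt \<Rightarrow> real) \<Rightarrow> bool" where
  "Linf_L2 T r \<longleftrightarrow> set_borel_measurable ST ({0..T} \<times> Omega) r \<and>
     (\<exists>C. AE t in lborel. t \<in> {0..T} \<longrightarrow>
        (\<integral>\<^sup>+x\<in>Omega. ennreal ((r (t, x))^2) \<partial>lborel) \<le> ennreal C)"

text \<open>L^1(0,T; L^2(Omega)) for scalar functions (predual of L^infinity(0,T;L^2)).\<close>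
definition L1_L2 :: "real \<Rightarrow> (real \<times> pt \<Rightarrow> real) \<Rightarrow> bool" where
  "L1_L2 T g \<longleftrightarrow> set_borel_measurable ST ({0..T} \<times> Omega) g \<and>
     (AE t in lborel. t \<in> {0..T} \<longrightarrow> set_integrable lborel Omega (\<lambda>x. (g (t, x))^2)) \<and>
     set_integrable lborel {0..T} (\<lambda>t. sqrt (LINT x:Omega|lborel. (g (t, x))^2))"

definition weak_star_Linf_L2 ::
  "real \<Rightarrow> (nat \<Rightarrow> real \<Rightarrow> pt \<Rightarrow> real) \<Rightarrow> (real \<Rightarrow> pt \<Rightarrow> real) \<Rightarrow> bool" where
  "weak_star_Linf_L2 T rs r \<longleftrightarrow> (\<forall>g. L1_L2 T g \<longrightarrow>
     (\<lambda>m. LINT z:{0..T} \<times> Omega|ST. rs m (fst z) (snd z) * g z)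
       \<longlonglongrightarrow> (LINT z:{0..T} \<times> Omega|ST. r (fst z) (snd z) * g z))"

definition weak_sol ::
  "real \<Rightarrow> real \<Rightarrow> real \<Rightarrow> real \<Rightarrow> real \<Rightarrow> real \<Rightarrow> real \<Rightarrow> real \<Rightarrow> real \<Rightarrow> (pt \<Rightarrow> mat3) \<Rightarrow>
   (real \<Rightarrow> pt \<Rightarrow> mat3) \<Rightarrow> (real \<Rightarrow> pt \<Rightarrow> real) \<Rightarrow> bool" where
  "weak_sol a b c A0 L1 L2 L3 M T Q0 Q r \<longleftrightarrow>
   (let D = {0..T} \<times> Omega; Qz = (\<lambda>z. Q (fst z) (snd z)); rz = (\<lambda>z. r (fst z) (snd z));
        r0 = (\<lambda>x. rfun a b c A0 (Q0 x)); P = Pfun a b c A0 in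
   (\<forall>t\<in>{0..T}. \<forall>x\<in>Omega. sym_tf (Q t x)) \<and>
   (\<exists>DQ Qt DQ0.
     \<comment> \<open>Q in L^infinity(0,T;H^1(Omega)) with spatial weak gradient DQ\<close>
     set_borel_measurable ST D Qz \<and>
     (\<forall>\<alpha>. set_borel_measurable ST D (DQ \<alpha>) \<and> weak_dx T Qz \<alpha> (DQ \<alpha>)) \<and>
     (\<exists>C. AE t in lborel. t \<in> {0..T} \<longrightarrow>
        (\<integral>\<^sup>+x\<in>Omega. ennreal ((fnorm (Q t x))^2 + (\<Sum>\<alpha>\<in>UNIV. (fnorm (DQ \<alpha> (t, x)))^2)) \<partial>lborel)
          \<le> ennreal C) \<and>
     \<comment> \<open>partial_t Q in L^2((0,T) x Omega)\<close>
     set_borel_measurable ST D Qt \<and> weak_dt T Qz Qt \<and>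
     (\<integral>\<^sup>+z\<in>D. ennreal ((fnorm (Qt z))^2) \<partial>ST) < \<infinity> \<and>
     \<comment> \<open>r in L^infinity(0,T;L^2(Omega))\<close>
     Linf_L2 T rz \<and>
     \<comment> \<open>DQ0 is the weak gradient of Q0\<close>
     (\<forall>\<alpha>. weak_d Q0 \<alpha> (DQ0 \<alpha>)) \<and>
     \<comment> \<open>(i)\<close>
     (\<forall>\<phi>::real \<times> pt \<Rightarrow> mat3. test_fun T \<phi> \<longrightarrow>
        (LINT z:D|ST. frob (Qz z) (pd_t \<phi> z))
        - (LINT x:Omega|lborel. frob (Q T x) (\<phi> (T, x)))
        + (LINT x:Omega|lborel. frob (Q0 x) (\<phi> (0, x)))
        = M * (LINT z:D|ST.
              L1 * (\<Sum>i\<in>UNIV. \<Sum>j\<in>UNIV. \<Sum>m\<in>UNIV. DQ m z $ i $ j * pd_x m \<phi> z $ i $ j)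
              + (L2 + L3) / 2 * (\<Sum>i\<in>UNIV. \<Sum>j\<in>UNIV. \<Sum>k\<in>UNIV.
                    DQ k z $ j $ k * pd_x i \<phi> z $ i $ j
                  + DQ k z $ i $ k * pd_x j \<phi> z $ i $ j
                  - 2/3 * DQ i z $ k $ i * pd_x k \<phi> z $ j $ j))
          + M * (LINT z:D|ST. rz z * frob (P (Qz z)) (\<phi> z))) \<and>
     \<comment> \<open>(ii)\<close>
     (\<forall>\<phi>::real \<times> pt \<Rightarrow> real. test_fun T \<phi> \<longrightarrow>
        (LINT z:D|ST. rz z * pd_t \<phi> z)
        - (LINT x:Omega|lborel. r T x * \<phi> (T, x))
        + (LINT x:Omega|lborel. r0 x * \<phi> (0, x))
        = - (LINT z:D|ST. frob (P (Qz z)) (Qt z) * \<phi> z)) \<and>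
     \<comment> \<open>(iii) energy inequality, H = M^-1 partial_t Q\<close>
     (AE t in lborel. t \<in> {0..T} \<longrightarrow>
        1/2 * (LINT x:Omega|lborel.
            L1 * (\<Sum>m\<in>UNIV. (fnorm (DQ m (t, x)))^2)
            + (L2 + L3) * (\<Sum>j\<in>UNIV. (\<Sum>i\<in>UNIV. DQ i (t, x) $ i $ j)^2)
            + (r t x)^2)
        \<le> 1/2 * (LINT x:Omega|lborel.
            L1 * (\<Sum>m\<in>UNIV. (fnorm (DQ0 m x))^2)
            + (L2 + L3) * (\<Sum>j\<in>UNIV. (\<Sum>i\<in>UNIV. DQ0 i x $ i $ j)^2)
            + (r0 x)^2)
          - M * (LINT z:{0..t} \<times> Omega|ST. (fnorm ((1/M) *\<^sub>R Qt z))^2))))"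

end

theory Submission
  imports Defs "HOL-Library.Diagonal_Subsequence"
begin

text \<open>
 Testing the scheme with the discrete time derivative gives an exact discrete energy balance. It shows
 that the linear system of a time step is uniquely solvable, and it bounds \<open>r\<close>, the discrete gradient and the
 divergence of \<open>Q\<close> uniformly in time and the discrete time derivative of \<open>Q\<close> in \<open>L\<^sup>2\<close>. Hence all these quantities
 converge weakly along a subsequence, and the resulting bounds on translations in time and space make the
 convergence of \<open>Q\<close> strong. Since \<open>r(Q)\<close> grows like \<open>|Q|\<^sup>2\<close>, the map \<open>P\<close> is Lipschitz continuous on symmetric
 matrices, so the extrapolated \<open>P\<close> converges strongly as well. After summation by parts against sampled test
 functions every term is a product of a weakly and a strongly convergent sequence. The energy inequality
 follows from weak lower semicontinuity on slabs \<open>A \<times> \<Omega>\<close> with \<open>A \<subseteq> [s, T]\<close>, where \<open>A\<close> and \<open>s\<close> vary; the initial energies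
 converge because the averaged difference quotients of \<open>Q\<^sub>0\<close> converge strongly and \<open>r(Q\<^sub>0)\<close> is square integrable
 by a Ladyzhenskaya inequality. The values \<open>Q(T)\<close> and \<open>r(T)\<close> are defined as the weak limits of the discrete
 solution at the final time. The scheme is continued up to time \<open>3T\<close>, so that averages over short later times make sense.
\<close>

text \<open>Every field is treated through scalar components extended by zero to the whole space. A
  grid function is identified with its step function: index shifts become translations, and
  summation by parts is translation invariance of Lebesgue measure. Extension by zero agrees with
  the homogeneous boundary values, so compactness can be proved on the whole space. The boundary is
  felt only by the initial data, whose averages are set to zero off the grid; the resulting jump has
  a negligible discrete gradient because \<open>Q0\<close> has zero trace. The energy balance is
  exact only for symmetric trace-free \<open>Q\<close>: then the \<open>L2 + L3\<close> term is a
  difference of squared divergences. Invariance of this class under a step therefore comes before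
  solvability. Neither \<open>r\<close> nor the discrete gradient is known to converge strongly, so
  the energy passes to the limit as an inequality only; and as space-time limits say nothing about
  individual times, it does so after integration over sets of times.\<close>

abbreviation "ind \<equiv> indicat_real"
abbreviation "bm \<equiv> borel_measurable borel"
abbreviation "bmL \<equiv> borel_measurable lborel"

section \<open>Square integrable functions\<close>

definition l2 :: "'a measure \<Rightarrow> ('a \<Rightarrow> real) \<Rightarrow> bool" where
 "l2 M f \<longleftrightarrow> f \<in> borel_measurable M \<and> integrable M (\<lambda>x. (f x)^2)"

definition nrm :: "'a measure \<Rightarrow> ('a \<Rightarrow> real) \<Rightarrow> real" where
 "nrm M f = sqrt (\<integral>x. (f x)^2 \<partial>M)"

lemma l2_meas [measurable_dest]: "l2 M f \<Longrightarrow> f \<in> borel_measurable M"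
 and l2_int: "l2 M f \<Longrightarrow> integrable M (\<lambda>x. (f x)^2)"
 by (auto simp: l2_def)

lemma l2_mult_int:
 assumes "l2 M f" "l2 M g"
 shows "integrable M (\<lambda>x. f x * g x)"
proof (rule Bochner_Integration.integrable_bound[of M "\<lambda>x. (f x)^2 + (g x)^2"])
 show "integrable M (\<lambda>x. (f x)^2 + (g x)^2)" using assms by (simp add: l2_def)
 show "(\<lambda>x. f x * g x) \<in> borel_measurable M" using assms by (auto simp: l2_def)
 have "norm (u * v) \<le> norm (u^2 + v^2)" for u v :: real
  using sum_squares_bound[of "\<bar>u\<bar>" "\<bar>v\<bar>"] mult_nonneg_nonneg[of "\<bar>u\<bar>" "\<bar>v\<bar>"]
  by (simp add: abs_mult del: mult_nonneg_nonneg)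
 thus "AE x in M. norm (f x * g x) \<le> norm ((f x)^2 + (g x)^2)" by blast
qed

lemma l2_cmult: "l2 M f \<Longrightarrow> l2 M (\<lambda>x. c * f x)"
 by (auto simp: l2_def power_mult_distrib)

lemma l2_add:
 assumes "l2 M f" "l2 M g" shows "l2 M (\<lambda>x. f x + g x)"
proof -
 have "integrable M (\<lambda>x. (f x)^2 + (g x)^2 + 2 * (f x * g x))"
  using assms l2_mult_int[OF assms] by (auto simp: l2_def)
 thus ?thesis using assms by (auto simp: l2_def power2_sum algebra_simps)
qed

lemma l2_diff:
 assumes "l2 M f" "l2 M g" shows "l2 M (\<lambda>x. f x - g x)"
 using l2_add[OF assms(1) l2_cmult[OF assms(2), of "-1"]] by simp

lemma l2_zero [simp]: "l2 M (\<lambda>x. 0)"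
 by (simp add: l2_def)

lemma l2_sum: "(\<And>i. i \<in> I \<Longrightarrow> l2 M (f i)) \<Longrightarrow> l2 M (\<lambda>x. \<Sum>i\<in>I. f i x)"
 by (induction I rule: infinite_finite_induct) (auto intro: l2_add)

lemma l2_bound:
 assumes "l2 M g" "f \<in> borel_measurable M" "AE x in M. \<bar>f x\<bar> \<le> \<bar>g x\<bar>"
 shows "l2 M f"
 unfolding l2_def
proof
 show "integrable M (\<lambda>x. (f x)^2)"
  by (rule Bochner_Integration.integrable_bound[of M "\<lambda>x. (g x)^2"])
   (use assms in \<open>auto simp: l2_def abs_le_square_iff\<close>)
qed fact

lemma l2_mult_bounded:
 assumes "l2 M f" "w \<in> borel_measurable M" "\<And>x. \<bar>w x\<bar> \<le> K"
 shows "l2 M (\<lambda>x. w x * f x)"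
proof (rule l2_bound[OF l2_cmult[OF assms(1), of K]])
 have "\<bar>w x * f x\<bar> \<le> \<bar>K * f x\<bar>" for x
  using mult_right_mono[OF order_trans[OF assms(3) abs_ge_self], of "\<bar>f x\<bar>" x] by (simp add: abs_mult)
 thus "AE x in M. \<bar>w x * f x\<bar> \<le> \<bar>K * f x\<bar>" by simp
qed (use assms in \<open>auto simp: l2_def\<close>)

lemma l2_indicator: "A \<in> sets M \<Longrightarrow> l2 M f \<Longrightarrow> l2 M (\<lambda>x. indicator A x * f x)"
 by (rule l2_mult_bounded[where K = 1]) (auto split: split_indicator)

lemma l2_indicat:
 assumes "A \<in> sets M" "emeasure M A < \<infinity>" shows "l2 M (ind A)"
proof -
 have "(\<lambda>x. (ind A x)^2) = ind A" by (auto split: split_indicator)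
 thus ?thesis using assms by (auto simp: l2_def)
qed

lemma nrm_nonneg [simp]: "0 \<le> nrm M f"
 by (simp add: nrm_def)

lemma nrm_sq: "(nrm M f)^2 = (\<integral>x. (f x)^2 \<partial>M)"
 by (simp add: nrm_def)

lemma nrm_cmult: "nrm M (\<lambda>x. c * f x) = \<bar>c\<bar> * nrm M f"
 by (simp add: nrm_def power_mult_distrib real_sqrt_mult)

lemma nrm_commute: "nrm M (\<lambda>x. f x - g x) = nrm M (\<lambda>x. g x - f x)"
 by (simp add: nrm_def power2_commute)

lemma integral_sq_add:
 assumes "l2 M f" "l2 M g"
 shows "(\<integral>x. (f x + t * g x)^2 \<partial>M) = (\<integral>x. (f x)^2 \<partial>M) + 2 * t * (\<integral>x. f x * g x \<partial>M) + t^2 * (\<integral>x. (g x)^2 \<partial>M)"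
proof -
 have "(\<lambda>x. (f x + t * g x)^2) = (\<lambda>x. (f x)^2 + (2 * t) * (f x * g x) + t^2 * (g x)^2)"
  by (auto simp: power2_eq_square algebra_simps)
 thus ?thesis using assms l2_mult_int[OF assms] by (simp add: l2_def)
qed

text \<open>Evaluate at the minimiser \<open>-B/C\<close>; if \<open>C = 0\<close> the expression is
  affine in \<open>t\<close> and a nonzero \<open>B\<close> would make it negative somewhere.
  Besides Cauchy-Schwarz this serves \<open>l2_riesz\<close>, where \<open>A = 0\<close> forces the
  first variation \<open>B\<close> to vanish.\<close>

lemma quadratic_nonneg_discriminant:
 fixes A B C :: real
 assumes q: "\<And>t. 0 \<le> A + 2 * t * B + t^2 * C" and C: "0 \<le> C" shows "B^2 \<le> A * C"
proof (cases "C = 0")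
 case True
 thus ?thesis using q[of "-(A+1)/(2*B)"] by (cases "B = 0") (auto simp: field_simps)
next
 case False
 thus ?thesis using q[of "-B/C"] C by (simp add: field_simps power2_eq_square)
qed

lemma l2_cauchy_schwarz:
 assumes "l2 M f" "l2 M g"
 shows "\<bar>\<integral>x. f x * g x \<partial>M\<bar> \<le> nrm M f * nrm M g"
proof -
 have "(\<integral>x. f x * g x \<partial>M)^2 \<le> (\<integral>x. (f x)^2 \<partial>M) * (\<integral>x. (g x)^2 \<partial>M)"
  by (rule quadratic_nonneg_discriminant) (simp_all flip: integral_sq_add[OF assms])
 hence "sqrt ((\<integral>x. f x * g x \<partial>M)^2) \<le> sqrt ((\<integral>x. (f x)^2 \<partial>M) * (\<integral>x. (g x)^2 \<partial>M))"
  by (rule real_sqrt_le_mono)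
 thus ?thesis by (simp add: nrm_def real_sqrt_mult)
qed

lemma nrm_add_le:
 assumes "l2 M f" "l2 M g"
 shows "nrm M (\<lambda>x. f x + g x) \<le> nrm M f + nrm M g"
proof (rule power2_le_imp_le)
 have "(nrm M (\<lambda>x. f x + g x))^2 = (nrm M f)^2 + 2 * (\<integral>x. f x * g x \<partial>M) + (nrm M g)^2"
  using integral_sq_add[OF assms, of 1] by (simp add: nrm_sq)
 also have "\<dots> \<le> (nrm M f + nrm M g)^2"
  using l2_cauchy_schwarz[OF assms] by (simp add: power2_sum abs_le_iff)
 finally show "(nrm M (\<lambda>x. f x + g x))^2 \<le> (nrm M f + nrm M g)^2" .
qed simp

lemma nrm_diff_le:
 assumes "l2 M f" "l2 M g"
 shows "nrm M (\<lambda>x. f x - g x) \<le> nrm M f + nrm M g"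
 using nrm_add_le[OF assms(1) l2_cmult[OF assms(2), of "-1"]] nrm_cmult[of M "-1" g] by simp

lemma nrm_triangle:
 assumes "l2 M f" "l2 M g" "l2 M h"
 shows "nrm M (\<lambda>x. f x - h x) \<le> nrm M (\<lambda>x. f x - g x) + nrm M (\<lambda>x. g x - h x)"
 using nrm_add_le[OF l2_diff[OF assms(1,2)] l2_diff[OF assms(2,3)]] by simp

lemma nrm_sum_le:
 "(\<And>i. i \<in> I \<Longrightarrow> l2 M (f i)) \<Longrightarrow> nrm M (\<lambda>x. \<Sum>i\<in>I. f i x) \<le> (\<Sum>i\<in>I. nrm M (f i))"
proof (induction I rule: infinite_finite_induct)
 case (insert i I)
 thus ?case using nrm_add_le[of M "f i" "\<lambda>x. \<Sum>i\<in>I. f i x"] by (force intro: l2_sum)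
qed (auto simp: nrm_def)

lemma nrm_mono:
 assumes "l2 M g" "f \<in> borel_measurable M" "AE x in M. \<bar>f x\<bar> \<le> \<bar>g x\<bar>"
 shows "nrm M f \<le> nrm M g"
 unfolding nrm_def
 by (intro real_sqrt_le_mono integral_mono_AE l2_int l2_bound[OF assms] assms(1))
  (use assms(3) in \<open>auto simp: abs_le_square_iff\<close>)

lemma nrm_cong: "(\<And>x. x \<in> space M \<Longrightarrow> (f x)^2 = (g x)^2) \<Longrightarrow> nrm M f = nrm M g"
 unfolding nrm_def by (metis (mono_tags, lifting) Bochner_Integration.integral_cong)

lemma nrm_mult_bounded:
 assumes "l2 M f" "w \<in> borel_measurable M" "\<And>x. \<bar>w x\<bar> \<le> K"
 shows "nrm M (\<lambda>x. w x * f x) \<le> K * nrm M f"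
proof -
 have K: "0 \<le> K" using assms(3) abs_ge_zero order_trans by blast
 have "nrm M (\<lambda>x. w x * f x) \<le> nrm M (\<lambda>x. K * f x)"
  by (rule nrm_mono) (use assms K in \<open>auto intro: l2_cmult l2_meas simp: abs_mult mult_right_mono\<close>)
 thus ?thesis using K by (simp add: nrm_cmult)
qed

section \<open>Strong and weak convergence in \<open>L2\<close>\<close>

definition slim :: "'a measure \<Rightarrow> (nat \<Rightarrow> 'a \<Rightarrow> real) \<Rightarrow> ('a \<Rightarrow> real) \<Rightarrow> bool" where
 "slim M F f \<longleftrightarrow> (\<forall>m. l2 M (F m)) \<and> l2 M f \<and> (\<lambda>m. nrm M (\<lambda>x. F m x - f x)) \<longlonglongrightarrow> 0"

text \<open>The norm bound belongs to the notion because every product with a strongly convergent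
  factor uses it when passing to the limit.\<close>

definition wlim :: "'a measure \<Rightarrow> (nat \<Rightarrow> 'a \<Rightarrow> real) \<Rightarrow> ('a \<Rightarrow> real) \<Rightarrow> bool" where
 "wlim M F f \<longleftrightarrow> (\<forall>m. l2 M (F m)) \<and> l2 M f \<and> (\<exists>B. \<forall>m. nrm M (F m) \<le> B) \<and>
   (\<forall>g. l2 M g \<longrightarrow> (\<lambda>m. \<integral>x. F m x * g x \<partial>M) \<longlonglongrightarrow> (\<integral>x. f x * g x \<partial>M))"

lemma slimD: "slim M F f \<Longrightarrow> l2 M (F m)" "slim M F f \<Longrightarrow> l2 M f"
  "slim M F f \<Longrightarrow> (\<lambda>m. nrm M (\<lambda>x. F m x - f x)) \<longlonglongrightarrow> 0"
 by (auto simp: slim_def)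

lemma slim_diff_l2: "slim M F f \<Longrightarrow> l2 M (\<lambda>x. F m x - f x)"
 by (auto simp: slim_def intro: l2_diff)

lemma wlimD: "wlim M F f \<Longrightarrow> l2 M (F m)" "wlim M F f \<Longrightarrow> l2 M f"
  "wlim M F f \<Longrightarrow> l2 M g \<Longrightarrow> (\<lambda>m. \<integral>x. F m x * g x \<partial>M) \<longlonglongrightarrow> (\<integral>x. f x * g x \<partial>M)"
 by (auto simp: wlim_def)

lemma wlimI:
 assumes "\<And>m. l2 M (F m)" "l2 M f" "\<And>m. nrm M (F m) \<le> B"
  "\<And>g. l2 M g \<Longrightarrow> (\<lambda>m. \<integral>x. F m x * g x \<partial>M) \<longlonglongrightarrow> (\<integral>x. f x * g x \<partial>M)"
 shows "wlim M F f"
 using assms unfolding wlim_def by metis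

lemma slimI:
 assumes "\<And>m. l2 M (F m)" "l2 M f" "(\<lambda>m. nrm M (\<lambda>x. F m x - f x)) \<longlonglongrightarrow> 0"
 shows "slim M F f"
 using assms unfolding slim_def by simp

lemma wlim_bound: "wlim M F f \<Longrightarrow> \<exists>B>0. \<forall>m. nrm M (F m) \<le> B"
 unfolding wlim_def by (meson le_max_iff_disj less_max_iff_disj zero_less_one)

text \<open>\<open>G m\<close> is replaced by its limit at a cost of at most \<open>B\<close> times
  the norm of \<open>G m - g\<close>; what remains is the definition of weak convergence. All
  nonlinear terms of the scheme reach the limit through this lemma.\<close>

lemma wlim_slim:
 assumes w: "wlim M F f" and s: "slim M G g"
 shows "(\<lambda>m. \<integral>x. F m x * G m x \<partial>M) \<longlonglongrightarrow> (\<integral>x. f x * g x \<partial>M)"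
proof -
 obtain B where B: "\<And>m. nrm M (F m) \<le> B" using wlim_bound[OF w] by auto
 have "(\<lambda>m. \<integral>x. F m x * (G m x - g x) \<partial>M) \<longlonglongrightarrow> 0"
 proof (rule Lim_null_comparison)
  show "\<forall>\<^sub>F m in sequentially. norm (\<integral>x. F m x * (G m x - g x) \<partial>M) \<le> B * nrm M (\<lambda>x. G m x - g x)"
  proof (rule always_eventually, rule allI)
   fix m
   have "norm (\<integral>x. F m x * (G m x - g x) \<partial>M) \<le> nrm M (F m) * nrm M (\<lambda>x. G m x - g x)"
    unfolding real_norm_def by (intro l2_cauchy_schwarz l2_diff wlimD[OF w] slimD[OF s])
   also have "\<dots> \<le> B * nrm M (\<lambda>x. G m x - g x)" by (intro mult_right_mono B) simp
   finally show "norm (\<integral>x. F m x * (G m x - g x) \<partial>M) \<le> B * nrm M (\<lambda>x. G m x - g x)" .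
  qed
  show "(\<lambda>m. B * nrm M (\<lambda>x. G m x - g x)) \<longlonglongrightarrow> 0"
   using tendsto_mult[OF tendsto_const[of B] slimD(3)[OF s]] by simp
 qed
 from tendsto_add[OF this wlimD(3)[OF w slimD(2)[OF s]]]
 have "(\<lambda>m. (\<integral>x. F m x * (G m x - g x) \<partial>M) + (\<integral>x. F m x * g x \<partial>M)) \<longlonglongrightarrow> (\<integral>x. f x * g x \<partial>M)"
  by simp
 moreover have "(\<integral>x. F m x * (G m x - g x) \<partial>M) + (\<integral>x. F m x * g x \<partial>M) = (\<integral>x. F m x * G m x \<partial>M)" for m
  by (subst Bochner_Integration.integral_add[symmetric])
   (auto intro!: l2_mult_int l2_diff wlimD[OF w] slimD[OF s] simp: algebra_simps)
 ultimately show ?thesis by simp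
qed

lemma slim_nrm_tendsto:
 assumes "slim M F f" shows "(\<lambda>m. nrm M (F m)) \<longlonglongrightarrow> nrm M f"
proof -
 have "(\<lambda>m. nrm M (F m) - nrm M f) \<longlonglongrightarrow> 0"
 proof (rule Lim_null_comparison[OF _ slimD(3)[OF assms]], rule always_eventually, rule allI)
  fix m
  have "nrm M (F m) \<le> nrm M (\<lambda>x. F m x - f x) + nrm M f"
   using nrm_add_le[OF slim_diff_l2[OF assms] slimD(2)[OF assms], of m] by simp
  moreover have "nrm M f \<le> nrm M (\<lambda>x. F m x - f x) + nrm M (F m)"
   using nrm_add_le[OF l2_diff[OF slimD(2)[OF assms] slimD(1)[OF assms]] slimD(1)[OF assms], of m m]
   by (simp add: nrm_commute[of M f])
  ultimately show "norm (nrm M (F m) - nrm M f) \<le> nrm M (\<lambda>x. F m x - f x)" by simp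
 qed
 thus ?thesis by (simp add: LIM_zero_iff)
qed

lemma nrm_null_comparison:
 assumes "\<And>m. nrm M (F m) \<le> b m" "b \<longlonglongrightarrow> 0" shows "(\<lambda>m. nrm M (F m)) \<longlonglongrightarrow> 0"
 by (rule tendsto_sandwich[OF _ _ tendsto_const assms(2)]) (auto intro: always_eventually assms(1))

lemma slim_const: "l2 M f \<Longrightarrow> slim M (\<lambda>m. f) f"
 by (simp add: slim_def nrm_def)

lemma slim_ip:
 assumes "slim M F f" "l2 M g" shows "(\<lambda>m. \<integral>x. F m x * g x \<partial>M) \<longlonglongrightarrow> (\<integral>x. f x * g x \<partial>M)"
proof -
 have "wlim M (\<lambda>m. g) g" using assms(2) by (auto simp: wlim_def)
 from wlim_slim[OF this assms(1)] show ?thesis by (simp add: mult.commute)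
qed

lemma slim_imp_wlim:
 assumes "slim M F f" shows "wlim M F f"
proof -
 have "Bseq (\<lambda>m. nrm M (F m))"
  using slim_nrm_tendsto[OF assms] convergent_imp_Bseq convergentI by blast
 then obtain B where "\<And>m. nrm M (F m) \<le> B" by (auto simp: Bseq_def)
 thus ?thesis by (intro wlimI[where B = B] slimD(1,2)[OF assms] slim_ip[OF assms])
qed

lemma wlim_subseq:
 assumes "wlim M F f" "strict_mono s" shows "wlim M (\<lambda>m. F (s m)) f"
proof -
 have "(\<lambda>m. \<integral>x. F (s m) x * g x \<partial>M) \<longlonglongrightarrow> (\<integral>x. f x * g x \<partial>M)" if "l2 M g" for g
  using LIMSEQ_subseq_LIMSEQ[OF wlimD(3)[OF assms(1) that] assms(2)] by (simp add: comp_def)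
 moreover obtain B where "\<And>m. nrm M (F m) \<le> B" using wlim_bound[OF assms(1)] by auto
 ultimately show ?thesis by (intro wlimI[where B = B] wlimD(1,2)[OF assms(1)])
qed

lemma wlim_add:
 assumes "wlim M F f" "wlim M G g"
 shows "wlim M (\<lambda>m x. F m x + G m x) (\<lambda>x. f x + g x)"
proof -
 obtain B C where BC: "\<And>m. nrm M (F m) \<le> B" "\<And>m. nrm M (G m) \<le> C"
  using wlim_bound[OF assms(1)] wlim_bound[OF assms(2)] by metis
 have "nrm M (\<lambda>x. F m x + G m x) \<le> B + C" for m
  using nrm_add_le[of M "F m" "G m"] BC[of m] assms wlimD(1) by fastforce
 moreover have "(\<lambda>m. \<integral>x. (F m x + G m x) * h x \<partial>M) \<longlonglongrightarrow> (\<integral>x. (f x + g x) * h x \<partial>M)" if "l2 M h" for h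
  using tendsto_add[OF wlimD(3)[OF assms(1) that] wlimD(3)[OF assms(2) that]]
   l2_mult_int[OF wlimD(1)[OF assms(1)] that] l2_mult_int[OF wlimD(1)[OF assms(2)] that]
   l2_mult_int[OF wlimD(2)[OF assms(1)] that] l2_mult_int[OF wlimD(2)[OF assms(2)] that]
  by (simp add: distrib_right)
 ultimately show ?thesis
  by (intro wlimI[where B = "B + C"] l2_add wlimD(1)[OF assms(1)] wlimD(2)[OF assms(1)]
    wlimD(1)[OF assms(2)] wlimD(2)[OF assms(2)])
qed

lemma wlim_mult_bounded:
 assumes F: "wlim M F f" and w: "w \<in> borel_measurable M" "\<And>x. \<bar>w x\<bar> \<le> K"
 shows "wlim M (\<lambda>m x. w x * F m x) (\<lambda>x. w x * f x)"
proof -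
 obtain B where B: "\<And>m. nrm M (F m) \<le> B" using wlim_bound[OF F] by auto
 have K: "0 \<le> K" using w(2) abs_ge_zero order_trans by blast
 have "nrm M (\<lambda>x. w x * F m x) \<le> K * B" for m
  using nrm_mult_bounded[OF wlimD(1)[OF F] w, of m] mult_left_mono[OF B K, of m] by linarith
 moreover have "(\<lambda>m. \<integral>x. (w x * F m x) * h x \<partial>M) \<longlonglongrightarrow> (\<integral>x. (w x * f x) * h x \<partial>M)" if "l2 M h" for h
  using wlimD(3)[OF F l2_mult_bounded[OF that w]] by (simp add: mult_ac)
 ultimately show ?thesis
  by (intro wlimI[where B = "K * B"] l2_mult_bounded[OF _ w] wlimD(1)[OF F] wlimD(2)[OF F])
qed

lemma wlim_cmult: "wlim M F f \<Longrightarrow> wlim M (\<lambda>m x. c * F m x) (\<lambda>x. c * f x)"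
 by (rule wlim_mult_bounded[where K = "\<bar>c\<bar>"]) auto

lemma wlim_zero: "wlim M (\<lambda>m x. 0) (\<lambda>x. 0)"
 by (auto simp: wlim_def nrm_def)

lemma wlim_sum:
 "(\<And>i. i \<in> I \<Longrightarrow> wlim M (F i) (f i)) \<Longrightarrow> wlim M (\<lambda>m x. \<Sum>i\<in>I. F i m x) (\<lambda>x. \<Sum>i\<in>I. f i x)"
 by (induction I rule: infinite_finite_induct) (auto intro: wlim_add wlim_zero)

lemma slim_add:
 assumes "slim M F f" "slim M G g"
 shows "slim M (\<lambda>m x. F m x + G m x) (\<lambda>x. f x + g x)"
proof -
 have "nrm M (\<lambda>x. F m x + G m x - (f x + g x)) \<le> nrm M (\<lambda>x. F m x - f x) + nrm M (\<lambda>x. G m x - g x)" for m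
  using nrm_add_le[OF slim_diff_l2[OF assms(1)] slim_diff_l2[OF assms(2)], of m m]
  by (simp add: algebra_simps)
 moreover have "(\<lambda>m. nrm M (\<lambda>x. F m x - f x) + nrm M (\<lambda>x. G m x - g x)) \<longlonglongrightarrow> 0"
  using tendsto_add[OF slimD(3)[OF assms(1)] slimD(3)[OF assms(2)]] by simp
 ultimately have "(\<lambda>m. nrm M (\<lambda>x. F m x + G m x - (f x + g x))) \<longlonglongrightarrow> 0"
  by (rule nrm_null_comparison)
 thus ?thesis by (intro slimI l2_add slimD(1)[OF assms(1)] slimD(1)[OF assms(2)] slimD(2)[OF assms(1)] slimD(2)[OF assms(2)])
qed

lemma slim_mult_bounded:
 assumes G: "slim M G g" and w: "w \<in> borel_measurable M" "\<And>x. \<bar>w x\<bar> \<le> K"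
 shows "slim M (\<lambda>m x. w x * G m x) (\<lambda>x. w x * g x)"
proof -
 have "nrm M (\<lambda>x. w x * G m x - w x * g x) \<le> K * nrm M (\<lambda>x. G m x - g x)" for m
  using nrm_mult_bounded[OF slim_diff_l2[OF G] w, of m] by (simp add: right_diff_distrib)
 moreover have "(\<lambda>m. K * nrm M (\<lambda>x. G m x - g x)) \<longlonglongrightarrow> 0"
  using tendsto_mult[OF tendsto_const slimD(3)[OF G]] by simp
 ultimately have "(\<lambda>m. nrm M (\<lambda>x. w x * G m x - w x * g x)) \<longlonglongrightarrow> 0"
  by (rule nrm_null_comparison)
 thus ?thesis by (intro slimI l2_mult_bounded[OF _ w] slimD(1)[OF G] slimD(2)[OF G])
qed

lemma slim_cmult: "slim M F f \<Longrightarrow> slim M (\<lambda>m x. c * F m x) (\<lambda>x. c * f x)"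
 by (rule slim_mult_bounded[where K = "\<bar>c\<bar>"]) auto

text \<open>The limit inherits the bound \<open>w\<close>, so \<open>(2 * w)^2\<close> dominates the
  squared difference.\<close>

lemma slim_dominated:
 assumes F: "\<And>m. F m \<in> borel_measurable M" and f: "f \<in> borel_measurable M" and w: "l2 M w"
  and lim: "AE x in M. (\<lambda>m. F m x) \<longlonglongrightarrow> f x" and bd: "\<And>m. AE x in M. \<bar>F m x\<bar> \<le> w x"
 shows "slim M F f"
proof -
 have bd': "AE x in M. \<forall>m. \<bar>F m x\<bar> \<le> w x" using bd by (simp add: AE_all_countable)
 have ae: "AE x in M. \<forall>m. \<bar>F m x\<bar> \<le> w x \<and> \<bar>f x\<bar> \<le> w x \<and> \<bar>F m x - f x\<bar> \<le> \<bar>2 * w x\<bar> \<and> (\<lambda>m. (F m x - f x)^2) \<longlonglongrightarrow> 0"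
  using lim bd'
 proof eventually_elim
  case (elim x)
  hence "\<bar>f x\<bar> \<le> w x" using LIMSEQ_le_const2[OF tendsto_rabs[OF elim(1)]] by blast
  moreover have "(\<lambda>m. (F m x - f x)^2) \<longlonglongrightarrow> (f x - f x)^2" by (intro tendsto_intros elim)
  moreover have "\<bar>F m x - f x\<bar> \<le> \<bar>2 * w x\<bar>" for m using elim(2)[rule_format, of m] \<open>\<bar>f x\<bar> \<le> w x\<close> by linarith
  ultimately show ?case using elim by simp
 qed
 have l: "l2 M (F m)" "l2 M f" for m
  by (rule l2_bound[OF w]; use ae F f in \<open>fastforce elim: eventually_mono\<close>)+
 have "(\<lambda>m. \<integral>x. (F m x - f x)^2 \<partial>M) \<longlonglongrightarrow> (\<integral>x. 0 \<partial>M)"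
  by (rule integral_dominated_convergence[where w = "\<lambda>x. (2 * w x)^2"])
   (use ae F f l2_int[OF l2_cmult[OF w, of 2]] in \<open>auto simp: abs_le_square_iff elim!: eventually_mono\<close>)
 from tendsto_real_sqrt[OF this] show ?thesis by (intro slimI l) (simp add: nrm_def)
qed

section \<open>Completeness, Riesz representation and weak compactness\<close>

lemma l2_complete:
 assumes F: "\<And>n. l2 M (F n)" and C: "\<And>n. (\<integral>x. (F (Suc n) x - F n x)^2 \<partial>M) \<le> C * (1/4)^n"
 shows "\<exists>g. slim M F g"
proof -
 \<comment> \<open>The weight \<open>2^j\<close> leaves the integrals summable, while summability of
   \<open>d j x\<close> bounds the increments at \<open>x\<close> by a geometric sequence with ratio
   \<open>sqrt (1/2)\<close> times \<open>sqrt D\<close>. This gives convergence almost everywhere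
   together with a dominating function.\<close>
 define d where "d j x = 2^j * (F (Suc j) x - F j x)^2" for j x
 have d0: "0 \<le> d j x" for j x by (simp add: d_def)
 have di: "integrable M (d j)" for j unfolding d_def by (intro integrable_mult_right l2_int l2_diff F)
 have "(\<integral>x. d j x \<partial>M) \<le> C * (1/2)^j" for j
  using mult_left_mono[OF C[of j], of "2^j"] by (simp add: d_def mult.left_commute flip: power_mult_distrib)
 hence sum: "summable (\<lambda>j. \<integral>x. norm (d j x) \<partial>M)"
  by (intro summable_comparison_test'[OF summable_mult[OF summable_geometric[of "1/2::real"]], of _ _ C]) (auto simp: d0)
 have "(\<integral>\<^sup>+x. (\<Sum>j. ennreal (d j x)) \<partial>M) = (\<Sum>j. \<integral>\<^sup>+x. ennreal (d j x) \<partial>M)"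
  by (rule nn_integral_suminf) (use borel_measurable_integrable[OF di] in measurable)
 also have "\<dots> = (\<Sum>j. ennreal (\<integral>x. norm (d j x) \<partial>M))"
  by (simp add: nn_integral_eq_integral[OF di] d0)
 also have "\<dots> = ennreal (\<Sum>j. \<integral>x. norm (d j x) \<partial>M)" by (rule suminf_ennreal2[OF _ sum]) simp
 finally have "AE x in M. (\<Sum>j. ennreal (d j x)) \<noteq> \<infinity>"
  by (intro nn_integral_PInf_AE) (use borel_measurable_integrable[OF di] in auto)
 hence s: "AE x in M. summable (\<lambda>j. d j x)"
  by eventually_elim (auto intro!: summable_suminf_not_top d0)
 define D where "D x = (\<Sum>j. d j x)" for x
 define S where "S = (\<Sum>j. sqrt (1/2) ^ j)"
 have sg: "summable (\<lambda>j. sqrt (1/2) ^ j)" by (rule summable_geometric) (simp add: real_sqrt_lt_1_iff)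
 have D: "l2 M (\<lambda>x. sqrt \<bar>D x\<bar>)"
  unfolding l2_def D_def using integrable_suminf[OF di _ sum] s by (simp add: d0)
 have c: "AE x in M. (\<lambda>n. F n x) \<longlonglongrightarrow> lim (\<lambda>n. F n x) \<and> (\<forall>n. \<bar>F n x\<bar> \<le> \<bar>F 0 x\<bar> + S * sqrt \<bar>D x\<bar>)"
  using s
 proof eventually_elim
  case (elim x)
  have e: "\<bar>F (Suc j) x - F j x\<bar> \<le> sqrt \<bar>D x\<bar> * sqrt (1/2) ^ j" for j
  proof -
   have "d j x \<le> \<bar>D x\<bar>" using sum_le_suminf[OF elim, of "{j}"] d0 by (simp add: D_def)
   hence "(F (Suc j) x - F j x)^2 \<le> \<bar>D x\<bar> * (1/2) ^ j" by (simp add: d_def field_simps)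
   from real_sqrt_le_mono[OF this] show ?thesis by (simp add: real_sqrt_mult flip: real_sqrt_power)
  qed
  have "summable (\<lambda>j. F (Suc j) x - F j x)"
   by (rule summable_comparison_test'[OF summable_mult[OF sg]]) (use e in auto)
  hence "convergent (\<lambda>n. (F n x - F 0 x) + F 0 x)"
   unfolding summable_iff_convergent sum_lessThan_telescope[of "\<lambda>j. F j x"] by (intro convergent_add convergent_const)
  moreover have "\<bar>F n x - F 0 x\<bar> \<le> S * sqrt \<bar>D x\<bar>" for n
  proof -
   have "\<bar>F n x - F 0 x\<bar> \<le> (\<Sum>j<n. sqrt \<bar>D x\<bar> * sqrt (1/2) ^ j)"
    unfolding sum_lessThan_telescope[of "\<lambda>j. F j x", symmetric] by (rule order_trans[OF sum_abs sum_mono[OF e]])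
   also have "\<dots> \<le> sqrt \<bar>D x\<bar> * S"
    unfolding sum_distrib_left[symmetric] S_def by (intro mult_left_mono sum_le_suminf sg) auto
   finally show ?thesis by (simp add: mult.commute)
  qed
  hence "\<bar>F n x\<bar> \<le> \<bar>F 0 x\<bar> + S * sqrt \<bar>D x\<bar>" for n using order_trans[OF abs_triangle_ineq[of "F 0 x" "F n x - F 0 x"]] by simp
  ultimately show ?case by (simp add: convergent_LIMSEQ_iff)
 qed
 have "slim M F (\<lambda>x. lim (\<lambda>n. F n x))"
 proof (rule slim_dominated[where w = "\<lambda>x. \<bar>F 0 x\<bar> + S * sqrt \<bar>D x\<bar>"])
  show "l2 M (\<lambda>x. \<bar>F 0 x\<bar> + S * sqrt \<bar>D x\<bar>)"
   by (intro l2_add l2_cmult D l2_bound[OF F[of 0], of "\<lambda>x. \<bar>F 0 x\<bar>"]) (use l2_meas[OF F] in auto)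
 qed (use c l2_meas[OF F] in \<open>auto elim: eventually_mono\<close>)
 thus ?thesis by blast
qed

text \<open>On the fixed limit \<open>g\<close> the factors act by dominated convergence; on
  \<open>G m - g\<close> their uniform bound suffices. Bounded convergence almost everywhere is what
  sampled test functions provide.\<close>

lemma slim_mult_conv:
 assumes G: "slim M G g"
  and W: "\<And>m. W m \<in> borel_measurable M" "w \<in> borel_measurable M" "\<And>m x. \<bar>W m x\<bar> \<le> K"
  and lim: "AE x in M. (\<lambda>m. W m x) \<longlonglongrightarrow> w x"
 shows "slim M (\<lambda>m x. W m x * G m x) (\<lambda>x. w x * g x)"
proof -
 have K: "0 \<le> K" using W(3) abs_ge_zero order_trans by blast
 have [measurable]: "g \<in> borel_measurable M" using slimD(2)[OF G] by (simp add: l2_def)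
 have 1: "slim M (\<lambda>m x. W m x * g x) (\<lambda>x. w x * g x)"
 proof (rule slim_dominated[where w = "\<lambda>x. K * \<bar>g x\<bar>"])
  show "l2 M (\<lambda>x. K * \<bar>g x\<bar>)"
   by (rule l2_bound[OF l2_cmult[OF slimD(2)[OF G], of K]]) (auto simp: abs_mult)
  show "AE x in M. (\<lambda>m. W m x * g x) \<longlonglongrightarrow> w x * g x"
   using lim by eventually_elim (intro tendsto_intros)
  show "AE x in M. \<bar>W m x * g x\<bar> \<le> K * \<bar>g x\<bar>" for m
   by (intro AE_I2) (simp add: abs_mult mult_right_mono W(3))
 qed (use W in measurable)
 have l: "l2 M (\<lambda>x. W m x * (G m x - g x))" for m
  by (rule l2_mult_bounded[OF slim_diff_l2[OF G] W(1,3)])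
 have 2: "slim M (\<lambda>m x. W m x * (G m x - g x)) (\<lambda>x. 0)"
  unfolding slim_def
 proof (intro conjI allI l l2_zero)
  show "(\<lambda>m. nrm M (\<lambda>x. W m x * (G m x - g x) - 0)) \<longlonglongrightarrow> 0"
  proof (rule nrm_null_comparison)
   show "nrm M (\<lambda>x. W m x * (G m x - g x) - 0) \<le> K * nrm M (\<lambda>x. G m x - g x)" for m
    using nrm_mult_bounded[OF slim_diff_l2[OF G] W(1,3)] by simp
   show "(\<lambda>m. K * nrm M (\<lambda>x. G m x - g x)) \<longlonglongrightarrow> 0"
    using tendsto_mult[OF tendsto_const slimD(3)[OF G]] by simp
  qed
 qed
 from slim_add[OF 1 2] show ?thesis by (simp add: algebra_simps)
qed

text \<open>Testing weak convergence with the limit itself bounds the square of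
  \<open>nrm M f\<close> by \<open>b * nrm M f\<close>.\<close>

lemma wlim_nrm_le:
 assumes w: "wlim M F f" and le: "\<And>m. nrm M (F m) \<le> a m" and a: "a \<longlonglongrightarrow> b"
 shows "nrm M f \<le> b"
proof -
 have "\<bar>\<integral>x. F m x * f x \<partial>M\<bar> \<le> a m * nrm M f" for m
  using l2_cauchy_schwarz[OF wlimD(1,2)[OF w], of m] mult_right_mono[OF le, of "nrm M f" m] by simp
 hence "(\<integral>x. f x * f x \<partial>M) \<le> b * nrm M f"
  by (intro LIMSEQ_le[OF wlimD(3)[OF w wlimD(2)[OF w]] tendsto_mult[OF a tendsto_const]]) (auto simp: abs_le_iff)
 hence "nrm M f * nrm M f \<le> b * nrm M f" by (simp add: nrm_sq flip: power2_eq_square)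
 moreover have "0 \<le> b" by (rule LIMSEQ_le_const[OF a]) (use order_trans[OF nrm_nonneg le] in blast)
 ultimately show ?thesis using nrm_nonneg[of M f] by (cases "nrm M f = 0") (auto simp: less_le)
qed

text \<open>A closed subspace, described through functions instead of classes: closedness under
  \<open>slim\<close> also makes it invariant under changes on null sets.\<close>

definition l2_subspace :: "'a measure \<Rightarrow> ('a \<Rightarrow> real) set \<Rightarrow> bool" where
 "l2_subspace M V \<longleftrightarrow> (\<forall>f\<in>V. l2 M f) \<and> (\<lambda>x. 0) \<in> V \<and>
   (\<forall>f\<in>V. \<forall>g\<in>V. \<forall>c. (\<lambda>x. f x + c * g x) \<in> V) \<and>
   (\<forall>F f. (\<forall>n. F n \<in> V) \<longrightarrow> slim M F f \<longrightarrow> f \<in> V)"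

text \<open>The representing element is the minimiser of \<open>J\<close>. By the parallelogram
  identity a sequence with \<open>J\<close> within \<open>(1/4)^n\<close> of the infimum satisfies
  the geometric condition of \<open>l2_complete\<close>, and the first variation at the minimiser
  vanishes. With \<phi> an inner product this is the orthogonal projection onto
  \<open>V\<close>.\<close>

lemma l2_riesz:
 assumes V: "l2_subspace M V"
  and lin: "\<And>f g c. f \<in> V \<Longrightarrow> g \<in> V \<Longrightarrow> \<phi> (\<lambda>x. f x + c * g x) = \<phi> f + c * \<phi> g"
  and bd: "\<And>f. f \<in> V \<Longrightarrow> \<bar>\<phi> f\<bar> \<le> C * nrm M f"
 shows "\<exists>g\<in>V. \<forall>f\<in>V. (\<integral>x. g x * f x \<partial>M) = \<phi> f"
proof -
 have Vl2: "f \<in> V \<Longrightarrow> l2 M f" and V0: "(\<lambda>x. 0) \<in> V"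
  and Vadd: "f \<in> V \<Longrightarrow> g \<in> V \<Longrightarrow> (\<lambda>x. f x + c * g x) \<in> V"
  and Vcl: "(\<And>n. F n \<in> V) \<Longrightarrow> slim M F f \<Longrightarrow> f \<in> V" for f g c F
  using V unfolding l2_subspace_def by blast+
 define J where "J f = (nrm M f)^2 - 2 * \<phi> f" for f
 have Jlow: "J f \<ge> - (C^2)" if "f \<in> V" for f
 proof -
  have "0 \<le> (nrm M f - C)^2" by simp
  hence "2 * (C * nrm M f) \<le> (nrm M f)^2 + C^2" by (simp add: power2_diff mult_ac)
  thus ?thesis using bd[OF that] by (simp add: J_def abs_le_iff)
 qed
 define I where "I = Inf (J ` V)"
 have bdd: "bdd_below (J ` V)" using Jlow by (intro bdd_belowI2[of _ "- (C^2)"])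
 have I_le: "I \<le> J f" if "f \<in> V" for f
  unfolding I_def by (rule cInf_lower) (use that bdd in auto)
 have "\<exists>f\<in>V. J f < I + (1/4)^n" for n :: nat
  using cInf_lessD[of "J ` V" "I + (1/4)^n"] V0 by (auto simp: I_def)
 then obtain v where vV: "\<And>n. v n \<in> V" and vJ: "\<And>n. J (v n) < I + (1/4)^n" by metis
 \<comment> \<open>Here \<open>u\<close> is the midpoint of \<open>v m\<close> and
   \<open>v n\<close>; it lies in \<open>V\<close>, so \<open>J u\<close> is at least the
   infimum.\<close>
 have par: "(\<integral>x. (v m x - v n x)^2 \<partial>M) \<le> 2 * (1/4)^m + 2 * (1/4)^n" for m n
 proof -
  define u where "u x = (0 + (1/2) * v m x) + (1/2) * v n x" for x
  have uV: "u \<in> V" unfolding u_def[abs_def] by (intro Vadd V0 vV)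
  have \<phi>0: "\<phi> (\<lambda>x. 0) = 0" using lin[OF V0 V0, of 1] by simp
  have \<phi>u: "\<phi> u = (\<phi> (v m) + \<phi> (v n)) / 2"
   unfolding u_def[abs_def] by (simp only: lin[OF Vadd[OF V0 vV] vV] lin[OF V0 vV] \<phi>0) simp
  have a: "(\<integral>x. (v m x - v n x)^2 \<partial>M) = (nrm M (v m))^2 - 2 * (\<integral>x. v m x * v n x \<partial>M) + (nrm M (v n))^2"
   using integral_sq_add[OF Vl2[OF vV] Vl2[OF vV], of m "-1" n] by (simp add: nrm_sq)
  have "(nrm M u)^2 = (1/4) * (\<integral>x. (v m x + 1 * v n x)^2 \<partial>M)"
   unfolding nrm_sq u_def by (subst integral_mult_right_zero[symmetric]) (simp add: field_simps power2_eq_square)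
  hence b: "4 * (nrm M u)^2 = (nrm M (v m))^2 + 2 * (\<integral>x. v m x * v n x \<partial>M) + (nrm M (v n))^2"
   unfolding integral_sq_add[OF Vl2[OF vV] Vl2[OF vV]] by (simp add: nrm_sq)
  have "(\<integral>x. (v m x - v n x)^2 \<partial>M) = 2 * J (v m) + 2 * J (v n) - 4 * J u"
   using a b \<phi>u by (simp add: J_def algebra_simps)
  thus ?thesis using vJ[of m] vJ[of n] I_le[OF uV] by simp
 qed
 have "(\<integral>x. (v (Suc n) x - v n x)^2 \<partial>M) \<le> 4 * (1/4)^n" for n by (rule order_trans[OF par]) simp
 from l2_complete[OF Vl2[OF vV] this] obtain g where sl: "slim M v g" by blast
 have gV: "g \<in> V" by (rule Vcl[OF vV sl])
 have "(\<integral>x. g x * f x \<partial>M) = \<phi> f" if f: "f \<in> V" for f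
 proof -
  \<comment> \<open>The variation of \<open>J\<close> at \<open>g\<close> in direction
    \<open>t * f\<close>, obtained as a limit from the almost minimising \<open>v n\<close>.\<close>
  have "0 \<le> 0 + 2 * t * ((\<integral>x. g x * f x \<partial>M) - \<phi> f) + t^2 * (nrm M f)^2" for t
  proof -
   have *: "- ((1/4)^n) \<le> 2 * t * ((\<integral>x. v n x * f x \<partial>M) - \<phi> f) + t^2 * (nrm M f)^2" for n
    using I_le[OF Vadd[OF vV f, of n t]] vJ[of n]
    by (simp add: J_def nrm_sq integral_sq_add[OF Vl2[OF vV] Vl2[OF f]] lin[OF vV f] algebra_simps)
   have "(\<lambda>n. 2 * t * ((\<integral>x. v n x * f x \<partial>M) - \<phi> f) + t^2 * (nrm M f)^2)
     \<longlonglongrightarrow> 2 * t * ((\<integral>x. g x * f x \<partial>M) - \<phi> f) + t^2 * (nrm M f)^2"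
    by (intro tendsto_intros slim_ip[OF sl Vl2[OF f]])
   moreover have "(\<lambda>n. - ((1/4)^n)) \<longlonglongrightarrow> - (0::real)" by (intro tendsto_minus LIMSEQ_realpow_zero) auto
   ultimately show ?thesis using LIMSEQ_le[of "\<lambda>n. - ((1/4)^n)"] * by fastforce
  qed
  from quadratic_nonneg_discriminant[OF this] show ?thesis by simp
 qed
 with gV show ?thesis by blast
qed

lemma bounded_family_convergent_subseq:
 fixes X :: "nat \<Rightarrow> nat \<Rightarrow> real"
 assumes "\<And>j m. \<bar>X j m\<bar> \<le> B j"
 shows "\<exists>s. strict_mono s \<and> (\<forall>j. convergent (\<lambda>m. X j (s m)))"
proof -
 interpret subseqs "\<lambda>j s. convergent (\<lambda>m. X j (s m))"
 proof
  fix n :: nat and s :: "nat \<Rightarrow> nat" assume "strict_mono s"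
  have "bounded (range (\<lambda>m. X n (s m)))" using assms by (auto simp: bounded_iff)
  then obtain l r where "strict_mono r" "((\<lambda>m. X n (s m)) \<circ> r) \<longlonglongrightarrow> l"
   using bounded_imp_convergent_subsequence by blast
  thus "\<exists>r. strict_mono r \<and> convergent (\<lambda>m. X n ((s \<circ> r) m))"
   by (auto simp: comp_def convergent_def)
 qed
 have "convergent (\<lambda>m. X j (diagseq m))" for j
 proof -
  have "convergent (\<lambda>m. X j ((diagseq \<circ> (+) (Suc j)) m))"
  proof (rule diagseq_holds)
   fix r s n assume "strict_mono (r :: nat \<Rightarrow> nat)" "convergent (\<lambda>m. X n (s m))"
   thus "convergent (\<lambda>m. X n ((s \<circ> r) m))"
    using convergent_subseq_convergent by (fastforce simp: comp_def)
  qed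
  thus ?thesis
   using convergent_ignore_initial_segment[of "\<lambda>m. X j (diagseq m)" "Suc j"] by (simp add: add.commute)
 qed
 with subseq_diagseq show ?thesis by blast
qed

text \<open>The subsequence is chosen so that the inner products with all members of the sequence itself
 converge; the test functions for which the inner products converge then form a closed subspace
 containing the sequence, and its orthogonal complement is tested trivially.\<close>

lemma weak_compactness:
 fixes F :: "nat \<Rightarrow> 'a \<Rightarrow> real"
 assumes l2: "\<And>m. l2 M (F m)" and bd: "\<And>m. nrm M (F m) \<le> B"
 shows "\<exists>s f. strict_mono s \<and> wlim M (\<lambda>m. F (s m)) f"
proof -
 have B0: "0 \<le> B" using bd[of 0] nrm_nonneg order_trans by blast
 have ipb: "\<bar>\<integral>x. F m x * g x \<partial>M\<bar> \<le> B * nrm M g" if "l2 M g" for m g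
  using l2_cauchy_schwarz[OF l2 that, of m] mult_right_mono[OF bd[of m], of "nrm M g"] by simp
 have "\<bar>\<integral>x. F m x * F j x \<partial>M\<bar> \<le> B * B" for j m
  using ipb[OF l2, of m j] mult_left_mono[OF bd[of j] B0] by simp
 from bounded_family_convergent_subseq[of "\<lambda>j m. \<integral>x. F m x * F j x \<partial>M", OF this]
 obtain s where s: "strict_mono s" and conv: "\<And>j. convergent (\<lambda>m. \<integral>x. F (s m) x * F j x \<partial>M)" by blast
 define V where "V = {g. l2 M g \<and> convergent (\<lambda>m. \<integral>x. F (s m) x * g x \<partial>M)}"
 have ipadd: "(\<integral>x. F m x * (f x + c * g x) \<partial>M) = (\<integral>x. F m x * f x \<partial>M) + c * (\<integral>x. F m x * g x \<partial>M)"
  if "l2 M f" "l2 M g" for m f g c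
  using l2_mult_int[OF l2 that(1), of m] l2_mult_int[OF l2 l2_cmult[OF that(2)], of m c]
   by (simp add: distrib_left mult.left_commute[of _ c])
 have V: "l2_subspace M V"
  unfolding l2_subspace_def
 proof (intro conjI ballI allI impI)
  show "(\<lambda>x. 0) \<in> V" by (simp add: V_def convergent_const)
  show "f \<in> V \<Longrightarrow> l2 M f" for f by (simp add: V_def)
  show "(\<lambda>x. f x + c * g x) \<in> V" if "f \<in> V" "g \<in> V" for f g c
   using that unfolding V_def
   by (auto simp: ipadd intro!: l2_add l2_cmult convergent_add convergent_mult convergent_const)
  fix G g assume G: "\<forall>n. G n \<in> V" and sl: "slim M G g"
  have "Cauchy (\<lambda>m. \<integral>x. F (s m) x * g x \<partial>M)"
  proof (rule metric_CauchyI)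
   fix e :: real assume e: "e > 0"
   have "\<forall>\<^sub>F n in sequentially. B * nrm M (\<lambda>x. G n x - g x) < e / 3"
    using tendsto_mult[OF tendsto_const[of B] slimD(3)[OF sl]] e by (intro order_tendstoD(2)[of _ 0]) auto
   then obtain n where n: "B * nrm M (\<lambda>x. G n x - g x) < e / 3" by (auto simp: eventually_sequentially)
   have cau: "Cauchy (\<lambda>m. \<integral>x. F (s m) x * G n x \<partial>M)" using G by (simp add: V_def convergent_Cauchy)
   obtain K where K: "\<And>m m'. m \<ge> K \<Longrightarrow> m' \<ge> K \<Longrightarrow>
     dist (\<integral>x. F (s m) x * G n x \<partial>M) (\<integral>x. F (s m') x * G n x \<partial>M) < e / 3"
    using e metric_CauchyD[OF cau, of "e/3"] by auto
   have d: "\<bar>(\<integral>x. F m x * G n x \<partial>M) - (\<integral>x. F m x * g x \<partial>M)\<bar> < e / 3" for m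
   proof -
    have "(\<integral>x. F m x * G n x \<partial>M) - (\<integral>x. F m x * g x \<partial>M) = (\<integral>x. F m x * (G n x - g x) \<partial>M)"
     using ipadd[OF slimD(1)[OF sl] slimD(2)[OF sl], of m n "-1"] by simp
    thus ?thesis using ipb[OF slim_diff_l2[OF sl], of m n] n by linarith
   qed
   have "dist (\<integral>x. F (s m) x * g x \<partial>M) (\<integral>x. F (s m') x * g x \<partial>M) < e" if "m \<ge> K" "m' \<ge> K" for m m'
    using K[OF that] d[of "s m"] d[of "s m'"] unfolding dist_real_def by linarith
   thus "\<exists>K. \<forall>m\<ge>K. \<forall>m'\<ge>K. dist (\<integral>x. F (s m) x * g x \<partial>M) (\<integral>x. F (s m') x * g x \<partial>M) < e" by blast
  qed
  thus "g \<in> V" using slimD(2)[OF sl] by (simp add: V_def Cauchy_convergent)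
 qed
 have FV: "F j \<in> V" for j using conv l2 by (simp add: V_def)
 have Vl2: "g \<in> V \<Longrightarrow> l2 M g" for g by (simp add: V_def)
 have "\<exists>f\<in>V. \<forall>g\<in>V. (\<integral>x. f x * g x \<partial>M) = lim (\<lambda>m. \<integral>x. F (s m) x * g x \<partial>M)"
 proof (rule l2_riesz[OF V])
  fix f g c assume "f \<in> V" "g \<in> V"
  thus "lim (\<lambda>m. \<integral>x. F (s m) x * (f x + c * g x) \<partial>M)
    = lim (\<lambda>m. \<integral>x. F (s m) x * f x \<partial>M) + c * lim (\<lambda>m. \<integral>x. F (s m) x * g x \<partial>M)"
   unfolding V_def by (intro limI) (auto simp: ipadd convergent_LIMSEQ_iff intro!: tendsto_intros)
 next
  fix g assume "g \<in> V"
  hence "(\<lambda>m. \<integral>x. F (s m) x * g x \<partial>M) \<longlonglongrightarrow> lim (\<lambda>m. \<integral>x. F (s m) x * g x \<partial>M)"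
   by (simp add: V_def convergent_LIMSEQ_iff)
  from tendsto_rabs[OF this] show "\<bar>lim (\<lambda>m. \<integral>x. F (s m) x * g x \<partial>M)\<bar> \<le> B * nrm M g"
   by (rule LIMSEQ_le_const2) (use ipb[OF Vl2[OF \<open>g \<in> V\<close>]] in blast)
 qed
 then obtain f where f: "f \<in> V" "\<And>g. g \<in> V \<Longrightarrow> (\<integral>x. f x * g x \<partial>M) = lim (\<lambda>m. \<integral>x. F (s m) x * g x \<partial>M)"
  by blast
 have "(\<lambda>m. \<integral>x. F (s m) x * g x \<partial>M) \<longlonglongrightarrow> (\<integral>x. f x * g x \<partial>M)" if g: "l2 M g" for g
 proof -
  have gadd: "(\<integral>x. g x * (u x + c * w x) \<partial>M) = (\<integral>x. g x * u x \<partial>M) + c * (\<integral>x. g x * w x \<partial>M)"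
   if "l2 M u" "l2 M w" for u w c
   using l2_mult_int[OF g that(1)] l2_mult_int[OF g l2_cmult[OF that(2)], of c]
   by (simp add: distrib_left mult.left_commute[of _ c])
  have "\<exists>p\<in>V. \<forall>u\<in>V. (\<integral>x. p x * u x \<partial>M) = (\<integral>x. g x * u x \<partial>M)"
   by (rule l2_riesz[OF V, where C = "nrm M g"]) (auto intro: gadd Vl2 l2_cauchy_schwarz g)
  then obtain p where p: "p \<in> V" "\<And>u. u \<in> V \<Longrightarrow> (\<integral>x. p x * u x \<partial>M) = (\<integral>x. g x * u x \<partial>M)" by blast
  have "(\<lambda>m. \<integral>x. F (s m) x * p x \<partial>M) \<longlonglongrightarrow> (\<integral>x. f x * p x \<partial>M)"
   using p(1) f(2)[OF p(1)] by (simp add: V_def convergent_LIMSEQ_iff)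
  thus ?thesis using p(2)[OF FV] p(2)[OF f(1)] by (simp add: mult.commute)
 qed
 hence "wlim M (\<lambda>m. F (s m)) f" by (intro wlimI[where B = B] l2 bd Vl2[OF f(1)])
 with s show ?thesis by blast
qed

lemma weak_compactness_family:
 fixes F :: "'i \<Rightarrow> nat \<Rightarrow> 'a \<Rightarrow> real"
 assumes "finite I" "\<And>i m. i \<in> I \<Longrightarrow> l2 M (F i m)" "\<And>i m. i \<in> I \<Longrightarrow> nrm M (F i m) \<le> B"
 shows "\<exists>s f. strict_mono s \<and> (\<forall>i\<in>I. wlim M (\<lambda>m. F i (s m)) (f i))"
 using assms
proof (induction I)
 case empty
 show ?case using strict_mono_id by blast
next
 case (insert i I)
 hence "\<exists>s f. strict_mono s \<and> (\<forall>i\<in>I. wlim M (\<lambda>m. F i (s m)) (f i))" by blast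
 then obtain s f where s: "strict_mono s" "\<And>j. j \<in> I \<Longrightarrow> wlim M (\<lambda>m. F j (s m)) (f j)" by blast
 obtain s' g where s': "strict_mono s'" "wlim M (\<lambda>m. F i (s (s' m))) g"
  using weak_compactness[of M "\<lambda>m. F i (s m)" B] insert.prems by auto
 have "wlim M (\<lambda>m. F j ((s \<circ> s') m)) ((f(i := g)) j)" if "j \<in> insert i I" for j
  using that s' wlim_subseq[OF s(2) s'(1)] insert.hyps(2) by (cases "j = i") auto
 moreover have "strict_mono (s \<circ> s')" using s(1) s'(1) by (rule strict_mono_o)
 ultimately show ?case by blast
qed

text \<open>From here on, \<open>\<Sum>i. f i\<close> is the finite sum over the index type and not an infinite series.\<close>

no_notation suminf (binder "\<Sum>" 10)

abbreviation sumU :: "('a \<Rightarrow> 'b::comm_monoid_add) \<Rightarrow> 'b" (binder "\<Sum>" 10) where "sumU f \<equiv> sum f UNIV"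
abbreviation nn_lborel :: "('a::euclidean_space \<Rightarrow> ennreal) \<Rightarrow> ennreal" (binder "NN " 10) where "nn_lborel f \<equiv> integral\<^sup>N lborel f"
abbreviation "l2L \<equiv> l2 lborel"
abbreviation "nrmL \<equiv> nrm lborel"
abbreviation "slimL \<equiv> slim lborel"
abbreviation "wlimL \<equiv> wlim lborel"

section \<open>Density and translations in Lebesgue space\<close>

lemma l2_cball_const: "l2L (\<lambda>x::'a::euclidean_space. K * ind (cball a R) x)"
 by (intro l2_cmult l2_indicat emeasure_bounded_finite) auto

text \<open>Cutting \<open>f\<close> off in value and in space makes it bounded with bounded
  support. Continuous functions converging to it almost everywhere are then cut off in the same way,
  so that dominated convergence turns pointwise into norm convergence.\<close>

lemma l2_lborel_dense:
 fixes f :: "'a::euclidean_space \<Rightarrow> real"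
 assumes f: "l2L f" and e: "e > 0"
 obtains g R where "continuous_on UNIV g" "l2L g" "nrmL (\<lambda>x. f x - g x) < e"
  "\<And>x. norm x \<ge> R \<Longrightarrow> g x = 0"
proof -
 have [measurable]: "f \<in> bm" using l2_meas[OF f] by simp
 define T where "T K u = max (- K) (min K u)" for K u :: real
 define F where "F n x = ind (cball 0 (real n)) x * T (real n) (f x)" for n x
 have Tabs: "\<bar>T K u\<bar> \<le> \<bar>u\<bar>" "\<bar>T K u\<bar> \<le> K" if "K \<ge> 0" for K u using that by (auto simp: T_def)
 have [measurable]: "F n \<in> bm" for n
  unfolding F_def T_def
  by (intro borel_measurable_times borel_measurable_indicator borel_measurable_max borel_measurable_min) auto
 have sF: "slimL F f"
 proof (rule slim_dominated[where w = "\<lambda>x. \<bar>f x\<bar>"])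
  show "l2L (\<lambda>x. \<bar>f x\<bar>)" by (rule l2_bound[OF f]) auto
  show "AE x in lborel. (\<lambda>n. F n x) \<longlonglongrightarrow> f x"
  proof (rule AE_I2)
   fix x
   have "\<forall>\<^sub>F n in sequentially. F n x = f x"
    using eventually_ge_at_top[of "nat \<lceil>norm x + \<bar>f x\<bar>\<rceil>"]
   proof eventually_elim
    fix n :: nat assume "nat \<lceil>norm x + \<bar>f x\<bar>\<rceil> \<le> n"
    hence "norm x + \<bar>f x\<bar> \<le> real n" by linarith
    hence "norm x \<le> real n" "\<bar>f x\<bar> \<le> real n" using norm_ge_zero[of x] by linarith+
    thus "F n x = f x" by (auto simp: F_def T_def)
   qed
   thus "(\<lambda>n. F n x) \<longlonglongrightarrow> f x" by (rule tendsto_eventually)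
  qed
  show "AE x in lborel. \<bar>F n x\<bar> \<le> \<bar>f x\<bar>" for n
   using Tabs(1)[of "real n"] by (intro AE_I2) (auto simp: F_def split: split_indicator)
 qed (auto intro: l2_meas[OF f])
 have "\<forall>\<^sub>F n in sequentially. nrmL (\<lambda>x. F n x - f x) < e/2"
  using slimD(3)[OF sF] e by (intro order_tendstoD(2)[of _ 0]) auto
 then obtain K where K: "nrmL (\<lambda>x. F K x - f x) < e/2" by (auto simp: eventually_sequentially)
 have "F K measurable_on UNIV"
  by (intro lebesgue_measurable_imp_measurable_on) (auto intro: borel_measurable_if_D measurable_completion)
 then obtain N g where N: "negligible N" "\<And>n. continuous_on UNIV (g n :: 'a \<Rightarrow> real)"
  "\<And>x. x \<notin> N \<Longrightarrow> (\<lambda>n. g n x) \<longlonglongrightarrow> F K x"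
  unfolding measurable_on_def by auto
 \<comment> \<open>A continuous cutoff equal to 1 on the ball that carries \<open>F K\<close>;
   multiplying by it leaves the limit \<open>F K\<close> unchanged.\<close>
 define c where "c x = max 0 (min 1 (real K + 1 - norm x))" for x :: 'a
 define h where "h n x = c x * T (real K) (g n x)" for n x
 have hc: "continuous_on UNIV (h n)" for n
  unfolding h_def c_def T_def by (intro continuous_intros N(2))
 have c0: "norm x \<ge> real K + 1 \<Longrightarrow> c x = 0" for x by (simp add: c_def)
 have cb: "0 \<le> c x" "c x \<le> 1" for x by (simp_all add: c_def)
 have hb: "\<bar>h n x\<bar> \<le> real K * ind (cball 0 (real K + 1)) x" for n x
  using c0[of x] cb[of x] Tabs(2)[of "real K" "g n x"] mult_mono[of "c x" 1 "\<bar>T (real K) (g n x)\<bar>" "real K"]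
  by (auto simp: h_def abs_mult split: split_indicator)
 have cF: "c x * T (real K) (F K x) = F K x" for x
  using Tabs(2)[of "real K" "f x"] by (auto simp: c_def F_def T_def split: split_indicator)
 have sh: "slimL h (F K)"
 proof (rule slim_dominated[OF _ _ l2_cball_const])
  show "h n \<in> bmL" for n using borel_measurable_continuous_onI[OF hc] by simp
  have "AE x in completion lborel. x \<notin> N"
   using N(1) by (intro AE_not_in) (simp add: negligible_iff_null_sets)
  hence "AE x in lborel. x \<notin> N" by (simp add: AE_completion_iff)
  thus "AE x in lborel. (\<lambda>n. h n x) \<longlonglongrightarrow> F K x"
  proof eventually_elim
   fix x assume "x \<notin> N"
   hence "(\<lambda>n. h n x) \<longlonglongrightarrow> c x * T (real K) (F K x)"
    unfolding h_def T_def by (intro tendsto_intros N(3))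
   thus "(\<lambda>n. h n x) \<longlonglongrightarrow> F K x" by (simp add: cF)
  qed
  show "AE x in lborel. \<bar>h n x\<bar> \<le> real K * ind (cball 0 (real K + 1)) x" for n
   using hb by (intro AE_I2)
 qed auto
 have "\<forall>\<^sub>F n in sequentially. nrmL (\<lambda>x. h n x - F K x) < e/2"
  using slimD(3)[OF sh] e by (intro order_tendstoD(2)[of _ 0]) auto
 then obtain n where n: "nrmL (\<lambda>x. h n x - F K x) < e/2" by (auto simp: eventually_sequentially)
 have "nrmL (\<lambda>x. f x - h n x) < e"
  using nrm_triangle[OF f slimD(1)[OF sF, of K] slimD(1)[OF sh, of n]] n K
  unfolding nrm_commute[of lborel f "F K"] nrm_commute[of lborel "F K" "h n"] by linarith
 moreover have "h n x = 0" if "norm x \<ge> real K + 1" for x using c0[OF that] by (simp add: h_def)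
 ultimately show ?thesis using that[of "h n"] hc slimD(1)[OF sh] by blast
qed

section \<open>Translations and local operators in \<open>L2\<close>\<close>

lemma lborel_integral_translate:
 fixes f :: "'a::euclidean_space \<Rightarrow> real"
 assumes "f \<in> bm"
 shows "(LBINT x. f (x + a)) = (LBINT x. f x)"
proof -
 have "(\<integral>x. f x \<partial>distr lborel borel ((+) a)) = (LBINT x. f (a + x))"
  by (rule integral_distr) (use assms in auto)
 thus ?thesis by (simp add: lborel_distr_plus add.commute)
qed

lemma lborel_nn_integral_translate:
 fixes f :: "'a::euclidean_space \<Rightarrow> ennreal"
 assumes "f \<in> bm"
 shows "(NN x. f (x + a)) = (NN x. f x)"
proof -
 have "(\<integral>\<^sup>+x. f x \<partial>distr lborel borel ((+) a)) = (NN x. f (a + x))"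
  by (rule nn_integral_distr) (use assms in auto)
 thus ?thesis by (simp add: lborel_distr_plus add.commute)
qed

lemma lborel_integrable_translate:
 fixes f :: "'a::euclidean_space \<Rightarrow> real"
 assumes "integrable lborel f"
 shows "integrable lborel (\<lambda>x. f (x + a))"
proof -
 have "integrable (distr lborel borel ((+) a)) f" using assms by (simp add: lborel_distr_plus)
 hence "integrable lborel (\<lambda>x. f (a + x))"
  by (subst (asm) integrable_distr_eq) (use assms in auto)
 thus ?thesis by (simp add: add.commute)
qed

lemma l2_translate:
 fixes f :: "'a::euclidean_space \<Rightarrow> real"
 assumes f: "l2L f" shows "l2L (\<lambda>x. f (x + a))"
proof -
 have [measurable]: "f \<in> bm" using l2_meas[OF f] by simp
 show ?thesis using lborel_integrable_translate[OF l2_int[OF f]] by (simp add: l2_def)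
qed

lemma nrm_translate:
 fixes f :: "'a::euclidean_space \<Rightarrow> real"
 assumes f: "f \<in> bm" shows "nrmL (\<lambda>x. f (x + a)) = nrmL f"
 unfolding nrm_def by (subst lborel_integral_translate) (use f in auto)

lemma slim_dominated_by_sum:
 assumes F: "\<And>m. l2 M (F m)" and f: "f \<in> borel_measurable M"
  and le: "\<And>m. AE z in M. \<bar>F m z - f z\<bar> \<le> (\<Sum>p\<in>I. \<bar>E p m z\<bar>)"
  and E: "\<And>p m. l2 M (E p m)" "\<And>p. (\<lambda>m. nrm M (E p m)) \<longlonglongrightarrow> 0"
 shows "slim M F f"
proof -
 have aE: "l2 M (\<lambda>z. \<bar>E p m z\<bar>)" for p m by (rule l2_bound[OF E(1)]) (use l2_meas[OF E(1)] in auto)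
 have S: "l2 M (\<lambda>z. \<Sum>p\<in>I. \<bar>E p m z\<bar>)" for m by (intro l2_sum aE)
 have ab: "AE z in M. \<bar>F m z - f z\<bar> \<le> \<bar>\<Sum>p\<in>I. \<bar>E p m z\<bar>\<bar>" for m
  using le[of m] by eventually_elim auto
 have mF: "(\<lambda>z. F m z - f z) \<in> borel_measurable M" for m using l2_meas[OF F] f by simp
 have "l2 M (\<lambda>z. F 0 z - (F 0 z - f z))" by (rule l2_diff[OF F l2_bound[OF S mF ab]])
 hence fl: "l2 M f" by simp
 have "nrm M (\<lambda>z. F m z - f z) \<le> (\<Sum>p\<in>I. nrm M (E p m))" for m
 proof -
  have "nrm M (\<lambda>z. F m z - f z) \<le> nrm M (\<lambda>z. \<Sum>p\<in>I. \<bar>E p m z\<bar>)" by (rule nrm_mono[OF S mF ab])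
  also have "\<dots> \<le> (\<Sum>p\<in>I. nrm M (\<lambda>z. \<bar>E p m z\<bar>))" by (rule nrm_sum_le[OF aE])
  finally show ?thesis by (simp add: nrm_def)
 qed
 moreover have "(\<lambda>m. \<Sum>p\<in>I. nrm M (E p m)) \<longlonglongrightarrow> (\<Sum>p\<in>I. 0)" by (intro tendsto_sum E)
 ultimately have "(\<lambda>m. nrm M (\<lambda>z. F m z - f z)) \<longlonglongrightarrow> 0" by (intro nrm_null_comparison) auto
 thus ?thesis by (intro slimI F fl)
qed

lemma slim_approximation:
 assumes F: "\<And>m. l2 M (F m)" and f: "l2 M f"
  and a: "\<And>e. e > 0 \<Longrightarrow> \<exists>G g. slim M G g \<and> (\<forall>m. nrm M (\<lambda>x. F m x - G m x) \<le> e) \<and> nrm M (\<lambda>x. g x - f x) \<le> e"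
 shows "slim M F f"
proof (rule slimI[OF F f], rule LIMSEQ_I)
 fix e :: real assume e: "e > 0"
 hence "e / 4 > 0" by simp
 from a[OF this] obtain G g where G: "slim M G g" "\<And>m. nrm M (\<lambda>x. F m x - G m x) \<le> e / 4" "nrm M (\<lambda>x. g x - f x) \<le> e / 4" by blast
 from LIMSEQ_D[OF slimD(3)[OF G(1)] \<open>e / 4 > 0\<close>] obtain K where K: "\<And>m. m \<ge> K \<Longrightarrow> nrm M (\<lambda>x. G m x - g x) < e / 4" by auto
 have "nrm M (\<lambda>x. F m x - f x) < e" if "m \<ge> K" for m
  using nrm_triangle[OF F slimD(1)[OF G(1)] f, of m m] nrm_triangle[OF slimD(1)[OF G(1)] slimD(2)[OF G(1)] f, of m] G(2)[of m] G(3) K[OF that] e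
  by linarith
 thus "\<exists>K. \<forall>m\<ge>K. norm (nrm M (\<lambda>x. F m x - f x) - 0) < e" by auto
qed

text \<open>\<open>loc\<close> says that \<open>F m x\<close> is no farther from a constant
  \<open>c\<close> than the values of \<open>u\<close> near \<open>x\<close> are. Translations, cell
  averages, sampled values and, through the mean value theorem, difference quotients are all of this
  kind. With \<open>c = u x\<close> it gives pointwise convergence, with \<open>c = 0\<close> the
  bound and the support for domination.\<close>

lemma slim_local:
 fixes u :: "'a::euclidean_space \<Rightarrow> real"
 assumes u: "continuous_on UNIV u" "\<And>x. norm x \<ge> R \<Longrightarrow> u x = 0" and F: "\<And>m. F m \<in> bmL"
  and loc: "\<And>m x c \<eta>. (\<And>y. norm (y - x) \<le> \<rho> m \<Longrightarrow> \<bar>u y - c\<bar> \<le> \<eta>) \<Longrightarrow> \<bar>F m x - c\<bar> \<le> \<eta>"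
  and \<rho>: "\<rho> \<longlonglongrightarrow> 0"
 shows "slimL F u"
proof -
 have "bounded (u ` cball 0 R)"
  by (rule compact_imp_bounded[OF compact_continuous_image[OF continuous_on_subset[OF u(1)] compact_cball]]) simp
 then obtain B where "\<forall>y\<in>u ` cball 0 R. norm y \<le> B" unfolding bounded_iff by blast
 hence B: "\<bar>u x\<bar> \<le> max B 0" for x using u(2)[of x] by (cases "norm x \<le> R") (auto intro: max.coboundedI1)
 have "Bseq \<rho>" by (rule convergent_imp_Bseq[OF convergentI[OF \<rho>]])
 then obtain C where C: "\<And>m. \<bar>\<rho> m\<bar> \<le> C" unfolding Bseq_def by auto
 show ?thesis
 proof (rule slim_dominated[OF F _ l2_cball_const[of "max B 0" 0 "R + C"]])
  show "AE x in lborel. (\<lambda>m. F m x) \<longlonglongrightarrow> u x"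
  proof (rule AE_I2, rule LIMSEQ_I)
   fix x and \<epsilon> :: real assume \<epsilon>: "\<epsilon> > 0"
   have "isCont u x" using u(1) by (simp add: continuous_on_eq_continuous_at)
   then obtain \<delta> where \<delta>: "\<delta> > 0" "\<And>y. dist y x < \<delta> \<Longrightarrow> dist (u y) (u x) < \<epsilon>/2"
    unfolding continuous_at_eps_delta using \<epsilon> by (meson half_gt_zero)
   have "\<forall>\<^sub>F m in sequentially. \<rho> m < \<delta>" by (rule order_tendstoD(2)[OF \<rho> \<delta>(1)])
   then obtain K where K: "\<And>m. m \<ge> K \<Longrightarrow> \<rho> m < \<delta>" by (auto simp: eventually_sequentially)
   have "\<bar>F m x - u x\<bar> \<le> \<epsilon>/2" if "m \<ge> K" for m
    by (rule loc) (use \<delta>(2) K[OF that] in \<open>fastforce simp: dist_norm intro: less_imp_le\<close>)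
   thus "\<exists>K. \<forall>m\<ge>K. norm (F m x - u x) < \<epsilon>" using \<epsilon> by (intro exI[of _ K]) force
  qed
  show "AE x in lborel. \<bar>F m x\<bar> \<le> max B 0 * ind (cball 0 (R + C)) x" for m
  proof (rule AE_I2)
   fix x
   show "\<bar>F m x\<bar> \<le> max B 0 * ind (cball 0 (R + C)) x"
   proof (cases "norm x \<le> R + C")
    case True
    thus ?thesis using loc[of x m 0 "max B 0"] B by simp
   next
    case False
    have "\<bar>F m x - 0\<bar> \<le> 0"
    proof (rule loc)
     fix y assume "norm (y - x) \<le> \<rho> m"
     hence "R \<le> norm y" using False C[of m] norm_triangle_ineq2[of x y] by (simp add: norm_minus_commute)
     thus "\<bar>u y - 0\<bar> \<le> 0" using u(2) by simp
    qed
    thus ?thesis by simp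
   qed
  qed
 qed (use borel_measurable_continuous_onI[OF u(1)] in simp)
qed

text \<open>A density argument: convergence on continuous functions of bounded support extends to
  \<open>q\<close> because \<open>T m\<close> does not increase the distance between
  \<open>q\<close> and its approximation.\<close>

lemma slim_local_contraction:
 fixes q :: "'a::euclidean_space \<Rightarrow> real"
 assumes q: "l2L q" "\<And>m. l2L (T m q)"
  and T: "\<And>u R m. l2L u \<Longrightarrow> (\<And>x. norm x \<ge> R \<Longrightarrow> u x = 0) \<Longrightarrow>
   l2L (T m u) \<and> nrmL (\<lambda>x. T m q x - T m u x) \<le> nrmL (\<lambda>x. q x - u x)"
  and loc: "\<And>u m x c \<eta>. l2L u \<Longrightarrow> (\<And>y. norm (y - x) \<le> \<rho> m \<Longrightarrow> \<bar>u y - c\<bar> \<le> \<eta>) \<Longrightarrow> \<bar>T m u x - c\<bar> \<le> \<eta>"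
  and \<rho>: "\<rho> \<longlonglongrightarrow> 0"
 shows "slimL (\<lambda>m. T m q) q"
proof (rule slim_approximation[OF q(2,1)])
 fix e :: real assume e: "e > 0"
 obtain u R where u: "continuous_on UNIV u" "l2L u" "nrmL (\<lambda>x. q x - u x) < e" "\<And>x. norm x \<ge> R \<Longrightarrow> u x = 0"
  by (rule l2_lborel_dense[OF q(1) e]) blast
 note Tu = T[OF u(2,4)]
 have "slimL (\<lambda>m. T m u) u"
  by (rule slim_local[OF u(1,4) l2_meas[OF conjunct1[OF Tu]] loc[OF u(2)] \<rho>])
 thus "\<exists>G g. slimL G g \<and> (\<forall>m. nrmL (\<lambda>x. T m q x - G m x) \<le> e) \<and> nrmL (\<lambda>x. g x - q x) \<le> e"
  using order_trans[OF conjunct2[OF Tu] less_imp_le[OF u(3)]] less_imp_le[OF u(3)]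
  unfolding nrm_commute[of lborel q u] by (intro exI[of _ "\<lambda>m. T m u"] exI[of _ u]) auto
qed

lemma slim_translate_const:
 fixes g :: "'a::euclidean_space \<Rightarrow> real"
 assumes g: "l2L g" and a: "a \<longlonglongrightarrow> 0"
 shows "slimL (\<lambda>m x. g (x + a m)) g"
proof (rule slim_local_contraction[where T = "\<lambda>m u x. u (x + a m)" and \<rho> = "\<lambda>m. norm (a m)", OF g l2_translate[OF g]])
 fix u :: "'a \<Rightarrow> real" and m assume u: "l2L u"
 have "(\<lambda>x. g x - u x) \<in> bm" using l2_meas[OF g] l2_meas[OF u] by simp
 from nrm_translate[OF this] show "l2L (\<lambda>x. u (x + a m)) \<and> nrmL (\<lambda>x. g (x + a m) - u (x + a m)) \<le> nrmL (\<lambda>x. g x - u x)"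
  using l2_translate[OF u] by simp
qed (use a tendsto_norm_zero in auto)

text \<open>The translation is moved to the test function, where it converges strongly.\<close>

lemma wlim_translate:
 fixes f :: "'a::euclidean_space \<Rightarrow> real"
 assumes F: "wlimL F f" and a: "a \<longlonglongrightarrow> 0"
 shows "wlimL (\<lambda>m x. F m (x + a m)) f"
proof -
 obtain B where B: "\<And>m. nrmL (F m) \<le> B" using wlim_bound[OF F] by auto
 have mF[measurable]: "F m \<in> bm" for m using l2_meas[OF wlimD(1)[OF F]] by simp
 show ?thesis
 proof (rule wlimI)
  show "l2L (\<lambda>x. F m (x + a m))" for m by (rule l2_translate[OF wlimD(1)[OF F]])
  show "nrmL (\<lambda>x. F m (x + a m)) \<le> B" for m by (subst nrm_translate) (auto intro: B)
  show "l2L f" by (rule wlimD(2)[OF F])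
  fix g :: "'a \<Rightarrow> real" assume g: "l2L g"
  have [measurable]: "g \<in> bm" using l2_meas[OF g] by simp
  have "(\<lambda>m. \<integral>x. F m x * g (x + - a m) \<partial>lborel) \<longlonglongrightarrow> (LBINT x. f x * g x)"
   using tendsto_minus[OF a] by (intro wlim_slim[OF F] slim_translate_const[OF g]) simp
  moreover have "(LBINT x. F m x * g (x + - a m)) = (LBINT x. F m (x + a m) * g x)" for m
   using lborel_integral_translate[of "\<lambda>x. F m x * g (x + - a m)" "a m"] by simp
  ultimately show "(\<lambda>m. \<integral>x. F m (x + a m) * g x \<partial>lborel) \<longlonglongrightarrow> (LBINT x. f x * g x)" by simp
 qed
qed

section \<open>Grid functions\<close>

definition st :: "real \<Rightarrow> (idx \<Rightarrow> 'a) \<Rightarrow> pt \<Rightarrow> 'a" where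
 "st h F x = F (cell_index h x)"

definition fs :: "(idx \<Rightarrow> real) \<Rightarrow> bool" where
 "fs F \<longleftrightarrow> finite {k. F k \<noteq> 0}"

text \<open>For grid functions of finite support this is \<open>h^3\<close> times the sum of
  products. The integral form makes an index shift a translation and \<open>IP h F F\<close> a
  squared \<open>L2\<close> norm.\<close>

definition IP :: "real \<Rightarrow> (idx \<Rightarrow> real) \<Rightarrow> (idx \<Rightarrow> real) \<Rightarrow> real" where
 "IP h F G = (LBINT x. st h F x * st h G x)"

lemma cell_index_eq_iff: "h > 0 \<Longrightarrow> cell_index h x = k \<longleftrightarrow> x \<in> cell h k"
proof -
 assume h: "h > 0"
 have "\<lfloor>u / h + 1/2\<rfloor> = j \<longleftrightarrow> real_of_int j * h - h/2 \<le> u \<and> u < real_of_int j * h + h/2" for u j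
 proof -
  have "real_of_int j \<le> u / h + 1/2 \<longleftrightarrow> (real_of_int j - 1/2) * h \<le> u"
   unfolding pos_le_divide_eq[OF h, symmetric] by linarith
  moreover have "u / h + 1/2 < real_of_int j + 1 \<longleftrightarrow> u < (real_of_int j + 1/2) * h"
   unfolding pos_divide_less_eq[OF h, symmetric] by linarith
  ultimately show ?thesis by (simp add: floor_eq_iff left_diff_distrib distrib_right)
 qed
 thus ?thesis by (auto simp: cell_index_def cell_def vec_eq_iff)
qed

lemma cell_index_shift:
 assumes "h > 0" shows "cell_index h (x + (real_of_int j * h) *\<^sub>R axis \<alpha> 1) = cell_index h x + j *s axis \<alpha> 1"
proof -
 have "\<lfloor>(u + real_of_int j * h) / h + 1/2\<rfloor> = \<lfloor>u / h + 1/2\<rfloor> + j" for u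
 proof -
  have "(u + real_of_int j * h) / h + 1/2 = (u / h + 1/2) + real_of_int j"
   using assms by (simp add: field_simps)
  thus ?thesis by linarith
 qed
 thus ?thesis by (auto simp: cell_index_def vec_eq_iff axis_def vector_scalar_mult_def)
qed

lemma cell_index_plus: "h > 0 \<Longrightarrow> cell_index h (x + h *\<^sub>R axis \<alpha> 1) = cell_index h x + axis \<alpha> 1"
 using cell_index_shift[of h x 1 \<alpha>] by (simp add: vector_scalar_mult_def vec_eq_iff)

lemma cell_index_minus: "h > 0 \<Longrightarrow> cell_index h (x - h *\<^sub>R axis \<alpha> 1) = cell_index h x - axis \<alpha> 1"
 using cell_index_plus[of h "x - h *\<^sub>R axis \<alpha> 1" \<alpha>] by simp

lemma cell_index_measurable [measurable]: "cell_index h \<in> borel \<rightarrow>\<^sub>M count_space UNIV"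
 unfolding measurable_count_space_eq2_countable
proof (intro conjI ballI)
 fix k :: idx
 have "cell_index h -` {k} \<inter> space borel = (\<Inter>\<alpha>. {x \<in> space borel. \<lfloor>x $ \<alpha> / h + 1/2\<rfloor> = k $ \<alpha>})"
  by (auto simp: cell_index_def vec_eq_iff)
 also have "\<dots> \<in> sets borel" by (intro sets.countable_INT'') measurable
 finally show "cell_index h -` {k} \<inter> space borel \<in> sets borel" .
qed auto

lemma st_measurable [measurable]: "st h (F :: idx \<Rightarrow> real) \<in> bm"
 unfolding st_def[abs_def] by (rule measurable_compose[OF cell_index_measurable]) simp

lemma cell_sets [measurable]: "cell h k \<in> sets borel"
proof -
 have "cell h k = {x \<in> space borel. \<forall>\<alpha>. real_of_int (k$\<alpha>) * h - h/2 \<le> x$\<alpha> \<and> x$\<alpha> < real_of_int (k$\<alpha>) * h + h/2}"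
  by (simp add: cell_def)
 also have "\<dots> \<in> sets borel" by measurable
 finally show ?thesis .
qed

lemma emeasure_cell: assumes h: "h > 0" shows "emeasure lborel (cell h k) = ennreal (h^3)"
proof (rule antisym)
 define l u where "l = (\<chi> \<alpha>. real_of_int (k$\<alpha>) * h - h/2)" and "u = (\<chi> \<alpha>. real_of_int (k$\<alpha>) * h + h/2)"
 have *: "(\<Prod>b\<in>Basis. (u - l) \<bullet> b) = h^3" "\<And>b. b \<in> Basis \<Longrightarrow> l \<bullet> b \<le> u \<bullet> b"
 proof -
  have ul: "(u - l) \<bullet> b = h" if "b \<in> Basis" for b
   using that by (auto simp: l_def u_def Basis_vec_def inner_axis)
  thus "(\<Prod>b\<in>Basis. (u - l) \<bullet> b) = h^3" by simp
  show "l \<bullet> b \<le> u \<bullet> b" if "b \<in> Basis" for b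
   using ul[OF that] h by (simp add: inner_diff_left)
 qed
 have "cell h k \<subseteq> cbox l u" by (auto simp: cell_def l_def u_def mem_box_cart less_imp_le)
 hence "emeasure lborel (cell h k) \<le> emeasure lborel (cbox l u)" by (rule emeasure_mono) simp
 also have "\<dots> = ennreal (h^3)" using * by (simp add: emeasure_lborel_cbox)
 finally show "emeasure lborel (cell h k) \<le> ennreal (h^3)" .
 have "box l u \<subseteq> cell h k" by (auto simp: cell_def l_def u_def mem_box_cart less_imp_le)
 hence "emeasure lborel (box l u) \<le> emeasure lborel (cell h k)" by (rule emeasure_mono) simp
 thus "ennreal (h^3) \<le> emeasure lborel (cell h k)" using * by (simp add: emeasure_lborel_box)
qed

lemma st_indicator_sum:
 assumes "h > 0" "finite S" "\<And>k. k \<notin> S \<Longrightarrow> F k = 0"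
 shows "st h F x = (\<Sum>k\<in>S. F k * ind (cell h k) x)"
proof -
 have "F k * ind (cell h k) x = (if k = cell_index h x then F k else 0)" for k
  using cell_index_eq_iff[OF assms(1), of x k] by (auto split: split_indicator)
 thus ?thesis using assms(2,3) by (simp add: st_def)
qed

lemma st_integrable: assumes "h > 0" "fs F" shows "integrable lborel (st h F)"
proof -
 have "integrable lborel (\<lambda>x. \<Sum>k\<in>{k. F k \<noteq> 0}. F k * ind (cell h k) x)"
  by (intro Bochner_Integration.integrable_sum integrable_mult_right integrable_real_indicator)
   (auto simp: emeasure_cell[OF assms(1)])
 moreover have "st h F = (\<lambda>x. \<Sum>k\<in>{k. F k \<noteq> 0}. F k * ind (cell h k) x)"
  by (rule ext, rule st_indicator_sum[OF assms(1)]) (use assms(2) in \<open>auto simp: fs_def\<close>)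
 ultimately show ?thesis by simp
qed

lemma integral_st_sum:
 assumes "h > 0" "finite S" "\<And>k. k \<notin> S \<Longrightarrow> F k = 0"
 shows "(LBINT x. st h F x) = h^3 * (\<Sum>k\<in>S. F k)"
proof -
 have "measure lborel (cell h k) = h^3" for k
  using assms(1) by (simp add: measure_def emeasure_cell)
 moreover have "st h F = (\<lambda>x. \<Sum>k\<in>S. F k * ind (cell h k) x)"
  by (rule ext, rule st_indicator_sum[OF assms])
 ultimately show ?thesis
  by (simp only:, subst Bochner_Integration.integral_sum)
   (auto simp: sum_distrib_right emeasure_cell[OF assms(1)] mult.commute intro!: integrable_mult_right integrable_real_indicator)
qed

lemma st_mult: "st h F x * st h G x = st h (\<lambda>k. F k * G k) x"
 and st_power: "(st h F x)^n = st h (\<lambda>k. (F k)^n) x"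
 by (simp_all add: st_def)

lemma fs_mult1: "fs F \<Longrightarrow> fs (\<lambda>k. F k * G k)"
 unfolding fs_def by (erule finite_subset[rotated]) auto

lemma fs_mult2: "fs F \<Longrightarrow> fs (\<lambda>k. G k * F k)"
 unfolding fs_def by (erule finite_subset[rotated]) auto

lemma fs_add: "fs F \<Longrightarrow> fs G \<Longrightarrow> fs (\<lambda>k. F k + G k)"
 unfolding fs_def by (rule finite_subset[of _ "{k. F k \<noteq> 0} \<union> {k. G k \<noteq> 0}"]) auto

lemma fs_diff: "fs F \<Longrightarrow> fs G \<Longrightarrow> fs (\<lambda>k. F k - G k)"
 unfolding fs_def by (rule finite_subset[of _ "{k. F k \<noteq> 0} \<union> {k. G k \<noteq> 0}"]) auto

lemma fs_zero [simp]: "fs (\<lambda>k. 0)" by (simp add: fs_def)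

lemma fs_sum: "(\<And>i. i \<in> I \<Longrightarrow> fs (F i)) \<Longrightarrow> fs (\<lambda>k. \<Sum>i\<in>I. F i k)"
 by (induction I rule: infinite_finite_induct) (auto intro: fs_add)

lemma fs_shift: assumes "fs F" shows "fs (\<lambda>k. F (k + a))"
proof -
 have "{k. F (k + a) \<noteq> 0} \<subseteq> (\<lambda>k. k - a) ` {k. F k \<noteq> 0}"
  by (auto simp: image_iff intro!: exI[of _ "_ + a"])
 thus ?thesis using assms unfolding fs_def by (meson finite_imageI finite_subset)
qed

lemma fs_shift': "fs F \<Longrightarrow> fs (\<lambda>k. F (k - a))"
 using fs_shift[of F "-a"] by simp

lemma fs_Dplus: "fs F \<Longrightarrow> fs (Dplus h \<alpha> F)"
 unfolding Dplus_def real_scaleR_def by (intro fs_mult2 fs_diff fs_shift)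

lemma fs_Dminus: "fs F \<Longrightarrow> fs (Dminus h \<alpha> F)"
 unfolding Dminus_def real_scaleR_def by (intro fs_mult2 fs_diff fs_shift')

lemma fs_Dcent: "fs F \<Longrightarrow> fs (Dcent h \<alpha> F)"
 unfolding Dcent_def real_scaleR_def by (intro fs_mult2 fs_diff fs_shift' fs_shift)

lemma st_l2: "h > 0 \<Longrightarrow> fs F \<Longrightarrow> l2L (st h F)"
 unfolding l2_def st_power by (auto intro!: st_integrable simp: power2_eq_square fs_mult1)

lemma IP_int: "h > 0 \<Longrightarrow> fs F \<or> fs G \<Longrightarrow> integrable lborel (\<lambda>x. st h F x * st h G x)"
 unfolding st_mult by (auto intro: st_integrable fs_mult1 fs_mult2)

lemma IP_commute: "IP h F G = IP h G F"
 by (simp add: IP_def mult.commute)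

lemma IP_add_left:
 "h > 0 \<Longrightarrow> fs F1 \<Longrightarrow> fs F2 \<Longrightarrow> IP h (\<lambda>k. F1 k + F2 k) G = IP h F1 G + IP h F2 G"
 unfolding IP_def st_mult
 by (subst Bochner_Integration.integral_add[symmetric])
  (auto intro!: st_integrable fs_mult1 Bochner_Integration.integral_cong simp: st_def distrib_right)

lemma IP_cmult_left: "IP h (\<lambda>k. c * F k) G = c * IP h F G"
 unfolding IP_def by (subst integral_mult_right_zero[symmetric]) (simp add: st_def mult_ac)

lemma IP_diff_left:
 "h > 0 \<Longrightarrow> fs F1 \<Longrightarrow> fs F2 \<Longrightarrow> IP h (\<lambda>k. F1 k - F2 k) G = IP h F1 G - IP h F2 G"
 using IP_add_left[of h F1 "\<lambda>k. (-1) * F2 k" G] IP_cmult_left[of h "-1" F2 G] fs_mult2[of F2 "\<lambda>k. -1"]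
 by simp

lemma IP_diff_right:
 "h > 0 \<Longrightarrow> fs F1 \<Longrightarrow> fs F2 \<Longrightarrow> IP h G (\<lambda>k. F1 k - F2 k) = IP h G F1 - IP h G F2"
 using IP_diff_left IP_commute by metis

lemma IP_cmult_right: "IP h G (\<lambda>k. c * F k) = c * IP h G F"
 using IP_cmult_left IP_commute by metis

lemma IP_zero_left [simp]: "IP h (\<lambda>k. 0) G = 0"
 by (simp add: IP_def st_def)

lemma IP_sum_left:
 "h > 0 \<Longrightarrow> (\<And>i. i \<in> I \<Longrightarrow> fs (F i)) \<Longrightarrow> IP h (\<lambda>k. \<Sum>i\<in>I. F i k) G = (\<Sum>i\<in>I. IP h (F i) G)"
 by (induction I rule: infinite_finite_induct) (auto simp: IP_add_left fs_sum)

lemma IP_sum_right: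
 "h > 0 \<Longrightarrow> (\<And>i. i \<in> I \<Longrightarrow> fs (F i)) \<Longrightarrow> IP h G (\<lambda>k. \<Sum>i\<in>I. F i k) = (\<Sum>i\<in>I. IP h G (F i))"
 using IP_sum_left[of h I F G] by (simp add: IP_commute[of h G])

lemma IP_self: "IP h F F = (nrmL (st h F))^2"
 unfolding IP_def nrm_sq by (simp add: power2_eq_square)

lemma IP_self_nonneg [simp]: "0 \<le> IP h F F" by (simp add: IP_self)

lemma IP_self_eq_0:
 assumes "h > 0" "fs F" "IP h F F = 0" shows "F k = 0"
proof -
 have "h^3 * (\<Sum>k\<in>{k. F k \<noteq> 0}. F k * F k) = 0"
  using assms integral_st_sum[OF assms(1), of "{k. F k \<noteq> 0}" "\<lambda>k. F k * F k"]
  by (auto simp: IP_def st_mult fs_def)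
 hence "(\<Sum>k\<in>{k. F k \<noteq> 0}. F k * F k) = 0" using assms(1) by simp
 thus ?thesis using assms(2) by (subst (asm) sum_nonneg_eq_0_iff) (auto simp: fs_def)
qed

lemma IP_cong: "(\<And>k. F k * G k = F' k * G' k) \<Longrightarrow> IP h F G = IP h F' G'"
 by (simp add: IP_def st_mult)

lemma IP_shift:
 assumes "h > 0"
 shows "IP h (\<lambda>k. F (k + axis \<alpha> 1)) G = IP h F (\<lambda>k. G (k - axis \<alpha> 1))"
proof -
 have "IP h F (\<lambda>k. G (k - axis \<alpha> 1)) = (LBINT x. st h F (x + h *\<^sub>R axis \<alpha> 1) * st h (\<lambda>k. G (k - axis \<alpha> 1)) (x + h *\<^sub>R axis \<alpha> 1))"
  unfolding IP_def by (rule lborel_integral_translate[symmetric]) measurable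
 also have "\<dots> = IP h (\<lambda>k. F (k + axis \<alpha> 1)) G"
  unfolding IP_def st_def by (simp add: cell_index_plus[OF assms])
 finally show ?thesis by simp
qed

lemma IP_Dminus:
 assumes "h > 0" "fs F" "fs G"
 shows "IP h (Dminus h \<alpha> F) G = - IP h F (Dplus h \<alpha> G)"
 using assms IP_shift[OF assms(1), of G \<alpha> F]
 unfolding Dminus_def Dplus_def real_scaleR_def IP_cmult_left IP_cmult_right
 by (simp add: IP_diff_left IP_diff_right fs_shift fs_shift' IP_commute algebra_simps)

lemma IP_Dcent:
 assumes "h > 0" "fs F" "fs G"
 shows "IP h (Dcent h \<alpha> F) G = - IP h F (Dcent h \<alpha> G)"
 using assms IP_shift[OF assms(1), of G \<alpha> F] IP_shift[OF assms(1), of F \<alpha> G]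
 unfolding Dcent_def real_scaleR_def IP_cmult_left IP_cmult_right
 by (simp add: IP_diff_left IP_diff_right fs_shift fs_shift' IP_commute algebra_simps)

lemma IP_lap_h:
 assumes "h > 0" "fs F" "fs G"
 shows "IP h (lap_h h F) G = - (\<Sum>\<alpha>. IP h (Dplus h \<alpha> F) (Dplus h \<alpha> G))"
 unfolding lap_h_def using assms
 by (simp add: IP_sum_left fs_Dminus fs_Dplus IP_Dminus sum_negf)

lemma st_Dplus:
 "h > 0 \<Longrightarrow> st h (Dplus h \<alpha> F) x = (1/h) *\<^sub>R (st h F (x + h *\<^sub>R axis \<alpha> 1) - st h F x)"
 by (simp add: st_def Dplus_def cell_index_plus)

text \<open>The central difference is the mean of the forward difference and its translate by one
  cell, so it inherits the limits of the forward difference.\<close>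

lemma st_Dcent:
 "h > 0 \<Longrightarrow> st h (Dcent h \<alpha> F) x =
   (1/2) * (st h (Dplus h \<alpha> F) x + st h (Dplus h \<alpha> F) (x - h *\<^sub>R axis \<alpha> (1::real)))" for F :: "idx \<Rightarrow> real"
 by (simp add: st_def Dplus_def Dcent_def cell_index_minus field_simps)

text \<open>Write \<open>s = j * h + \<rho>\<close> with \<open>0 \<le> \<rho> < h\<close>. The
  \<open>j\<close> full steps telescope. Over the distance \<rho> the cell index either stays or
  moves to the next cell, so the pointwise difference is zero or that of one full step; this
  rounding is the extra \<open>h\<close>.\<close>

lemma nrm_st_translate:
 assumes h: "h > 0" and F: "fs F" and s: "s \<ge> 0"
 shows "nrmL (\<lambda>x. st h F (x + s *\<^sub>R axis \<alpha> 1) - st h F x) \<le> (s + h) * nrmL (st h (Dplus h \<alpha> F))"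
proof -
 define e where "e = (axis \<alpha> 1 :: pt)"
 define D where "D = nrmL (st h (Dplus h \<alpha> F))"
 define j where "j = nat \<lfloor>s / h\<rfloor>"
 define \<rho> where "\<rho> = s - real j * h"
 have jh: "real j * h \<le> s" "s < real j * h + h"
 proof -
  have "real j \<le> s / h" "s / h < real j + 1" using s h by (simp_all add: j_def)
  thus "real j * h \<le> s" "s < real j * h + h" using h by (simp_all add: field_simps)
 qed
 have l: "l2L (st h F)" using st_l2[OF h F] .
 have one: "nrmL (\<lambda>x. st h F (x + h *\<^sub>R e) - st h F x) = h * D"
 proof -
  have "(\<lambda>x. st h F (x + h *\<^sub>R e) - st h F x) = (\<lambda>x. h * st h (Dplus h \<alpha> F) x)"
   using h by (simp add: st_Dplus e_def)
  thus ?thesis using h by (simp add: nrm_cmult D_def)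
 qed
 have tele: "nrmL (\<lambda>x. st h F (x + (real i * h) *\<^sub>R e) - st h F x) \<le> real i * h * D" for i
 proof (induction i)
  case 0 thus ?case by (simp add: nrm_def)
 next
  case (Suc i)
  have "nrmL (\<lambda>x. st h F (x + (real (Suc i) * h) *\<^sub>R e) - st h F x)
    \<le> nrmL (\<lambda>x. st h F (x + (real (Suc i) * h) *\<^sub>R e) - st h F (x + (real i * h) *\<^sub>R e))
     + nrmL (\<lambda>x. st h F (x + (real i * h) *\<^sub>R e) - st h F x)"
   by (rule nrm_triangle[OF l2_translate[OF l] l2_translate[OF l] l])
  also have "(\<lambda>x. st h F (x + (real (Suc i) * h) *\<^sub>R e) - st h F (x + (real i * h) *\<^sub>R e))
    = (\<lambda>x. (\<lambda>y. st h F (y + h *\<^sub>R e) - st h F y) (x + (real i * h) *\<^sub>R e))"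
   by (simp add: algebra_simps)
  also have "nrmL \<dots> = h * D" by (subst nrm_translate) (simp_all add: one)
  finally show ?case using Suc.IH by (simp add: algebra_simps)
 qed
 have small: "nrmL (\<lambda>x. st h F (x + \<rho> *\<^sub>R e) - st h F x) \<le> h * D"
  unfolding one[symmetric]
 proof (rule nrm_mono)
  show "l2L (\<lambda>x. st h F (x + h *\<^sub>R e) - st h F x)" by (rule l2_diff[OF l2_translate[OF l] l])
  show "AE x in lborel. \<bar>st h F (x + \<rho> *\<^sub>R e) - st h F x\<bar> \<le> \<bar>st h F (x + h *\<^sub>R e) - st h F x\<bar>"
  proof (rule AE_I2)
   fix x :: pt
   have "cell_index h (x + \<rho> *\<^sub>R e) = cell_index h x \<or> cell_index h (x + \<rho> *\<^sub>R e) = cell_index h (x + h *\<^sub>R e)"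
   proof -
    have \<rho>: "0 \<le> \<rho>" "\<rho> < h" using jh by (simp_all add: \<rho>_def)
    define u where "u = x $ \<alpha> / h + 1/2"
    have "\<lfloor>(x $ \<alpha> + \<rho>) / h + 1/2\<rfloor> = \<lfloor>u\<rfloor> \<or> \<lfloor>(x $ \<alpha> + \<rho>) / h + 1/2\<rfloor> = \<lfloor>(x $ \<alpha> + h) / h + 1/2\<rfloor>"
    proof -
     have 1: "(x $ \<alpha> + \<rho>) / h + 1/2 = u + \<rho> / h" "(x $ \<alpha> + h) / h + 1/2 = u + 1"
      using h by (simp_all add: u_def field_simps)
     have "0 \<le> \<rho> / h" "\<rho> / h < 1" using \<rho> h by simp_all
     hence "\<lfloor>u + \<rho> / h\<rfloor> = \<lfloor>u\<rfloor> \<or> \<lfloor>u + \<rho> / h\<rfloor> = \<lfloor>u\<rfloor> + 1" by linarith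
     thus ?thesis unfolding 1 by simp
    qed
    thus ?thesis
     by (auto simp: cell_index_def vec_eq_iff e_def axis_def u_def)
   qed
   thus "\<bar>st h F (x + \<rho> *\<^sub>R e) - st h F x\<bar> \<le> \<bar>st h F (x + h *\<^sub>R e) - st h F x\<bar>"
    by (auto simp: st_def)
  qed
 qed measurable
 have "nrmL (\<lambda>x. st h F (x + s *\<^sub>R e) - st h F x)
   \<le> nrmL (\<lambda>x. st h F (x + s *\<^sub>R e) - st h F (x + (real j * h) *\<^sub>R e))
    + nrmL (\<lambda>x. st h F (x + (real j * h) *\<^sub>R e) - st h F x)"
  by (rule nrm_triangle[OF l2_translate[OF l] l2_translate[OF l] l])
 also have "(\<lambda>x. st h F (x + s *\<^sub>R e) - st h F (x + (real j * h) *\<^sub>R e))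
   = (\<lambda>x. (\<lambda>y. st h F (y + \<rho> *\<^sub>R e) - st h F y) (x + (real j * h) *\<^sub>R e))"
  by (simp add: \<rho>_def algebra_simps)
 also have "nrmL \<dots> = nrmL (\<lambda>x. st h F (x + \<rho> *\<^sub>R e) - st h F x)"
  by (subst nrm_translate) simp_all
 also note small
 also note tele[of j]
 also have "h * D + real j * h * D \<le> (s + h) * D"
  using jh(1) mult_right_mono[of "real j * h + h" "s + h" D] by (simp add: D_def algebra_simps)
 finally show ?thesis by (simp add: D_def e_def)
qed

section \<open>The nonlinearity\<close>

lemma mat3_entry_measurable [measurable]: "(\<lambda>Q::mat3. Q $ i $ j) \<in> bm"
 by (intro borel_measurable_continuous_onI continuous_intros)

lemma frob_inner: "frob A B = A \<bullet> B"
 by (simp add: frob_def inner_vec_def)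

lemma fnorm_norm: "fnorm A = norm A"
 by (simp add: fnorm_def frob_inner norm_eq_sqrt_inner)

lemma norm_sq_components: "(norm (A::mat3))^2 = (\<Sum>i j. (A$i$j)^2)"
 unfolding power2_norm_eq_inner by (simp add: inner_vec_def power2_eq_square)

lemma trace_matmul: "trace ((A::mat3) ** B) = transpose A \<bullet> B"
proof -
 have "trace (A ** B) = (\<Sum>i k. A$i$k * B$k$i)"
  by (simp add: trace_def matrix_matrix_mult_def)
 also have "\<dots> = (\<Sum>k i. A$i$k * B$k$i)" by (rule sum.swap)
 finally show ?thesis by (simp add: inner_vec_def transpose_def)
qed

lemma norm_transpose: "norm (transpose (A::mat3)) = norm A"
proof -
 have "(norm (transpose A))^2 = (norm A)^2"
  unfolding norm_sq_components by (simp add: transpose_def) (rule sum.swap)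
 thus ?thesis by simp
qed

lemma abs_trace_matmul: "\<bar>trace ((A::mat3) ** B)\<bar> \<le> norm A * norm B"
 unfolding trace_matmul using Cauchy_Schwarz_ineq2[of "transpose A" B] by (simp add: norm_transpose)

lemma norm_matmul: "norm ((A::mat3) ** (B::mat3)) \<le> norm A * norm B"
proof (rule power2_le_imp_le)
 have "(norm (A ** B))^2 = (\<Sum>i j. (A$i \<bullet> transpose B $ j)^2)"
  unfolding norm_sq_components by (simp add: matrix_matrix_mult_def inner_vec_def transpose_def)
 also have "\<dots> \<le> (\<Sum>i j. (norm (A$i))^2 * (norm (transpose B $ j))^2)"
  by (intro sum_mono) (metis Cauchy_Schwarz_ineq power2_norm_eq_inner)
 also have "\<dots> = (\<Sum>i. (norm (A$i))^2) * (\<Sum>j. (norm (transpose B $ j))^2)"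
  by (simp add: sum_product)
 also have "\<dots> = (norm A)^2 * (norm (transpose B))^2"
  by (simp add: power2_norm_eq_inner inner_vec_def)
 finally show "(norm (A ** B))^2 \<le> (norm A * norm B)^2"
  by (simp add: norm_transpose power_mult_distrib)
qed simp

lemma norm_mat_1: "norm (mat 1 :: mat3) \<le> 2"
proof (rule power2_le_imp_le)
 show "(norm (mat 1 :: mat3))^2 \<le> 2^2"
  unfolding norm_sq_components by (simp add: mat_def sum_3)
qed simp

lemma trace_diff': "trace (A - B) = trace A - trace (B::mat3)"
 by (rule trace_sub)

lemma matmul_diff_right: "(A::mat3) ** (B - C) = A ** B - A ** C"
 and matmul_diff_left: "(A - B) ** C = A ** C - B ** (C::mat3)"
 by (simp_all add: matrix_matrix_mult_def vec_eq_iff right_diff_distrib left_diff_distrib sum_subtractf)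

text \<open>Telescoping factorisations such as \<open>Q ** (Q - R) + (Q - R) ** R\<close>, with
  every remaining factor bounded by \<open>m\<close>. The powers of \<open>m\<close> are what the
  growth of \<open>r\<close> has to compensate later.\<close>

lemma sq_diff_bounds:
 fixes Q R :: mat3
 assumes "norm Q \<le> m" "norm R \<le> m"
 shows "norm (Q ** Q - R ** R) \<le> 2 * m * norm (Q - R)" (is ?g1)
  and "\<bar>trace (Q ** Q) - trace (R ** R)\<bar> \<le> 2 * m * norm (Q - R)" (is ?g2)
  and "\<bar>trace (Q ** Q ** Q) - trace (R ** R ** R)\<bar> \<le> 3 * m^2 * norm (Q - R)" (is ?g3)
  and "\<bar>trace (Q ** Q)\<bar> \<le> m^2" (is ?g4)
proof -
 have m: "0 \<le> m" using assms(1) norm_ge_zero order_trans by blast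
 have eq: "Q ** Q - R ** R = Q ** (Q - R) + (Q - R) ** R"
  by (simp add: matmul_diff_right matmul_diff_left)
 have b1: "norm Q * norm (Q - R) \<le> m * norm (Q - R)" "norm (Q - R) * norm R \<le> m * norm (Q - R)"
  using assms mult_left_mono[OF assms(2), of "norm (Q - R)"] by (simp_all add: mult_right_mono mult.commute)
 show ?g1
  unfolding eq using norm_triangle_ineq[of "Q ** (Q - R)" "(Q - R) ** R"]
   norm_matmul[of Q "Q - R"] norm_matmul[of "Q - R" R] b1 by simp
 show ?g2
  unfolding trace_diff'[symmetric] eq trace_add
  using abs_triangle_ineq[of "trace (Q ** (Q - R))" "trace ((Q - R) ** R)"]
   abs_trace_matmul[of Q "Q - R"] abs_trace_matmul[of "Q - R" R] b1 by simp
 have eq3: "Q ** Q ** Q - R ** R ** R = (Q - R) ** (Q ** Q) + R ** ((Q - R) ** Q) + R ** R ** (Q - R)"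
  by (simp add: matmul_diff_right matmul_diff_left matrix_mul_assoc)
 have m2: "norm (A ** B) \<le> m * norm B" if "norm A \<le> m" for A B :: mat3
  using norm_matmul[of A B] mult_right_mono[OF that, of "norm B"] by simp
 have m2': "norm (B ** A) \<le> m * norm B" if "norm A \<le> m" for A B :: mat3
  using norm_matmul[of B A] mult_right_mono[OF that, of "norm B"] by (simp add: mult.commute)
 have q2: "norm (Q ** Q) \<le> m^2" "norm (R ** R) \<le> m^2"
  using m2[OF assms(1), of Q] m2[OF assms(2), of R] mult_left_mono[OF assms(1) m] mult_left_mono[OF assms(2) m]
  by (simp_all add: power2_eq_square)
 have "\<bar>trace ((Q - R) ** (Q ** Q))\<bar> \<le> m^2 * norm (Q - R)"
  using abs_trace_matmul[of "Q - R" "Q ** Q"] mult_left_mono[OF q2(1), of "norm (Q - R)"] by (simp add: mult.commute)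
 moreover have "\<bar>trace (R ** ((Q - R) ** Q))\<bar> \<le> m^2 * norm (Q - R)"
 proof -
  have "norm R * norm ((Q - R) ** Q) \<le> m * (m * norm (Q - R))"
   by (intro mult_mono assms m2' m) auto
  thus ?thesis using abs_trace_matmul[of R "(Q - R) ** Q"] by (simp add: power2_eq_square mult.assoc)
 qed
 moreover have "\<bar>trace (R ** R ** (Q - R))\<bar> \<le> m^2 * norm (Q - R)"
  using abs_trace_matmul[of "R ** R" "Q - R"] mult_right_mono[OF q2(2), of "norm (Q - R)"] by simp
 ultimately show ?g3
  unfolding trace_diff'[symmetric] eq3 trace_add by linarith
 show ?g4
  using abs_trace_matmul[of Q Q] mult_mono[OF assms(1,1) m] by (simp add: power2_eq_square)
qed

locale bulk_potential =
 fixes a b c A0 :: real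
 assumes c_pos: "c > 0"
  and bulk_lower: "\<exists>\<delta>>0. \<forall>Q::mat3. transpose Q = Q \<longrightarrow> bulk a b c A0 Q \<ge> \<delta>"
begin

abbreviation "SF \<equiv> Sfun a b c"
abbreviation "rF \<equiv> rfun a b c A0"
abbreviation "PF \<equiv> Pfun a b c A0"
abbreviation "symm Q \<equiv> transpose Q = (Q::mat3)"

lemma bulk_0: "bulk a b c A0 0 = A0"
 by (simp add: bulk_def trace_def matrix_matrix_mult_def)

lemma bulk_diff:
 assumes "norm Q \<le> m" "norm R \<le> m"
 shows "\<bar>bulk a b c A0 Q - bulk a b c A0 R\<bar> \<le> (\<bar>a\<bar> * m + \<bar>b\<bar> * m^2 + c * m^3) * norm (Q - R)"
proof -
 have m: "0 \<le> m" using assms(1) norm_ge_zero order_trans by blast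
 define x y x3 y3 d where defs: "x = trace (Q ** Q)" "y = trace (R ** R)"
  "x3 = trace (Q ** Q ** Q)" "y3 = trace (R ** R ** R)" "d = norm (Q - R)"
 note bds = sq_diff_bounds[OF assms, folded defs] sq_diff_bounds(4)[OF assms(2,2), folded defs]
 have d: "0 \<le> d" by (simp add: defs)
 have "bulk a b c A0 Q - bulk a b c A0 R = a/2 * (x - y) - b/3 * (x3 - y3) + c/4 * ((x + y) * (x - y))"
  by (simp add: bulk_def defs field_simps power2_eq_square)
 moreover have "\<bar>a/2 * (x - y)\<bar> \<le> \<bar>a\<bar>/2 * (2 * m * d)"
  unfolding abs_mult by (intro mult_mono bds) (use m in auto)
 moreover have "\<bar>b/3 * (x3 - y3)\<bar> \<le> \<bar>b\<bar>/3 * (3 * m^2 * d)"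
  unfolding abs_mult by (intro mult_mono bds) (use m in auto)
 moreover have "\<bar>c/4 * ((x + y) * (x - y))\<bar> \<le> c/4 * ((2 * m^2) * (2 * m * d))"
  unfolding abs_mult using c_pos bds m d by (intro mult_mono) auto
 ultimately have "\<bar>bulk a b c A0 Q - bulk a b c A0 R\<bar>
   \<le> \<bar>a\<bar>/2 * (2 * m * d) + \<bar>b\<bar>/3 * (3 * m^2 * d) + c/4 * ((2 * m^2) * (2 * m * d))" by linarith
 also have "\<dots> = (\<bar>a\<bar> * m + \<bar>b\<bar> * m^2 + c * m^3) * d"
  by (simp add: algebra_simps power3_eq_cube power2_eq_square)
 finally show ?thesis by (simp add: defs)
qed

lemma S_diff:
 assumes "norm Q \<le> m" "norm R \<le> m"
 shows "norm (SF Q - SF R) \<le> (\<bar>a\<bar> + 2 * \<bar>b\<bar> + 3 * c) * (1 + m^2) * norm (Q - R)"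
proof -
 have m: "0 \<le> m" using assms(1) norm_ge_zero order_trans by blast
 define x y d where defs: "x = trace (Q ** Q)" "y = trace (R ** R)" "d = norm (Q - R)"
 note bds = sq_diff_bounds[OF assms, folded defs] sq_diff_bounds(4)[OF assms(2,2), folded defs]
 have d: "0 \<le> d" by (simp add: defs)
 have eq: "SF Q - SF R = a *\<^sub>R (Q - R) - b *\<^sub>R (Q ** Q - R ** R) + (b * (x - y) / 3) *\<^sub>R mat 1
   + (c * x) *\<^sub>R (Q - R) + (c * (x - y)) *\<^sub>R R"
  unfolding Sfun_def defs[symmetric] by (simp add: algebra_simps diff_divide_distrib)
 have "norm (a *\<^sub>R (Q - R)) = \<bar>a\<bar> * d" by (simp add: defs)
 moreover have "norm (b *\<^sub>R (Q ** Q - R ** R)) \<le> \<bar>b\<bar> * (2 * m * d)"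
  using bds(1) by (simp add: mult_left_mono)
 moreover have "norm ((b * (x - y) / 3) *\<^sub>R (mat 1 :: mat3)) \<le> (\<bar>b\<bar> * (2 * m * d) / 3) * 2"
  unfolding norm_scaleR by (intro mult_mono norm_mat_1) (use bds(2) m d in \<open>auto simp: abs_mult mult_left_mono\<close>)
 moreover have "norm ((c * x) *\<^sub>R (Q - R)) \<le> (c * m^2) * d"
  unfolding norm_scaleR using c_pos bds(4) by (intro mult_mono) (auto simp: abs_mult defs)
 moreover have "norm ((c * (x - y)) *\<^sub>R R) \<le> (c * (2 * m * d)) * m"
  unfolding norm_scaleR using c_pos bds(2) assms(2) m d by (intro mult_mono) (auto simp: abs_mult)
 ultimately have "norm (SF Q - SF R) \<le> \<bar>a\<bar> * d + \<bar>b\<bar> * (2 * m * d) + (\<bar>b\<bar> * (2 * m * d) / 3) * 2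
   + (c * m^2) * d + (c * (2 * m * d)) * m"
  unfolding eq by (smt (verit, best) norm_triangle_ineq norm_triangle_ineq4)
 also have "\<dots> = (\<bar>a\<bar> + (10/3) * (\<bar>b\<bar> * m) + 3 * (c * m^2)) * d"
  by (simp add: algebra_simps power2_eq_square)
 also have "\<dots> \<le> ((\<bar>a\<bar> + 2 * \<bar>b\<bar> + 3 * c) * (1 + m^2)) * d"
 proof (rule mult_right_mono[OF _ d])
  have "2 * m \<le> 1 + m^2" using sum_squares_bound[of 1 m] by simp
  hence "\<bar>b\<bar> * (2 * m) \<le> \<bar>b\<bar> * (1 + m^2)" by (rule mult_left_mono) simp
  moreover have "(\<bar>a\<bar> + 2 * \<bar>b\<bar> + 3 * c) * (1 + m^2)
    = \<bar>a\<bar> + \<bar>a\<bar> * m^2 + 2 * (\<bar>b\<bar> * (1 + m^2)) + 3 * c + 3 * (c * m^2)"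
   by (simp add: algebra_simps)
  moreover have "\<bar>b\<bar> * (2 * m) = 2 * (\<bar>b\<bar> * m)" by simp
  ultimately show "\<bar>a\<bar> + (10/3) * (\<bar>b\<bar> * m) + 3 * (c * m^2) \<le> (\<bar>a\<bar> + 2 * \<bar>b\<bar> + 3 * c) * (1 + m^2)"
   using c_pos mult_nonneg_nonneg[OF abs_ge_zero[of a] zero_le_power2[of m]]
    mult_nonneg_nonneg[OF abs_ge_zero[of b], of "1 + m^2"] zero_le_power2[of m] by linarith
 qed
 finally show ?thesis by (simp add: defs)
qed

text \<open>For \<open>norm Q \<le> S\<close> the positive lower bound is enough. For larger
  \<open>s = norm Q\<close> the quartic term \<open>c/4 * s^4\<close> wins: \<open>S\<close> is
  chosen so that \<open>\<bar>a\<bar> + \<bar>b\<bar> \<le> c/8 * s\<close>, and the lower order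
  terms take at most \<open>c/8 * s^4\<close>. Since \<open>(1 + s^2)^2 \<le> 4 * s^4\<close> for
  \<open>s \<ge> 1\<close>, the constant \<open>c/32\<close> remains.\<close>

lemma bulk_coercive: "\<exists>c1>0. \<forall>Q. symm Q \<longrightarrow> bulk a b c A0 Q \<ge> c1 * (1 + (norm Q)^2)^2"
proof -
 obtain \<delta> where \<delta>: "\<delta> > 0" "\<And>Q. symm Q \<Longrightarrow> bulk a b c A0 Q \<ge> \<delta>" using bulk_lower by blast
 have A0: "A0 > 0" using \<delta>(1) \<delta>(2)[of 0] by (simp add: bulk_0 transpose_def vec_eq_iff)
 define S where "S = max 1 (8 / c * (\<bar>a\<bar> + \<bar>b\<bar>))"
 define c1 where "c1 = min (c / 32) (\<delta> / (1 + S^2)^2)"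
 have S1: "S \<ge> 1" by (simp add: S_def)
 have pos: "(1 + S^2)^2 > 0" by (intro zero_less_power add_pos_nonneg) auto
 have "bulk a b c A0 Q \<ge> c1 * (1 + (norm Q)^2)^2" if Q: "symm Q" for Q
 proof (cases "norm Q \<le> S")
  case True
  hence "(1 + (norm Q)^2)^2 \<le> (1 + S^2)^2" by (intro power_mono add_left_mono) auto
  hence "c1 * (1 + (norm Q)^2)^2 \<le> \<delta> / (1 + S^2)^2 * (1 + S^2)^2"
   using \<delta>(1) pos by (intro mult_mono) (auto simp: c1_def)
  also have "\<dots> = \<delta>" using pos by simp
  finally show ?thesis using \<delta>(2)[OF Q] by simp
 next
  case False
  define s where "s = norm Q"
  have s: "s \<ge> 1" "s \<ge> 8 / c * (\<bar>a\<bar> + \<bar>b\<bar>)" using False by (auto simp: S_def s_def)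
  hence cs: "c / 8 * s \<ge> \<bar>a\<bar> + \<bar>b\<bar>" using c_pos by (simp add: field_simps)
  have tr2: "trace (Q ** Q) = s^2" using Q by (simp add: trace_matmul s_def power2_norm_eq_inner)
  have tr3: "\<bar>trace (Q ** Q ** Q)\<bar> \<le> s^3"
  proof -
   have "norm (Q ** Q) * norm Q \<le> (s * s) * s"
    unfolding s_def by (intro mult_right_mono norm_matmul) simp
   thus ?thesis using abs_trace_matmul[of "Q ** Q" Q] by (simp add: power3_eq_cube)
  qed
  have h1: "a/2 * s^2 \<ge> - (\<bar>a\<bar> * s^3)"
  proof -
   have "s^2 \<le> s^3" using s(1) by (intro power_increasing) auto
   hence "\<bar>a\<bar> * s^2 \<le> \<bar>a\<bar> * s^3" by (intro mult_left_mono) auto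
   moreover have "- (\<bar>a\<bar> * s^2) \<le> 2 * (a/2 * s^2)" 
    using mult_right_mono[of "-\<bar>a\<bar>" a "s^2"] by simp
   moreover have "0 \<le> \<bar>a\<bar> * s^3" using s(1) by simp
   ultimately show ?thesis by linarith
  qed
  have h2: "b/3 * trace (Q ** Q ** Q) \<le> \<bar>b\<bar> * s^3"
  proof -
   have "\<bar>b * trace (Q ** Q ** Q)\<bar> \<le> \<bar>b\<bar> * s^3" unfolding abs_mult by (intro mult_left_mono tr3) simp
   moreover have "0 \<le> \<bar>b\<bar> * s^3" using s(1) by simp
   ultimately show ?thesis by (simp add: abs_le_iff)
  qed
  have "(\<bar>a\<bar> + \<bar>b\<bar>) * s^3 \<le> (c / 8 * s) * s^3" using s(1) by (intro mult_right_mono cs) simp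
  hence h3: "(\<bar>a\<bar> + \<bar>b\<bar>) * s^3 \<le> c / 8 * s^4" by (simp add: power_numeral_reduce)
  have "bulk a b c A0 Q \<ge> c / 8 * s^4"
   using h1 h2 h3 A0 unfolding bulk_def tr2 by (simp add: algebra_simps flip: power_mult)
  moreover have "c1 * (1 + s^2)^2 \<le> c / 32 * (4 * s^4)"
  proof (rule mult_mono)
   have "1 \<le> s^2" using s(1) by simp
   hence "(1 + s^2)^2 \<le> (2 * s^2)^2" by (intro power_mono) auto
   thus "(1 + s^2)^2 \<le> 4 * s^4" by (simp add: power_mult_distrib flip: power_mult)
   show "c1 \<le> c / 32" unfolding c1_def by (rule min.cobounded1)
  qed (use c_pos in auto)
  ultimately show ?thesis by (simp add: s_def)
 qed
 moreover have "c1 > 0" using c_pos \<delta>(1) pos by (simp add: c1_def)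
 ultimately show ?thesis by blast
qed

lemma r_coercive: "\<exists>c0>0. \<forall>Q. symm Q \<longrightarrow> rF Q \<ge> c0 * (1 + (norm Q)^2)"
proof -
 obtain c1 where c1: "c1 > 0" "\<And>Q. symm Q \<Longrightarrow> bulk a b c A0 Q \<ge> c1 * (1 + (norm Q)^2)^2"
  using bulk_coercive by blast
 have "rF Q \<ge> sqrt (2 * c1) * (1 + (norm Q)^2)" if "symm Q" for Q
 proof -
  have "sqrt (2 * (c1 * (1 + (norm Q)^2)^2)) \<le> rF Q"
   unfolding rfun_def using c1(2)[OF that] by (intro real_sqrt_le_mono) simp
  thus ?thesis by (simp add: real_sqrt_mult)
 qed
 thus ?thesis using c1(1) by (intro exI[of _ "sqrt (2 * c1)"]) auto
qed

lemma r_sq: "symm Q \<Longrightarrow> (rF Q)^2 = 2 * bulk a b c A0 Q"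
 using bulk_lower unfolding rfun_def by (metis less_imp_le mult_nonneg_nonneg order_trans real_sqrt_pow2 zero_le_numeral)

text \<open>The quotient rule splits the difference into \<open>(S(Q) - S(R)) / r(Q)\<close> and a
  term with \<open>r(Q) - r(R)\<close>. The Lipschitz constant of \<open>S\<close> on a ball of
  radius \<open>m\<close> grows like \<open>1 + m^2\<close>, which is also the lower bound for
  \<open>r\<close>, so the quotient stays bounded. By symmetry \<open>Q\<close> may be taken as the
  matrix of larger norm, so that \<open>r(Q)\<close> controls both terms.\<close>

lemma P_lipschitz: "\<exists>L\<ge>0. \<forall>Q R. symm Q \<longrightarrow> symm R \<longrightarrow> norm (PF Q - PF R) \<le> L * norm (Q - R)"
proof -
 obtain k where k: "k > 0" "\<And>Q. symm Q \<Longrightarrow> rF Q \<ge> k * (1 + (norm Q)^2)" using r_coercive by blast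
 define C1 where "C1 = \<bar>a\<bar> + 2 * \<bar>b\<bar> + 3 * c"
 define C2 where "C2 = \<bar>a\<bar> + \<bar>b\<bar> + c"
 define L where "L = C1 / k + 4 * C1 * C2 / k^3"
 have C: "C1 \<ge> 0" "C2 \<ge> 0" "L \<ge> 0" using c_pos k(1) by (simp_all add: C1_def C2_def L_def)
 have S0: "SF 0 = 0" by (simp add: Sfun_def trace_def matrix_matrix_mult_def vec_eq_iff)
 have key: "norm (PF Q - PF R) \<le> L * norm (Q - R)"
  if QR: "symm Q" "symm R" and le: "norm R \<le> norm Q" for Q R
 proof -
  define m d q x y where "m = norm Q" and "d = norm (Q - R)" and "q = 1 + m^2" and "x = rF Q" and "y = rF R"
  have m: "m \<ge> 0" "norm Q \<le> m" "norm R \<le> m" "d \<ge> 0" "q > 0" using le by (simp_all add: m_def d_def q_def add_pos_nonneg)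
  have kq: "k * q > 0" "k * q \<le> x" "k * (1 + (norm R)^2) \<le> y" using k(2)[OF QR(1)] k(2)[OF QR(2)] k(1) m by (simp_all add: q_def m_def x_def y_def)
  moreover have "0 < k * (1 + (norm R)^2)" using k(1) by (simp add: add_pos_nonneg)
  ultimately have p: "x > 0" "y > 0" by linarith+
  have SR: "norm (SF R) \<le> C1 / k * m * y"
  proof -
   have "norm (SF R) \<le> C1 * (1 + (norm R)^2) * norm R" using S_diff[of R "norm R" 0] by (simp add: S0 C1_def)
   also have "\<dots> \<le> C1 * (y / k) * m" using kq(3) k(1) C m p by (intro mult_mono) (auto simp: field_simps)
   finally show ?thesis by (simp add: mult_ac)
  qed
  \<comment> \<open>\<open>x - y\<close> is obtained from \<open>x^2 - y^2\<close>, twice a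
    difference of bulk energies, whose Lipschitz constant is at most of order \<open>m * q\<close>;
    dividing by \<open>x + y \<ge> k * q\<close> leaves the factor \<open>m\<close>.\<close>
  have xy: "\<bar>x - y\<bar> \<le> 4 * C2 / k * m * d"
  proof -
   have "2 * m^2 \<le> m + m^3" "m * q = m + m^3"
    using mult_left_mono[OF sum_squares_bound[of m 1] m(1)] by (simp_all add: q_def power2_eq_square power3_eq_cube algebra_simps)
   hence "m^2 \<le> 2 * m * q" "m \<le> 2 * m * q" "m^3 \<le> 2 * m * q"
    using m(1) zero_le_power2[of m] zero_le_power[OF m(1), of 3] by linarith+
   hence "\<bar>a\<bar> * m + \<bar>b\<bar> * m^2 + c * m^3 \<le> \<bar>a\<bar> * (2 * m * q) + \<bar>b\<bar> * (2 * m * q) + c * (2 * m * q)"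
    using c_pos m by (intro add_mono mult_left_mono) auto
   hence "(\<bar>a\<bar> * m + \<bar>b\<bar> * m^2 + c * m^3) * d \<le> (2 * C2 * m * q) * d" using m(4) by (intro mult_right_mono) (auto simp: C2_def algebra_simps)
   moreover have "\<bar>x^2 - y^2\<bar> = 2 * \<bar>bulk a b c A0 Q - bulk a b c A0 R\<bar>"
    unfolding x_def y_def r_sq[OF QR(1)] r_sq[OF QR(2)] by (simp add: abs_if)
   ultimately have "\<bar>x^2 - y^2\<bar> \<le> 4 * C2 * m * d * q" using bulk_diff[OF m(2,3)] by (simp add: d_def mult_ac)
   moreover have "x^2 - y^2 = (x - y) * (x + y)" by (simp add: algebra_simps power2_eq_square)
   moreover have "\<bar>x - y\<bar> * (k * q) \<le> \<bar>x - y\<bar> * (x + y)" using kq p by (intro mult_left_mono) auto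
   ultimately have "\<bar>x - y\<bar> * k * q \<le> 4 * C2 * m * d * q" using p by (simp add: abs_mult mult_ac)
   thus ?thesis using m k(1) by (simp add: field_simps)
  qed
  have "PF Q - PF R = (1 / x) *\<^sub>R (SF Q - SF R) + ((y - x) / (x * y)) *\<^sub>R SF R"
   using p by (simp add: Pfun_def x_def y_def algebra_simps diff_divide_distrib)
  hence "norm (PF Q - PF R) \<le> 1 / x * norm (SF Q - SF R) + \<bar>x - y\<bar> / (x * y) * norm (SF R)"
   using norm_triangle_ineq[of "(1 / x) *\<^sub>R (SF Q - SF R)" "((y - x) / (x * y)) *\<^sub>R SF R"] p by (simp add: abs_mult abs_minus_commute)
  also have "\<dots> \<le> 1 / (k * q) * (C1 * q * d) + (4 * C2 / k * m * d) / (x * y) * (C1 / k * m * y)"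
  proof (rule add_mono)
   show "1 / x * norm (SF Q - SF R) \<le> 1 / (k * q) * (C1 * q * d)"
    by (rule mult_mono[OF frac_le]) (use S_diff[OF m(2,3)] kq C m in \<open>auto simp: C1_def q_def d_def\<close>)
   show "\<bar>x - y\<bar> / (x * y) * norm (SF R) \<le> (4 * C2 / k * m * d) / (x * y) * (C1 / k * m * y)"
    by (rule mult_mono[OF divide_right_mono[OF xy] SR]) (use C m p k(1) in simp_all)
  qed
  also have "\<dots> = C1 / k * d + 4 * C1 * C2 / k^2 * d * (m^2 / x)"
   using p k(1) m by (simp add: power2_eq_square mult_ac)
  \<comment> \<open>The two factors \<open>m\<close>, one from \<open>xy\<close> and one from
    \<open>SR\<close>, are absorbed by the quadratic growth of \<open>x\<close>.\<close>
  also have "m^2 / x \<le> 1 / k" using kq k(1) p by (simp add: q_def field_simps)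
  hence "C1 / k * d + 4 * C1 * C2 / k^2 * d * (m^2 / x) \<le> C1 / k * d + 4 * C1 * C2 / k^2 * d * (1 / k)"
   using C m by (intro add_left_mono mult_left_mono) auto
  finally show ?thesis using k(1) by (simp add: L_def d_def field_simps power3_eq_cube power2_eq_square)
 qed
 have "norm (PF Q - PF R) \<le> L * norm (Q - R)" if "symm Q" "symm R" for Q R
  using key[OF that] key[OF that(2,1)] by (cases "norm R \<le> norm Q") (auto simp: norm_minus_commute)
 thus ?thesis using C by blast
qed

text \<open>This growth is the reason why square integrability of \<open>r(Q0)\<close> calls for a
  fourth power estimate of \<open>Q0\<close>.\<close>

lemma r_growth: "\<exists>K\<ge>0. \<forall>Q. symm Q \<longrightarrow> (rF Q)^2 \<le> K * (1 + (norm Q)^4)"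
proof -
 obtain \<delta> where \<delta>: "\<delta> > 0" "\<And>Q. symm Q \<Longrightarrow> bulk a b c A0 Q \<ge> \<delta>" using bulk_lower by blast
 have A0: "A0 > 0" using \<delta>(1) \<delta>(2)[of 0] by (simp add: bulk_0 transpose_def vec_eq_iff)
 have "(rF Q)^2 \<le> 2 * (A0 + \<bar>a\<bar> + \<bar>b\<bar> + c) * (1 + (norm Q)^4)" if "symm Q" for Q
 proof -
  define m where "m = norm Q"
  have m: "m \<ge> 0" by (simp add: m_def)
  have "\<bar>bulk a b c A0 Q - A0\<bar> \<le> (\<bar>a\<bar> * m + \<bar>b\<bar> * m^2 + c * m^3) * m"
   using bulk_diff[of Q m 0] m by (simp add: m_def bulk_0)
  also have "\<dots> = \<bar>a\<bar> * m^2 + \<bar>b\<bar> * m^3 + c * m^4"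
   by (simp add: algebra_simps power_numeral_reduce)
  also have "\<dots> \<le> \<bar>a\<bar> * (1 + m^4) + \<bar>b\<bar> * (1 + m^4) + c * (1 + m^4)"
  proof -
   have m2: "2 * m^2 \<le> 1 + m^4" using sum_squares_bound[of 1 "m^2"] by (simp flip: power_mult)
   have "2 * (m * m^2) \<le> m^2 + (m^2)^2" using sum_squares_bound[of m "m^2"] by simp
   moreover have "m^3 = m * m^2" "m^4 = (m^2)^2" by (simp_all add: power_numeral_reduce)
   ultimately have m3: "m^3 \<le> 1 + m^4" using m2 zero_le_power2[of "m^2"] by linarith
   have "m^2 \<le> 1 + m^4" using m2 by (smt (verit) zero_le_power2)
   with m3 show ?thesis using c_pos by (intro add_mono mult_left_mono) auto
  qed
  finally have "bulk a b c A0 Q \<le> A0 * (1 + m^4) + (\<bar>a\<bar> * (1 + m^4) + \<bar>b\<bar> * (1 + m^4) + c * (1 + m^4))"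
   using A0 m by (simp add: distrib_left) (smt (verit) mult_nonneg_nonneg zero_le_power)
  thus ?thesis unfolding r_sq[OF that] by (simp add: m_def algebra_simps)
 qed
 thus ?thesis using A0 c_pos by (intro exI[of _ "2 * (A0 + \<bar>a\<bar> + \<bar>b\<bar> + c)"]) auto
qed

lemma P_0 [simp]: "PF 0 = 0"
 by (simp add: Pfun_def Sfun_def trace_def matrix_matrix_mult_def vec_eq_iff)

text \<open>The multiple of the identity subtracted from \<open>Q ** Q\<close> in
  \<open>Sfun\<close> removes exactly its trace.\<close>

lemma P_sym_tf: assumes "sym_tf Q" shows "sym_tf (PF Q)"
proof -
 have t: "transpose Q = Q" "trace Q = 0" using assms by (auto simp: sym_tf_def)
 have 1: "transpose (x *\<^sub>R A) = x *\<^sub>R transpose A" "transpose (A + B) = transpose A + transpose B"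
  "transpose (A - B) = transpose A - transpose B" for x and A B :: mat3
  by (simp_all add: transpose_def vec_eq_iff)
 have 2: "trace (x *\<^sub>R A) = x * trace A" for x and A :: mat3
  by (simp add: trace_def sum_distrib_left)
 show ?thesis
  unfolding sym_tf_def Pfun_def Sfun_def
  by (simp add: 1 2 t trace_add trace_sub matrix_transpose_mul transpose_mat trace_I)
qed

lemma rF_measurable [measurable]: "rF \<in> bm"
 unfolding rfun_def[abs_def] bulk_def trace_def matrix_matrix_mult_def by (simp add: sum_3) measurable

lemma PF_measurable [measurable]: "(\<lambda>Q. PF Q $ i $ j) \<in> bm"
 unfolding Pfun_def Sfun_def trace_def matrix_matrix_mult_def
 by (cases "i = j"; simp add: sum_3 mat_def; measurable)

end

section \<open>Solvability of the implicit step\<close>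

text \<open>Gaussian elimination, one unknown per induction step. Were column \<open>i0\<close>
  zero, the unit vector at \<open>i0\<close> would lie in the kernel, so a pivot exists; the
  eliminated system \<open>A'\<close> has trivial kernel because each element of its kernel extends
  to one of the full kernel.\<close>

lemma square_system_solvable:
 fixes A :: "'j \<Rightarrow> 'i \<Rightarrow> real"
 assumes "finite I" "finite J" "card I = card J"
  and "\<And>x. (\<forall>j\<in>J. (\<Sum>i\<in>I. A j i * x i) = 0) \<Longrightarrow> \<forall>i\<in>I. x i = 0"
 shows "\<exists>x. \<forall>j\<in>J. (\<Sum>i\<in>I. A j i * x i) = y j"
 using assms
proof (induction "card I" arbitrary: I J A y)
 case 0
 thus ?case by auto
next
 case (Suc n)
 then obtain i0 where i0: "i0 \<in> I" by fastforce
 have col: "\<exists>j0\<in>J. A j0 i0 \<noteq> 0"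
 proof (rule ccontr)
  assume *: "\<not> (\<exists>j0\<in>J. A j0 i0 \<noteq> 0)"
  have "(\<Sum>i\<in>I. A j i * (if i = i0 then 1 else 0)) = 0" if "j \<in> J" for j
   using * that by (intro sum.neutral) auto
  hence "\<forall>i\<in>I. (if i = i0 then 1 else 0) = (0::real)" by (intro Suc.prems(4)) auto
  thus False using i0 by auto
 qed
 then obtain j0 where j0: "j0 \<in> J" and p: "A j0 i0 \<noteq> 0" by blast
 define I' J' where "I' = I - {i0}" and "J' = J - {j0}"
 define A' where "A' j i = A j i - A j i0 / A j0 i0 * A j0 i" for j i
 have split: "(\<Sum>i\<in>I. A j i * x i) = A j i0 * x i0 + (\<Sum>i\<in>I'. A j i * x i)" for j x
  unfolding I'_def using Suc.prems(1) i0 by (rule sum.remove)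
 have A'_sum: "(\<Sum>i\<in>I'. A' j i * x i) = (\<Sum>i\<in>I'. A j i * x i) - A j i0 / A j0 i0 * (\<Sum>i\<in>I'. A j0 i * x i)" for j x
  by (simp only: A'_def left_diff_distrib sum_subtractf sum_distrib_left mult.assoc)
 have Iext: "(\<Sum>i\<in>I'. A j i * (x(i0 := t)) i) = (\<Sum>i\<in>I'. A j i * x i)" for j x t
  by (rule sum.cong) (auto simp: I'_def)
 have "\<exists>x. \<forall>j\<in>J'. (\<Sum>i\<in>I'. A' j i * x i) = y j - A j i0 / A j0 i0 * y j0"
 proof (rule Suc.hyps(1))
  show "n = card I'" "finite I'" "finite J'" "card I' = card J'"
   using Suc i0 j0 by (auto simp: I'_def J'_def)
  fix x assume x: "\<forall>j\<in>J'. (\<Sum>i\<in>I'. A' j i * x i) = 0"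
  define z where "z = x(i0 := - (\<Sum>i\<in>I'. A j0 i * x i) / A j0 i0)"
  have zi0: "z i0 = - (\<Sum>i\<in>I'. A j0 i * x i) / A j0 i0" by (simp add: z_def)
  have zI: "(\<Sum>i\<in>I'. A j i * z i) = (\<Sum>i\<in>I'. A j i * x i)" for j unfolding z_def by (rule Iext)
  have "(\<Sum>i\<in>I. A j i * z i) = 0" if "j \<in> J" for j
  proof (cases "j = j0")
   case True
   thus ?thesis using p by (simp add: split zi0 zI)
  next
   case False
   hence "(\<Sum>i\<in>I'. A' j i * x i) = 0" using that x by (simp add: J'_def)
   thus ?thesis by (simp add: split zi0 zI A'_sum)
  qed
  hence "\<forall>i\<in>I. z i = 0" by (intro Suc.prems(4)) auto
  thus "\<forall>i\<in>I'. x i = 0" by (auto simp: z_def I'_def split: if_splits)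
 qed
 then obtain x where x: "\<And>j. j \<in> J' \<Longrightarrow> (\<Sum>i\<in>I'. A' j i * x i) = y j - A j i0 / A j0 i0 * y j0" by blast
 define z where "z = x(i0 := (y j0 - (\<Sum>i\<in>I'. A j0 i * x i)) / A j0 i0)"
 have zi0: "z i0 = (y j0 - (\<Sum>i\<in>I'. A j0 i * x i)) / A j0 i0" by (simp add: z_def)
 have zI: "(\<Sum>i\<in>I'. A j i * z i) = (\<Sum>i\<in>I'. A j i * x i)" for j unfolding z_def by (rule Iext)
 have "(\<Sum>i\<in>I. A j i * z i) = y j" if "j \<in> J" for j
 proof (cases "j = j0")
  case True
  thus ?thesis using p by (simp add: split zi0 zI)
 next
  case False
  hence "(\<Sum>i\<in>I'. A j i * x i) - A j i0 / A j0 i0 * (\<Sum>i\<in>I'. A j0 i * x i) = y j - A j i0 / A j0 i0 * y j0"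
   using that x[of j] by (simp add: J'_def A'_sum)
  thus ?thesis unfolding split zi0 zI by (simp add: right_diff_distrib diff_divide_distrib)
 qed
 thus ?case by blast
qed

text \<open>A linear operator on functions supported in \<open>I\<close>, observed only at the
  points of \<open>I\<close>, is a square system in the coefficients of the unit functions
  \<open>e k\<close>.\<close>

lemma injective_operator_surjective:
 fixes L :: "('i \<Rightarrow> real) \<Rightarrow> 'i \<Rightarrow> real"
 assumes I: "finite I"
  and lin: "\<And>f g t. L (\<lambda>i. t * f i + g i) = (\<lambda>i. t * L f i + L g i)"
  and inj: "\<And>f. (\<And>i. i \<notin> I \<Longrightarrow> f i = 0) \<Longrightarrow> (\<And>i. i \<in> I \<Longrightarrow> L f i = 0) \<Longrightarrow> f = (\<lambda>i. 0)"
 shows "\<exists>f. (\<forall>i. i \<notin> I \<longrightarrow> f i = 0) \<and> (\<forall>i\<in>I. L f i = y i)"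
proof -
 define e where "e k = (\<lambda>i. if i = k then 1 else 0 :: real)" for k :: 'i
 have L0: "L (\<lambda>i. 0) = (\<lambda>i. 0)"
  using lin[of 0 "\<lambda>i. 0" "\<lambda>i. 0"] lin[of 1 "\<lambda>i. 0" "\<lambda>i. 0"] by (simp add: fun_eq_iff)
 have Lsum: "L (\<lambda>i. \<Sum>k\<in>K. x k * e k i) = (\<lambda>i. \<Sum>k\<in>K. x k * L (e k) i)" if "finite K" for K x
  using that by (induction K rule: finite_induct) (auto simp: L0 lin)
 have ex: "(\<Sum>k\<in>I. x k * e k i) = (if i \<in> I then x i else 0)" for x i
 proof -
  have "x k * e k i = (if i = k then x k else 0)" for k by (simp add: e_def)
  thus ?thesis using I by simp
 qed
 have "\<exists>x. \<forall>j\<in>I. (\<Sum>k\<in>I. L (e k) j * x k) = y j"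
 proof (rule square_system_solvable[OF I I refl])
  fix x assume x: "\<forall>j\<in>I. (\<Sum>k\<in>I. L (e k) j * x k) = 0"
  have "(\<lambda>i. \<Sum>k\<in>I. x k * e k i) = (\<lambda>i. 0)"
  proof (rule inj)
   show "(\<Sum>k\<in>I. x k * e k i) = 0" if "i \<notin> I" for i using that by (simp only: ex if_False)
   show "L (\<lambda>i. \<Sum>k\<in>I. x k * e k i) i = 0" if "i \<in> I" for i
    unfolding Lsum[OF I] using x that by (simp add: mult.commute)
  qed
  hence "(if i \<in> I then x i else 0) = 0" for i unfolding ex by meson
  thus "\<forall>i\<in>I. x i = 0" by meson
 qed
 then obtain x where x: "\<forall>j\<in>I. (\<Sum>k\<in>I. L (e k) j * x k) = y j" by blast
 show ?thesis
 proof (intro exI[of _ "\<lambda>i. \<Sum>k\<in>I. x k * e k i"] conjI allI impI ballI)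
  show "(\<Sum>k\<in>I. x k * e k i) = 0" if "i \<notin> I" for i using that by (simp only: ex if_False)
  show "L (\<lambda>i. \<Sum>k\<in>I. x k * e k i) i = y i" if "i \<in> I" for i
   unfolding Lsum[OF I] using x that by (simp add: mult.commute)
 qed
qed

section \<open>Finite support, linearity and summation by parts for matrix grid functions\<close>

lemma finite_idx: assumes "finite A" shows "finite {k :: idx. \<forall>\<alpha>. k $ \<alpha> \<in> A}"
proof -
 have "{k :: idx. \<forall>\<alpha>. k $ \<alpha> \<in> A} \<subseteq> vec_lambda ` (\<Pi>\<^sub>E \<alpha>\<in>(UNIV::3 set). A)"
 proof
  fix k :: idx assume "k \<in> {k. \<forall>\<alpha>. k $ \<alpha> \<in> A}"
  hence "vec_nth k \<in> (\<Pi>\<^sub>E \<alpha>\<in>(UNIV::3 set). A)" by auto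
  thus "k \<in> vec_lambda ` (\<Pi>\<^sub>E \<alpha>\<in>(UNIV::3 set). A)" by (metis image_eqI vec_nth_inverse)
 qed
 thus ?thesis by (rule finite_subset) (use assms in \<open>intro finite_imageI finite_PiE; simp\<close>)
qed

lemma finite_grid: "finite {k. in_grid N k}"
 using finite_idx[of "{1..int N}"] by (simp add: in_grid_def)

lemma bc_fs: "bc N F \<Longrightarrow> fs F"
 unfolding fs_def bc_def by (rule finite_subset[OF _ finite_grid[of N]]) auto

abbreviation cp :: "3 \<Rightarrow> 3 \<Rightarrow> (idx \<Rightarrow> mat3) \<Rightarrow> idx \<Rightarrow> real" where
 "cp i j Q \<equiv> (\<lambda>k. Q k $ i $ j)"

lemma bc_cp: "bc N Q \<Longrightarrow> bc N (cp i j Q)"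
 by (auto simp: bc_def)

lemma bc_cp_fs: "bc N Q \<Longrightarrow> fs (cp i j Q)"
 by (intro bc_fs bc_cp)

lemma Dcent_linear:
 fixes f g :: "idx \<Rightarrow> real"
 shows "Dcent h \<alpha> (\<lambda>k. t * f k + g k) = (\<lambda>k. t * Dcent h \<alpha> f k + Dcent h \<alpha> g k)"
 by (simp add: Dcent_def fun_eq_iff algebra_simps)

lemma Dcent_sum:
 fixes f :: "'i \<Rightarrow> idx \<Rightarrow> real"
 shows "Dcent h \<alpha> (\<lambda>k. \<Sum>i\<in>I. f i k) = (\<lambda>k. \<Sum>i\<in>I. Dcent h \<alpha> (f i) k)"
 by (simp add: Dcent_def fun_eq_iff sum_subtractf flip: sum_divide_distrib)

lemma lap_h_linear:
 fixes f g :: "idx \<Rightarrow> real"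
 shows "lap_h h (\<lambda>k. t * f k + g k) = (\<lambda>k. t * lap_h h f k + lap_h h g k)"
 by (simp add: lap_h_def Dplus_def Dminus_def sum_3 fun_eq_iff algebra_simps add_divide_distrib diff_divide_distrib)

lemma lap_h_linear_mat:
 fixes f g :: "idx \<Rightarrow> mat3"
 shows "lap_h h (\<lambda>k. t *\<^sub>R f k + g k) = (\<lambda>k. t *\<^sub>R lap_h h f k + lap_h h g k)"
 by (simp add: lap_h_def Dplus_def Dminus_def sum_3 fun_eq_iff vec_eq_iff algebra_simps add_divide_distrib diff_divide_distrib)

lemma cp_lap_h: "lap_h h Q k $ i $ j = lap_h h (cp i j Q) k"
 by (simp add: lap_h_def Dplus_def Dminus_def)

lemma alpha_h_linear:
 "alpha_h h (\<lambda>k. t *\<^sub>R Q k + R k) = (\<lambda>k. t *\<^sub>R alpha_h h Q k + alpha_h h R k)"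
 by (simp add: alpha_h_def fun_eq_iff vec_eq_iff Dcent_linear) (simp add: sum_3 algebra_simps add_divide_distrib)

lemma alpha_h_symmetric: "alpha_h h Q k $ i $ j = alpha_h h Q k $ j $ i"
 by (simp add: alpha_h_def add.commute)

lemma alpha_h_trace: "(\<Sum>i. alpha_h h Q k $ i $ i) = 0"
 by (simp add: alpha_h_def sum_3 field_simps)

text \<open>The right-hand side has the shape of the bilinear form in the weak formulation, trace
  part included, so that the two can be matched term by term in the limit.\<close>

lemma alpha_h_by_parts:
 assumes h: "h > 0" and A: "\<And>i j. fs (cp i j A)" and \<phi>: "\<And>i j. fs (\<phi> i j)"
 shows "(\<Sum>i j. IP h (cp i j (alpha_h h A)) (\<phi> i j)) =
  - (\<Sum>i j k. IP h (Dcent h k (cp j k A)) (Dcent h i (\<phi> i j)) + IP h (Dcent h k (cp i k A)) (Dcent h j (\<phi> i j))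
    - 2/3 * IP h (Dcent h i (cp k i A)) (Dcent h k (\<phi> j j)))"
proof -
 have d: "fs (Dcent h m (Dcent h n (cp i j A)))" for m n i j by (intro fs_Dcent A)
 have gen: "IP h (\<lambda>l. (\<Sum>k. Dcent h i (Dcent h k (cp j k A)) l + Dcent h j (Dcent h k (cp i k A)) l)
    - c * (\<Sum>m n. Dcent h m (Dcent h n (cp m n A)) l)) (\<phi> i j)
   = (\<Sum>k. IP h (Dcent h i (Dcent h k (cp j k A))) (\<phi> i j) + IP h (Dcent h j (Dcent h k (cp i k A))) (\<phi> i j))
    - c * (\<Sum>m n. IP h (Dcent h m (Dcent h n (cp m n A))) (\<phi> i j))" for i j c
  by (subst IP_diff_left[OF h])
   (auto intro!: fs_sum fs_add fs_mult2 d simp: IP_cmult_left IP_sum_left[OF h] IP_add_left[OF h] d fs_sum fs_add)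
 have *: "IP h (cp i j (alpha_h h A)) (\<phi> i j) =
   (\<Sum>k. - IP h (Dcent h k (cp j k A)) (Dcent h i (\<phi> i j)) - IP h (Dcent h k (cp i k A)) (Dcent h j (\<phi> i j)))
   + (if i = j then 2/3 else 0) * (\<Sum>m n. IP h (Dcent h n (cp m n A)) (Dcent h m (\<phi> i j)))"
  for i j
 proof -
  have "cp i j (alpha_h h A) = (\<lambda>l. (\<Sum>k. Dcent h i (Dcent h k (cp j k A)) l + Dcent h j (Dcent h k (cp i k A)) l)
    - (if i = j then 2/3 else 0) * (\<Sum>m n. Dcent h m (Dcent h n (cp m n A)) l))"
   by (auto simp: alpha_h_def)
  thus ?thesis
   by (simp only: gen) (simp add: IP_Dcent[OF h] fs_Dcent A \<phi> sum_negf sum_subtractf)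
 qed
 show ?thesis unfolding * by (simp add: sum_3 algebra_simps)
qed

section \<open>One implicit step: invariance, energy and unique solvability\<close>

definition gstep :: "real \<Rightarrow> real \<Rightarrow> real \<Rightarrow> nat \<Rightarrow> real \<Rightarrow> (idx \<Rightarrow> mat3) \<Rightarrow> (idx \<Rightarrow> mat3) \<Rightarrow> (idx \<Rightarrow> real) \<Rightarrow>
  (idx \<Rightarrow> mat3) \<Rightarrow> (idx \<Rightarrow> real) \<Rightarrow> bool" where
 "gstep L1 L23 M N dt P Qc rc Qn rn \<longleftrightarrow> bc N Qn \<and> bc N rn \<and> (\<forall>k. in_grid N k \<longrightarrow>
   (1/dt) *\<^sub>R (Qn k - Qc k) = M *\<^sub>R (L1 *\<^sub>R lap_h (mesh N) (\<lambda>l. (1/2) *\<^sub>R (Qn l + Qc l)) k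
    - ((rn k + rc k) / 2) *\<^sub>R P k + (L23 / 2) *\<^sub>R ((1/2) *\<^sub>R (alpha_h (mesh N) Qn k + alpha_h (mesh N) Qc k)))
   \<and> rn k - rc k = frob (P k) (Qn k - Qc k))"

text \<open>The extrapolated \<open>P\<close> involves only earlier levels and counts as given data;
  the step is then linear in \<open>(Qn, rn)\<close>.\<close>

lemma step_eq_gstep:
 "step_eq a b c A0 L1 L2 L3 M N dt Qp Qc rc Qn rn = gstep L1 (L2 + L3) M N dt
   (\<lambda>k. (3/2) *\<^sub>R Pfun a b c A0 (Qc k) - (1/2) *\<^sub>R Pfun a b c A0 (Qp k)) Qc rc Qn rn"
 by (simp add: step_eq_def gstep_def Let_def)

definition divh :: "real \<Rightarrow> 3 \<Rightarrow> (idx \<Rightarrow> mat3) \<Rightarrow> idx \<Rightarrow> real" where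
 "divh h j Q = (\<lambda>k. \<Sum>i. Dcent h i (cp i j Q) k)"

text \<open>Forward differences in the gradient and central ones in the divergence, as summation by
  parts of \<open>lap_h\<close> and \<open>alpha_h\<close> produces them.\<close>

definition Eh :: "real \<Rightarrow> real \<Rightarrow> real \<Rightarrow> (idx \<Rightarrow> mat3) \<Rightarrow> (idx \<Rightarrow> real) \<Rightarrow> real" where
 "Eh L1 L23 h Q r = 1/2 * (L1 * (\<Sum>i j m. IP h (Dplus h m (cp i j Q)) (Dplus h m (cp i j Q)))
   + L23 * (\<Sum>j. IP h (divh h j Q) (divh h j Q)) + IP h r r)"

lemma mesh_pos [simp]: "mesh N > 0"
 by (simp add: mesh_def)

text \<open>Testing with \<open>u\<close> itself equates a nonnegative with a nonpositive
  quantity.\<close>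

lemma heat_step_zero:
 assumes bc: "bc N u" and eq: "\<And>k. in_grid N k \<Longrightarrow> u k / dt = \<kappa> * lap_h (mesh N) u k"
  and pos: "dt > 0" "\<kappa> > 0"
 shows "u k = (0::real)"
proof -
 note fs = bc_fs[OF bc]
 have "IP (mesh N) (\<lambda>k. (1/dt) * u k) u = IP (mesh N) (\<lambda>k. \<kappa> * lap_h (mesh N) u k) u"
 proof (rule IP_cong)
  fix k show "(1/dt) * u k * u k = \<kappa> * lap_h (mesh N) u k * u k"
   using eq[of k] bc by (cases "in_grid N k") (auto simp: bc_def)
 qed
 hence "(1/dt) * IP (mesh N) u u = - \<kappa> * (\<Sum>\<alpha>. IP (mesh N) (Dplus (mesh N) \<alpha> u) (Dplus (mesh N) \<alpha> u))"
  by (simp only: IP_cmult_left IP_lap_h[OF mesh_pos fs fs])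
 also have "\<dots> \<le> 0" using pos by (simp add: sum_nonneg)
 finally have "IP (mesh N) u u = 0"
  using pos IP_self_nonneg[of "mesh N" u] by (simp add: divide_le_0_iff)
 thus ?thesis using IP_self_eq_0[OF mesh_pos fs] by blast
qed

lemma gstep_comp:
 assumes "gstep L1 L23 M N dt P Qc rc Qn rn" "in_grid N k"
 shows "(Qn k $ i $ j - Qc k $ i $ j) / dt = M * (L1 * (1/2 * (lap_h (mesh N) (cp i j Qn) k + lap_h (mesh N) (cp i j Qc) k))
  - (rn k + rc k) / 2 * P k $ i $ j + L23 / 4 * (alpha_h (mesh N) Qn k $ i $ j + alpha_h (mesh N) Qc k $ i $ j))"
proof -
 have l: "lap_h (mesh N) (\<lambda>l. (1/2) *\<^sub>R (Qn l + Qc l)) k $ i $ j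
   = 1/2 * (lap_h (mesh N) (cp i j Qn) k + lap_h (mesh N) (cp i j Qc) k)"
  unfolding cp_lap_h using lap_h_linear[of "mesh N" "1/2" "cp i j Qn" "\<lambda>l. 1/2 * cp i j Qc l"]
   lap_h_linear[of "mesh N" "1/2" "cp i j Qc" "\<lambda>l. 0"] 
  by (simp add: algebra_simps fun_eq_iff lap_h_def Dplus_def Dminus_def)
 have "(1/dt) *\<^sub>R (Qn k - Qc k) = M *\<^sub>R (L1 *\<^sub>R lap_h (mesh N) (\<lambda>l. (1/2) *\<^sub>R (Qn l + Qc l)) k
    - ((rn k + rc k) / 2) *\<^sub>R P k + (L23 / 2) *\<^sub>R ((1/2) *\<^sub>R (alpha_h (mesh N) Qn k + alpha_h (mesh N) Qc k)))"
  using assms unfolding gstep_def by blast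
 from arg_cong[OF this, of "\<lambda>A. A $ i $ j"]
 have "(1/dt) * (Qn k $ i $ j - Qc k $ i $ j) = M * (L1 * (1/2 * (lap_h (mesh N) (cp i j Qn) k + lap_h (mesh N) (cp i j Qc) k))
  - (rn k + rc k) / 2 * P k $ i $ j + L23 / 2 * (1/2 * (alpha_h (mesh N) Qn k $ i $ j + alpha_h (mesh N) Qc k $ i $ j)))"
  by (simp only: l vector_scaleR_component vector_add_component vector_minus_component real_scaleR_def)
 thus ?thesis by simp
qed

lemma sym_tf_iff: "sym_tf Q \<longleftrightarrow> (\<forall>i j. Q $ i $ j = Q $ j $ i) \<and> (\<Sum>i. Q $ i $ i) = 0"
 by (auto simp: sym_tf_def transpose_def vec_eq_iff trace_def)

text \<open>The antisymmetric part and the trace of \<open>Qn\<close> solve a homogeneous implicit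
  heat step: \<open>alpha_h\<close> has symmetric trace-free values for every argument,
  \<open>P\<close> and \<open>Qc\<close> have them by assumption. The energy balance cannot be used
  here, since it presupposes this invariance.\<close>

lemma gstep_sym_tf:
 assumes step: "gstep L1 L23 M N dt P Qc rc Qn rn" and pos: "dt > 0" "M > 0" "L1 > 0"
  and Qc: "\<And>k. sym_tf (Qc k)" and P: "\<And>k. sym_tf (P k)"
 shows "sym_tf (Qn k)"
proof -
 have bc: "bc N (cp i j Qn)" for i j using step by (auto simp: gstep_def intro: bc_cp)
 \<comment> \<open>Only the new half of the averaged Laplacian survives, which gives the coefficient
   \<open>M * L1 / 2\<close>.\<close>
 have \<kappa>: "M * L1 / 2 > 0" using pos by simp
 have as: "Qn k $ i $ j - Qn k $ j $ i = 0" for i j k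
 proof (rule heat_step_zero[where u = "\<lambda>k. Qn k $ i $ j - Qn k $ j $ i", OF _ _ pos(1) \<kappa>])
  show "bc N (\<lambda>k. Qn k $ i $ j - Qn k $ j $ i)" using bc by (auto simp: bc_def)
  fix k assume k: "in_grid N k"
  have c: "cp i j Qc = cp j i Qc" using Qc by (auto simp: sym_tf_iff)
  have p: "P k $ i $ j = P k $ j $ i" using P by (auto simp: sym_tf_iff)
  have "lap_h (mesh N) (\<lambda>k. Qn k $ i $ j - Qn k $ j $ i) k = lap_h (mesh N) (cp i j Qn) k - lap_h (mesh N) (cp j i Qn) k"
   using lap_h_linear[of "mesh N" "-1" "cp j i Qn" "cp i j Qn"] by (simp add: fun_eq_iff)
  note lapd = this
  have "(Qn k $ i $ j - Qn k $ j $ i) / dt = (Qn k $ i $ j - Qc k $ i $ j) / dt - (Qn k $ j $ i - Qc k $ j $ i) / dt"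
   using fun_cong[OF c, of k] by (simp add: diff_divide_distrib)
  thus "(Qn k $ i $ j - Qn k $ j $ i) / dt = M * L1 / 2 * lap_h (mesh N) (\<lambda>k. Qn k $ i $ j - Qn k $ j $ i) k"
   unfolding gstep_comp[OF step k] lapd alpha_h_symmetric[of "mesh N" _ k i j] p c
   by (simp add: algebra_simps)
 qed
 have tr: "(\<Sum>i. Qn k $ i $ i) = 0" for k
 proof (rule heat_step_zero[where u = "\<lambda>k. (\<Sum>i. Qn k $ i $ i)", OF _ _ pos(1) \<kappa>])
  show "bc N (\<lambda>k. \<Sum>i. Qn k $ i $ i)" using bc by (auto simp: bc_def)
  fix k assume k: "in_grid N k"
  have lapsum: "lap_h (mesh N) (\<lambda>k. \<Sum>i. R k $ i $ i) k = (\<Sum>i. lap_h (mesh N) (cp i i R) k)" for R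
   by (simp add: sum_3 lap_h_def Dplus_def Dminus_def algebra_simps)
  have c: "(\<lambda>k. \<Sum>i. Qc k $ i $ i) = (\<lambda>k. 0)" and p: "(\<Sum>i. P k $ i $ i) = 0"
   using Qc P by (auto simp: sym_tf_iff)
  have lc: "(\<Sum>i. lap_h (mesh N) (cp i i Qc) k) = 0"
   unfolding lapsum[symmetric] c by (simp add: lap_h_def Dplus_def Dminus_def)
  have "(\<Sum>i. (Qn k $ i $ i - Qc k $ i $ i) / dt)
   = M * L1 / 2 * (\<Sum>i. lap_h (mesh N) (cp i i Qn) k) + M * L1 / 2 * (\<Sum>i. lap_h (mesh N) (cp i i Qc) k)
    - M * (rn k + rc k) / 2 * (\<Sum>i. P k $ i $ i)
    + M * L23 / 4 * ((\<Sum>i. alpha_h (mesh N) Qn k $ i $ i) + (\<Sum>i. alpha_h (mesh N) Qc k $ i $ i))"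
   unfolding gstep_comp[OF step k] by (simp add: sum_3 algebra_simps)
  also have "(\<Sum>i. (Qn k $ i $ i - Qc k $ i $ i) / dt) = (\<Sum>i. Qn k $ i $ i) / dt"
   using fun_cong[OF c, of k] by (simp add: sum_subtractf flip: sum_divide_distrib)
  finally show "(\<Sum>i. Qn k $ i $ i) / dt = M * L1 / 2 * lap_h (mesh N) (\<lambda>k. \<Sum>i. Qn k $ i $ i) k"
   by (simp add: alpha_h_trace p lc lapsum)
 qed
 show ?thesis using as[of k] tr[of k] by (auto simp: sym_tf_iff)
qed

text \<open>The algebra behind the midpoint averages: tested with an increment, an average gives
  half a difference of squares without remainder.\<close>

lemma IP_mean_diff:
 assumes "h > 0" "fs F" "fs G"
 shows "IP h (\<lambda>k. 1/2 * (F k + G k)) (\<lambda>k. F k - G k) = 1/2 * (IP h F F - IP h G G)"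
 unfolding IP_cmult_left
 by (simp add: IP_add_left IP_diff_right assms IP_commute[of h G F])

lemma IP_linear3:
 assumes "h > 0" "fs F1" "fs F2" "fs F3"
 shows "IP h (\<lambda>k. c1 * F1 k - c2 * F2 k + c3 * F3 k) G = c1 * IP h F1 G - c2 * IP h F2 G + c3 * IP h F3 G"
 by (simp add: IP_add_left IP_diff_left IP_cmult_left fs_diff fs_mult2 assms)

text \<open>The equations of the step hold only at grid indices; \<Phi> vanishes at all others, so
  they may be summed over the whole lattice.\<close>

lemma gstep_test:
 assumes step: "gstep L1 L23 M N dt P Qc rc Qn rn" and bcc: "bc N Qc" "bc N rc" and \<Phi>: "bc N \<Phi>"
 shows "IP (mesh N) (\<lambda>k. (Qn k $ i $ j - Qc k $ i $ j) / dt) \<Phi> =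
   M * L1 * IP (mesh N) (lap_h (mesh N) (\<lambda>k. 1/2 * (cp i j Qn k + cp i j Qc k))) \<Phi>
   - M * IP (mesh N) (\<lambda>k. 1/2 * (rn k + rc k)) (\<lambda>k. P k $ i $ j * \<Phi> k)
   + M * L23 / 2 * IP (mesh N) (cp i j (alpha_h (mesh N) (\<lambda>k. (1/2) *\<^sub>R (Qn k + Qc k)))) \<Phi>"
proof -
 define h where "h = mesh N"
 have h: "h > 0" by (simp add: h_def)
 have bcn: "bc N Qn" "bc N rn" using step by (auto simp: gstep_def)
 note fq = bc_cp_fs[OF bcn(1)] bc_cp_fs[OF bcc(1)] bc_fs[OF bcn(2)] bc_fs[OF bcc(2)]
 define m where "m k = (1/2) *\<^sub>R (Qn k + Qc k)" for k
 have m_cp: "cp i j m = (\<lambda>k. 1/2 * (cp i j Qn k + cp i j Qc k))" for i j by (simp add: m_def)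
 have fm: "fs (cp i j m)" for i j unfolding m_cp by (intro fs_mult2 fs_add fq)
 have am: "alpha_h h m k = (1/2) *\<^sub>R (alpha_h h Qn k + alpha_h h Qc k)" for k
 proof -
  have "m = (\<lambda>k. (1/2) *\<^sub>R Qn k + ((1/2) *\<^sub>R Qc k + 0))" by (simp add: m_def fun_eq_iff scaleR_add_right)
  moreover have "alpha_h h (\<lambda>k. 0) k = 0" by (simp add: alpha_h_def Dcent_def vec_eq_iff)
  ultimately show ?thesis by (simp only: alpha_h_linear) (simp add: scaleR_add_right)
 qed
 have lm: "lap_h h (cp i j m) k = 1/2 * (lap_h h (cp i j Qn) k + lap_h h (cp i j Qc) k)" for i j k
  unfolding m_cp by (simp add: lap_h_def Dplus_def Dminus_def sum_3 algebra_simps)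
 have fl: "fs (lap_h h (cp i j m))" unfolding lap_h_def by (intro fs_sum fs_Dminus fs_Dplus fm)
 have fa: "fs (cp i j (alpha_h h m))"
  unfolding alpha_h_def vec_lambda_beta
  by (intro fs_diff fs_sum fs_add fs_Dcent fs_mult1[OF fs_mult2] fm)
 have "IP h (\<lambda>k. (Qn k $ i $ j - Qc k $ i $ j) / dt) \<Phi> = IP h (\<lambda>k. (M * L1) * lap_h h (cp i j m) k
   - M * (1/2 * (rn k + rc k) * P k $ i $ j) + (M * L23 / 2) * alpha_h h m k $ i $ j) \<Phi>"
 proof (rule IP_cong)
  fix k
  show "(Qn k $ i $ j - Qc k $ i $ j) / dt * \<Phi> k = ((M * L1) * lap_h h (cp i j m) k
   - M * (1/2 * (rn k + rc k) * P k $ i $ j) + (M * L23 / 2) * alpha_h h m k $ i $ j) * \<Phi> k"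
  proof (cases "in_grid N k")
   case True
   show ?thesis
    by (rule arg_cong[of _ _ "\<lambda>u. u * \<Phi> k"])
     (use gstep_comp[OF step True, of i j] in \<open>simp add: lm am h_def[symmetric] algebra_simps\<close>)
  qed (use \<Phi> in \<open>simp add: bc_def\<close>)
 qed
 also have "\<dots> = M * L1 * IP h (lap_h h (cp i j m)) \<Phi>
  - M * IP h (\<lambda>k. 1/2 * (rn k + rc k) * P k $ i $ j) \<Phi> + M * L23 / 2 * IP h (cp i j (alpha_h h m)) \<Phi>"
  by (rule IP_linear3[OF h fl _ fa]) (intro fs_mult1[OF fs_mult2] fs_add fq)
 also have "IP h (\<lambda>k. 1/2 * (rn k + rc k) * P k $ i $ j) \<Phi> = IP h (\<lambda>k. 1/2 * (rn k + rc k)) (\<lambda>k. P k $ i $ j * \<Phi> k)"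
  by (rule IP_cong) simp
 finally show ?thesis unfolding m_cp[symmetric] h_def m_def .
qed

text \<open>The step is tested with its own increment \<open>d\<close>. Each spatial term becomes
  half a difference of squares by \<open>IP_mean_diff\<close>; the second equation of the scheme
  turns \<open>P : d\<close> into the increment of \<open>r\<close>, so the coupling term does the
  same.\<close>

lemma gstep_energy:
 assumes step: "gstep L1 L23 M N dt P Qc rc Qn rn" and pos: "dt > 0" "M > 0"
  and bcc: "bc N Qc" "bc N rc" and Qc: "\<And>k. sym_tf (Qc k)" and Qn: "\<And>k. sym_tf (Qn k)"
 shows "Eh L1 L23 (mesh N) Qn rn + dt / M * (\<Sum>i j. IP (mesh N) (\<lambda>k. (Qn k $ i $ j - Qc k $ i $ j) / dt) (\<lambda>k. (Qn k $ i $ j - Qc k $ i $ j) / dt)) = Eh L1 L23 (mesh N) Qc rc"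
proof -
 define h where "h = mesh N"
 have h: "h > 0" by (simp add: h_def)
 have bcn: "bc N Qn" "bc N rn" using step by (auto simp: gstep_def)
 note fq = bc_cp_fs[OF bcn(1)] bc_cp_fs[OF bcc(1)] bc_fs[OF bcn(2)] bc_fs[OF bcc(2)]
 define d where "d i j = (\<lambda>k. Qn k $ i $ j - Qc k $ i $ j)" for i j
 define m where "m k = (1/2) *\<^sub>R (Qn k + Qc k)" for k
 have fd: "fs (d i j)" for i j unfolding d_def by (intro fs_diff fq)
 have m_cp: "cp i j m = (\<lambda>k. 1/2 * (cp i j Qn k + cp i j Qc k))" for i j by (simp add: m_def)
 have fm: "fs (cp i j m)" for i j unfolding m_cp by (intro fs_mult2 fs_add fq)
 have bd: "bc N (d i j)" for i j unfolding d_def using bcn(1) bcc(1) by (simp add: bc_def)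
 have main: "IP h (\<lambda>k. (d i j k) / dt) (d i j) = M * L1 * IP h (lap_h h (cp i j m)) (d i j)
   - M * IP h (\<lambda>k. 1/2 * (rn k + rc k)) (\<lambda>k. P k $ i $ j * d i j k) + M * L23 / 2 * IP h (cp i j (alpha_h h m)) (d i j)" for i j
  using gstep_test[OF step bcc bd, of i j i j] unfolding h_def d_def m_def[abs_def] by simp
 have lap: "IP h (lap_h h (cp i j m)) (d i j) = - (\<Sum>\<alpha>. 1/2 * (IP h (Dplus h \<alpha> (cp i j Qn)) (Dplus h \<alpha> (cp i j Qn))
   - IP h (Dplus h \<alpha> (cp i j Qc)) (Dplus h \<alpha> (cp i j Qc))))" for i j
 proof -
  have "IP h (Dplus h \<alpha> (cp i j m)) (Dplus h \<alpha> (d i j)) =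
   IP h (\<lambda>k. 1/2 * (Dplus h \<alpha> (cp i j Qn) k + Dplus h \<alpha> (cp i j Qc) k)) (\<lambda>k. Dplus h \<alpha> (cp i j Qn) k - Dplus h \<alpha> (cp i j Qc) k)" for \<alpha>
   by (rule IP_cong) (simp add: m_def d_def Dplus_def algebra_simps)
  thus ?thesis
   unfolding IP_lap_h[OF h fm fd] by (simp only: IP_mean_diff[OF h fs_Dplus[OF fq(1)] fs_Dplus[OF fq(2)]])
 qed
 have rr: "(\<Sum>i j. IP h (\<lambda>k. 1/2 * (rn k + rc k)) (\<lambda>k. P k $ i $ j * d i j k)) = 1/2 * (IP h rn rn - IP h rc rc)"
 proof -
  have "(\<Sum>i j. IP h (\<lambda>k. 1/2 * (rn k + rc k)) (\<lambda>k. P k $ i $ j * d i j k))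
   = IP h (\<lambda>k. 1/2 * (rn k + rc k)) (\<lambda>k. \<Sum>i j. P k $ i $ j * d i j k)"
   by (simp add: IP_sum_right[OF h] fs_sum fs_mult2 fd)
  also have "\<dots> = IP h (\<lambda>k. 1/2 * (rn k + rc k)) (\<lambda>k. rn k - rc k)"
  proof (rule IP_cong)
   fix k show "1/2 * (rn k + rc k) * (\<Sum>i j. P k $ i $ j * d i j k) = 1/2 * (rn k + rc k) * (rn k - rc k)"
   proof (cases "in_grid N k")
    case True
    hence "rn k - rc k = frob (P k) (Qn k - Qc k)" using step by (auto simp: gstep_def)
    thus ?thesis by (simp add: frob_def d_def)
   next
    case False
    thus ?thesis using bcn(2) bcc(2) by (simp add: bc_def)
   qed
  qed
  also have "\<dots> = 1/2 * (IP h rn rn - IP h rc rc)" by (rule IP_mean_diff[OF h fq(3,4)])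
  finally show ?thesis .
 qed
 \<comment> \<open>By symmetry the two divergence products of \<open>alpha_h_by_parts\<close> agree,
   and the trace product vanishes because \<open>d\<close> is trace-free; squared divergences
   remain.\<close>
 have al: "(\<Sum>i j. IP h (cp i j (alpha_h h m)) (d i j))
   = - (\<Sum>j. IP h (divh h j Qn) (divh h j Qn) - IP h (divh h j Qc) (divh h j Qc))"
 proof -
  have sQ: "cp i j Qn = cp j i Qn" "cp i j Qc = cp j i Qc" for i j using Qn Qc by (auto simp: sym_tf_iff)
  have sm: "cp i j m = cp j i m" and sd: "d i j = d j i" for i j
   using sQ[of i j] by (auto simp: m_def d_def fun_eq_iff)
  have fdiv: "fs (divh h j Qn)" "fs (divh h j Qc)" "fs (divh h j m)" for j
   unfolding divh_def by (intro fs_sum fs_Dcent fq fm)+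
  have fdd: "fs (\<lambda>k. \<Sum>i. Dcent h i (d i j) k)" for j by (intro fs_sum fs_Dcent fd)
  have trd: "(\<Sum>j. Dcent h k (d j j) l) = 0" for k l
  proof -
   have "(\<Sum>j. Dcent h k (d j j) l) = Dcent h k (\<lambda>l. \<Sum>j. d j j l) l" by (simp add: Dcent_sum)
   also have "(\<lambda>l. \<Sum>j. d j j l) = (\<lambda>l. 0)" using Qn Qc by (auto simp: sym_tf_iff d_def sum_subtractf)
   finally show ?thesis by (simp add: Dcent_def)
  qed
  have tr0: "(\<Sum>j. IP h F (Dcent h k (d j j))) = 0" for F k
   using IP_sum_right[OF h, of UNIV "\<lambda>j. Dcent h k (d j j)" F] fs_Dcent[OF fd]
   by (simp add: trd IP_commute[of h F "\<lambda>k. 0"])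
  have 1: "(\<Sum>i k. IP h (Dcent h k (cp j k m)) (Dcent h i (d i j))) =
    IP h (divh h j m) (\<lambda>l. \<Sum>i. Dcent h i (d i j) l)" for j
   unfolding divh_def using sm[of j]
   by (simp add: IP_sum_right[OF h] IP_sum_left[OF h] fs_Dcent fd fm fs_sum)
  have 2: "IP h (divh h j m) (\<lambda>l. \<Sum>i. Dcent h i (d i j) l)
    = 1/2 * (IP h (divh h j Qn) (divh h j Qn) - IP h (divh h j Qc) (divh h j Qc))" for j
  proof -
   have "IP h (divh h j m) (\<lambda>l. \<Sum>i. Dcent h i (d i j) l)
    = IP h (\<lambda>l. 1/2 * (divh h j Qn l + divh h j Qc l)) (\<lambda>l. divh h j Qn l - divh h j Qc l)"
    by (rule IP_cong) (simp add: divh_def m_def d_def Dcent_def sum_3 algebra_simps)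
   thus ?thesis by (simp only: IP_mean_diff[OF h fdiv(1,2)])
  qed
  have 3: "(\<Sum>i j k. IP h (Dcent h k (cp j k m)) (Dcent h i (d i j)))
    = (\<Sum>j. 1/2 * (IP h (divh h j Qn) (divh h j Qn) - IP h (divh h j Qc) (divh h j Qc)))"
   by (subst sum.swap) (simp only: 1 2)
  have 4: "(\<Sum>i j k. IP h (Dcent h k (cp i k m)) (Dcent h j (d i j)))
    = (\<Sum>j. 1/2 * (IP h (divh h j Qn) (divh h j Qn) - IP h (divh h j Qc) (divh h j Qc)))"
   unfolding 3[symmetric] by (subst sum.swap) (simp only: sd)
  have 5: "(\<Sum>i j k. IP h (Dcent h i (cp k i m)) (Dcent h k (d j j))) = 0"
  proof (rule sum.neutral, rule ballI)
   fix i :: 3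
   show "(\<Sum>j k. IP h (Dcent h i (cp k i m)) (Dcent h k (d j j))) = 0"
    by (subst sum.swap) (simp only: tr0, simp)
  qed
  show ?thesis
   unfolding alpha_h_by_parts[OF h fm fd]
   by (simp only: sum.distrib sum_subtractf 3 4 sum_distrib_left[symmetric] 5) (simp add: sum_subtractf)
 qed
 have dd: "IP h (\<lambda>k. (d i j k) / dt) (\<lambda>k. (d i j k) / dt) = 1 / dt * IP h (\<lambda>k. (d i j k) / dt) (d i j)" for i j
  using IP_cmult_right[of h "\<lambda>k. (d i j k) / dt" "1/dt" "d i j"] by simp
 have "dt / M * (\<Sum>i j. IP h (\<lambda>k. (d i j k) / dt) (\<lambda>k. (d i j k) / dt))
   = 1 / M * (\<Sum>i j. IP h (\<lambda>k. (d i j k) / dt) (d i j))"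
  using pos(1) by (simp add: dd sum_distrib_left)
 also have "\<dots> = 1 / M * (M * L1 * (\<Sum>i j. IP h (lap_h h (cp i j m)) (d i j))
   - M * (\<Sum>i j. IP h (\<lambda>k. 1/2 * (rn k + rc k)) (\<lambda>k. P k $ i $ j * d i j k))
   + M * L23 / 2 * (\<Sum>i j. IP h (cp i j (alpha_h h m)) (d i j)))"
  unfolding main by (simp only: sum.distrib sum_subtractf sum_distrib_left)
 also have "\<dots> = L1 * (\<Sum>i j. IP h (lap_h h (cp i j m)) (d i j))
   - 1/2 * (IP h rn rn - IP h rc rc) - L23 / 2 * (\<Sum>j. IP h (divh h j Qn) (divh h j Qn) - IP h (divh h j Qc) (divh h j Qc))"
  unfolding rr al using pos(2) by (simp add: field_simps)
 also have "(\<Sum>i j. IP h (lap_h h (cp i j m)) (d i j)) =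
   - 1/2 * ((\<Sum>i j \<alpha>. IP h (Dplus h \<alpha> (cp i j Qn)) (Dplus h \<alpha> (cp i j Qn)))
    - (\<Sum>i j \<alpha>. IP h (Dplus h \<alpha> (cp i j Qc)) (Dplus h \<alpha> (cp i j Qc))))"
  unfolding lap by (simp add: sum_negf sum_subtractf flip: sum_distrib_left sum_divide_distrib)
 finally show ?thesis
  unfolding Eh_def h_def[symmetric] d_def by (simp add: sum_subtractf algebra_simps)
qed

text \<open>The second equation expresses \<open>rn\<close> through \<open>Qn\<close>. Inserting it
  leaves a square linear system for the entries of \<open>Qn\<close>, whose kernel is trivial by the
  energy balance with zero old data.\<close>

lemma gstep_unique_exists:
 assumes pos: "dt > 0" "M > 0" "L1 > 0" "L23 \<ge> 0" and P: "\<And>k. sym_tf (P k)"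
 shows "\<exists>!p. gstep L1 L23 M N dt P Qc rc (fst p) (snd p)"
proof -
 define h where "h = mesh N"
 have z: "sym_tf (0::mat3)" by (simp add: sym_tf_iff)
 have hom: "Q = (\<lambda>k. 0) \<and> r = (\<lambda>k. 0)" if s: "gstep L1 L23 M N dt P (\<lambda>k. 0) (\<lambda>k. 0) Q r" for Q r
 proof -
  have bcQ: "bc N Q" "bc N r" using s by (auto simp: gstep_def)
  have Qs: "sym_tf (Q k)" for k by (rule gstep_sym_tf[OF s pos(1,2,3) z P])
  have E0: "Eh L1 L23 (mesh N) (\<lambda>k. 0) (\<lambda>k. 0) = 0"
   by (simp add: Eh_def Dplus_def divh_def Dcent_def)
  have En: "Eh L1 L23 (mesh N) Q r \<ge> 0"
   unfolding Eh_def using pos by (intro mult_nonneg_nonneg add_nonneg_nonneg sum_nonneg) auto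
  have "Eh L1 L23 (mesh N) Q r + dt / M * (\<Sum>i j. IP (mesh N) (\<lambda>k. Q k $ i $ j / dt) (\<lambda>k. Q k $ i $ j / dt)) = 0"
   using gstep_energy[OF s pos(1,2) _ _ z Qs] by (simp add: E0 bc_def)
  moreover have nn: "0 \<le> (\<Sum>i j. IP (mesh N) (\<lambda>k. Q k $ i $ j / dt) (\<lambda>k. Q k $ i $ j / dt))"
   by (intro sum_nonneg) auto
  ultimately have "dt / M * (\<Sum>i j. IP (mesh N) (\<lambda>k. Q k $ i $ j / dt) (\<lambda>k. Q k $ i $ j / dt)) \<le> 0"
   using En by linarith
  hence "(\<Sum>i j. IP (mesh N) (\<lambda>k. Q k $ i $ j / dt) (\<lambda>k. Q k $ i $ j / dt)) = 0"
   using nn pos by (simp add: mult_le_0_iff divide_le_0_iff)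
  hence "IP (mesh N) (\<lambda>k. Q k $ i $ j / dt) (\<lambda>k. Q k $ i $ j / dt) = 0" for i j
   by (simp add: sum_nonneg_eq_0_iff sum_nonneg)
  hence "Q k $ i $ j / dt = 0" for k i j
   using IP_self_eq_0[OF mesh_pos, of "\<lambda>k. Q k $ i $ j / dt" N k] bc_cp_fs[OF bcQ(1)] fs_mult1[of "cp i j Q" "\<lambda>k. 1/dt"] by simp
  hence Q0: "Q k = 0" for k using pos(1) by (simp add: vec_eq_iff)
  have "r k = 0" for k
   using s bcQ(2) by (cases "in_grid N k") (auto simp: gstep_def bc_def Q0 frob_def)
  thus ?thesis using Q0 by auto
 qed
 \<comment> \<open>\<open>rn = rc + P : (Qn - Qc)\<close> is inserted in the mean
   \<open>(rn + rc) / 2\<close>. \<open>B\<close> collects what depends on the new matrix field,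
   \<open>y\<close> below what depends on the old data.\<close>
 define B where "B Q k = (1/dt) *\<^sub>R Q k - M *\<^sub>R (L1 *\<^sub>R lap_h h (\<lambda>l. (1/2) *\<^sub>R Q l) k
   - (frob (P k) (Q k) / 2) *\<^sub>R P k + (L23 / 2) *\<^sub>R ((1/2) *\<^sub>R alpha_h h Q k))" for Q k
 have Blin: "B (\<lambda>k. t *\<^sub>R Q k + R k) k = t *\<^sub>R B Q k + B R k" for t Q R k
 proof -
  have "(\<lambda>l. (1/2) *\<^sub>R (t *\<^sub>R Q l + R l)) = (\<lambda>l. t *\<^sub>R ((1/2) *\<^sub>R Q l) + (1/2) *\<^sub>R R l)"
   by (simp add: scaleR_add_right mult.commute)
  thus ?thesis
   unfolding B_def by (simp only: lap_h_linear_mat alpha_h_linear) (simp add: frob_inner inner_add_right algebra_simps add_divide_distrib scaleR_add_left)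
 qed
 have lapB: "lap_h h (\<lambda>l. (1/2) *\<^sub>R (Q l + R l)) k = lap_h h (\<lambda>l. (1/2) *\<^sub>R Q l) k + lap_h h (\<lambda>l. (1/2) *\<^sub>R R l) k"
  for Q R :: "idx \<Rightarrow> mat3" and k
  using lap_h_linear_mat[of h 1 "\<lambda>l. (1/2) *\<^sub>R Q l" "\<lambda>l. (1/2) *\<^sub>R R l"] by (simp add: scaleR_add_right)
 have lapm: "lap_h h (\<lambda>l. (1/2) *\<^sub>R (- Q l)) k = - lap_h h (\<lambda>l. (1/2) *\<^sub>R Q l) k" for Q :: "idx \<Rightarrow> mat3" and k
  by (simp add: lap_h_def Dplus_def Dminus_def algebra_simps sum_negf[symmetric])
 define y where "y k = (1/dt) *\<^sub>R Qc k + M *\<^sub>R (L1 *\<^sub>R lap_h h (\<lambda>l. (1/2) *\<^sub>R Qc l) k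
   - ((2 * rc k - frob (P k) (Qc k)) / 2) *\<^sub>R P k + (L23 / 2) *\<^sub>R ((1/2) *\<^sub>R alpha_h h Qc k))" for k
 have iff: "gstep L1 L23 M N dt P Qc rc Q r \<longleftrightarrow> bc N Q \<and> bc N r \<and>
   (\<forall>k. in_grid N k \<longrightarrow> B Q k = y k \<and> r k = rc k + frob (P k) (Q k - Qc k))" for Q r
 proof -
  have "((1/dt) *\<^sub>R (Q k - Qc k) = M *\<^sub>R (L1 *\<^sub>R lap_h h (\<lambda>l. (1/2) *\<^sub>R (Q l + Qc l)) k
    - ((r k + rc k) / 2) *\<^sub>R P k + (L23 / 2) *\<^sub>R ((1/2) *\<^sub>R (alpha_h h Q k + alpha_h h Qc k)))
   \<longleftrightarrow> B Q k = y k)" if "r k = rc k + frob (P k) (Q k - Qc k)" for k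
   unfolding that lapB B_def y_def by (auto simp: frob_inner inner_diff_right vec_eq_iff algebra_simps add_divide_distrib diff_divide_distrib)
  thus ?thesis unfolding gstep_def h_def by (auto simp: algebra_simps)
 qed
 define tom where "tom f = (\<lambda>k. \<chi> i j. f (k, i, j))" for f :: "idx \<times> 3 \<times> 3 \<Rightarrow> real"
 define I where "I = {k. in_grid N k} \<times> (UNIV :: (3 \<times> 3) set)"
 have "\<exists>f. (\<forall>i. i \<notin> I \<longrightarrow> f i = 0) \<and> (\<forall>z\<in>I. (case z of (k, i, j) \<Rightarrow> B (tom f) k $ i $ j) = (case z of (k, i, j) \<Rightarrow> y k $ i $ j))"
 proof (rule injective_operator_surjective)
  show "finite I" using finite_grid by (simp add: I_def)
  fix f g t
  have tl: "tom (\<lambda>i. t * f i + g i) = (\<lambda>k. t *\<^sub>R tom f k + tom g k)" by (simp add: tom_def fun_eq_iff vec_eq_iff)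
  show "(\<lambda>z. case z of (k, i, j) \<Rightarrow> B (tom (\<lambda>i. t * f i + g i)) k $ i $ j)
    = (\<lambda>z. t * (case z of (k, i, j) \<Rightarrow> B (tom f) k $ i $ j) + (case z of (k, i, j) \<Rightarrow> B (tom g) k $ i $ j))"
   unfolding tl Blin by (simp add: fun_eq_iff)
 next
  fix f assume f: "\<And>z. z \<notin> I \<Longrightarrow> f z = 0" "\<And>z. z \<in> I \<Longrightarrow> (case z of (k, i, j) \<Rightarrow> B (tom f) k $ i $ j) = 0"
  define r where "r k = (if in_grid N k then frob (P k) (tom f k) else 0)" for k
  have "gstep L1 L23 M N dt P (\<lambda>k. 0) (\<lambda>k. 0) (tom f) r"
  proof -
   have "bc N (tom f)" unfolding bc_def tom_def using f(1) by (auto simp: I_def vec_eq_iff)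
   moreover have "B (tom f) k = 0" if "in_grid N k" for k
    using f(2)[of "(k, _, _)"] that by (simp add: I_def vec_eq_iff)
   moreover have "alpha_h h (\<lambda>k. 0) k = 0" for k by (simp add: alpha_h_def Dcent_def vec_eq_iff)
   ultimately show ?thesis by (simp add: gstep_def bc_def r_def B_def h_def)
  qed
  from hom[OF this] have "tom f k $ i $ j = 0" for k i j by simp
  thus "f = (\<lambda>i. 0)" by (auto simp: tom_def)
 qed
 then obtain f where f: "\<And>z. z \<notin> I \<Longrightarrow> f z = 0"
   "\<And>z. z \<in> I \<Longrightarrow> (case z of (k, i, j) \<Rightarrow> B (tom f) k $ i $ j) = (case z of (k, i, j) \<Rightarrow> y k $ i $ j)" by blast
 have ex: "gstep L1 L23 M N dt P Qc rc (tom f) (\<lambda>k. if in_grid N k then rc k + frob (P k) (tom f k - Qc k) else 0)"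
  unfolding iff
 proof (intro conjI allI impI)
  show "bc N (tom f)" unfolding bc_def tom_def using f(1) by (auto simp: I_def vec_eq_iff)
  show "B (tom f) k = y k" if "in_grid N k" for k
   using f(2)[of "(k, _, _)"] that by (simp add: I_def vec_eq_iff)
 qed (auto simp: bc_def)
 have uniq: "Q = Q' \<and> r = r'" if "gstep L1 L23 M N dt P Qc rc Q r" "gstep L1 L23 M N dt P Qc rc Q' r'" for Q r Q' r'
 proof -
  have s: "bc N Q" "bc N r" "bc N Q'" "bc N r'" 
   "\<And>k. in_grid N k \<Longrightarrow> B Q k = y k" "\<And>k. in_grid N k \<Longrightarrow> B Q' k = y k"
   "\<And>k. in_grid N k \<Longrightarrow> r k = rc k + frob (P k) (Q k - Qc k)"
   "\<And>k. in_grid N k \<Longrightarrow> r' k = rc k + frob (P k) (Q' k - Qc k)"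
   using that unfolding iff by auto
  have BB: "B (\<lambda>k. Q k - Q' k) k = B Q k - B Q' k" for k using Blin[of "-1" Q' Q k] by simp
  have al0: "alpha_h h (\<lambda>k. 0) k = 0" for k by (simp add: alpha_h_def Dcent_def vec_eq_iff)
  have "gstep L1 L23 M N dt P (\<lambda>k. 0) (\<lambda>k. 0) (\<lambda>k. Q k - Q' k) (\<lambda>k. r k - r' k)"
   unfolding gstep_def h_def[symmetric]
  proof (intro conjI allI impI)
   show "bc N (\<lambda>k. Q k - Q' k)" "bc N (\<lambda>k. r k - r' k)" using s(1-4) by (auto simp: bc_def)
   fix k assume k: "in_grid N k"
   show rr: "r k - r' k - 0 = frob (P k) (Q k - Q' k - 0)"
    using s(7,8)[OF k] by (simp add: frob_inner inner_diff_right)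
   have "B (\<lambda>k. Q k - Q' k) k = 0" using BB s(5,6)[OF k] by simp
   thus "(1/dt) *\<^sub>R (Q k - Q' k - 0) = M *\<^sub>R (L1 *\<^sub>R lap_h h (\<lambda>l. (1/2) *\<^sub>R (Q l - Q' l + 0)) k
    - ((r k - r' k + 0) / 2) *\<^sub>R P k + (L23 / 2) *\<^sub>R ((1/2) *\<^sub>R (alpha_h h (\<lambda>k. Q k - Q' k) k + alpha_h h (\<lambda>k. 0) k)))"
    using rr by (simp add: B_def al0)
  qed
  from hom[OF this] show ?thesis by (simp add: fun_eq_iff)
 qed
 show ?thesis
  by (rule ex1I[of _ "(tom f, \<lambda>k. if in_grid N k then rc k + frob (P k) (tom f k - Qc k) else 0)"])
   (use ex uniq in \<open>auto simp: prod_eq_iff\<close>)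
qed

section \<open>Space-time functions\<close>

lemma nn_integral_lborel_pair:
 fixes f :: "'a::euclidean_space \<times> 'b::euclidean_space \<Rightarrow> ennreal"
 assumes "f \<in> bm"
 shows "(NN z. f z) = (NN t x. f (t, x))"
 using lborel.nn_integral_fst[of f lborel] assms by (simp add: lborel_prod)

lemma integral_lborel_pair:
 fixes f :: "'a::euclidean_space \<times> 'b::euclidean_space \<Rightarrow> real"
 assumes "integrable lborel f"
 shows "(LBINT z. f z) = (LBINT t. \<integral>x. f (t, x) \<partial>lborel)"
  and "AE t in lborel. integrable lborel (\<lambda>x. f (t, x))"
  and "integrable lborel (\<lambda>t. \<integral>x. f (t, x) \<partial>lborel)"
 using lborel_pair.integral_fst'[of f] lborel_pair.AE_integrable_fst'[of f] lborel_pair.integrable_fst'[of f] assms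
 by (simp_all add: lborel_prod)

lemma lborel_product_integral:
 fixes a :: "'a::euclidean_space \<Rightarrow> real" and b :: "'b::euclidean_space \<Rightarrow> real"
 assumes a: "integrable lborel a" and b: "integrable lborel b"
 shows "integrable lborel (\<lambda>z. a (fst z) * b (snd z))" (is ?I)
  and "(LBINT z. a (fst z) * b (snd z)) = (LBINT t. a t) * (LBINT x. b x)" (is ?E)
proof -
 have [measurable]: "a \<in> bm" "b \<in> bm" using a b by auto
 have "integrable (lborel \<Otimes>\<^sub>M lborel) (\<lambda>z. a (fst z) * b (snd z))"
 proof (rule lborel_pair.Fubini_integrable)
  show "integrable lborel (\<lambda>x. \<integral>y. norm (a (fst (x, y)) * b (snd (x, y))) \<partial>lborel)"
   using a by (simp add: abs_mult)
  show "AE x in lborel. integrable lborel (\<lambda>y. a (fst (x, y)) * b (snd (x, y)))"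
   using b by simp
 qed measurable
 thus I: ?I by (simp add: lborel_prod)
 show ?E by (simp add: integral_lborel_pair(1)[OF I])
qed

lemma nn_integral_sq_eq: "l2 M f \<Longrightarrow> (\<integral>\<^sup>+x. ennreal ((f x)^2) \<partial>M) = ennreal ((nrm M f)^2)"
 unfolding nrm_sq by (rule nn_integral_eq_integral[OF l2_int]) auto

lemma nn_integral_sq_le_imp:
 assumes f: "f \<in> borel_measurable M" and le: "(\<integral>\<^sup>+x. ennreal ((f x)^2) \<partial>M) \<le> ennreal (C^2)" and C: "0 \<le> C"
 shows "l2 M f" "nrm M f \<le> C"
proof -
 have "integrable M (\<lambda>x. (f x)^2)"
 proof (rule integrableI_nonneg)
  show "(\<integral>\<^sup>+x. ennreal ((f x)^2) \<partial>M) < \<infinity>"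
   using le ennreal_less_top[of "C^2"] by (metis infinity_ennreal_def le_less_trans)
 qed (use f in auto)
 thus l2: "l2 M f" using f by (simp add: l2_def)
 have "ennreal ((nrm M f)^2) \<le> ennreal (C^2)" using le by (simp add: nn_integral_sq_eq[OF l2])
 hence "(nrm M f)^2 \<le> C^2" by (simp add: ennreal_le_iff)
 thus "nrm M f \<le> C" using C by (rule power2_le_imp_le)
qed

section \<open>Functions that are piecewise constant in time\<close>

definition tsf :: "real \<Rightarrow> nat \<Rightarrow> (nat \<Rightarrow> pt \<Rightarrow> real) \<Rightarrow> real \<times> pt \<Rightarrow> real" where
 "tsf dt n K z = (if 0 \<le> fst z \<and> fst z < real n * dt then K (nat \<lfloor>fst z / dt\<rfloor>) (snd z) else 0)"

lemma time_index:
 assumes "dt > 0" shows "nat \<lfloor>t / dt\<rfloor> = i \<and> 0 \<le> t \<longleftrightarrow> real i * dt \<le> t \<and> t < (real i + 1) * dt"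
proof (cases "0 \<le> t")
 case True
 have "nat \<lfloor>t / dt\<rfloor> = i \<longleftrightarrow> real i \<le> t / dt \<and> t / dt < real i + 1"
  using True assms by (simp add: nat_eq_iff floor_eq_iff)
 thus ?thesis using True assms by (simp add: pos_le_divide_eq pos_divide_less_eq)
next
 case False
 hence "t < real i * dt" using assms by (meson less_le_trans mult_nonneg_nonneg not_le of_nat_0_le_iff less_imp_le)
 thus ?thesis using False by simp
qed

lemma time_index_less:
 assumes "dt > 0" "0 \<le> t" shows "nat \<lfloor>t / dt\<rfloor> < n \<longleftrightarrow> t < real n * dt"
proof -
 have "nat \<lfloor>t / dt\<rfloor> < n \<longleftrightarrow> t / dt < real n" using assms by (simp add: nat_less_iff floor_less_iff)
 thus ?thesis using assms by (simp add: pos_divide_less_eq)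
qed

lemma tsf_sum:
 assumes dt: "dt > 0"
 shows "tsf dt n K z = (\<Sum>i<n. ind {real i * dt..<(real i + 1) * dt} (fst z) * K i (snd z))"
proof (cases "0 \<le> fst z")
 case True
 have "ind {real i * dt..<(real i + 1) * dt} (fst z) * K i (snd z)
   = (if i = nat \<lfloor>fst z / dt\<rfloor> then K i (snd z) else 0)" for i
  using time_index[OF dt, of "fst z" i] True by (auto split: split_indicator)
 thus ?thesis using time_index_less[OF dt True, of n] True by (simp add: tsf_def)
next
 case False
 have "ind {real i * dt..<(real i + 1) * dt} (fst z) = 0" for i
  using time_index[OF dt, of "fst z" i] False by (auto split: split_indicator)
 thus ?thesis using False by (simp add: tsf_def)
qed

lemma tsf_measurable:
 assumes "dt > 0" "\<And>i. i < n \<Longrightarrow> K i \<in> bm"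
 shows "tsf dt n K \<in> bm"
proof -
 have "(\<lambda>z. \<Sum>i<n. ind {real i * dt..<(real i + 1) * dt} (fst z) * K i (snd z)) \<in> borel_measurable (borel \<Otimes>\<^sub>M borel)"
  by (intro borel_measurable_sum borel_measurable_times measurable_compose[OF measurable_fst] measurable_compose[OF measurable_snd])
   (use assms(2) in auto)
 thus ?thesis using tsf_sum[OF assms(1), of n K, abs_def] by (simp add: borel_prod)
qed

lemma tsf_integral:
 assumes dt: "dt > 0" and K: "\<And>i. i < n \<Longrightarrow> integrable lborel (K i)"
 shows "integrable lborel (tsf dt n K)" (is ?g1) and "(LBINT z. tsf dt n K z) = dt * (\<Sum>i<n. \<integral>x. K i x \<partial>lborel)" (is ?g2)
proof -
 have m: "measure lborel {real i * dt..<(real i + 1) * dt} = dt" for i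
  using dt by (simp add: measure_def algebra_simps)
 have I: "integrable lborel (\<lambda>t. ind {real i * dt..<(real i + 1) * dt} t)" for i
  by (rule integrable_real_indicator) (use dt in \<open>simp_all add: algebra_simps\<close>)
 have E: "(LBINT t. ind {real i * dt..<(real i + 1) * dt} t) = dt" for i
  using m by simp
 have e: "tsf dt n K = (\<lambda>z. \<Sum>i<n. ind {real i * dt..<(real i + 1) * dt} (fst z) * K i (snd z))"
  using tsf_sum[OF dt] by (rule ext)
 show ?g1
  unfolding e by (intro Bochner_Integration.integrable_sum lborel_product_integral I K) auto
 have "(LBINT z. tsf dt n K z) = (\<Sum>i<n. \<integral>z. ind {real i * dt..<(real i + 1) * dt} (fst z) * K i (snd z) \<partial>lborel)"
  unfolding e by (intro Bochner_Integration.integral_sum lborel_product_integral I K) auto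
 also have "\<dots> = (\<Sum>i<n. dt * (LBINT x. K i x))"
  by (intro sum.cong refl, subst lborel_product_integral(2)[OF I K]) (auto simp only: E lessThan_iff)
 finally show ?g2 by (simp add: sum_distrib_left)
qed

lemma tsf_sq: "(tsf dt n K z)^2 = tsf dt n (\<lambda>i x. (K i x)^2) z"
 by (simp add: tsf_def)

lemma tsf_l2:
 assumes dt: "dt > 0" and K: "\<And>i. i < n \<Longrightarrow> l2L (K i)"
 shows "l2L (tsf dt n K)" and "(nrmL (tsf dt n K))^2 = dt * (\<Sum>i<n. (nrmL (K i))^2)" (is ?g2)
proof -
 have "tsf dt n K \<in> bm" by (rule tsf_measurable[OF dt]) (use l2_meas[OF K] in auto)
 thus "l2L (tsf dt n K)"
  unfolding l2_def tsf_sq using tsf_integral(1)[OF dt, of n "\<lambda>i x. (K i x)^2"] l2_int[OF K] by auto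
 show ?g2
  unfolding nrm_sq tsf_sq by (rule tsf_integral(2)[OF dt]) (use l2_int[OF K] in auto)
qed

lemma nrm_tsf_le:
 assumes dt: "dt > 0" and K: "\<And>i. i < n \<Longrightarrow> l2L (K i)" and C: "\<And>i. i < n \<Longrightarrow> nrmL (K i) \<le> C" "0 \<le> C"
 shows "nrmL (tsf dt n K) \<le> sqrt (real n * dt) * C"
proof (rule power2_le_imp_le)
 have "(nrmL (tsf dt n K))^2 = dt * (\<Sum>i<n. (nrmL (K i))^2)" by (rule tsf_l2[OF dt K])
 also have "\<dots> \<le> dt * (\<Sum>i<n. C^2)"
  using dt C by (intro mult_left_mono sum_mono power_mono) auto
 also have "\<dots> = (sqrt (real n * dt) * C)^2" using dt by (simp add: power_mult_distrib)
 finally show "(nrmL (tsf dt n K))^2 \<le> (sqrt (real n * dt) * C)^2" .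
qed (use dt C in auto)

definition TI :: "real \<Rightarrow> (real \<times> pt) \<Rightarrow> real" where
 "TI T z = ind {0..T} (fst z)"

lemma TI_measurable [measurable]: "TI T \<in> bm"
proof -
 have "TI T = ind ({0..T} \<times> UNIV)" by (auto simp: TI_def fun_eq_iff split: split_indicator)
 thus ?thesis by (simp add: borel_measurable_indicator borel_closed closed_Times)
qed

lemma TI_bound: "\<bar>TI T z\<bar> \<le> 1" by (simp add: TI_def split: split_indicator)

text \<open>A shift of the time index is a translation by \<open>dt m\<close>, except at the two
  ends of the time range. The cutoff to \<open>[0, T]\<close>, together with a final time beyond
  \<open>T + dt m\<close>, hides both ends.\<close>

lemma wlim_time_shift:
 assumes w: "wlimL (\<lambda>m. tsf (dt m) (n m) (K m)) u" and dt: "dt \<longlonglongrightarrow> 0" "\<And>m. dt m > 0"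
  and T: "\<And>m. T + dt m < real (n m) * dt m" "\<And>m. n m > 0"
  and l2: "\<And>m i. l2L (K m i)"
 shows "wlimL (\<lambda>m z. TI T z * tsf (dt m) (n m) (\<lambda>i. K m (Suc i)) z) (\<lambda>z. TI T z * u z)"
proof -
 have "(\<lambda>m. (dt m, 0::pt)) \<longlonglongrightarrow> (0, 0)" by (intro tendsto_Pair dt tendsto_const)
 hence "wlimL (\<lambda>m z. tsf (dt m) (n m) (K m) (z + (dt m, 0))) u"
  by (intro wlim_translate[OF w]) (simp add: zero_prod_def)
 from wlim_mult_bounded[OF this _ TI_bound]
 have "wlimL (\<lambda>m z. TI T z * tsf (dt m) (n m) (K m) (z + (dt m, 0))) (\<lambda>z. TI T z * u z)" by simp
 moreover have "TI T z * tsf (dt m) (n m) (K m) (z + (dt m, 0)) = TI T z * tsf (dt m) (n m) (\<lambda>i. K m (Suc i)) z" for m z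
 proof (cases "0 \<le> fst z \<and> fst z \<le> T")
  case True
  have "(fst z + dt m) / dt m = fst z / dt m + 1" using dt(2)[of m] by (simp add: field_simps)
  hence "nat \<lfloor>(fst z + dt m) / dt m\<rfloor> = Suc (nat \<lfloor>fst z / dt m\<rfloor>)"
   using True dt(2)[of m] by (simp add: nat_add_distrib)
  moreover have "fst z + dt m < real (n m) * dt m" "fst z < real (n m) * dt m" "0 \<le> fst z + dt m"
   using True T(1)[of m] dt(2)[of m] by linarith+
  ultimately show ?thesis using True by (simp add: tsf_def)
 next
  case False
  thus ?thesis by (simp add: TI_def)
 qed
 ultimately show ?thesis by simp
qed

lemma nrm_st_translate_vec:
 assumes h: "h > 0" and F: "fs F" and s: "\<And>\<alpha>. 0 \<le> s$\<alpha> \<and> s$\<alpha> \<le> \<epsilon>" and C: "\<And>\<alpha>. nrmL (st h (Dplus h \<alpha> F)) \<le> C"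
 shows "nrmL (\<lambda>x. st h F (x + s) - st h F x) \<le> 3 * (\<epsilon> + h) * C"
proof -
 note l = st_l2[OF h F]
 have C0: "0 \<le> C" using C[of undefined] nrm_nonneg order_trans by blast
 have e0: "0 \<le> \<epsilon>" using s[of undefined] by linarith
 define q where "q = (\<epsilon> + h) * C"
 define a where "a \<alpha> = (s$\<alpha>) *\<^sub>R (axis \<alpha> 1 :: pt)" for \<alpha>
 have s_eq: "s = a 1 + a 2 + a 3"
  by (simp add: vec_eq_iff a_def forall_3 axis_def)
 have one: "nrmL (\<lambda>x. st h F (x + b + a \<alpha>) - st h F (x + b)) \<le> (\<epsilon> + h) * C" for b \<alpha>
 proof -
  have "nrmL (\<lambda>x. (\<lambda>y. st h F (y + a \<alpha>) - st h F y) (x + b)) = nrmL (\<lambda>y. st h F (y + a \<alpha>) - st h F y)"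
   by (rule nrm_translate) measurable
  also have "\<dots> \<le> (s$\<alpha> + h) * nrmL (st h (Dplus h \<alpha> F))"
   unfolding a_def by (rule nrm_st_translate[OF h F]) (use s in auto)
  also have "\<dots> \<le> (\<epsilon> + h) * C" using s[of \<alpha>] C h e0 by (intro mult_mono) auto
  finally show ?thesis .
 qed
 have "nrmL (\<lambda>x. st h F (x + s) - st h F x)
   \<le> nrmL (\<lambda>x. st h F (x + s) - st h F (x + (a 1 + a 2))) + nrmL (\<lambda>x. st h F (x + (a 1 + a 2)) - st h F x)"
  by (rule nrm_triangle[OF l2_translate[OF l] l2_translate[OF l] l])
 also have "nrmL (\<lambda>x. st h F (x + (a 1 + a 2)) - st h F x)
   \<le> nrmL (\<lambda>x. st h F (x + (a 1 + a 2)) - st h F (x + a 1)) + nrmL (\<lambda>x. st h F (x + a 1) - st h F x)"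
  by (rule nrm_triangle[OF l2_translate[OF l] l2_translate[OF l] l])
 finally have "nrmL (\<lambda>x. st h F (x + s) - st h F x) \<le> q + (q + q)"
  using one[of "a 1 + a 2" 3] one[of "a 1" 2] one[of 0 1] unfolding s_eq q_def[symmetric]
  by (simp add: add.assoc)
 thus ?thesis by (simp add: q_def algebra_simps)
qed

section \<open>Strong compactness\<close>

text \<open>The cube lies on one side of the origin: averages over its translates look only at later
  times, for which the scheme still provides values.\<close>

definition ecube :: "real \<Rightarrow> (real \<times> pt) set" where
 "ecube \<epsilon> = cbox 0 (\<epsilon>, \<chi> i. \<epsilon>)"

text \<open>The average of \<open>F\<close> over \<open>z + ecube \<epsilon>\<close>, written as the
  inner product of \<open>F\<close> with a square integrable function of \<open>y\<close>, so that
  weak convergence of \<open>F\<close> gives convergence at every point \<open>z\<close>.\<close>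

definition avg4 :: "real \<Rightarrow> (real \<times> pt \<Rightarrow> real) \<Rightarrow> real \<times> pt \<Rightarrow> real" where
 "avg4 \<epsilon> F z = (1/\<epsilon>^4) * (LBINT y. F y * ind (ecube \<epsilon>) (y - z))"

lemma ecube_sets [measurable]: "ecube \<epsilon> \<in> sets borel" by (simp add: ecube_def)

lemma emeasure_ecube: assumes "\<epsilon> > 0" shows "emeasure lborel (ecube \<epsilon>) = ennreal (\<epsilon>^4)"
proof -
 have "ecube \<epsilon> = {0..\<epsilon>} \<times> cbox 0 (\<chi> i. \<epsilon>)"
  unfolding ecube_def zero_prod_def by (simp add: cbox_Pair_eq del: interval_cbox_cart interval_cbox)
 moreover have "(\<Prod>b\<in>Basis. (\<chi> i. \<epsilon>) \<bullet> (b::pt)) = \<epsilon>^3"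
 proof -
  have "(\<Prod>b\<in>Basis. (\<chi> i. \<epsilon>) \<bullet> (b::pt)) = (\<Prod>b\<in>(Basis::pt set). \<epsilon>)"
   by (intro prod.cong) (auto simp: Basis_vec_def inner_axis)
  thus ?thesis by simp
 qed
 moreover have "\<forall>b\<in>(Basis::pt set). 0 \<le> (\<chi> i. \<epsilon>) \<bullet> b" using assms by (auto simp: Basis_vec_def inner_axis)
 moreover have "emeasure lborel ({0..\<epsilon>} \<times> (cbox 0 (\<chi> i. \<epsilon>) :: pt set)) = emeasure lborel {0..\<epsilon>} * emeasure lborel (cbox 0 (\<chi> i. \<epsilon>) :: pt set)"
  unfolding lborel_prod[symmetric] by (rule lborel.emeasure_pair_measure_Times) auto
 ultimately show ?thesis using assms by (simp add: emeasure_lborel_cbox_eq ennreal_mult[symmetric] power_numeral_reduce)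
qed

lemma l2_ecube: "\<epsilon> > 0 \<Longrightarrow> l2L (ind (ecube \<epsilon>))"
 by (intro l2_indicat) (auto simp: emeasure_ecube)

lemma nrm_ecube: assumes "\<epsilon> > 0" shows "nrmL (ind (ecube \<epsilon>)) = \<epsilon>^2"
proof -
 have "(nrmL (ind (ecube \<epsilon>)))^2 = (LBINT x. ind (ecube \<epsilon>) x)"
  unfolding nrm_sq by (intro Bochner_Integration.integral_cong) (auto split: split_indicator)
 also have "\<dots> = (\<epsilon>^2)^2" using assms by (simp add: measure_def emeasure_ecube)
 finally show ?thesis by (rule power2_eq_imp_eq) simp_all
qed

lemma avg4_alt:
 assumes F: "F \<in> bm"
 shows "avg4 \<epsilon> F z = (1/\<epsilon>^4) * (LBINT s. F (z + s) * ind (ecube \<epsilon>) s)"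
proof -
 have "(LBINT s. F (s + z) * ind (ecube \<epsilon>) (s + z - z)) = (LBINT y. F y * ind (ecube \<epsilon>) (y - z))"
  using lborel_integral_translate[of "\<lambda>y. F y * ind (ecube \<epsilon>) (y - z)" z] F by simp
 thus ?thesis by (simp add: avg4_def add.commute)
qed

lemma avg4_measurable:
 assumes [measurable]: "F \<in> bm" shows "avg4 \<epsilon> F \<in> bm"
 unfolding avg4_def[abs_def] by measurable

lemma avg4_bound:
 assumes F: "l2L F" and e: "\<epsilon> > 0" shows "\<bar>avg4 \<epsilon> F z\<bar> \<le> nrmL F / \<epsilon>^2"
proof -
 have l: "l2L (\<lambda>y. ind (ecube \<epsilon>) (y + - z))" by (rule l2_translate[OF l2_ecube[OF e]])
 have "\<bar>\<integral>y. F y * ind (ecube \<epsilon>) (y + - z) \<partial>lborel\<bar> \<le> nrmL F * nrmL (\<lambda>y. ind (ecube \<epsilon>) (y + - z))"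
  by (rule l2_cauchy_schwarz[OF F l])
 also have "nrmL (\<lambda>y. ind (ecube \<epsilon>) (y + - z)) = \<epsilon>^2"
  by (subst nrm_translate) (auto simp: nrm_ecube[OF e])
 finally have "\<bar>avg4 \<epsilon> F z\<bar> \<le> (1/\<epsilon>^4) * (nrmL F * \<epsilon>^2)"
  unfolding avg4_def abs_mult using e by (intro mult_mono) auto
 also have "\<dots> = nrmL F / \<epsilon>^2" using e by (simp add: field_simps power_numeral_reduce)
 finally show ?thesis .
qed

lemma avg4_tendsto:
 assumes w: "wlimL F f" and e: "\<epsilon> > 0" shows "(\<lambda>m. avg4 \<epsilon> (F m) z) \<longlonglongrightarrow> avg4 \<epsilon> f z"
proof -
 have "l2L (\<lambda>y. ind (ecube \<epsilon>) (y + - z))" by (rule l2_translate[OF l2_ecube[OF e]])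
 from wlimD(3)[OF w this] show ?thesis unfolding avg4_def by (intro tendsto_intros) simp
qed

text \<open>Cauchy-Schwarz under the average bounds the squared deviation by the average of the
  squared translation differences; exchanging the integrals leaves for each \<open>s\<close> a
  quantity that \<open>tr\<close> controls.\<close>

lemma nrm_avg4_diff:
 assumes F: "l2L F" and e: "\<epsilon> > 0" and W: "W \<in> sets borel" and \<delta>: "0 \<le> \<delta>"
  and tr: "\<And>s. s \<in> ecube \<epsilon> \<Longrightarrow> nrmL (\<lambda>z. ind W z * (F (z + s) - F z)) \<le> \<delta>"
 shows "nrmL (\<lambda>z. ind W z * (avg4 \<epsilon> F z - F z)) \<le> \<delta>"
proof (rule nn_integral_sq_le_imp(2)[OF _ _ \<delta>])
 have mF[measurable]: "F \<in> bm" using l2_meas[OF F] by simp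
 note [measurable] = W avg4_measurable[OF mF]
 show "(\<lambda>z. ind W z * (avg4 \<epsilon> F z - F z)) \<in> bmL" by simp
 define E where "E = ind (ecube \<epsilon>)"
 define D where "D z s = F (z + s) - F z" for z s
 define k where "k z s = ennreal (1/\<epsilon>^4) * ennreal ((E s * (ind W z * D z s))^2)" for z s
 have E: "l2L E" "nrmL E = \<epsilon>^2" "(LBINT s. E s) = \<epsilon>^4"
  using e by (simp_all add: E_def l2_ecube nrm_ecube measure_def emeasure_ecube)
 have [measurable]: "E \<in> bm" "D z \<in> bm" for z unfolding D_def by (simp_all add: E_def)
 have jensen: "ennreal ((ind W z * (avg4 \<epsilon> F z - F z))^2) \<le> (NN s. k z s)" for z
 proof (cases "z \<in> W")
  case True
  have EE: "E s * (E s * D z s) = F (s + z) * E s - F z * E s" for s by (auto simp: E_def D_def indicator_def add.commute)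
  have l: "l2L (\<lambda>s. E s * D z s)"
   using l2_diff[OF l2_indicator[of "ecube \<epsilon>", OF _ l2_translate[OF F, of z]] l2_cmult[OF E(1), of "F z"]]
   by (simp add: E_def D_def right_diff_distrib add.commute mult.commute)
  have "integrable lborel (\<lambda>s. F (s + z) * E s)" "integrable lborel (\<lambda>s. F z * E s)"
   using l2_mult_int[OF l2_translate[OF F] E(1)] e by (auto simp: E_def emeasure_ecube)
  hence a: "avg4 \<epsilon> F z - F z = (1/\<epsilon>^4) * (LBINT s. E s * (E s * D z s))"
   unfolding EE using e E(3) by (simp add: avg4_alt[OF mF] right_diff_distrib add.commute flip: E_def)
  have "(LBINT s. E s * (E s * D z s))^2 \<le> (\<epsilon>^2 * nrmL (\<lambda>s. E s * D z s))^2"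
   using l2_cauchy_schwarz[OF E(1) l] unfolding E(2) abs_le_square_iff[symmetric] by simp
  hence "(avg4 \<epsilon> F z - F z)^2 \<le> (1/\<epsilon>^4)^2 * (\<epsilon>^2 * nrmL (\<lambda>s. E s * D z s))^2"
   unfolding a power_mult_distrib[of "1/\<epsilon>^4"] by (rule mult_left_mono) simp
  also have "\<dots> = (1/\<epsilon>^4) * (nrmL (\<lambda>s. E s * D z s))^2" using e by (simp add: power_mult_distrib power_divide flip: power_mult) (simp add: power_numeral_reduce)
  finally have "(avg4 \<epsilon> F z - F z)^2 \<le> (1/\<epsilon>^4) * (nrmL (\<lambda>s. E s * D z s))^2" .
  note le = ennreal_leI[OF this]
  have "(NN s. k z s) = ennreal (1/\<epsilon>^4) * ennreal ((nrmL (\<lambda>s. E s * D z s))^2)"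
   using True by (simp add: k_def nn_integral_cmult nn_integral_sq_eq[OF l])
  thus ?thesis using True e le by (simp add: ennreal_mult[symmetric])
 qed simp
 have "(NN z. ennreal ((ind W z * (avg4 \<epsilon> F z - F z))^2)) \<le> (NN z s. k z s)"
  by (rule nn_integral_mono) (rule jensen)
 also have "\<dots> = (NN s z. k z s)"
  unfolding k_def D_def by (rule lborel_pair.Fubini'[symmetric]) measurable
 also have "\<dots> \<le> (NN s. ennreal (\<delta>^2 / \<epsilon>^4) * indicator (ecube \<epsilon>) s)"
 proof (rule nn_integral_mono)
  fix s
  have "l2L (\<lambda>z. ind W z * (F (z + s) - F z))"
   by (intro l2_indicator l2_diff l2_translate[OF F] F) simp
  note q = nn_integral_sq_eq[OF this]
  show "(NN z. k z s) \<le> ennreal (\<delta>^2 / \<epsilon>^4) * indicator (ecube \<epsilon>) s"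
  proof (cases "s \<in> ecube \<epsilon>")
   case True
   hence "(NN z. k z s) = ennreal (1/\<epsilon>^4) * ennreal ((nrmL (\<lambda>z. ind W z * (F (z + s) - F z)))^2)"
    by (simp add: k_def E_def D_def nn_integral_cmult q)
   thus ?thesis
    using True e power_mono[OF tr[OF True] nrm_nonneg, of 2] by (simp add: ennreal_mult[symmetric] ennreal_leI divide_right_mono)
  qed (simp add: k_def E_def)
 qed
 also have "\<dots> = ennreal (\<delta>^2)"
  using e by (subst nn_integral_cmult_indicator) (auto simp: emeasure_ecube ennreal_mult[symmetric])
 finally show "(NN z. ennreal ((ind W z * (avg4 \<epsilon> F z - F z))^2)) \<le> ennreal (\<delta>^2)" .
qed

text \<open>The Kolmogorov-Riesz argument: for fixed \<epsilon> the averages converge pointwise and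
  boundedly on \<open>W\<close>, hence strongly; they stay within
  \<open>\<omega> \<epsilon> + \<eta> m\<close> of \<open>F m\<close>; and the limit inherits the
  bound \<open>\<omega> \<epsilon>\<close> by weak lower semicontinuity. The term \<eta> accounts
  for step functions, which show no equicontinuity below the mesh size.\<close>

lemma strong_of_weak:
 assumes w: "wlimL F f" and W: "W \<in> sets borel" "emeasure lborel W < \<infinity>"
  and tr: "\<And>\<epsilon> m s. 0 < \<epsilon> \<Longrightarrow> \<epsilon> < \<epsilon>0 \<Longrightarrow> s \<in> ecube \<epsilon> \<Longrightarrow>
   nrmL (\<lambda>z. ind W z * (F m (z + s) - F m z)) \<le> \<omega> \<epsilon> + \<eta> m"
  and \<eta>: "\<eta> \<longlonglongrightarrow> 0" and \<omega>: "\<And>e. e > 0 \<Longrightarrow> \<exists>\<epsilon>>0. \<epsilon> < \<epsilon>0 \<and> \<omega> \<epsilon> < e"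
 shows "slimL (\<lambda>m z. ind W z * F m z) (\<lambda>z. ind W z * f z)"
proof (rule slimI)
 have W': "W \<in> sets lborel" using W by simp
 show lF: "l2L (\<lambda>z. ind W z * F m z)" for m by (rule l2_indicator[OF W' wlimD(1)[OF w]])
 show lf: "l2L (\<lambda>z. ind W z * f z)" by (rule l2_indicator[OF W' wlimD(2)[OF w]])
 obtain B where B: "B > 0" "\<And>m. nrmL (F m) \<le> B" using wlim_bound[OF w] by auto
 have m: "F m \<in> bm" "f \<in> bm" for m
  using l2_meas[OF wlimD(1)[OF w]] l2_meas[OF wlimD(2)[OF w]] by simp_all
 note [measurable] = W(1) avg4_measurable[OF m(1)] avg4_measurable[OF m(2)]
 show "(\<lambda>m. nrmL (\<lambda>z. ind W z * F m z - ind W z * f z)) \<longlonglongrightarrow> 0"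
 proof (rule LIMSEQ_I)
  fix e :: real assume e: "e > 0"
  then obtain \<epsilon> where \<epsilon>: "\<epsilon> > 0" "\<epsilon> < \<epsilon>0" "\<omega> \<epsilon> < e / 4" using \<omega>[of "e/4"] by auto
  define G where "G m z = ind W z * avg4 \<epsilon> (F m) z" for m z
  define g where "g z = ind W z * avg4 \<epsilon> f z" for z
  have sG: "slimL G g"
  proof (rule slim_dominated[where w = "\<lambda>z. B / \<epsilon>^2 * ind W z"])
   show "l2L (\<lambda>z. B / \<epsilon>^2 * ind W z)" by (intro l2_cmult l2_indicat W' W)
   show "AE z in lborel. (\<lambda>m. G m z) \<longlonglongrightarrow> g z"
    unfolding G_def g_def by (intro AE_I2 tendsto_mult tendsto_const avg4_tendsto[OF w \<epsilon>(1)])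
   have "\<bar>avg4 \<epsilon> (F m) z\<bar> \<le> B / \<epsilon>^2" for m z
    using avg4_bound[OF wlimD(1)[OF w] \<epsilon>(1), of m z] divide_right_mono[OF B(2)[of m], of "\<epsilon>^2"] by simp
   thus "AE z in lborel. \<bar>G m z\<bar> \<le> B / \<epsilon>^2 * ind W z" for m
    by (intro AE_I2) (auto simp: G_def split: split_indicator)
  qed (simp_all add: G_def[abs_def] g_def[abs_def])
  \<comment> \<open>Nonnegativity of the modulus, read off from the admissible shift
    \<open>s = 0\<close>.\<close>
  have d0: "0 \<le> \<omega> \<epsilon> + \<eta> m" for m
   using tr[OF \<epsilon>(1,2), of 0 m] \<epsilon>(1) order_trans[OF nrm_nonneg]
   by (force simp: ecube_def zero_prod_def cbox_Pair_eq mem_box_cart)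
  have diff: "nrmL (\<lambda>z. G m z - ind W z * F m z) \<le> \<omega> \<epsilon> + \<eta> m" for m
   using nrm_avg4_diff[OF wlimD(1)[OF w, of m] \<epsilon>(1) W(1) d0[of m] tr[OF \<epsilon>(1,2), of _ m]] by (simp add: G_def right_diff_distrib)
  have wd: "wlimL (\<lambda>m z. G m z + (-1) * (ind W z * F m z)) (\<lambda>z. g z + (-1) * (ind W z * f z))"
   by (intro wlim_add slim_imp_wlim[OF sG] wlim_cmult wlim_mult_bounded[OF w, where K = 1])
    (auto split: split_indicator)
  have "nrmL (\<lambda>z. g z + (-1) * (ind W z * f z)) \<le> \<omega> \<epsilon> + 0"
   by (rule wlim_nrm_le[OF wd _ tendsto_add[OF tendsto_const \<eta>]]) (use diff in simp)
  hence gf: "nrmL (\<lambda>z. g z - ind W z * f z) \<le> \<omega> \<epsilon>" by simp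
  have "\<forall>\<^sub>F m in sequentially. nrmL (\<lambda>z. G m z - g z) < e/4"
   by (rule order_tendstoD(2)[OF slimD(3)[OF sG]]) (use e in simp)
  moreover have "\<forall>\<^sub>F m in sequentially. \<eta> m < e/4" by (rule order_tendstoD(2)[OF \<eta>]) (use e in simp)
  ultimately have "\<forall>\<^sub>F m in sequentially. nrmL (\<lambda>z. ind W z * F m z - ind W z * f z) < e"
  proof eventually_elim
   case (elim m)
   thus ?case
    using nrm_triangle[OF lF slimD(1)[OF sG] lf, of m m] nrm_triangle[OF slimD(1)[OF sG] slimD(2)[OF sG] lf, of m] diff[of m] gf \<epsilon>(3)
    unfolding nrm_commute[of lborel _ "G m"] by linarith
  qed
  thus "\<exists>K. \<forall>m\<ge>K. norm (nrmL (\<lambda>z. ind W z * F m z - ind W z * f z) - 0) < e"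
   by (simp add: eventually_sequentially)
 qed
qed

section \<open>A Ladyzhenskaya inequality\<close>

text \<open>The arguments come in the order third, second, first coordinate, so that iterated
  integration over pairs has the third coordinate outermost and the planar slices inside.\<close>

definition vec3 :: "real \<times> real \<times> real \<Rightarrow> pt" where
 "vec3 z = (\<chi> i. if i = 1 then snd (snd z) else if i = 2 then fst (snd z) else fst z)"

lemma vec3_nth [simp]: "vec3 (c, b, a) $ 1 = a" "vec3 (c, b, a) $ 2 = b" "vec3 (c, b, a) $ 3 = c"
 by (simp_all add: vec3_def)

lemma vec3_measurable [measurable]: "vec3 \<in> bm"
 unfolding vec3_def[abs_def]
proof (intro borel_measurable_continuous_onI continuous_on_vec_lambda)
 fix i :: 3
 show "continuous_on UNIV (\<lambda>z. if i = 1 then snd (snd z) else if i = 2 then fst (snd z) else fst z)"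
  by (cases "i = 1"; cases "i = 2"; simp; intro continuous_intros)
qed

lemma Basis_pt: "(Basis :: pt set) = {axis 1 1, axis 2 1, axis 3 1}"
 by (auto simp: Basis_vec_def UNIV_3)

lemma emeasure_lborel_Times:
 fixes A :: "'a::euclidean_space set" and B :: "'b::euclidean_space set"
 assumes "A \<in> sets borel" "B \<in> sets borel"
 shows "emeasure lborel (A \<times> B) = emeasure lborel A * emeasure lborel B"
 unfolding lborel_prod[symmetric] by (rule lborel.emeasure_pair_measure_Times) (use assms in auto)

lemma lborel_vec3: "distr lborel borel vec3 = lborel"
proof (rule lborel_eqI[symmetric])
 fix l u :: pt assume le: "\<And>b. b \<in> Basis \<Longrightarrow> l \<bullet> b \<le> u \<bullet> b"
 have le': "l $ i \<le> u $ i" for i using le[of "axis i 1"] by (simp add: inner_axis)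
 have "vec3 -` box l u \<inter> space lborel = box (l$3) (u$3) \<times> box (l$2) (u$2) \<times> box (l$1) (u$1)"
  by (auto simp: mem_box_cart forall_3)
 hence "emeasure (distr lborel borel vec3) (box l u)
   = emeasure lborel (box (l$3) (u$3) \<times> box (l$2) (u$2) \<times> box (l$1) (u$1))"
  by (subst emeasure_distr) auto
 also have "\<dots> = emeasure lborel (box (l$3) (u$3)) * (emeasure lborel (box (l$2) (u$2)) * emeasure lborel (box (l$1) (u$1)))"
  by (subst emeasure_lborel_Times, (auto intro!: borel_open open_Times)[2])+ simp
 also have "\<dots> = ennreal ((u$3 - l$3) * ((u$2 - l$2) * (u$1 - l$1)))"
  using le' by (simp add: ennreal_mult[symmetric] box_real)
 also have "(u$3 - l$3) * ((u$2 - l$2) * (u$1 - l$1)) = (\<Prod>b\<in>Basis. (u - l) \<bullet> b)"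
  unfolding Basis_pt by (simp add: inner_axis axis_eq_axis)
 finally show "emeasure (distr lborel borel vec3) (box l u) = ennreal (\<Prod>b\<in>Basis. (u - l) \<bullet> b)" .
qed simp

lemma nn_integral_vec3:
 fixes f :: "pt \<Rightarrow> ennreal"
 assumes f: "f \<in> bm"
 shows "(NN x. f x) = (NN c z. f (vec3 (c, z)))"
proof -
 have "(NN x. f x) = (NN z. f (vec3 z))"
  by (subst lborel_vec3[symmetric], subst nn_integral_distr) (use f in auto)
 also have "\<dots> = (NN c z. f (vec3 (c, z)))"
  by (rule nn_integral_lborel_pair) (use measurable_compose[OF vec3_measurable f] in simp)
 finally show ?thesis .
qed

text \<open>Continuously differentiable functions with compact support in the open cube: the class
  on which estimates are computed before passing to the closure.\<close>

definition ccs :: "(pt \<Rightarrow> real) \<Rightarrow> bool" where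
 "ccs p \<longleftrightarrow> (\<forall>x. p differentiable (at x)) \<and> (\<forall>\<alpha>. continuous_on UNIV (pd \<alpha> p)) \<and>
   (\<exists>K. compact K \<and> K \<subseteq> box 0 1 \<and> (\<forall>x. x \<notin> K \<longrightarrow> p x = 0))"

lemma ccsD:
 assumes "ccs p"
 shows "p differentiable (at x)" "continuous_on UNIV (pd \<alpha> p)" (is ?g2) "continuous_on UNIV p"
  "x \<notin> box 0 1 \<Longrightarrow> p x = 0" "x \<notin> box 0 1 \<Longrightarrow> pd \<alpha> p x = 0"
proof -
 show d: "p differentiable (at x)" for x using assms by (simp add: ccs_def)
 show ?g2 using assms by (simp add: ccs_def)
 show "continuous_on UNIV p"
  using d by (meson differentiable_at_imp_differentiable_on differentiable_imp_continuous_on)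
 obtain K where K: "compact K" "K \<subseteq> box 0 1" "\<And>x. x \<notin> K \<Longrightarrow> p x = 0" using assms by (auto simp: ccs_def)
 show "x \<notin> box 0 1 \<Longrightarrow> p x = 0" using K by auto
 show "pd \<alpha> p x = 0" if "x \<notin> box 0 1"
 proof -
  have o: "open (- K)" "x \<in> - K" using K that by (auto intro: compact_imp_closed)
  have "((\<lambda>x. 0) has_derivative (\<lambda>x. 0)) (at x)" by (rule has_derivative_const)
  hence "(p has_derivative (\<lambda>x. 0)) (at x)"
   by (rule has_derivative_transform_within_open[OF _ o]) (use K(3) in auto)
  hence "frechet_derivative p (at x) = (\<lambda>x. 0)" by (metis frechet_derivative_at)
  thus ?thesis by (simp add: pd_def)
 qed
qed

lemma pd_DERIV:
 fixes p :: "pt \<Rightarrow> real"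
 assumes "\<And>x. p differentiable (at x)"
 shows "((\<lambda>s. p (x + s *\<^sub>R axis \<alpha> 1)) has_real_derivative pd \<alpha> p (x + s *\<^sub>R axis \<alpha> 1)) (at s)"
proof -
 have 1: "((\<lambda>s. x + s *\<^sub>R axis \<alpha> (1::real)) has_derivative (\<lambda>t. t *\<^sub>R axis \<alpha> 1)) (at s)"
  by (auto intro!: derivative_eq_intros)
 have 2: "(p has_derivative frechet_derivative p (at (x + s *\<^sub>R axis \<alpha> 1))) (at (x + s *\<^sub>R axis \<alpha> 1))"
  using assms by (simp add: frechet_derivative_works)
 have "((\<lambda>s. p (x + s *\<^sub>R axis \<alpha> 1)) has_derivative (\<lambda>t. frechet_derivative p (at (x + s *\<^sub>R axis \<alpha> 1)) (t *\<^sub>R axis \<alpha> 1))) (at s)"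
  using has_derivative_compose[OF 1 2] .
 moreover have "(\<lambda>t. frechet_derivative p (at (x + s *\<^sub>R axis \<alpha> 1)) (t *\<^sub>R axis \<alpha> 1)) = (*) (pd \<alpha> p (x + s *\<^sub>R axis \<alpha> 1))"
  using has_derivative_linear[OF 2] by (auto simp: pd_def linear_cmul)
 ultimately show ?thesis by (simp add: has_field_derivative_def)
qed

text \<open>The fundamental theorem of calculus for \<open>p^2\<close> along a coordinate line,
  started on the face \<open>x $ \<alpha> = 0\<close> where \<open>p\<close> vanishes.\<close>

lemma ccs_sq_le_line:
 assumes p: "ccs p"
 shows "ennreal ((p x)^2) \<le> (NN s. ennreal (2 * \<bar>p (x + s *\<^sub>R axis \<alpha> 1) * pd \<alpha> p (x + s *\<^sub>R axis \<alpha> 1)\<bar>))"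
proof (cases "x \<in> box 0 1")
 case False
 thus ?thesis by (simp add: ccsD(4)[OF p])
next
 case True
 define e :: pt where "e = axis \<alpha> 1"
 define F where "F s = (p (x + s *\<^sub>R e))^2" for s
 define f where "f s = 2 * (p (x + s *\<^sub>R e) * pd \<alpha> p (x + s *\<^sub>R e))" for s
 have x0: "x $ \<alpha> \<ge> 0" using True by (simp add: mem_box_cart less_imp_le)
 have "has_bochner_integral lborel (\<lambda>s. f s * indicator {- x$\<alpha>..0} s) (F 0 - F (- x$\<alpha>))"
 proof (rule has_bochner_integral_FTC_Icc_real)
  show "- x$\<alpha> \<le> 0" using x0 by simp
  fix s
  show "(F has_real_derivative f s) (at s)"
   unfolding F_def f_def e_def
   by (auto intro!: derivative_eq_intros pd_DERIV ccsD(1)[OF p])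
  have "continuous_on UNIV f" unfolding f_def
   by (intro continuous_intros continuous_on_compose2[OF ccsD(3)[OF p]] continuous_on_compose2[OF ccsD(2)[OF p]]) auto
  thus "isCont f s" by (simp add: continuous_on_eq_continuous_at)
 qed
 moreover have "F (- x$\<alpha>) = 0"
 proof -
  have "(x + (- x$\<alpha>) *\<^sub>R e) $ \<alpha> = 0" by (simp add: e_def)
  hence "x + (- x$\<alpha>) *\<^sub>R e \<notin> box 0 1" by (metis less_irrefl mem_box_cart(1) zero_index)
  thus ?thesis by (simp add: F_def ccsD(4)[OF p])
 qed
 ultimately have I: "integrable lborel (\<lambda>s. f s * indicator {- x$\<alpha>..0} s)"
  and E: "(LBINT s. f s * indicator {- x$\<alpha>..0} s) = (p x)^2"
  by (auto simp: has_bochner_integral_iff F_def)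
 have "ennreal ((p x)^2) = ennreal (norm (LBINT s. f s * indicator {- x$\<alpha>..0} s))" by (simp add: E)
 also have "\<dots> \<le> (NN s. ennreal (norm (f s * indicator {- x$\<alpha>..0} s)))"
  by (rule integral_norm_bound_ennreal[OF I])
 also have "\<dots> \<le> (NN s. ennreal (2 * \<bar>p (x + s *\<^sub>R e) * pd \<alpha> p (x + s *\<^sub>R e)\<bar>))"
  by (intro nn_integral_mono ennreal_leI) (auto simp: f_def abs_mult split: split_indicator)
 finally show ?thesis by (simp add: e_def)
qed

lemma ennreal_mult_le_sq_add: "x * y \<le> x^2 + (y::ennreal)^2"
proof (cases "x \<le> y")
 case True
 hence "x * y \<le> y^2" by (simp add: power2_eq_square mult_right_mono)
 thus ?thesis by (simp add: add_increasing)
next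
 case False
 hence "x * y \<le> x^2" by (simp add: power2_eq_square mult_left_mono)
 thus ?thesis by (simp add: add_increasing2)
qed

text \<open>The planar argument is applied on each slice \<open>c\<close> of the third coordinate:
  \<open>p^2\<close> is bounded by a function of \<open>b\<close> and by one of \<open>a\<close>, so
  the slice integral of \<open>p^4\<close> is at most \<open>F 1 c * F 2 c\<close>. The slice
  integral of \<open>p^2\<close> that enters \<open>F\<close> is bounded uniformly in
  \<open>c\<close> by the line estimate in the third direction, which is the origin of
  \<open>K\<close>; afterwards only squared derivatives remain to be integrated over
  \<open>c\<close>.\<close>

lemma ladyzhenskaya:
 assumes p: "ccs p"
 shows "(NN x. ennreal ((p x)^4)) \<le> 4 * ((NN x. ennreal ((p x)^2)) + (NN x. ennreal ((pd 3 p x)^2))) *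
   ((NN x. ennreal ((pd 1 p x)^2)) + (NN x. ennreal ((pd 2 p x)^2)))"
proof -
 have [measurable]: "p \<in> bm" "pd \<alpha> p \<in> bm" for \<alpha>
  using ccsD(2,3)[OF p] by (auto intro: borel_measurable_continuous_onI)
 have [measurable]: "(\<lambda>z. vec3 (c, z)) \<in> bm" for c
  by (rule measurable_compose[OF _ vec3_measurable]) (intro borel_measurable_continuous_onI continuous_intros)
 define u where "u c z = ennreal ((p (vec3 (c, z)))^2)" for c z
 define g where "g \<alpha> c z = ennreal (2 * \<bar>p (vec3 (c, z)) * pd \<alpha> p (vec3 (c, z))\<bar>)" for \<alpha> c z
 define w where "w \<alpha> c z = ennreal ((pd \<alpha> p (vec3 (c, z)))^2)" for \<alpha> c z
 note defs = u_def[abs_def] g_def[abs_def] w_def[abs_def]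
 have [measurable]: "u c \<in> bm" "g \<alpha> c \<in> bm" "w \<alpha> c \<in> bm" for c \<alpha>
  unfolding defs by simp_all
 have gm [measurable]: "g \<alpha> c \<in> borel_measurable (borel \<Otimes>\<^sub>M borel)" for \<alpha> c unfolding borel_prod by simp
 have sh: "vec3 (c, b, a) + s *\<^sub>R axis 1 1 = vec3 (c, b, s + a)" "vec3 (c, b, a) + s *\<^sub>R axis 2 1 = vec3 (c, s + b, a)"
  "vec3 (c, b, a) + s *\<^sub>R axis 3 1 = vec3 (s + c, b, a)" for a b c s by (simp_all add: vec_eq_iff forall_3 axis_def)
 have "(\<lambda>s. vec3 (c, b, s)) \<in> bm" "(\<lambda>s. vec3 (c, s, b)) \<in> bm"
  "(\<lambda>s. vec3 (s, b, c)) \<in> bm" for b c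
  by (rule measurable_compose[OF _ vec3_measurable], intro borel_measurable_continuous_onI continuous_intros)+
 note [measurable] = this
 have line: "u c (b, a) \<le> (NN s. g 1 c (b, s))" "u c (b, a) \<le> (NN s. g 2 c (s, a))" "u c (b, a) \<le> (NN s. g 3 s (b, a))" for a b c
  using ccs_sq_le_line[OF p, of "vec3 (c, b, a)" 1] ccs_sq_le_line[OF p, of "vec3 (c, b, a)" 2] ccs_sq_le_line[OF p, of "vec3 (c, b, a)" 3] lborel_nn_integral_translate[of "\<lambda>s. g 1 c (b, s)" a]
   lborel_nn_integral_translate[of "\<lambda>s. g 2 c (s, a)" b] lborel_nn_integral_translate[of "\<lambda>s. g 3 s (b, a)" c]
  by (simp_all add: u_def g_def flip: sh)
 define K where "K = (NN x. ennreal (2 * \<bar>p x * pd 3 p x\<bar>))"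
 define F where "F \<alpha> c = (NN z. g \<alpha> c z)" for \<alpha> c
 have v3: "(\<lambda>(c, z). f (vec3 (c, z))) \<in> bm" if "f \<in> bm" for f :: "pt \<Rightarrow> ennreal"
  using that by (simp add: case_prod_unfold)
 have F_sq: "(F \<alpha> c)^2 \<le> 4 * K * (NN z. w \<alpha> c z)" for \<alpha> c
 proof -
  have "(NN z. u c z) \<le> (NN z s. g 3 s z)"
   by (intro nn_integral_mono) (metis line(3) surj_pair)
  also have "\<dots> = (NN s z. g 3 s z)"
   by (rule lborel_pair.Fubini') (use v3[of "\<lambda>x. ennreal (2 * \<bar>p x * pd 3 p x\<bar>)"] in \<open>simp add: g_def lborel_prod\<close>)
  also have "\<dots> = K" unfolding K_def by (subst nn_integral_vec3) (auto simp: defs)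
  finally have K: "(NN z. u c z) \<le> K" .
  define f1 where "f1 z = ennreal (2 * \<bar>p (vec3 (c, z))\<bar>)" for z
  define f2 where "f2 z = ennreal \<bar>pd \<alpha> p (vec3 (c, z))\<bar>" for z
  have "g \<alpha> c z = f1 z * f2 z" "(f1 z)^2 = 4 * u c z" "(f2 z)^2 = w \<alpha> c z" for z
   by (simp_all add: f1_def f2_def g_def u_def w_def ennreal_power power_mult_distrib ennreal_mult abs_mult mult.assoc)
  hence "(F \<alpha> c)^2 \<le> 4 * (NN z. u c z) * (NN z. w \<alpha> c z)"
   using Cauchy_Schwarz_nn_integral[of f1 lborel f2] by (simp add: F_def f1_def[abs_def] f2_def[abs_def] nn_integral_cmult)
  also have "\<dots> \<le> 4 * K * (NN z. w \<alpha> c z)" by (intro mult_right_mono mult_left_mono K) auto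
  finally show ?thesis .
 qed
 have slice: "(NN z. (u c z)^2) \<le> F 1 c * F 2 c" for c
 proof -
  have "(NN z. (u c z)^2) = (NN b a. (u c (b, a))^2)"
   by (rule nn_integral_lborel_pair) (auto intro: borel_measurable_power_ennreal)
  also have "\<dots> \<le> (NN b a. (NN s. g 1 c (b, s)) * (NN s. g 2 c (s, a)))"
   unfolding power2_eq_square by (intro nn_integral_mono mult_mono line) auto
  also have "\<dots> = (NN b s. g 1 c (b, s)) * (NN a s. g 2 c (s, a))"
   by (simp add: nn_integral_cmult nn_integral_multc)
  also have "(NN a s. g 2 c (s, a)) = (NN s a. g 2 c (s, a))"
   by (rule lborel_pair.Fubini') simp
  finally show ?thesis unfolding F_def by (simp add: nn_integral_lborel_pair)
 qed
 have W: "(NN c z. w \<alpha> c z) = (NN x. ennreal ((pd \<alpha> p x)^2))" for \<alpha>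
  by (subst nn_integral_vec3) (auto simp: defs)
 have mw: "(\<lambda>c. \<integral>\<^sup>+z. w \<alpha> c z \<partial>lborel) \<in> bmL" for \<alpha>
  using lborel.borel_measurable_nn_integral[of "w \<alpha>" borel] v3[of "\<lambda>x. ennreal ((pd \<alpha> p x)^2)"] by (simp add: w_def borel_prod)
 have "(NN x. ennreal ((p x)^4)) = (NN c z. (u c z)^2)"
  by (subst nn_integral_vec3) (auto simp: u_def ennreal_power simp flip: power_mult)
 also have "\<dots> \<le> (NN c. 4 * K * (NN z. w 1 c z) + 4 * K * (NN z. w 2 c z))"
  by (intro nn_integral_mono order_trans[OF slice] order_trans[OF ennreal_mult_le_sq_add] add_mono F_sq)
 also have "\<dots> = 4 * K * ((NN x. ennreal ((pd 1 p x)^2)) + (NN x. ennreal ((pd 2 p x)^2)))"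
  using mw by (simp add: nn_integral_add nn_integral_cmult W distrib_left)
 also have "K \<le> (NN x. ennreal ((p x)^2) + ennreal ((pd 3 p x)^2))"
  unfolding K_def
 proof (rule nn_integral_mono)
  fix x
  show "ennreal (2 * \<bar>p x * pd 3 p x\<bar>) \<le> ennreal ((p x)^2) + ennreal ((pd 3 p x)^2)"
   using sum_squares_bound[of "\<bar>p x\<bar>" "\<bar>pd 3 p x\<bar>"] by (simp add: abs_mult mult.assoc ennreal_leI flip: ennreal_plus)
 qed
 also have "\<dots> = (NN x. ennreal ((p x)^2)) + (NN x. ennreal ((pd 3 p x)^2))"
  by (simp add: nn_integral_add)
 finally show ?thesis by (simp add: mult_left_mono mult_right_mono)
qed

section \<open>Cell averages\<close>

lemma ccs_pd_bound: assumes "ccs p" shows "\<exists>B>0. \<forall>x. \<bar>pd \<alpha> p x\<bar> \<le> B"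
proof -
 have "bounded (pd \<alpha> p ` cbox 0 1)"
  by (rule compact_imp_bounded[OF compact_continuous_image[OF continuous_on_subset[OF ccsD(2)[OF assms]] compact_cbox]]) simp
 then obtain B where "\<forall>y\<in>pd \<alpha> p ` cbox 0 1. norm y \<le> B" unfolding bounded_iff by blast
 hence "\<bar>pd \<alpha> p x\<bar> \<le> max B 1" for x
  using ccsD(5)[OF assms, of x \<alpha>] subsetD[OF box_subset_cbox, of x 0 1]
  by (cases "x \<in> box 0 1") (auto simp: le_max_iff_disj)
 thus ?thesis by (intro exI[of _ "max B 1"]) auto
qed

lemma ccs_mvt:
 assumes p: "ccs p" and t: "t \<noteq> 0"
 shows "\<exists>\<theta>. \<bar>\<theta>\<bar> \<le> \<bar>t\<bar> \<and> p (x + t *\<^sub>R axis \<alpha> 1) - p x = t * pd \<alpha> p (x + \<theta> *\<^sub>R axis \<alpha> 1)"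
proof -
 have D: "((\<lambda>s. p (x + s *\<^sub>R axis \<alpha> 1)) has_real_derivative pd \<alpha> p (x + s *\<^sub>R axis \<alpha> 1)) (at s)" for s
  by (rule pd_DERIV[OF ccsD(1)[OF p]])
 show ?thesis
 proof (cases "t > 0")
  case True
  obtain z where "0 < z" "z < t" "p (x + t *\<^sub>R axis \<alpha> 1) - p (x + 0 *\<^sub>R axis \<alpha> 1) = (t - 0) * pd \<alpha> p (x + z *\<^sub>R axis \<alpha> 1)"
   using MVT2[OF True, of "\<lambda>s. p (x + s *\<^sub>R axis \<alpha> 1)" "\<lambda>s. pd \<alpha> p (x + s *\<^sub>R axis \<alpha> 1)"] D by blast
  thus ?thesis by (intro exI[of _ z]) auto
 next
  case False
  hence "t < 0" using t by simp
  then obtain z where "t < z" "z < 0" "p (x + 0 *\<^sub>R axis \<alpha> 1) - p (x + t *\<^sub>R axis \<alpha> 1) = (0 - t) * pd \<alpha> p (x + z *\<^sub>R axis \<alpha> 1)"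
   using MVT2[of t 0, of "\<lambda>s. p (x + s *\<^sub>R axis \<alpha> 1)" "\<lambda>s. pd \<alpha> p (x + s *\<^sub>R axis \<alpha> 1)"] D by blast
  thus ?thesis by (intro exI[of _ z]) auto
 qed
qed

lemma ccs_measurable:
 assumes "ccs p" shows "p \<in> bm" "pd \<alpha> p \<in> bm"
 using ccsD(2,3)[OF assms] by (auto intro: borel_measurable_continuous_onI)

lemma ccs_l2: assumes "ccs p" shows "l2L p" "l2L (pd \<alpha> p)"
proof -
 have i: "l2L (\<lambda>x. B * ind (box 0 1 :: pt set) x)" for B
  by (intro l2_cmult l2_indicat emeasure_bounded_finite) auto
 obtain B where B: "\<And>x. \<bar>pd \<alpha> p x\<bar> \<le> B" "B > 0" using ccs_pd_bound[OF assms] by blast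
 show "l2L (pd \<alpha> p)"
  by (rule l2_bound[OF i[of B]]) (use B ccsD(5)[OF assms] ccs_measurable[OF assms] in \<open>auto split: split_indicator\<close>)
 have "bounded (p ` cbox 0 1)"
  by (rule compact_imp_bounded[OF compact_continuous_image[OF continuous_on_subset[OF ccsD(3)[OF assms]] compact_cbox]]) simp
 then obtain C where "\<forall>y\<in>p ` cbox 0 1. norm y \<le> C" unfolding bounded_iff by blast
 hence C: "\<bar>p x\<bar> \<le> C" if "x \<in> box 0 1" for x using that subsetD[OF box_subset_cbox] by force
 show "l2L p"
  by (rule l2_bound[OF i[of C]]) (use C ccsD(4)[OF assms] ccs_measurable[OF assms] in \<open>force split: split_indicator\<close>)+
qed

lemma pd_diff:
 fixes p q :: "pt \<Rightarrow> 'b::real_normed_vector"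
 assumes "p differentiable (at x)" "q differentiable (at x)"
 shows "pd \<alpha> (\<lambda>x. p x - q x) x = pd \<alpha> p x - pd \<alpha> q x"
proof -
 have "((\<lambda>x. p x - q x) has_derivative (\<lambda>v. frechet_derivative p (at x) v - frechet_derivative q (at x) v)) (at x)"
  using assms by (intro has_derivative_diff) (simp_all add: frechet_derivative_works)
 from frechet_derivative_at[OF this] show ?thesis by (simp add: pd_def fun_eq_iff)
qed

lemma ccs_diff: assumes "ccs p" "ccs q" shows "ccs (\<lambda>x. p x - q x)"
proof -
 obtain K1 where K1: "compact K1" "K1 \<subseteq> box 0 1" "\<And>x. x \<notin> K1 \<Longrightarrow> p x = 0" using assms(1) by (auto simp: ccs_def)
 obtain K2 where K2: "compact K2" "K2 \<subseteq> box 0 1" "\<And>x. x \<notin> K2 \<Longrightarrow> q x = 0" using assms(2) by (auto simp: ccs_def)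
 have "pd \<alpha> (\<lambda>x. p x - q x) = (\<lambda>x. pd \<alpha> p x - pd \<alpha> q x)" for \<alpha>
  using pd_diff ccsD(1)[OF assms(1)] ccsD(1)[OF assms(2)] by blast
 moreover have "compact (K1 \<union> K2)" "K1 \<union> K2 \<subseteq> box 0 1" "\<forall>x. x \<notin> K1 \<union> K2 \<longrightarrow> p x - q x = 0"
  using K1 K2 by (auto intro: compact_Un)
 ultimately show ?thesis
  unfolding ccs_def using ccsD(1,2)[OF assms(1)] ccsD(1,2)[OF assms(2)]
  by (auto intro!: continuous_intros differentiable_diff)
qed

lemma ccs_difference_quotient:
 assumes p: "ccs p" and t: "t \<longlonglongrightarrow> 0" "\<And>n. t n \<noteq> 0"
 shows "slimL (\<lambda>n x. (p (x + t n *\<^sub>R axis \<alpha> 1) - p x) / t n) (pd \<alpha> p)"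
proof -
 obtain R where R: "\<And>x. x \<in> box 0 (1::pt) \<Longrightarrow> norm x \<le> R"
  using bounded_box[of 0 "1::pt"] unfolding bounded_iff by blast
 show ?thesis
 proof (rule slim_local[OF ccsD(2)[OF p]])
  fix x :: pt assume "R + 1 \<le> norm x"
  hence "x \<notin> box 0 1" using R[of x] by force
  thus "pd \<alpha> p x = 0" by (rule ccsD(5)[OF p])
 next
  show "(\<lambda>x. (p (x + t n *\<^sub>R axis \<alpha> 1) - p x) / t n) \<in> bmL" for n
   using ccs_measurable(1)[OF p] by simp
  fix n x c \<eta> assume H: "\<And>y. norm (y - x) \<le> \<bar>t n\<bar> \<Longrightarrow> \<bar>pd \<alpha> p y - c\<bar> \<le> \<eta>"
  obtain \<theta> where \<theta>: "\<bar>\<theta>\<bar> \<le> \<bar>t n\<bar>" "p (x + t n *\<^sub>R axis \<alpha> 1) - p x = t n * pd \<alpha> p (x + \<theta> *\<^sub>R axis \<alpha> 1)"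
   using ccs_mvt[OF p t(2)] by blast
  thus "\<bar>(p (x + t n *\<^sub>R axis \<alpha> 1) - p x) / t n - c\<bar> \<le> \<eta>"
   using H[of "x + \<theta> *\<^sub>R axis \<alpha> 1"] t(2)[of n] by simp
 qed (rule tendsto_rabs_zero[OF t(1)])
qed

text \<open>Dividing the translation into \<open>n + 1\<close> equal steps bounds it by
  \<open>\<bar>s\<bar>\<close> times the norm of a difference quotient with step
  \<open>s / (n + 1)\<close>; these quotients converge to the derivative.\<close>

lemma ccs_translate_bound:
 assumes p: "ccs p"
 shows "nrmL (\<lambda>x. p (x + s *\<^sub>R axis \<alpha> 1) - p x) \<le> \<bar>s\<bar> * nrmL (pd \<alpha> p)"
proof (cases "s = 0")
 case True
 thus ?thesis by (simp add: nrm_def)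
next
 case False
 define e :: pt where "e = axis \<alpha> 1"
 note l = ccs_l2(1)[OF p]
 have mp: "p \<in> bm" by (rule ccs_measurable[OF p])
 define t where "t n = s / real (Suc n)" for n
 have tele: "nrmL (\<lambda>x. p (x + (real i * u) *\<^sub>R e) - p x) \<le> real i * nrmL (\<lambda>x. p (x + u *\<^sub>R e) - p x)" for i u
 proof (induction i)
  case 0 thus ?case by (simp add: nrm_def)
 next
  case (Suc i)
  have "nrmL (\<lambda>x. p (x + (real (Suc i) * u) *\<^sub>R e) - p x)
    \<le> nrmL (\<lambda>x. p (x + (real (Suc i) * u) *\<^sub>R e) - p (x + (real i * u) *\<^sub>R e))
     + nrmL (\<lambda>x. p (x + (real i * u) *\<^sub>R e) - p x)"
   by (rule nrm_triangle[OF l2_translate[OF l] l2_translate[OF l] l])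
  also have "(\<lambda>x. p (x + (real (Suc i) * u) *\<^sub>R e) - p (x + (real i * u) *\<^sub>R e))
    = (\<lambda>x. (\<lambda>y. p (y + u *\<^sub>R e) - p y) (x + (real i * u) *\<^sub>R e))"
   by (simp add: algebra_simps)
  also have "nrmL \<dots> = nrmL (\<lambda>y. p (y + u *\<^sub>R e) - p y)" by (subst nrm_translate) (use mp in simp_all)
  finally show ?case using Suc.IH by (simp add: algebra_simps)
 qed
 have bd: "nrmL (\<lambda>x. p (x + s *\<^sub>R e) - p x) \<le> \<bar>s\<bar> * nrmL (\<lambda>x. (p (x + t n *\<^sub>R e) - p x) / t n)" for n
 proof -
  have "real (Suc n) * t n = s" by (simp add: t_def)
  hence "nrmL (\<lambda>x. p (x + s *\<^sub>R e) - p x) \<le> real (Suc n) * nrmL (\<lambda>x. p (x + t n *\<^sub>R e) - p x)"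
   using tele[of "Suc n" "t n"] by simp
  also have "(\<lambda>x. p (x + t n *\<^sub>R e) - p x) = (\<lambda>x. t n * ((p (x + t n *\<^sub>R e) - p x) / t n))"
   using False by (simp add: t_def)
  also have "real (Suc n) * nrmL \<dots> = \<bar>s\<bar> * nrmL (\<lambda>x. (p (x + t n *\<^sub>R e) - p x) / t n)"
   unfolding nrm_cmult by (simp add: t_def)
  finally show ?thesis .
 qed
 have "t \<longlonglongrightarrow> s * 0" unfolding t_def divide_inverse by (intro tendsto_mult tendsto_const LIMSEQ_inverse_real_of_nat)
 hence t0: "t \<longlonglongrightarrow> 0" by simp
 have "slimL (\<lambda>n x. (p (x + t n *\<^sub>R e) - p x) / t n) (pd \<alpha> p)"
  unfolding e_def by (rule ccs_difference_quotient[OF p t0]) (use False in \<open>simp add: t_def\<close>)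
 from tendsto_mult[OF tendsto_const[of "\<bar>s\<bar>"] slim_nrm_tendsto[OF this]]
 show ?thesis unfolding e_def[symmetric] by (rule LIMSEQ_le_const) (use bd in blast)
qed

text \<open>\<open>q\<close> and its gradient \<open>d\<close>, both extended by zero, are limits of
  functions from \<open>ccs\<close> and of their derivatives. Because of the zero extension,
  translates may cross the boundary without producing a jump.\<close>

definition H10s :: "(pt \<Rightarrow> real) \<Rightarrow> (3 \<Rightarrow> pt \<Rightarrow> real) \<Rightarrow> bool" where
 "H10s q d \<longleftrightarrow> (\<forall>x. x \<notin> box 0 1 \<longrightarrow> q x = 0 \<and> (\<forall>\<alpha>. d \<alpha> x = 0)) \<and>
   (\<exists>p. (\<forall>n. ccs (p n)) \<and> slimL p q \<and> (\<forall>\<alpha>. slimL (\<lambda>n. pd \<alpha> (p n)) (d \<alpha>)))"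

lemma H10s_translate_bound:
 assumes "H10s q d"
 shows "nrmL (\<lambda>x. q (x + s *\<^sub>R axis \<alpha> 1) - q x) \<le> \<bar>s\<bar> * nrmL (d \<alpha>)"
proof -
 obtain p where p: "\<And>n. ccs (p n)" "slimL p q" "slimL (\<lambda>n. pd \<alpha> (p n)) (d \<alpha>)"
  using assms unfolding H10s_def by blast
 define e :: pt where "e = axis \<alpha> 1"
 have mq: "q \<in> bm" using l2_meas[OF slimD(2)[OF p(2)]] by simp
 have mp: "p n \<in> bm" for n by (rule ccs_measurable[OF p(1)])
 have "slimL (\<lambda>n x. p n (x + s *\<^sub>R e)) (\<lambda>x. q (x + s *\<^sub>R e))"
 proof (rule slimI)
  have "nrmL (\<lambda>x. (\<lambda>y. p n y - q y) (x + s *\<^sub>R e)) = nrmL (\<lambda>y. p n y - q y)" for n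
   by (rule nrm_translate) (use mq mp in simp)
  thus "(\<lambda>n. nrmL (\<lambda>x. p n (x + s *\<^sub>R e) - q (x + s *\<^sub>R e))) \<longlonglongrightarrow> 0"
   using slimD(3)[OF p(2)] by simp
 qed (rule l2_translate[OF slimD(1)[OF p(2)]] l2_translate[OF slimD(2)[OF p(2)]])+
 from slim_add[OF this slim_cmult[OF p(2), of "-1"]]
 have "slimL (\<lambda>n x. p n (x + s *\<^sub>R e) - p n x) (\<lambda>x. q (x + s *\<^sub>R e) - q x)" by simp
 from LIMSEQ_le[OF slim_nrm_tendsto[OF this] tendsto_mult[OF tendsto_const[of "\<bar>s\<bar>"] slim_nrm_tendsto[OF p(3)]]]
 show ?thesis using ccs_translate_bound[OF p(1)] unfolding e_def by blast
qed

lemma H10s_diff_ccs: assumes q: "H10s q d" and p: "ccs p" shows "H10s (\<lambda>x. q x - p x) (\<lambda>\<alpha> x. d \<alpha> x - pd \<alpha> p x)"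
proof -
 obtain u where u: "\<And>n. ccs (u n)" "slimL u q" "\<And>\<alpha>. slimL (\<lambda>n. pd \<alpha> (u n)) (d \<alpha>)"
  using q unfolding H10s_def by blast
 have pe: "pd \<alpha> (\<lambda>x. u n x - p x) = (\<lambda>x. pd \<alpha> (u n) x - pd \<alpha> p x)" for n \<alpha>
  using pd_diff ccsD(1)[OF u(1)] ccsD(1)[OF p] by blast
 have "slimL (\<lambda>n x. u n x + (-1) * p x) (\<lambda>x. q x + (-1) * p x)"
  "slimL (\<lambda>n x. pd \<alpha> (u n) x + (-1) * pd \<alpha> p x) (\<lambda>x. d \<alpha> x + (-1) * pd \<alpha> p x)" for \<alpha>
  by (intro slim_add u slim_const l2_cmult ccs_l2[OF p])+
 thus ?thesis
  unfolding H10s_def using q ccsD(4,5)[OF p] ccs_diff[OF u(1) p]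
  by (intro conjI exI[of _ "\<lambda>n x. u n x - p x"]) (auto simp: pe H10s_def)
qed

text \<open>The bound \<open>H10s_translate_bound\<close>, applied to \<open>q - p k\<close>, makes
  the approximation error of the difference quotients independent of the step \<open>t n\<close>;
  for fixed \<open>p k\<close> the quotients converge.\<close>

lemma H10s_difference_quotient:
 assumes q: "H10s q d" and t: "t \<longlonglongrightarrow> 0" "\<And>n. t n \<noteq> 0"
 shows "slimL (\<lambda>n x. (q (x + t n *\<^sub>R axis \<alpha> 1) - q x) / t n) (d \<alpha>)"
proof -
 obtain p where p: "\<And>n. ccs (p n)" "slimL p q" "\<And>\<alpha>. slimL (\<lambda>n. pd \<alpha> (p n)) (d \<alpha>)"
  using q unfolding H10s_def by blast
 have Dl: "l2L (\<lambda>x. (f (x + t n *\<^sub>R axis \<alpha> 1) - f x) / t n)" if "l2L f" for f n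
  using l2_cmult[OF l2_diff[OF l2_translate[OF that] that], of "1 / t n"] by simp
 show ?thesis
 proof (rule slim_approximation[OF Dl[OF slimD(2)[OF p(2)]] slimD(2)[OF p(3)]])
  fix e :: real assume "e > 0"
  from LIMSEQ_D[OF slimD(3)[OF p(3)[of \<alpha>]] this] obtain k where k: "nrmL (\<lambda>x. pd \<alpha> (p k) x - d \<alpha> x) < e" by auto
  have "nrmL (\<lambda>x. (q (x + t n *\<^sub>R axis \<alpha> 1) - q x) / t n - (p k (x + t n *\<^sub>R axis \<alpha> 1) - p k x) / t n) \<le> e" for n
  proof -
   have "nrmL (\<lambda>x. (q (x + t n *\<^sub>R axis \<alpha> 1) - q x) / t n - (p k (x + t n *\<^sub>R axis \<alpha> 1) - p k x) / t n)
    = nrmL (\<lambda>x. (1 / t n) * ((q (x + t n *\<^sub>R axis \<alpha> 1) - p k (x + t n *\<^sub>R axis \<alpha> 1)) - (q x - p k x)))"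
    by (simp add: diff_divide_distrib algebra_simps)
   also have "\<dots> \<le> \<bar>1 / t n\<bar> * (\<bar>t n\<bar> * nrmL (\<lambda>x. d \<alpha> x - pd \<alpha> (p k) x))"
    unfolding nrm_cmult by (intro mult_left_mono H10s_translate_bound[OF H10s_diff_ccs[OF q p(1)]]) simp
   also have "\<dots> = nrmL (\<lambda>x. pd \<alpha> (p k) x - d \<alpha> x)" using t(2)[of n] unfolding nrm_commute[of lborel "d \<alpha>"] by simp
   finally show ?thesis using k by linarith
  qed
  thus "\<exists>G g. slimL G g \<and> (\<forall>n. nrmL (\<lambda>x. (q (x + t n *\<^sub>R axis \<alpha> 1) - q x) / t n - G n x) \<le> e) \<and> nrmL (\<lambda>x. g x - d \<alpha> x) \<le> e"
   using ccs_difference_quotient[OF p(1) t] k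
   by (intro exI[of _ "\<lambda>n x. (p k (x + t n *\<^sub>R axis \<alpha> 1) - p k x) / t n"] exI[of _ "pd \<alpha> (p k)"]) auto
 qed
qed

section \<open>Averages over cells and the boundary layer they miss\<close>

definition avg :: "real \<Rightarrow> (pt \<Rightarrow> real) \<Rightarrow> idx \<Rightarrow> real" where
 "avg h q k = (1 / h ^ 3) * (LBINT x. ind (cell h k) x * q x)"

text \<open>The initial data of the scheme for one component. In contrast to \<open>avg\<close>,
  which commutes with shifts, it is zero at indices off the grid.\<close>

definition cavg :: "nat \<Rightarrow> (pt \<Rightarrow> real) \<Rightarrow> idx \<Rightarrow> real" where
 "cavg N q k = (if in_grid N k then (1 / mesh N ^ 3) * (LBINT x. ind (cell (mesh N) k) x * q x) else 0)"

lemma cavg_bc: "bc N (cavg N q)"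
 by (simp add: bc_def cavg_def)

lemma mesh_eq: "real N * mesh N = 1 - mesh N"
 by (simp add: mesh_def field_simps)

lemma l2_cell: "h > 0 \<Longrightarrow> l2L (ind (cell h k))"
 by (intro l2_indicat) (auto simp: emeasure_cell)

lemma integrable_cell:
 assumes "h > 0" "l2L q" shows "integrable lborel (\<lambda>x. ind (cell h k) x * q x)"
 by (rule l2_mult_int[OF l2_cell[OF assms(1)] assms(2)])

lemma cell_average_sq:
 assumes h: "h > 0" and q: "l2L q"
 shows "(avg h q k)^2 \<le> (1/h^3) * (LBINT x. ind (cell h k) x * (q x)^2)"
proof -
 have n1: "(nrmL (ind (cell h k)))^2 = h^3"
 proof -
  have "(nrmL (ind (cell h k)))^2 = (LBINT x. ind (cell h k) x)"
   unfolding nrm_sq by (intro Bochner_Integration.integral_cong) (auto split: split_indicator)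
  thus ?thesis using h by (simp add: measure_def emeasure_cell)
 qed
 have lq: "l2L (\<lambda>x. ind (cell h k) x * q x)" by (intro l2_indicator q) simp
 have n2: "(nrmL (\<lambda>x. ind (cell h k) x * q x))^2 = (LBINT x. ind (cell h k) x * (q x)^2)"
  unfolding nrm_sq by (intro Bochner_Integration.integral_cong) (auto split: split_indicator)
 have "(LBINT x. ind (cell h k) x * q x) = (LBINT x. ind (cell h k) x * (ind (cell h k) x * q x))"
  by (intro Bochner_Integration.integral_cong) (auto split: split_indicator)
 also have "\<bar>\<dots>\<bar> \<le> nrmL (ind (cell h k)) * nrmL (\<lambda>x. ind (cell h k) x * q x)"
  by (rule l2_cauchy_schwarz[OF l2_cell[OF h] lq])
 finally have "\<bar>\<integral>x. ind (cell h k) x * q x \<partial>lborel\<bar>^2 \<le> (nrmL (ind (cell h k)) * nrmL (\<lambda>x. ind (cell h k) x * q x))^2"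
  by (intro power_mono) auto
 hence "(LBINT x. ind (cell h k) x * q x)^2 \<le> h^3 * (LBINT x. ind (cell h k) x * (q x)^2)"
  by (simp add: power_mult_distrib n1 n2)
 from mult_left_mono[OF this, of "(1/h^3)^2"]
 have "(avg h q k)^2
   \<le> (1/h^3)^2 * (h^3 * (LBINT x. ind (cell h k) x * (q x)^2))"
  by (simp only: avg_def power_mult_distrib zero_le_power2 simp_thms)
 also have "\<dots> = (1/h^3) * (LBINT x. ind (cell h k) x * (q x)^2)"
 proof -
  have "(1/u)^2 * (u * v) = (1/u) * v" if "u \<noteq> 0" for u v :: real using that by (simp add: power2_eq_square)
  thus ?thesis using h by simp
 qed
 finally show ?thesis .
qed

lemma nrm_st_le_cells:
 assumes h: "h > 0" and F: "fs F" and w: "integrable lborel w" "\<And>x. 0 \<le> w x"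
  and le: "\<And>k. (F k)^2 \<le> (1/h^3) * (LBINT x. ind (cell h k) x * w x)"
 shows "(nrmL (st h F))^2 \<le> (LBINT x. w x)"
proof -
 define S where "S = {k. F k \<noteq> 0}"
 have S: "finite S" using F by (simp add: S_def fs_def)
 have iw: "integrable lborel (\<lambda>x. ind (cell h k) x * w x)" for k
  using integrable_real_mult_indicator[OF _ w(1), of "cell h k"] by (simp add: mult.commute)
 have "(nrmL (st h F))^2 = h^3 * (\<Sum>k\<in>S. (F k)^2)"
  unfolding nrm_sq st_power by (rule integral_st_sum[OF h S]) (simp add: S_def)
 also have "\<dots> \<le> h^3 * (\<Sum>k\<in>S. (1/h^3) * (LBINT x. ind (cell h k) x * w x))"
  using h by (intro mult_left_mono sum_mono le) auto
 also have "\<dots> = (LBINT x. (\<Sum>k\<in>S. ind (cell h k) x * w x))"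
  using h iw by (simp add: sum_divide_distrib[symmetric])
 also have "\<dots> \<le> (LBINT x. w x)"
 proof (rule integral_mono)
  fix x
  have "(\<Sum>k\<in>S. ind (cell h k) x * w x) = (\<Sum>k\<in>S. if k = cell_index h x then w x else 0)"
  proof (intro sum.cong refl)
   fix k
   show "ind (cell h k) x * w x = (if k = cell_index h x then w x else 0)"
    using cell_index_eq_iff[OF h, of x k] by (auto split: split_indicator)
  qed
  also have "\<dots> \<le> w x" using S w(2)[of x] by simp
  finally show "(\<Sum>k\<in>S. ind (cell h k) x * w x) \<le> w x" .
 qed (use iw w in auto)
 finally show ?thesis .
qed

lemma cell_integral_shift:
 assumes "h > 0" "q \<in> bm"
 shows "(LBINT x. ind (cell h (k + axis \<alpha> 1)) x * q x) = (LBINT x. ind (cell h k) x * q (x + h *\<^sub>R axis \<alpha> 1))"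
proof -
 have "(LBINT x. ind (cell h (k + axis \<alpha> 1)) (x + h *\<^sub>R axis \<alpha> 1) * q (x + h *\<^sub>R axis \<alpha> 1))
   = (LBINT x. ind (cell h (k + axis \<alpha> 1)) x * q x)"
  by (rule lborel_integral_translate) (use assms in measurable)
 moreover have "x + h *\<^sub>R axis \<alpha> 1 \<in> cell h (k + axis \<alpha> 1) \<longleftrightarrow> x \<in> cell h k" for x
  using cell_index_eq_iff[OF assms(1)] cell_index_plus[OF assms(1), of x \<alpha>] by (metis add_right_cancel)
 ultimately show ?thesis by (simp add: indicator_def)
qed

lemma cell_average_close:
 assumes h: "h > 0" and f: "l2L f" and c: "\<And>y. y \<in> cell h k \<Longrightarrow> \<bar>f y - c\<bar> \<le> \<eta>"
 shows "\<bar>avg h f k - c\<bar> \<le> \<eta>"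
proof -
 have ic: "integrable lborel (ind (cell h k))"
  by (intro integrable_real_indicator) (auto simp: emeasure_cell[OF h])
 have mc: "measure lborel (cell h k) = h^3" using h by (simp add: measure_def emeasure_cell)
 note i = integrable_cell[OF h f, of k] integrable_mult_left[OF ic, of c]
 have i1: "integrable lborel (\<lambda>y. ind (cell h k) y * (f y - c))"
  unfolding right_diff_distrib using i by (rule Bochner_Integration.integrable_diff)
 have "(LBINT y. ind (cell h k) y * f y) - c * h^3 = (LBINT y. ind (cell h k) y * (f y - c))"
  unfolding right_diff_distrib using i by (subst Bochner_Integration.integral_diff) (auto simp: mc)
 also have "\<bar>\<dots>\<bar> \<le> (LBINT y. \<eta> * ind (cell h k) y)"
 proof (rule order_trans[OF integral_abs_bound integral_mono])
  show "integrable lborel (\<lambda>y. \<bar>ind (cell h k) y * (f y - c)\<bar>)" by (rule integrable_abs[OF i1])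
  show "integrable lborel (\<lambda>y. \<eta> * ind (cell h k) y)" by (intro integrable_mult_right ic)
  show "\<bar>ind (cell h k) y * (f y - c)\<bar> \<le> \<eta> * ind (cell h k) y" for y
   using c[of y] by (auto split: split_indicator)
 qed
 also have "\<dots> = \<eta> * h^3" by (simp add: mc)
 finally have "\<bar>(LBINT y. ind (cell h k) y * f y) - c * h^3\<bar> / h^3 \<le> \<eta>"
  using h by (simp add: pos_divide_le_eq)
 moreover have "avg h f k - c
   = ((LBINT y. ind (cell h k) y * f y) - c * h^3) / h^3"
  using h by (simp add: avg_def diff_divide_distrib)
 ultimately show ?thesis using h by (simp add: abs_divide)
qed

lemma cell_dist:
 assumes "h > 0" "x \<in> cell h k" "y \<in> cell h k" shows "norm (y - x) \<le> 3 * h"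
proof -
 have "\<bar>(y - x) $ \<alpha>\<bar> \<le> h" for \<alpha>
 proof -
  have "real_of_int (k$\<alpha>) * h - h/2 \<le> x$\<alpha>" "x$\<alpha> < real_of_int (k$\<alpha>) * h + h/2"
   "real_of_int (k$\<alpha>) * h - h/2 \<le> y$\<alpha>" "y$\<alpha> < real_of_int (k$\<alpha>) * h + h/2" using assms by (auto simp: cell_def)
  thus ?thesis by (simp add: abs_le_iff)
 qed
 hence "(\<Sum>\<alpha>. \<bar>(y - x) $ \<alpha>\<bar>) \<le> (\<Sum>\<alpha>\<in>(UNIV::3 set). h)" by (intro sum_mono)
 thus ?thesis using norm_le_l1_cart[of "y - x"] by simp
qed

lemma in_cell_index: "h > 0 \<Longrightarrow> x \<in> cell h (cell_index h x)"
 using cell_index_eq_iff by blast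

lemma grid_cell_subset: assumes "in_grid N k" shows "cell (mesh N) k \<subseteq> box 0 1"
proof
 define h where "h = mesh N"
 have h: "h > 0" by (simp add: h_def)
 fix x assume x: "x \<in> cell (mesh N) k"
 have "0 < x $ \<alpha> \<and> x $ \<alpha> < 1" for \<alpha>
 proof -
  have k: "1 \<le> real_of_int (k $ \<alpha>)" "real_of_int (k $ \<alpha>) \<le> real N" using assms unfolding in_grid_def by (metis of_int_1_le_iff, metis of_int_le_iff of_int_of_nat_eq)
  have "h \<le> real_of_int (k $ \<alpha>) * h" "real_of_int (k $ \<alpha>) * h \<le> real N * h"
   using mult_right_mono[OF k(1), of h] mult_right_mono[OF k(2), of h] h by simp_all
  moreover have "real_of_int (k$\<alpha>) * h - h/2 \<le> x$\<alpha>" "x$\<alpha> < real_of_int (k$\<alpha>) * h + h/2"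
   using x by (auto simp: cell_def h_def)
  moreover have "real N * h = 1 - h" by (simp add: h_def mesh_eq)
  ultimately show ?thesis using h by linarith
 qed
 thus "x \<in> box 0 1" by (simp add: mem_box_cart)
qed

lemma not_in_grid_cell:
 assumes "\<not> in_grid N (cell_index (mesh N) x)"
 shows "\<exists>\<alpha>. x $ \<alpha> < mesh N \<or> x $ \<alpha> > 1 - mesh N"
proof -
 define h where "h = mesh N"
 have h: "h > 0" by (simp add: h_def)
 define k where "k = cell_index h x"
 obtain \<alpha> where \<alpha>: "\<not> (1 \<le> k $ \<alpha> \<and> k $ \<alpha> \<le> int N)" using assms by (auto simp: in_grid_def k_def h_def)
 have x: "real_of_int (k$\<alpha>) * h - h/2 \<le> x$\<alpha>" "x$\<alpha> < real_of_int (k$\<alpha>) * h + h/2"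
  using in_cell_index[OF h, of x] by (auto simp: cell_def k_def)
 have Nh: "real N * h = 1 - h" by (simp add: h_def mesh_eq)
 show ?thesis
 proof (cases "k $ \<alpha> < 1")
  case True
  hence "real_of_int (k$\<alpha>) * h \<le> 0" using h by (simp add: mult_le_0_iff)
  thus ?thesis using x h by (intro exI[of _ \<alpha>]) (simp add: h_def)
 next
  case False
  hence "real N + 1 \<le> real_of_int (k $ \<alpha>)" using \<alpha> by linarith
  hence "(real N + 1) * h \<le> real_of_int (k $ \<alpha>) * h" using h by (intro mult_right_mono) auto
  thus ?thesis using x h Nh by (intro exI[of _ \<alpha>]) (simp add: h_def algebra_simps)
 qed
qed

lemma avg_diff:
 assumes "h > 0" "l2L q" "l2L p" shows "avg h (\<lambda>x. q x - p x) k = avg h q k - avg h p k"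
 using integrable_cell[OF assms(1,2)] integrable_cell[OF assms(1,3)]
 by (simp add: avg_def right_diff_distrib diff_divide_distrib)

lemma fs_avg:
 assumes h: "h > 0" and q: "\<And>x. norm x \<ge> R \<Longrightarrow> q x = 0" shows "fs (avg h q)"
proof -
 define S where "S = {k :: idx. \<forall>\<alpha>. k $ \<alpha> \<in> {- \<lceil>(R + 3 * h) / h\<rceil>..\<lceil>(R + 3 * h) / h\<rceil>}}"
 have "k \<in> S" if k: "avg h q k \<noteq> 0" for k
 proof -
  have "\<exists>x. x \<in> cell h k \<and> q x \<noteq> 0"
  proof (rule ccontr)
   assume "\<not> ?thesis"
   hence z: "ind (cell h k) x * q x = 0" for x by (auto simp: indicator_def)
   show False using k unfolding avg_def z by simp
  qed
  then obtain x where x: "x \<in> cell h k" "q x \<noteq> 0" by blast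
  have "k $ \<alpha> \<in> {- \<lceil>(R + 3 * h) / h\<rceil>..\<lceil>(R + 3 * h) / h\<rceil>}" for \<alpha>
  proof -
   have "\<bar>x $ \<alpha>\<bar> \<le> R" using component_le_norm_cart[of x \<alpha>] q[of x] x(2) by linarith
   moreover have "real_of_int (k$\<alpha>) * h - h/2 \<le> x$\<alpha>" "x$\<alpha> < real_of_int (k$\<alpha>) * h + h/2" using x(1) by (auto simp: cell_def)
   ultimately have "\<bar>real_of_int (k$\<alpha>) * h\<bar> \<le> R + 3 * h" using h by linarith
   hence "\<bar>real_of_int (k$\<alpha>)\<bar> \<le> (R + 3 * h) / h" using h by (simp add: pos_le_divide_eq abs_mult)
   thus ?thesis unfolding atLeastAtMost_iff by linarith
  qed
  thus ?thesis unfolding S_def by blast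
 qed
 moreover have "finite S" unfolding S_def by (rule finite_idx) simp
 ultimately show ?thesis unfolding fs_def using finite_subset[of "{k. avg h q k \<noteq> 0}" S] by blast
qed

lemma nrm_avg_le:
 assumes h: "h > 0" and q: "l2L q" "\<And>x. norm x \<ge> R \<Longrightarrow> q x = 0"
 shows "nrmL (st h (avg h q)) \<le> nrmL q"
proof (rule power2_le_imp_le)
 show "(nrmL (st h (avg h q)))^2 \<le> (nrmL q)^2"
  unfolding nrm_sq[of lborel q] by (rule nrm_st_le_cells[OF h fs_avg[OF h q(2)] l2_int[OF q(1)] _ cell_average_sq[OF h q(1)]]) simp_all
qed simp

lemma slim_avg:
 assumes q: "l2L q" "\<And>x. norm x \<ge> R \<Longrightarrow> q x = 0" and h: "\<And>m. h m > 0" "h \<longlonglongrightarrow> 0"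
 shows "slimL (\<lambda>m. st (h m) (avg (h m) q)) q"
proof (rule slim_local_contraction[where T = "\<lambda>m u. st (h m) (avg (h m) u)" and \<rho> = "\<lambda>m. 3 * h m", OF q(1)])
 fix m
 have "fs (avg (h m) q)" by (rule fs_avg[OF h(1), of R]) (rule q(2))
 thus "l2L (st (h m) (avg (h m) q))" by (rule st_l2[OF h(1)])
next
 fix u :: "pt \<Rightarrow> real" and S m assume u: "l2L u" "\<And>x. norm x \<ge> S \<Longrightarrow> u x = 0"
 have z: "q x - u x = 0" if "norm x \<ge> max R S" for x using that q(2) u(2) by simp
 have fu: "fs (avg (h m) u)" by (rule fs_avg[OF h(1), of S]) (rule u(2))
 show "l2L (st (h m) (avg (h m) u)) \<and> nrmL (\<lambda>x. st (h m) (avg (h m) q) x - st (h m) (avg (h m) u) x) \<le> nrmL (\<lambda>x. q x - u x)"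
  using nrm_avg_le[where R = "max R S", OF h(1)[of m] l2_diff[OF q(1) u(1)] z] st_l2[OF h(1)[of m] fu]
  by (simp add: st_def[abs_def] avg_diff[OF h(1) q(1) u(1)])
next
 fix u :: "pt \<Rightarrow> real" and m x c \<eta> assume u: "l2L u" and c: "\<And>y. norm (y - x) \<le> 3 * h m \<Longrightarrow> \<bar>u y - c\<bar> \<le> \<eta>"
 show "\<bar>st (h m) (avg (h m) u) x - c\<bar> \<le> \<eta>"
  unfolding st_def by (rule cell_average_close[OF h(1) u]) (use c cell_dist[OF h(1) in_cell_index[OF h(1)]] in blast)
next
 show "(\<lambda>m. 3 * h m) \<longlonglongrightarrow> 0" using tendsto_mult[OF tendsto_const h(2), of 3] by simp
qed

text \<open>What \<open>cavg\<close> loses: inside the cube it is the part of \<open>q\<close> in a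
  layer of width at most \<open>h\<close> along the faces.\<close>

definition outer :: "nat \<Rightarrow> (pt \<Rightarrow> real) \<Rightarrow> pt \<Rightarrow> real" where
 "outer N q x = (if in_grid N (cell_index (mesh N) x) then 0 else q x)"

lemma outer_measurable: "q \<in> bm \<Longrightarrow> outer N q \<in> bm"
proof -
 have "{x. in_grid N (cell_index (mesh N) x)} = (\<Union>k\<in>{k. in_grid N k}. cell (mesh N) k)"
  by (auto simp: cell_index_eq_iff[OF mesh_pos, symmetric])
 hence [measurable]: "{x. in_grid N (cell_index (mesh N) x)} \<in> sets borel" using finite_grid[of N] by auto
 assume [measurable]: "q \<in> bm"
 show ?thesis unfolding outer_def[abs_def] by measurable
qed

lemma outer_l2: "l2L q \<Longrightarrow> l2L (outer N q)"
 by (rule l2_bound[of lborel q]) (use outer_measurable[of q N] l2_meas[of lborel q] in \<open>auto simp: outer_def\<close>)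

lemma cavg_avg:
 assumes q: "l2L q" shows "cavg N q k = avg (mesh N) q k - avg (mesh N) (outer N q) k"
proof -
 have "ind (cell (mesh N) k) x * outer N q x = (if in_grid N k then 0 else ind (cell (mesh N) k) x * q x)" for x
  using cell_index_eq_iff[of "mesh N" x k] by (auto simp: outer_def indicator_def)
 thus ?thesis by (simp add: cavg_def avg_def)
qed

lemma nrm_cavg_le:
 assumes q: "l2L q" "\<And>x. x \<notin> box 0 1 \<Longrightarrow> q x = 0" shows "nrmL (st (mesh N) (cavg N q)) \<le> nrmL q"
proof (rule power2_le_imp_le)
 have "(cavg N q k)^2 \<le> (avg (mesh N) q k)^2" for k by (simp add: cavg_def avg_def)
 thus "(nrmL (st (mesh N) (cavg N q)))^2 \<le> (nrmL q)^2"
  unfolding nrm_sq[of lborel q]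
  by (intro nrm_st_le_cells[OF mesh_pos bc_fs[OF cavg_bc] l2_int[OF q(1)]] order_trans[OF _ cell_average_sq[OF mesh_pos q(1)]]) simp_all
qed simp

lemma box_norm: "norm x \<ge> 4 \<Longrightarrow> x \<notin> box 0 (1 :: pt)"
proof
 assume "norm x \<ge> 4" "x \<in> box 0 1"
 hence "(\<Sum>\<alpha>. \<bar>x $ \<alpha>\<bar>) \<le> (\<Sum>\<alpha>\<in>(UNIV::3 set). 1)" by (intro sum_mono) (auto simp: mem_box_cart abs_le_iff less_imp_le intro: order_trans[of _ 0])
 thus False using norm_le_l1_cart[of x] \<open>norm x \<ge> 4\<close> by simp
qed

lemma slim_outer:
 assumes q: "l2L q" "\<And>x. x \<notin> box 0 1 \<Longrightarrow> q x = 0" and h: "(\<lambda>m. mesh (N m)) \<longlonglongrightarrow> 0"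
 shows "slimL (\<lambda>m. outer (N m) q) (\<lambda>x. 0)"
proof (rule slim_dominated[of _ _ _ "\<lambda>x. \<bar>q x\<bar>"])
 show "AE x in lborel. (\<lambda>m. outer (N m) q x) \<longlonglongrightarrow> 0"
 proof (rule AE_I2)
  fix x
  show "(\<lambda>m. outer (N m) q x) \<longlonglongrightarrow> 0"
  proof (cases "x \<in> box 0 1")
   case True
   have "\<forall>\<^sub>F m in sequentially. \<forall>\<alpha>. mesh (N m) < x $ \<alpha> \<and> mesh (N m) < 1 - x $ \<alpha>"
    by (intro eventually_all_finite eventually_conj order_tendstoD(2)[OF h]) (use True in \<open>auto simp: mem_box_cart\<close>)
   hence "\<forall>\<^sub>F m in sequentially. outer (N m) q x = 0"
   proof eventually_elim
    fix m assume "\<forall>\<alpha>. mesh (N m) < x $ \<alpha> \<and> mesh (N m) < 1 - x $ \<alpha>"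
    hence "in_grid (N m) (cell_index (mesh (N m)) x)" using not_in_grid_cell[of "N m" x] by (smt (verit))
    thus "outer (N m) q x = 0" by (simp add: outer_def)
   qed
   thus ?thesis by (rule tendsto_eventually)
  next
   case False
   hence "outer (N m) q x = 0" for m by (simp add: outer_def q(2))
   thus ?thesis by simp
  qed
 qed
 show "l2L (\<lambda>x. \<bar>q x\<bar>)" by (rule l2_bound[OF q(1)]) (use l2_meas[OF q(1)] in auto)
qed (use l2_meas[OF outer_l2[OF q(1)]] in \<open>auto simp: outer_def\<close>)

lemma slim_cavg:
 assumes q: "l2L q" "\<And>x. x \<notin> box 0 1 \<Longrightarrow> q x = 0" and h: "(\<lambda>m. mesh (N m)) \<longlonglongrightarrow> 0"
 shows "slimL (\<lambda>m. st (mesh (N m)) (cavg (N m) q)) q"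
proof -
 have z: "q x = 0" "outer N q x = 0" if "norm x \<ge> 4" for x N using q(2)[OF box_norm[OF that]] by (simp_all add: outer_def)
 have "slimL (\<lambda>m. st (mesh (N m)) (avg (mesh (N m)) (outer (N m) q))) (\<lambda>x. 0)"
 proof (rule slimI)
  show "(\<lambda>m. nrmL (\<lambda>x. st (mesh (N m)) (avg (mesh (N m)) (outer (N m) q)) x - 0)) \<longlonglongrightarrow> 0"
   using slimD(3)[OF slim_outer[OF q h]] nrm_avg_le[OF mesh_pos outer_l2[OF q(1)] z(2)] by (intro nrm_null_comparison) simp_all
 qed (simp_all add: st_l2 fs_avg[OF mesh_pos z(2)])
 from slim_add[OF slim_avg[OF q(1) z(1) mesh_pos h] slim_cmult[OF this, of "-1"]]
 show ?thesis by (simp add: st_def[abs_def] cavg_avg[OF q(1)])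
qed

text \<open>Where \<open>outer N q\<close> does not vanish, \<open>q x\<close> is, up to sign, the difference of \<open>q\<close> across the boundary face at distance \<open>h\<close>,
 so that \<open>outer N q\<close> is even of order \<open>o(h)\<close>.\<close>

lemma slim_outer_H10s:
 assumes q: "H10s q d" and h: "(\<lambda>m. mesh (N m)) \<longlonglongrightarrow> 0"
 shows "slimL (\<lambda>m x. (1 / mesh (N m)) * outer (N m) q x) (\<lambda>x. 0)"
proof -
 have q0: "\<And>x. x \<notin> box 0 1 \<Longrightarrow> q x = 0" "\<And>x \<alpha>. x \<notin> box 0 1 \<Longrightarrow> d \<alpha> x = 0" and ql: "l2L q" and dl: "\<And>\<alpha>. l2L (d \<alpha>)"
  using q slimD(2) unfolding H10s_def by blast+
 \<comment> \<open>The flag \<open>b\<close> distinguishes the face at 1 from the face at 0, and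
   \<open>s b\<close> is the direction in which a step of length \<open>h\<close> from the layer
   leaves the cube.\<close>
 define s where "s b = (if b then 1 else - 1 :: real)" for b
 define near where "near b m \<alpha> x = (if b then x $ \<alpha> > 1 - mesh (N m) else x $ \<alpha> < mesh (N m))" for b m \<alpha> and x :: pt
 define D where "D p m x = (q (x + (s (snd p) * mesh (N m)) *\<^sub>R axis (fst p) 1) - q x) / (s (snd p) * mesh (N m))" for p :: "3 \<times> bool" and m x
 define w where "w p m x = (if near (snd p) m (fst p) x then 1 else 0 :: real)" for p :: "3 \<times> bool" and m x
 have "(\<lambda>m. s b * mesh (N m)) \<longlonglongrightarrow> 0" for b using tendsto_mult[OF tendsto_const h, of "s b"] by simp
 hence sD: "slimL (D p) (d (fst p))" for p
  unfolding D_def[abs_def] by (rule H10s_difference_quotient[OF q]) (use mesh_pos in \<open>auto simp: s_def less_le\<close>)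
 \<comment> \<open>The pointwise limit of the layer indicators: the closed half space behind the
   face, on which the extended gradient \<open>d\<close> vanishes. Hence the products tend to
   zero.\<close>
 define w' where "w' p x = (if if snd p then x $ fst p \<ge> 1 else x $ fst p \<le> 0 then 1 else 0 :: real)" for p :: "3 \<times> bool" and x :: pt
 have [measurable]: "(\<lambda>x::pt. x $ \<alpha>) \<in> bm" for \<alpha> by (intro borel_measurable_continuous_onI continuous_intros)
 have sE: "slimL (\<lambda>m x. w p m x * D p m x) (\<lambda>x. w' p x * d (fst p) x)" for p
 proof (rule slim_mult_conv[OF sD, where K = 1])
  show "w p m \<in> bmL" "w' p \<in> bmL" for m
   unfolding w_def[abs_def] w'_def[abs_def] near_def by (cases "snd p"; simp)+
  show "AE x in lborel. (\<lambda>m. w p m x) \<longlonglongrightarrow> w' p x"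
  proof (rule AE_I2, rule tendsto_eventually)
   fix x :: pt
   show "\<forall>\<^sub>F m in sequentially. w p m x = w' p x"
   proof (cases "if snd p then x $ fst p \<ge> 1 else x $ fst p \<le> 0")
    case True
    hence "w p m x = w' p x" for m unfolding w_def w'_def near_def by (smt (verit) mesh_pos)
    thus ?thesis by simp
   next
    case False
    have "\<forall>\<^sub>F m in sequentially. mesh (N m) < (if snd p then 1 - x $ fst p else x $ fst p)"
     by (rule order_tendstoD(2)[OF h]) (use False in \<open>auto split: if_splits\<close>)
    thus ?thesis by eventually_elim (use False in \<open>auto simp: w_def w'_def near_def\<close>)
   qed
  qed
 qed (simp add: w_def)
 have w'0: "w' p x * d (fst p) x = 0" for p x
 proof (cases "x \<in> box 0 1")
  case True
  hence "0 < x $ fst p" "x $ fst p < 1" by (simp_all add: mem_box_cart)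
  thus ?thesis by (simp add: w'_def)
 qed (simp add: q0(2))
 have E0: "(\<lambda>m. nrmL (\<lambda>x. w p m x * D p m x)) \<longlonglongrightarrow> 0" for p using slimD(3)[OF sE[of p]] by (simp add: w'0)
 show ?thesis
 proof (rule slim_dominated_by_sum[where I = UNIV and E = "\<lambda>p m x. w p m x * D p m x"])
  show "l2L (\<lambda>x. (1 / mesh (N m)) * outer (N m) q x)" for m by (intro l2_cmult outer_l2 ql)
  show "l2L (\<lambda>x. w p m x * D p m x)" for p m by (rule slimD(1)[OF sE])
  show "AE x in lborel. \<bar>(1 / mesh (N m)) * outer (N m) q x - 0\<bar> \<le> (\<Sum>p. \<bar>w p m x * D p m x\<bar>)" for m
  proof (rule AE_I2)
   fix x
   show "\<bar>(1 / mesh (N m)) * outer (N m) q x - 0\<bar> \<le> (\<Sum>p. \<bar>w p m x * D p m x\<bar>)"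
   proof (cases "in_grid (N m) (cell_index (mesh (N m)) x)")
    case False
    then obtain \<alpha> b where nb: "near b m \<alpha> x" using not_in_grid_cell[of "N m" x] by (force simp: near_def)
    hence "x + (s b * mesh (N m)) *\<^sub>R axis \<alpha> 1 \<notin> box 0 1"
     by (auto simp: near_def s_def mem_box_cart split: if_splits intro!: exI[of _ \<alpha>])
    hence "\<bar>(1 / mesh (N m)) * outer (N m) q x - 0\<bar> = \<bar>w (\<alpha>, b) m x * D (\<alpha>, b) m x\<bar>"
     using nb by (simp add: outer_def False w_def D_def q0(1) s_def abs_mult)
    also have "\<dots> \<le> (\<Sum>p. \<bar>w p m x * D p m x\<bar>)"
     by (rule member_le_sum[of "(\<alpha>, b)" UNIV "\<lambda>p. \<bar>w p m x * D p m x\<bar>"]) auto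
    finally show ?thesis .
   qed (simp add: outer_def sum_nonneg)
  qed
 qed (use E0 in simp_all)
qed

lemma Dplus_avg:
 assumes h: "h > 0" and q: "l2L q"
 shows "Dplus h \<alpha> (avg h q) k = avg h (\<lambda>x. (q (x + h *\<^sub>R axis \<alpha> 1) - q x) / h) k"
proof -
 have "avg h (\<lambda>x. (q (x + h *\<^sub>R axis \<alpha> 1) - q x) / h) k = (avg h (\<lambda>x. q (x + h *\<^sub>R axis \<alpha> 1)) k - avg h q k) / h"
  using integrable_cell[OF h q, of k] integrable_cell[OF h l2_translate[OF q], of k]
  by (simp add: avg_def right_diff_distrib diff_divide_distrib)
 thus ?thesis
  using cell_integral_shift[OF h, of q k \<alpha>] l2_meas[OF q] by (simp add: Dplus_def avg_def)
qed

text \<open>\<open>cavg\<close> is the average of \<open>q\<close> minus that of its outer part. For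
  the first, the discrete derivative commutes with averaging and becomes the average of a difference
  quotient converging to \<open>d\<close>; for the second, the crude factor \<open>2/h\<close> is
  affordable because the norm of \<open>outer\<close> is of order \<open>o(h)\<close>.\<close>

lemma slim_Dplus_cavg:
 assumes q: "H10s q d" and h: "(\<lambda>m. mesh (N m)) \<longlonglongrightarrow> 0"
 shows "slimL (\<lambda>m. st (mesh (N m)) (Dplus (mesh (N m)) \<alpha> (cavg (N m) q))) (d \<alpha>)"
proof -
 define H where "H m = mesh (N m)" for m
 have H: "H m > 0" "H \<longlonglongrightarrow> 0" for m using h by (simp_all add: H_def[abs_def])
 have q0: "\<And>x. x \<notin> box 0 1 \<Longrightarrow> q x = 0" "\<And>x \<alpha>. x \<notin> box 0 1 \<Longrightarrow> d \<alpha> x = 0" and ql: "l2L q" and dl: "\<And>\<alpha>. l2L (d \<alpha>)"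
  using q slimD(2) unfolding H10s_def by blast+
 define D where "D m x = (q (x + H m *\<^sub>R axis \<alpha> 1) - q x) / H m" for m x
 have sD: "slimL D (d \<alpha>)"
  unfolding D_def[abs_def] by (rule H10s_difference_quotient[OF q H(2)]) (use H(1) in \<open>simp add: less_le\<close>)
 have H1: "H m \<le> 1" for m by (simp add: H_def mesh_def)
 have z: "outer n q x = 0" "d \<alpha> x = 0" "D m x = 0" if x: "norm x \<ge> 5" for x n m
 proof -
  have "norm (x + H m *\<^sub>R axis \<alpha> 1) \<ge> 4"
   using norm_triangle_ineq2[of x "- (H m *\<^sub>R axis \<alpha> 1)"] x H(1)[of m] H1[of m] by simp
  thus "outer n q x = 0" "d \<alpha> x = 0" "D m x = 0" using x q0 box_norm[of x] box_norm by (simp_all add: outer_def D_def)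
 qed
 have "slimL (\<lambda>m. st (H m) (avg (H m) (\<lambda>x. D m x - d \<alpha> x))) (\<lambda>x. 0)"
 proof (rule slimI)
  show "(\<lambda>m. nrmL (\<lambda>x. st (H m) (avg (H m) (\<lambda>x. D m x - d \<alpha> x)) x - 0)) \<longlonglongrightarrow> 0"
   using slimD(3)[OF sD] nrm_avg_le[OF H(1) slim_diff_l2[OF sD], of 5] z by (intro nrm_null_comparison) simp_all
 qed (use z in \<open>auto intro!: st_l2 fs_avg[where R = 5] H(1)\<close>)
 moreover have "slimL (\<lambda>m. st (H m) (Dplus (H m) \<alpha> (avg (H m) (outer (N m) q)))) (\<lambda>x. 0)"
 proof (rule slimI)
  let ?B = "\<lambda>m. avg (H m) (outer (N m) q)"
  have f: "fs (?B m)" for m by (rule fs_avg[OF H(1), of 5]) (rule z)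
  show "l2L (st (H m) (Dplus (H m) \<alpha> (?B m)))" for m by (rule st_l2[OF H(1) fs_Dplus[OF f]])
  have "nrmL (st (H m) (Dplus (H m) \<alpha> (?B m))) \<le> 2 * nrmL (\<lambda>x. (1 / H m) * outer (N m) q x)" for m
  proof -
   note l = st_l2[OF H(1)[of m] f[of m]]
   have "nrmL (st (H m) (Dplus (H m) \<alpha> (?B m))) = (1 / H m) * nrmL (\<lambda>x. st (H m) (?B m) (x + H m *\<^sub>R axis \<alpha> 1) - st (H m) (?B m) x)"
    using H(1)[of m] nrm_cmult[of lborel "1 / H m"] by (simp add: st_Dplus abs_of_pos cong: nrm_cong)
   also have "\<dots> \<le> (1 / H m) * (nrmL (outer (N m) q) + nrmL (outer (N m) q))"
   proof (rule mult_left_mono)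
    have "nrmL (st (H m) (?B m)) \<le> nrmL (outer (N m) q)" by (rule nrm_avg_le[OF H(1) outer_l2[OF ql], of 5]) (rule z)
    thus "nrmL (\<lambda>x. st (H m) (?B m) (x + H m *\<^sub>R axis \<alpha> 1) - st (H m) (?B m) x) \<le> nrmL (outer (N m) q) + nrmL (outer (N m) q)"
     using nrm_diff_le[OF l2_translate[OF l] l, of "H m *\<^sub>R axis \<alpha> 1"] nrm_translate[of "st (H m) (?B m)" "H m *\<^sub>R axis \<alpha> 1"] by simp
   qed (use H(1)[of m] in simp)
   also have "\<dots> = 2 * nrmL (\<lambda>x. (1 / H m) * outer (N m) q x)" unfolding nrm_cmult using H(1)[of m] by simp
   finally show ?thesis .
  qed
  moreover have "(\<lambda>m. 2 * nrmL (\<lambda>x. (1 / H m) * outer (N m) q x)) \<longlonglongrightarrow> 2 * 0"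
   using slimD(3)[OF slim_outer_H10s[OF q h]] by (intro tendsto_intros) (simp add: H_def)
  ultimately show "(\<lambda>m. nrmL (\<lambda>x. st (H m) (Dplus (H m) \<alpha> (?B m)) x - 0)) \<longlonglongrightarrow> 0"
   unfolding diff_0_right mult_zero_right by (rule nrm_null_comparison)
 qed simp
 ultimately have "slimL (\<lambda>m x. st (H m) (avg (H m) (\<lambda>x. D m x - d \<alpha> x)) x + st (H m) (avg (H m) (d \<alpha>)) x
   + (- 1) * st (H m) (Dplus (H m) \<alpha> (avg (H m) (outer (N m) q))) x) (\<lambda>x. 0 + d \<alpha> x + (- 1) * 0)"
  using slim_avg[OF dl z(2) H] by (intro slim_add slim_cmult)
 moreover have "Dplus (H m) \<alpha> (cavg (N m) q) k = avg (H m) (\<lambda>x. D m x - d \<alpha> x) k + avg (H m) (d \<alpha>) k + (- 1) * Dplus (H m) \<alpha> (avg (H m) (outer (N m) q)) k" for m k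
 proof -
  have "Dplus (H m) \<alpha> (cavg (N m) q) k = Dplus (H m) \<alpha> (avg (H m) q) k - Dplus (H m) \<alpha> (avg (H m) (outer (N m) q)) k"
   by (simp add: Dplus_def cavg_avg[OF ql] H_def diff_divide_distrib)
  thus ?thesis using Dplus_avg[OF H(1) ql, of m \<alpha> k] avg_diff[OF H(1) slimD(1)[OF sD] dl, of m m \<alpha> k] by (simp add: D_def[abs_def])
 qed
 ultimately show ?thesis by (simp add: st_def[abs_def] H_def)
qed

section \<open>Convergence of the discrete initial data\<close>

lemma slim_translate:
 fixes f :: "'a::euclidean_space \<Rightarrow> real"
 assumes F: "slimL F f" and a: "a \<longlonglongrightarrow> 0"
 shows "slimL (\<lambda>m x. F m (x + a m)) f"
proof -
 have mF: "F m \<in> bm" for m using l2_meas[OF slimD(1)[OF F]] by simp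
 have mf: "f \<in> bm" using l2_meas[OF slimD(2)[OF F]] by simp
 have "slimL (\<lambda>m x. F m (x + a m) - f (x + a m)) (\<lambda>x. 0)"
 proof (rule slimI)
  show "l2L (\<lambda>x. F m (x + a m) - f (x + a m))" for m
   by (rule l2_diff[OF l2_translate[OF slimD(1)[OF F]] l2_translate[OF slimD(2)[OF F]]])
  have "nrmL (\<lambda>x. (\<lambda>y. F m y - f y) (x + a m)) = nrmL (\<lambda>y. F m y - f y)" for m
   by (rule nrm_translate) (use mF mf in simp)
  thus "(\<lambda>m. nrmL (\<lambda>x. F m (x + a m) - f (x + a m) - 0)) \<longlonglongrightarrow> 0" using slimD(3)[OF F] by simp
 qed simp
 from slim_add[OF this slim_translate_const[OF slimD(2)[OF F] a]] show ?thesis by simp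
qed

lemma slim_Dcent_of_Dplus:
 assumes h: "\<And>m. h m > 0" "h \<longlonglongrightarrow> 0" and s: "slimL (\<lambda>m. st (h m) (Dplus (h m) \<alpha> (F m))) d"
 shows "slimL (\<lambda>m. st (h m) (Dcent (h m) \<alpha> (F m))) d"
proof -
 have a: "(\<lambda>m. - (h m *\<^sub>R axis \<alpha> 1 :: pt)) \<longlonglongrightarrow> 0"
  using tendsto_minus[OF tendsto_scaleR[OF h(2) tendsto_const[of "axis \<alpha> 1 :: pt"]]] by simp
 have "slimL (\<lambda>m x. 1/2 * (st (h m) (Dplus (h m) \<alpha> (F m)) x + st (h m) (Dplus (h m) \<alpha> (F m)) (x + - (h m *\<^sub>R axis \<alpha> 1)))) (\<lambda>x. 1/2 * (d x + d x))"
  by (intro slim_cmult slim_add s slim_translate[OF s a])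
 moreover have "st (h m) (Dcent (h m) \<alpha> (F m)) = (\<lambda>x. 1/2 * (st (h m) (Dplus (h m) \<alpha> (F m)) x
   + st (h m) (Dplus (h m) \<alpha> (F m)) (x + - (h m *\<^sub>R axis \<alpha> 1))))" for m
  by (rule ext) (simp add: st_Dcent[OF h(1)])
 ultimately show ?thesis by simp
qed

text \<open>\<open>ladyzhenskaya\<close> bounds the approximations uniformly; Fatou's lemma along a
  subsequence converging almost everywhere transfers the bound.\<close>

lemma H10s_L4:
 assumes "H10s q d" shows "(NN x. ennreal ((q x)^4)) < \<infinity>"
proof -
 obtain p where p: "\<And>n. ccs (p n)" "slimL p q" "\<And>\<alpha>. slimL (\<lambda>n. pd \<alpha> (p n)) (d \<alpha>)"
  using assms by (auto simp: H10s_def)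
 note mq = l2_meas[OF slimD(2)[OF p(2)]] and mp = ccs_measurable(1)[OF p(1)]
 have bdd: "\<exists>B. \<forall>n. nrmL (F n) \<le> B" if "slimL F f" for F f
  using wlim_bound[OF slim_imp_wlim[OF that]] by blast
 obtain B0 where B0: "\<And>n. nrmL (p n) \<le> B0" using bdd[OF p(2)] by blast
 obtain B where B: "\<And>\<alpha> n. nrmL (pd \<alpha> (p n)) \<le> B \<alpha>" using bdd[OF p(3)] by metis
 define C where "C = 4 * (ennreal (B0^2) + ennreal ((B 3)^2)) * (ennreal ((B 1)^2) + ennreal ((B 2)^2))"
 have C: "C < \<infinity>" by (simp add: C_def ennreal_mult_less_top)
 have le: "(NN x. ennreal ((p n x)^4)) \<le> C" for n
 proof -
  have 1: "(NN x. ennreal ((p n x)^2)) \<le> ennreal (B0^2)"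
   unfolding nn_integral_sq_eq[OF slimD(1)[OF p(2)]] by (intro ennreal_leI power_mono B0) simp
  have 2: "(NN x. ennreal ((pd \<alpha> (p n) x)^2)) \<le> ennreal ((B \<alpha>)^2)" for \<alpha>
   unfolding nn_integral_sq_eq[OF slimD(1)[OF p(3)]] by (intro ennreal_leI power_mono B) simp
  show ?thesis
   unfolding C_def by (rule order_trans[OF ladyzhenskaya[OF p(1)]]) (intro mult_mono add_mono 1 2 order_refl; simp)
 qed
 have "\<exists>r. strict_mono r \<and> (AE x in lborel. (\<lambda>n. (p (r n) x - q x)^2) \<longlonglongrightarrow> 0)"
 proof (rule tendsto_L1_AE_subseq)
  show "integrable lborel (\<lambda>x. (p n x - q x)^2)" for n by (rule l2_int[OF slim_diff_l2[OF p(2)]])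
  show "(\<lambda>n. \<integral>x. norm ((p n x - q x)^2) \<partial>lborel) \<longlonglongrightarrow> 0"
   using tendsto_power[OF slimD(3)[OF p(2)], of 2] by (simp add: nrm_sq)
 qed
 then obtain r where r: "AE x in lborel. (\<lambda>n. (p (r n) x - q x)^2) \<longlonglongrightarrow> 0" by blast
 have "(NN x. ennreal ((q x)^4)) = (NN x. liminf (\<lambda>n. ennreal ((p (r n) x)^4)))"
 proof (rule nn_integral_cong_AE)
  show "AE x in lborel. ennreal ((q x)^4) = liminf (\<lambda>n. ennreal ((p (r n) x)^4))"
   using r
  proof eventually_elim
   fix x assume "(\<lambda>n. (p (r n) x - q x)^2) \<longlonglongrightarrow> 0"
   hence "(\<lambda>n. sqrt ((p (r n) x - q x)^2)) \<longlonglongrightarrow> sqrt 0" by (rule tendsto_real_sqrt)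
   hence "(\<lambda>n. p (r n) x - q x) \<longlonglongrightarrow> 0" by (simp add: tendsto_rabs_zero_iff)
   hence "(\<lambda>n. p (r n) x) \<longlonglongrightarrow> q x" by (simp add: LIM_zero_iff)
   hence "(\<lambda>n. ennreal ((p (r n) x)^4)) \<longlonglongrightarrow> ennreal ((q x)^4)" by (intro tendsto_ennrealI tendsto_power)
   thus "ennreal ((q x)^4) = liminf (\<lambda>n. ennreal ((p (r n) x)^4))"
    by (rule lim_imp_Liminf[OF trivial_limit_sequentially, symmetric])
  qed
 qed
 also have "\<dots> \<le> liminf (\<lambda>n. \<integral>\<^sup>+x. ennreal ((p (r n) x)^4) \<partial>lborel)"
  by (rule nn_integral_liminf) (use mp in simp)
 also have "\<dots> \<le> liminf (\<lambda>n. C)" by (intro Liminf_mono always_eventually allI le)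
 also have "\<dots> = C" by (simp add: Liminf_const)
 finally show ?thesis using C by (rule le_less_trans)
qed

lemma mat3_expand: "(A::mat3) = (\<Sum>i j. A$i$j *\<^sub>R axis i (axis j 1))"
 by (simp add: vec_eq_iff sum_3 forall_3 axis_def)

lemma bounded_linear_cp: "bounded_linear (\<lambda>A::mat3. A $ i $ j)"
 using bounded_linear_compose[OF bounded_linear_vec_nth[of j] bounded_linear_vec_nth[of i]] by simp

lemma integrable_mat3:
 fixes f :: "'z \<Rightarrow> mat3"
 assumes "\<And>i j. integrable M (\<lambda>x. f x $ i $ j)" shows "integrable M f"
proof -
 have "integrable M (\<lambda>x. \<Sum>i j. f x$i$j *\<^sub>R (axis i (axis j 1) :: mat3))"
  by (intro Bochner_Integration.integrable_sum integrable_scaleR_left assms)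
 thus ?thesis by (simp flip: mat3_expand)
qed

lemma integral_mat3:
 fixes f :: "'z \<Rightarrow> mat3"
 assumes "integrable M f" shows "(\<integral>x. f x \<partial>M) $ i $ j = (\<integral>x. f x $ i $ j \<partial>M)"
 by (rule integral_bounded_linear[OF bounded_linear_cp assms, symmetric])

lemma borel_measurable_mat3:
 fixes f :: "'z \<Rightarrow> mat3"
 assumes "\<And>i j. (\<lambda>x. f x $ i $ j) \<in> borel_measurable M" shows "f \<in> borel_measurable M"
proof -
 have "(\<lambda>x. \<Sum>i j. f x$i$j *\<^sub>R (axis i (axis j 1) :: mat3)) \<in> borel_measurable M"
  by (intro borel_measurable_sum borel_measurable_scaleR assms) simp
 thus ?thesis by (simp flip: mat3_expand)
qed

lemma smooth_C1:
 assumes "smooth f"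
 shows "f differentiable (at x)" "v \<in> Basis \<Longrightarrow> continuous_on UNIV (\<lambda>x. frechet_derivative f (at x) v)"
proof -
 have "Ck (Suc 0) f" using assms by (simp add: smooth_def del: Ck.simps)
 thus "f differentiable (at x)" "v \<in> Basis \<Longrightarrow> continuous_on UNIV (\<lambda>x. frechet_derivative f (at x) v)" by simp_all
qed

lemma frechet_derivative_cp:
 fixes f :: "'z::euclidean_space \<Rightarrow> mat3"
 assumes "f differentiable (at x)"
 shows "(\<lambda>x. f x $ i $ j) differentiable (at x)" (is ?g1)
  "frechet_derivative (\<lambda>x. f x $ i $ j) (at x) v = frechet_derivative f (at x) v $ i $ j" (is ?g2)
proof -
 have "((\<lambda>x. f x $ i $ j) has_derivative (\<lambda>v. frechet_derivative f (at x) v $ i $ j)) (at x)"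
  using bounded_linear.has_derivative[OF bounded_linear_cp] assms frechet_derivative_works by blast
 from this frechet_derivative_at[OF this] show ?g1
  ?g2
  by (auto simp: differentiable_def fun_eq_iff)
qed

lemma cc_test_ccs:
 fixes \<psi> :: "pt \<Rightarrow> mat3"
 assumes "cc_test \<psi>" shows "ccs (\<lambda>x. \<psi> x $ i $ j)" (is ?g1) "pd \<alpha> (\<lambda>x. \<psi> x $ i $ j) x = pd \<alpha> \<psi> x $ i $ j"
proof -
 have s: "smooth \<psi>" using assms by (simp add: cc_test_def)
 show e: "pd \<alpha> (\<lambda>x. \<psi> x $ i $ j) x = pd \<alpha> \<psi> x $ i $ j" for x \<alpha>
  unfolding pd_def by (rule frechet_derivative_cp(2)[OF smooth_C1(1)[OF s]])
 have "continuous_on UNIV (\<lambda>x. pd \<alpha> \<psi> x $ i $ j)" for \<alpha>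
  unfolding pd_def by (intro continuous_intros smooth_C1(2)[OF s]) (auto simp: Basis_vec_def)
 moreover obtain K where "compact K" "K \<subseteq> box 0 1" "\<forall>x. x \<notin> K \<longrightarrow> \<psi> x = 0" using assms by (auto simp: cc_test_def)
 ultimately show ?g1
  unfolding ccs_def using frechet_derivative_cp(1)[OF smooth_C1(1)[OF s]] by (auto simp: e[abs_def])
qed

lemma Omega_box: "emeasure lborel (Omega - box 0 1) = 0"
proof -
 have "emeasure lborel (Omega - box 0 1) = emeasure lborel Omega - emeasure lborel (box 0 (1::pt))"
  by (rule emeasure_Diff) (simp_all add: Omega_def box_subset_cbox emeasure_lborel_box_eq)
 thus ?thesis by (simp add: Omega_def emeasure_lborel_box_eq emeasure_lborel_cbox_eq)
qed

lemma AE_Omega_box: "AE x in lborel. x \<in> Omega \<longleftrightarrow> x \<in> box 0 1"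
proof (rule AE_I')
 show "Omega - box 0 1 \<in> null_sets lborel" using Omega_box by (auto simp: null_sets_def Omega_def)
 show "{x \<in> space lborel. \<not> ((x \<in> Omega) = (x \<in> box 0 1))} \<subseteq> Omega - box 0 1"
  using box_subset_cbox[of 0 "1::pt"] by (auto simp: Omega_def)
qed

section \<open>The scheme\<close>

lemma l2_of_fnorm:
 fixes F :: "pt \<Rightarrow> mat3"
 assumes m: "set_borel_measurable lborel Omega F" and fin: "(\<integral>\<^sup>+x\<in>Omega. ennreal ((fnorm (F x))^2) \<partial>lborel) < \<infinity>"
 shows "l2L (\<lambda>x. ind (box 0 1) x * F x $ i $ j)"
proof -
 have 1: "(\<lambda>x. (ind Omega x *\<^sub>R F x) $ i $ j) \<in> bm"
  by (rule measurable_compose[OF _ mat3_entry_measurable]) (use m in \<open>simp add: set_borel_measurable_def\<close>)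
 have e: "ind (box 0 1) x * F x $ i $ j = ind (box 0 1) x * (ind Omega x *\<^sub>R F x) $ i $ j" for x
  using box_subset_cbox[of 0 "1::pt"] by (auto simp: Omega_def split: split_indicator)
 have me: "(\<lambda>x. ind (box 0 1) x * F x $ i $ j) \<in> bmL"
  unfolding e using 1 by simp
 have sq: "(A $ i $ j)^2 \<le> (fnorm A)^2" for A :: mat3
 proof -
  have "(A $ i $ j)^2 \<le> (\<Sum>j. (A $ i $ j)^2)" by (rule member_le_sum) auto
  also have "\<dots> \<le> (\<Sum>i j. (A $ i $ j)^2)" by (rule member_le_sum) (auto intro: sum_nonneg)
  finally show ?thesis by (simp add: fnorm_norm norm_sq_components)
 qed
 have le: "(NN x. ennreal ((ind (box 0 1) x * F x $ i $ j)^2)) \<le> (\<integral>\<^sup>+x\<in>Omega. ennreal ((fnorm (F x))^2) \<partial>lborel)"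
  using box_subset_cbox[of 0 "1::pt"] sq
  by (intro nn_integral_mono) (auto simp: Omega_def power_mult_distrib intro!: ennreal_leI split: split_indicator)
 show ?thesis
  unfolding l2_def
 proof
  show "integrable lborel (\<lambda>x. (ind (box 0 1) x * F x $ i $ j)^2)"
   by (rule integrableI_nonneg) (use me le_less_trans[OF le fin] in auto)
 qed (rule me)
qed

locale scheme = bulk_potential +
 fixes L1 L2 L3 M T :: real and Q0 :: "pt \<Rightarrow> mat3"
 assumes L1_pos: "L1 > 0" and L2_pos: "L2 > 0" and L3_pos: "L3 > 0" and M_pos: "M > 0" and T_pos: "T > 0"
  and Q0_H1: "H1_0 Q0" and Q0_sym: "AE x in lborel. x \<in> Omega \<longrightarrow> sym_tf (Q0 x)"
begin

text \<open>The gradient is chosen together with its approximation by test functions, which is what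
  later ties it to difference quotients.\<close>

definition "DQ0 = (SOME Df. H1 Q0 Df \<and> (\<exists>\<psi>s::nat \<Rightarrow> pt \<Rightarrow> mat3. (\<forall>n. cc_test (\<psi>s n)) \<and>
    (\<lambda>n. \<integral>\<^sup>+x\<in>Omega. ennreal ((fnorm (Q0 x - \<psi>s n x))^2
       + (\<Sum>\<alpha>. (fnorm (Df \<alpha> x - pd \<alpha> (\<psi>s n) x))^2)) \<partial>lborel) \<longlonglongrightarrow> 0))"

lemma DQ0: "H1 Q0 DQ0 \<and> (\<exists>\<psi>s::nat \<Rightarrow> pt \<Rightarrow> mat3. (\<forall>n. cc_test (\<psi>s n)) \<and>
    (\<lambda>n. \<integral>\<^sup>+x\<in>Omega. ennreal ((fnorm (Q0 x - \<psi>s n x))^2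
       + (\<Sum>\<alpha>. (fnorm (DQ0 \<alpha> x - pd \<alpha> (\<psi>s n) x))^2)) \<partial>lborel) \<longlonglongrightarrow> 0)"
 unfolding DQ0_def by (fact someI_ex[OF Q0_H1[unfolded H1_0_def]])

definition "q0 i j x = ind (box 0 1) x * Q0 x $ i $ j"
definition "d0 i j \<alpha> x = ind (box 0 1) x * DQ0 \<alpha> x $ i $ j"
definition "r0 x = ind (box 0 1) x * rF (Q0 x)"

lemma q0_l2: "l2L (q0 i j)" and d0_l2: "l2L (d0 i j \<alpha>)"
 unfolding q0_def[abs_def] d0_def[abs_def] using DQ0 by (auto simp: H1_def intro!: l2_of_fnorm)

lemma H10s_q0: "H10s (q0 i j) (d0 i j)"
proof -
 obtain \<psi>s where \<psi>: "\<And>n::nat. cc_test (\<psi>s n :: pt \<Rightarrow> mat3)"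
  and lim: "(\<lambda>n. \<integral>\<^sup>+x\<in>Omega. ennreal ((fnorm (Q0 x - \<psi>s n x))^2
       + (\<Sum>\<alpha>. (fnorm (DQ0 \<alpha> x - pd \<alpha> (\<psi>s n) x))^2)) \<partial>lborel) \<longlonglongrightarrow> 0"
  using DQ0 by blast
 define a where "a n = (\<integral>\<^sup>+x\<in>Omega. ennreal ((fnorm (Q0 x - \<psi>s n x))^2
       + (\<Sum>\<alpha>. (fnorm (DQ0 \<alpha> x - pd \<alpha> (\<psi>s n) x))^2)) \<partial>lborel)" for n
 define p where "p n x = \<psi>s n x $ i $ j" for n x
 have p: "ccs (p n)" for n unfolding p_def by (rule cc_test_ccs[OF \<psi>])
 have pdp: "pd \<alpha> (p n) x = pd \<alpha> (\<psi>s n) x $ i $ j" for \<alpha> n x unfolding p_def by (rule cc_test_ccs[OF \<psi>])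
 have sq: "(A $ i $ j)^2 \<le> (fnorm A)^2" for A :: mat3
 proof -
  have "(A $ i $ j)^2 \<le> (\<Sum>j. (A $ i $ j)^2)" by (rule member_le_sum) auto
  also have "\<dots> \<le> (\<Sum>i j. (A $ i $ j)^2)" by (rule member_le_sum) (auto intro: sum_nonneg)
  finally show ?thesis by (simp add: fnorm_norm norm_sq_components)
 qed
 have conv: "(\<lambda>n. nrmL (F n)) \<longlonglongrightarrow> 0"
  if l: "\<And>n. l2L (F n)" and le: "\<And>n x. (F n x)^2 \<le> ind Omega x * ((fnorm (Q0 x - \<psi>s n x))^2
       + (\<Sum>\<alpha>. (fnorm (DQ0 \<alpha> x - pd \<alpha> (\<psi>s n) x))^2))" for F
 proof -
  have "ennreal ((nrmL (F n))^2) \<le> a n" for n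
   unfolding nn_integral_sq_eq[OF l, symmetric] a_def
  proof (rule nn_integral_mono)
   fix x
   show "ennreal ((F n x)^2) \<le> ennreal ((fnorm (Q0 x - \<psi>s n x))^2 + (\<Sum>\<alpha>. (fnorm (DQ0 \<alpha> x - pd \<alpha> (\<psi>s n) x))^2)) * indicator Omega x"
    using le[of n x] by (cases "x \<in> Omega") (auto intro: ennreal_leI)
  qed
  hence "(\<lambda>n. ennreal ((nrmL (F n))^2)) \<longlonglongrightarrow> 0"
   by (intro tendsto_sandwich[OF _ _ tendsto_const lim[folded a_def]] always_eventually) auto
  hence "(\<lambda>n. ennreal ((nrmL (F n))^2)) \<longlonglongrightarrow> ennreal 0" by simp
  hence "(\<lambda>n. (nrmL (F n))^2) \<longlonglongrightarrow> 0" by (subst (asm) tendsto_ennreal_iff) auto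
  hence "(\<lambda>n. sqrt ((nrmL (F n))^2)) \<longlonglongrightarrow> sqrt 0" by (rule tendsto_real_sqrt)
  thus ?thesis by simp
 qed
 have bO: "x \<in> box 0 1 \<Longrightarrow> x \<in> Omega" for x using box_subset_cbox[of 0 "1::pt"] by (auto simp: Omega_def)
 have "slimL p (q0 i j)"
 proof (rule slimI[OF ccs_l2(1)[OF p] q0_l2], rule conv)
  show "l2L (\<lambda>x. p n x - q0 i j x)" for n by (rule l2_diff[OF ccs_l2(1)[OF p] q0_l2])
  fix n x
  show "(p n x - q0 i j x)^2 \<le> ind Omega x * ((fnorm (Q0 x - \<psi>s n x))^2 + (\<Sum>\<alpha>. (fnorm (DQ0 \<alpha> x - pd \<alpha> (\<psi>s n) x))^2))"
  proof (cases "x \<in> box 0 1")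
   case True
   have "(p n x - q0 i j x)^2 = ((Q0 x - \<psi>s n x) $ i $ j)^2" using True by (simp add: p_def q0_def power2_commute)
   also have "\<dots> \<le> (fnorm (Q0 x - \<psi>s n x))^2" by (rule sq)
   finally show ?thesis using bO[OF True] by (simp add: add_increasing2 sum_nonneg)
  next
   case False
   thus ?thesis by (simp add: ccsD(4)[OF p] q0_def add_nonneg_nonneg sum_nonneg)
  qed
 qed
 moreover have "slimL (\<lambda>n. pd \<alpha> (p n)) (d0 i j \<alpha>)" for \<alpha>
 proof (rule slimI[OF ccs_l2(2)[OF p] d0_l2], rule conv)
  show "l2L (\<lambda>x. pd \<alpha> (p n) x - d0 i j \<alpha> x)" for n by (rule l2_diff[OF ccs_l2(2)[OF p] d0_l2])
  fix n x
  show "(pd \<alpha> (p n) x - d0 i j \<alpha> x)^2 \<le> ind Omega x * ((fnorm (Q0 x - \<psi>s n x))^2 + (\<Sum>\<alpha>. (fnorm (DQ0 \<alpha> x - pd \<alpha> (\<psi>s n) x))^2))"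
  proof (cases "x \<in> box 0 1")
   case True
   have "(pd \<alpha> (p n) x - d0 i j \<alpha> x)^2 = ((DQ0 \<alpha> x - pd \<alpha> (\<psi>s n) x) $ i $ j)^2" using True by (simp add: pdp d0_def power2_commute)
   also have "\<dots> \<le> (fnorm (DQ0 \<alpha> x - pd \<alpha> (\<psi>s n) x))^2" by (rule sq)
   also have "\<dots> \<le> (\<Sum>\<alpha>. (fnorm (DQ0 \<alpha> x - pd \<alpha> (\<psi>s n) x))^2)" by (rule member_le_sum) auto
   finally show ?thesis using bO[OF True] by (simp add: add_increasing)
  next
   case False
   thus ?thesis by (simp add: ccsD(5)[OF p] d0_def add_nonneg_nonneg sum_nonneg)
  qed
 qed
 ultimately show ?thesis unfolding H10s_def using p by (auto simp: q0_def d0_def)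
qed

lemma AE_box_sym: "AE x in lborel. x \<in> box 0 1 \<longrightarrow> sym_tf (Q0 x)"
 using Q0_sym box_subset_cbox[of 0 "1::pt"] by (auto simp: Omega_def elim!: eventually_mono)

text \<open>By \<open>r_growth\<close> the square of \<open>r(Q0)\<close> grows at most like the
  fourth power of \<open>Q0\<close>, and \<open>H10s_L4\<close> integrates fourth powers of the
  entries.\<close>

lemma r0_l2: "l2L r0"
proof -
 obtain K where K: "K \<ge> 0" "\<And>Q. symm Q \<Longrightarrow> (rF Q)^2 \<le> K * (1 + (norm Q)^4)" using r_growth by blast
 define G where "G x = K * (ind (box 0 1) x + 9 * (\<Sum>i j. (q0 i j x)^4))" for x
 have q4: "integrable lborel (\<lambda>x. (q0 i j x)^4)" for i j
  by (rule integrableI_nonneg) (use l2_meas[OF q0_l2[of i j]] H10s_L4[OF H10s_q0[of i j]] in auto)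
 have iG: "integrable lborel G"
  unfolding G_def[abs_def]
  by (intro integrable_mult_right Bochner_Integration.integrable_add Bochner_Integration.integrable_sum q4 integrable_real_indicator emeasure_bounded_finite) auto
 \<comment> \<open>\<open>Q0\<close> is known to be measurable on \<open>Omega\<close> only, so
   measurability of \<open>r0\<close> goes through the cut-off field.\<close>
 define QQ where "QQ x = (\<chi> i j. q0 i j x)" for x
 have QQ: "ind (box 0 1) x *\<^sub>R Q0 x = QQ x" for x by (simp add: QQ_def q0_def vec_eq_iff)
 have mQ: "QQ \<in> bm"
  by (rule borel_measurable_mat3) (use l2_meas[OF q0_l2] in \<open>simp add: QQ_def\<close>)
 have r0_eq: "r0 x = ind (box 0 1) x * rF (QQ x)" for x
  using QQ[of x] by (auto simp: r0_def split: split_indicator)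
 have mr: "r0 \<in> bm"
  unfolding r0_eq[abs_def] using measurable_compose[OF mQ rF_measurable] by simp
 have "AE x in lborel. (r0 x)^2 \<le> G x"
  using AE_box_sym
 proof eventually_elim
  fix x assume s: "x \<in> box 0 1 \<longrightarrow> sym_tf (Q0 x)"
  show "(r0 x)^2 \<le> G x"
  proof (cases "x \<in> box 0 1")
   case True
   have "(norm (Q0 x))^4 = ((norm (Q0 x))^2)^2" by (simp flip: power_mult)
   also have "\<dots> = (\<Sum>i j. (q0 i j x)^2)^2"
    unfolding norm_sq_components using True by (simp add: q0_def)
   \<comment> \<open>The square of a sum of three terms is at most three times the sum of the
     squares; used once in each index, this gives the factor 9.\<close>
   also have "\<dots> \<le> (\<Sum>i. (\<Sum>j. (q0 i j x)^2)^2) * 3"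
    using sum_squared_le_sum_of_squares[of "\<lambda>i. \<Sum>j. (q0 i j x)^2" "UNIV::3 set"] by simp
   also have "\<dots> \<le> (\<Sum>i. (\<Sum>j. ((q0 i j x)^2)^2) * 3) * 3"
    using sum_squared_le_sum_of_squares[of "\<lambda>j. (q0 _ j x)^2" "UNIV::3 set"] by (intro mult_right_mono sum_mono) simp_all
   also have "\<dots> = 9 * (\<Sum>i j. (q0 i j x)^4)"
    by (simp add: sum_distrib_right[symmetric] flip: power_mult)
   finally have n4: "(norm (Q0 x))^4 \<le> 9 * (\<Sum>i j. (q0 i j x)^4)" .
   have "(r0 x)^2 = (rF (Q0 x))^2" using True by (simp add: r0_def)
   also have "\<dots> \<le> K * (1 + (norm (Q0 x))^4)" using K(2) s True by (simp add: sym_tf_def)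
   also have "\<dots> \<le> K * (1 + 9 * (\<Sum>i j. (q0 i j x)^4))" using K(1) n4 by (intro mult_left_mono) auto
   finally show ?thesis using True by (simp add: G_def)
  next
   case False
   thus ?thesis using K(1) by (simp add: r0_def G_def sum_nonneg)
  qed
 qed
 hence "integrable lborel (\<lambda>x. (r0 x)^2)"
  by (intro Bochner_Integration.integrable_bound[OF iG]) (use mr in auto)
 thus ?thesis using mr by (simp add: l2_def)
qed

lemma Q_init_cp: "Q_init N Q0 k $ i $ j = cavg N (q0 i j) k"
proof (cases "in_grid N k")
 case True
 have e: "(ind (cell (mesh N) k) x *\<^sub>R Q0 x) $ i $ j = ind (cell (mesh N) k) x * q0 i j x" for x i j
  using grid_cell_subset[OF True] by (auto simp: q0_def split: split_indicator)
 have "integrable lborel (\<lambda>x. ind (cell (mesh N) k) x *\<^sub>R Q0 x)"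
  by (rule integrable_mat3) (unfold e, rule integrable_cell[OF mesh_pos q0_l2])
 from integral_mat3[OF this, of i j] show ?thesis
  using True unfolding e by (simp add: Q_init_def cavg_def set_lebesgue_integral_def)
next
 case False
 thus ?thesis by (simp add: Q_init_def cavg_def)
qed

lemma r_init_eq: "r_init a b c A0 N Q0 = cavg N r0"
proof
 fix k
 show "r_init a b c A0 N Q0 k = cavg N r0 k"
 proof (cases "in_grid N k")
  case True
  have e: "ind (cell (mesh N) k) x *\<^sub>R rF (Q0 x) = ind (cell (mesh N) k) x * r0 x" for x
   using grid_cell_subset[OF True] by (auto simp: r0_def split: split_indicator)
  show ?thesis using True unfolding r_init_def cavg_def set_lebesgue_integral_def e by simp
 next
  case False
  thus ?thesis by (simp add: r_init_def cavg_def)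
 qed
qed

lemma Q_init_sym_tf: "sym_tf (Q_init N Q0 k)"
 unfolding sym_tf_iff Q_init_cp
proof (intro conjI allI)
 fix i j
 have m: "(\<lambda>x. ind (cell (mesh N) k) x * q0 i j x) \<in> bmL" for i j
  using integrable_cell[OF mesh_pos q0_l2] by (rule borel_measurable_integrable)
 have "(LBINT x. ind (cell (mesh N) k) x * q0 i j x) = (LBINT x. ind (cell (mesh N) k) x * q0 j i x)"
  by (rule integral_cong_AE[OF m m]) (use AE_box_sym in \<open>auto simp: q0_def sym_tf_iff elim!: eventually_mono split: split_indicator\<close>)
 thus "cavg N (q0 i j) k = cavg N (q0 j i) k" by (simp add: cavg_def)
 have "(\<Sum>i. \<integral>x. ind (cell (mesh N) k) x * q0 i i x \<partial>lborel) = (LBINT x. (\<Sum>i. ind (cell (mesh N) k) x * q0 i i x))"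
  by (rule Bochner_Integration.integral_sum[symmetric]) (rule integrable_cell[OF mesh_pos q0_l2])
 also have "\<dots> = (\<integral>x. 0 \<partial>(lborel :: pt measure))"
 proof (rule integral_cong_AE)
  show "AE x in lborel. (\<Sum>i. ind (cell (mesh N) k) x * q0 i i x) = 0"
   using AE_box_sym by eventually_elim (auto simp: q0_def sym_tf_iff simp flip: sum_distrib_left split: split_indicator)
  show "(\<lambda>x. \<Sum>i. ind (cell (mesh N) k) x * q0 i i x) \<in> bmL"
   by (rule borel_measurable_sum) (rule m)
 qed simp
 finally have "(\<Sum>i. \<integral>x. ind (cell (mesh N) k) x * q0 i i x \<partial>lborel) = 0" by simp
 thus "(\<Sum>i. cavg N (q0 i i) k) = 0"
  by (cases "in_grid N k") (simp_all add: cavg_def flip: sum_divide_distrib)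
qed

abbreviation "L23 \<equiv> L2 + L3"

definition "QS N NT n = Q_seq a b c A0 L1 L2 L3 M T Q0 N NT n"
definition "RS N NT n = r_seq a b c A0 L1 L2 L3 M T Q0 N NT n"
text \<open>For \<open>n = 0\<close> the truncated subtraction gives \<open>n - 1 = 0\<close>, which
  is the convention \<open>Q^(-1) = Q^0\<close>.\<close>

definition "PB N NT n k = (3/2) *\<^sub>R PF (QS N NT n k) - (1/2) *\<^sub>R PF (QS N NT (n - 1) k)"
definition "dT NT = T / real NT"

lemma dT_pos: "NT > 0 \<Longrightarrow> dT NT > 0"
 using T_pos by (simp add: dT_def)

lemma QS_0: "QS N NT 0 = Q_init N Q0" and RS_0: "RS N NT 0 = cavg N r0"
 by (simp_all add: QS_def RS_def Q_seq_def r_seq_def r_init_eq)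

lemma scheme_state_eq:
 "scheme_state a b c A0 L1 L2 L3 M T Q0 N NT n = (QS N NT (n - 1), QS N NT n, RS N NT n)"
proof (cases n)
 case 0
 thus ?thesis by (simp add: QS_def RS_def Q_seq_def r_seq_def)
next
 case (Suc m)
 have "fst (scheme_state a b c A0 L1 L2 L3 M T Q0 N NT (Suc m)) = QS N NT m"
  by (simp add: QS_def Q_seq_def Let_def split: prod.split)
 thus ?thesis using Suc by (simp add: QS_def RS_def Q_seq_def r_seq_def prod_eq_iff del: scheme_state.simps)
qed

lemma sym_tf_combination:
 assumes "sym_tf A" "sym_tf B" shows "sym_tf (x *\<^sub>R A - y *\<^sub>R B)"
proof -
 have "(\<Sum>i. x * A $ i $ i) = 0" "(\<Sum>i. y * B $ i $ i) = 0"
  using assms by (auto simp: sym_tf_iff simp flip: sum_distrib_left)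
 thus ?thesis using assms by (simp add: sym_tf_iff sum_subtractf)
qed

text \<open>The description operator in the scheme denotes a solution only where the step is
  uniquely solvable. That is known for symmetric trace-free extrapolated \<open>P\<close>, hence for
  such fields on the two previous levels; so well-definedness and this invariant share one
  induction.\<close>

lemma scheme_step:
 assumes NT: "NT > 0"
 shows "sym_tf (QS N NT n k)" "bc N (QS N NT n)" "bc N (RS N NT n)"
  "gstep L1 L23 M N (dT NT) (PB N NT n) (QS N NT n) (RS N NT n) (QS N NT (Suc n)) (RS N NT (Suc n))" (is ?g4)
proof -
 have step: "gstep L1 L23 M N (dT NT) (PB N NT n) (QS N NT n) (RS N NT n) (QS N NT (Suc n)) (RS N NT (Suc n))"
  if s: "\<And>k. sym_tf (QS N NT n k)" "\<And>k. sym_tf (QS N NT (n - 1) k)" for n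
 proof -
  have PBs: "sym_tf (PB N NT n k)" for k
   unfolding PB_def by (intro sym_tf_combination P_sym_tf s)
  have "\<exists>!p. gstep L1 L23 M N (dT NT) (PB N NT n) (QS N NT n) (RS N NT n) (fst p) (snd p)"
   by (rule gstep_unique_exists[OF dT_pos[OF NT] M_pos L1_pos _ PBs]) (use L2_pos L3_pos in simp)
  from theI'[OF this]
  have *: "gstep L1 L23 M N (dT NT) (PB N NT n) (QS N NT n) (RS N NT n)
    (fst (THE p. gstep L1 L23 M N (dT NT) (PB N NT n) (QS N NT n) (RS N NT n) (fst p) (snd p)))
    (snd (THE p. gstep L1 L23 M N (dT NT) (PB N NT n) (QS N NT n) (RS N NT n) (fst p) (snd p)))" .
  have "scheme_state a b c A0 L1 L2 L3 M T Q0 N NT (Suc n) = (QS N NT n,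
    fst (THE p. gstep L1 L23 M N (dT NT) (PB N NT n) (QS N NT n) (RS N NT n) (fst p) (snd p)),
    snd (THE p. gstep L1 L23 M N (dT NT) (PB N NT n) (QS N NT n) (RS N NT n) (fst p) (snd p)))"
   by (simp add: scheme_state_eq step_eq_gstep Let_def dT_def PB_def[abs_def])
  hence "QS N NT (Suc n) = fst (THE p. gstep L1 L23 M N (dT NT) (PB N NT n) (QS N NT n) (RS N NT n) (fst p) (snd p))"
   "RS N NT (Suc n) = snd (THE p. gstep L1 L23 M N (dT NT) (PB N NT n) (QS N NT n) (RS N NT n) (fst p) (snd p))"
   by (simp_all add: scheme_state_eq[of _ _ "Suc n"] del: scheme_state.simps prod.collapse)
  with * show ?thesis by simp
 qed
 have all: "(\<forall>k. sym_tf (QS N NT n k)) \<and> (\<forall>k. sym_tf (QS N NT (n - 1) k)) \<and> bc N (QS N NT n) \<and> bc N (RS N NT n)" for n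
 proof (induction n)
  case 0
  have "bc N (Q_init N Q0)" by (simp add: bc_def Q_init_def)
  thus ?case by (simp add: QS_0 RS_0 Q_init_sym_tf cavg_bc)
 next
  case (Suc n)
  have st: "gstep L1 L23 M N (dT NT) (PB N NT n) (QS N NT n) (RS N NT n) (QS N NT (Suc n)) (RS N NT (Suc n))"
   by (rule step) (use Suc in auto)
  have "sym_tf (QS N NT (Suc n) k)" for k
  proof (rule gstep_sym_tf[OF st dT_pos[OF NT] M_pos L1_pos])
   show "sym_tf (QS N NT n k)" for k using Suc by blast
   show "sym_tf (PB N NT n k)" for k unfolding PB_def using Suc by (intro sym_tf_combination P_sym_tf) blast+
  qed
  thus ?case using Suc st by (auto simp: gstep_def)
 qed
 show "sym_tf (QS N NT n k)" "bc N (QS N NT n)" "bc N (RS N NT n)" using all by blast+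
 show ?g4
  by (rule step) (use all in blast)+
qed

definition "HS N NT i j n k = (QS N NT (Suc n) k $ i $ j - QS N NT n k $ i $ j) / dT NT"
definition "EN N NT n = Eh L1 L23 (mesh N) (QS N NT n) (RS N NT n)"

lemma HS_fs: "NT > 0 \<Longrightarrow> fs (HS N NT i j n)"
proof -
 assume "NT > 0"
 hence "fs (\<lambda>k. (1 / dT NT) * (QS N NT (Suc n) k $ i $ j - QS N NT n k $ i $ j))"
  by (intro fs_mult2 fs_diff bc_cp_fs[OF scheme_step(2)])
 thus ?thesis by (simp add: HS_def[abs_def])
qed

lemma QS_fs: "NT > 0 \<Longrightarrow> fs (cp i j (QS N NT n))" and RS_fs: "NT > 0 \<Longrightarrow> fs (RS N NT n)"
 by (rule bc_cp_fs[OF scheme_step(2)] bc_fs[OF scheme_step(3)], simp)+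

lemma energy:
 assumes "NT > 0"
 shows "EN N NT n + dT NT / M * (\<Sum>m<n. \<Sum>i j. IP (mesh N) (HS N NT i j m) (HS N NT i j m)) = EN N NT 0"
proof (induction n)
 case 0
 thus ?case by simp
next
 case (Suc n)
 have "EN N NT (Suc n) + dT NT / M * (\<Sum>i j. IP (mesh N) (HS N NT i j n) (HS N NT i j n)) = EN N NT n"
  unfolding EN_def HS_def
  by (rule gstep_energy[OF scheme_step(4)[OF assms] dT_pos[OF assms] M_pos scheme_step(2)[OF assms] scheme_step(3)[OF assms]
     scheme_step(1)[OF assms] scheme_step(1)[OF assms]])
 thus ?case using Suc by (simp add: distrib_left)
qed

lemma EN_nonneg: "NT > 0 \<Longrightarrow> 0 \<le> EN N NT n"
 unfolding EN_def Eh_def using L1_pos L2_pos L3_pos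
 by (intro mult_nonneg_nonneg add_nonneg_nonneg sum_nonneg) auto

end

section \<open>Compactness of the approximations\<close>

lemma slim_sum:
 "(\<And>i. i \<in> I \<Longrightarrow> slim M (F i) (f i)) \<Longrightarrow> slim M (\<lambda>m x. \<Sum>i\<in>I. F i m x) (\<lambda>x. \<Sum>i\<in>I. f i x)"
 by (induction I rule: infinite_finite_induct) (auto intro: slim_add slim_const)

lemma st_sum: "st h (\<lambda>k. \<Sum>i\<in>I. F i k) x = (\<Sum>i\<in>I. st h (F i) x)"
 by (simp add: st_def)

locale scheme_seq = scheme +
 fixes N NT :: "nat \<Rightarrow> nat"
 assumes NT_pos: "\<And>m. NT m > 0" and h_lim: "(\<lambda>m. mesh (N m)) \<longlonglongrightarrow> 0" and dt_lim: "(\<lambda>m. T / real (NT m)) \<longlonglongrightarrow> 0"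
begin

abbreviation "h m \<equiv> mesh (N m)"
abbreviation "dt m \<equiv> dT (NT m)"
text \<open>The number of steps up to time \<open>3 T\<close>: for \<open>t \<le> T\<close>, both a
  shift by less than \<open>T\<close> and the shift by \<open>dt m \<le> T\<close> stay strictly
  below it.\<close>

abbreviation "nn m \<equiv> 3 * NT m"
abbreviation "Qs m n \<equiv> QS (N m) (NT m) n"
abbreviation "Rs m n \<equiv> RS (N m) (NT m) n"
abbreviation "Hs m i j n \<equiv> HS (N m) (NT m) i j n"

lemma dt_pos [simp]: "dt m > 0" by (rule dT_pos[OF NT_pos])
lemma dt_lim': "dt \<longlonglongrightarrow> 0" using dt_lim by (simp add: dT_def[abs_def])
lemma NT_dt: "real (NT m) * dt m = T" using NT_pos[of m] by (simp add: dT_def)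
lemma nn_dt: "real (nn m) * dt m = 3 * T" using NT_dt[of m] by simp

text \<open>The energy of the initial data in components; \<open>E0_eq\<close> identifies it with
  the integral over \<open>Omega\<close> in the energy inequality.\<close>

definition "E0 = 1/2 * (L1 * (\<Sum>i j m. (nrmL (d0 i j m))^2)
  + L23 * (\<Sum>j. (nrmL (\<lambda>x. \<Sum>i. d0 i j i x))^2) + (nrmL r0)^2)"

lemma EN0_tendsto: "(\<lambda>m. EN (N m) (NT m) 0) \<longlonglongrightarrow> E0"
proof -
 have cpQ: "cp i j (Qs m 0) = cavg (N m) (q0 i j)" for i j m by (rule ext) (simp add: QS_0 Q_init_cp)
 have sD: "slimL (\<lambda>m. st (h m) (Dplus (h m) \<alpha> (cavg (N m) (q0 i j)))) (d0 i j \<alpha>)" for i j \<alpha>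
  by (rule slim_Dplus_cavg[OF H10s_q0 h_lim])
 have sdiv: "slimL (\<lambda>m. st (h m) (divh (h m) j (Qs m 0))) (\<lambda>x. \<Sum>i. d0 i j i x)" for j
 proof -
  have "slimL (\<lambda>m x. \<Sum>i. st (h m) (Dcent (h m) i (cavg (N m) (q0 i j))) x) (\<lambda>x. \<Sum>i. d0 i j i x)"
   by (intro slim_sum slim_Dcent_of_Dplus[OF mesh_pos h_lim sD])
  thus ?thesis by (simp add: divh_def[abs_def] st_sum[abs_def] cpQ)
 qed
 have sr: "slimL (\<lambda>m. st (h m) (cavg (N m) r0)) r0"
  by (rule slim_cavg[OF r0_l2 _ h_lim]) (simp add: r0_def)
 have "(\<lambda>m. 1/2 * (L1 * (\<Sum>i j \<alpha>. (nrmL (st (h m) (Dplus (h m) \<alpha> (cavg (N m) (q0 i j)))))^2)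
  + L23 * (\<Sum>j. (nrmL (st (h m) (divh (h m) j (Qs m 0))))^2) + (nrmL (st (h m) (cavg (N m) r0)))^2)) \<longlonglongrightarrow> E0"
  unfolding E0_def by (intro tendsto_intros slim_nrm_tendsto sD sdiv sr)
 thus ?thesis by (simp add: EN_def Eh_def IP_self cpQ RS_0)
qed

lemma EN_bound: "\<exists>C>0. \<forall>m. EN (N m) (NT m) 0 \<le> C"
proof -
 have "Bseq (\<lambda>m. EN (N m) (NT m) 0)" by (rule convergent_imp_Bseq[OF convergentI[OF EN0_tendsto]])
 then obtain K where "K > 0" "\<And>m. norm (EN (N m) (NT m) 0) \<le> K" unfolding Bseq_def by blast
 thus ?thesis by (intro exI[of _ K]) (auto simp: abs_le_iff)
qed

section \<open>Bounds uniform in the mesh\<close>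

definition "CE = (SOME C. C > 0 \<and> (\<forall>m. EN (N m) (NT m) 0 \<le> C))"

lemma CE: "CE > 0" "EN (N m) (NT m) 0 \<le> CE"
 using someI_ex[OF EN_bound, folded CE_def] by auto

lemma st_Qs_l2: "l2L (st (h m) (cp i j (Qs m n)))"
 and st_Dp_l2: "l2L (st (h m) (Dplus (h m) \<alpha> (cp i j (Qs m n))))"
 and st_Dc_l2: "l2L (st (h m) (Dcent (h m) \<alpha> (cp i j (Qs m n))))"
 and st_Hs_l2: "l2L (st (h m) (Hs m i j n))"
 and st_Rs_l2: "l2L (st (h m) (Rs m n))"
 by (intro st_l2 mesh_pos fs_Dplus fs_Dcent QS_fs RS_fs HS_fs NT_pos)+

lemma EN_le: "EN (N m) (NT m) n \<le> CE"
proof -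
 have "0 \<le> dt m / M * (\<Sum>l<n. \<Sum>i j. IP (h m) (Hs m i j l) (Hs m i j l))"
  using less_imp_le[OF dt_pos[of m]] M_pos by (intro mult_nonneg_nonneg sum_nonneg) auto
 thus ?thesis using energy[OF NT_pos[of m], of "N m" n] CE(2)[of m] by linarith
qed

lemma EN_expand: "EN (N m) (NT m) n = 1/2 * (L1 * (\<Sum>i j \<alpha>. (nrmL (st (h m) (Dplus (h m) \<alpha> (cp i j (Qs m n)))))^2)
  + L23 * (\<Sum>j. (nrmL (st (h m) (divh (h m) j (Qs m n))))^2) + (nrmL (st (h m) (Rs m n)))^2)"
 by (simp add: EN_def Eh_def IP_self)

lemma nrm_Dp_le: "nrmL (st (h m) (Dplus (h m) \<alpha> (cp i j (Qs m n)))) \<le> sqrt (2 * CE / L1)" (is ?g1)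
 and nrm_Rs_le: "nrmL (st (h m) (Rs m n)) \<le> sqrt (2 * CE)" (is ?g2)
proof -
 define S where "S = (\<Sum>i j \<alpha>. (nrmL (st (h m) (Dplus (h m) \<alpha> (cp i j (Qs m n)))))^2)"
 have S0: "0 \<le> L1 * S" unfolding S_def using L1_pos by (intro mult_nonneg_nonneg sum_nonneg) auto
 have D0: "0 \<le> L23 * (\<Sum>j. (nrmL (st (h m) (divh (h m) j (Qs m n))))^2)"
  using L2_pos L3_pos by (intro mult_nonneg_nonneg sum_nonneg) auto
 have le: "L1 * S + L23 * (\<Sum>j. (nrmL (st (h m) (divh (h m) j (Qs m n))))^2) + (nrmL (st (h m) (Rs m n)))^2 \<le> 2 * CE"
  using EN_le[of m n] unfolding EN_expand S_def by simp
 have "(nrmL (st (h m) (Rs m n)))^2 \<le> 2 * CE" using le S0 D0 by linarith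
 thus ?g2 by (rule real_le_rsqrt)
 have "L1 * S \<le> 2 * CE" using le D0 zero_le_power2[of "nrmL (st (h m) (Rs m n))"] by linarith
 hence "S \<le> 2 * CE / L1" using L1_pos by (simp add: field_simps)
 moreover have "(nrmL (st (h m) (Dplus (h m) \<alpha> (cp i j (Qs m n)))))^2 \<le> S"
 proof -
  have "(nrmL (st (h m) (Dplus (h m) \<alpha> (cp i j (Qs m n)))))^2 \<le> (\<Sum>\<alpha>. (nrmL (st (h m) (Dplus (h m) \<alpha> (cp i j (Qs m n)))))^2)"
   by (rule member_le_sum) auto
  also have "\<dots> \<le> (\<Sum>j \<alpha>. (nrmL (st (h m) (Dplus (h m) \<alpha> (cp i j (Qs m n)))))^2)"
   by (rule member_le_sum) (auto intro!: sum_nonneg)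
  also have "\<dots> \<le> S" unfolding S_def by (rule member_le_sum) (auto intro!: sum_nonneg)
  finally show ?thesis .
 qed
 ultimately have "(nrmL (st (h m) (Dplus (h m) \<alpha> (cp i j (Qs m n)))))^2 \<le> 2 * CE / L1" by linarith
 thus ?g1 by (rule real_le_rsqrt)
qed

lemma sum_Hs_le: "dt m * (\<Sum>l<n. (nrmL (st (h m) (Hs m i j l)))^2) \<le> M * CE"
proof -
 have "(\<Sum>l<n. (nrmL (st (h m) (Hs m i j l)))^2) \<le> (\<Sum>l<n. \<Sum>i j. IP (h m) (Hs m i j l) (Hs m i j l))"
 proof (rule sum_mono)
  fix l
  have "(nrmL (st (h m) (Hs m i j l)))^2 \<le> (\<Sum>j. (nrmL (st (h m) (Hs m i j l)))^2)"
   by (rule member_le_sum) auto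
  also have "\<dots> \<le> (\<Sum>i j. (nrmL (st (h m) (Hs m i j l)))^2)"
   by (rule member_le_sum) (auto intro!: sum_nonneg)
  finally show "(nrmL (st (h m) (Hs m i j l)))^2 \<le> (\<Sum>i j. IP (h m) (Hs m i j l) (Hs m i j l))"
   by (simp add: IP_self)
 qed
 hence "dt m * (\<Sum>l<n. (nrmL (st (h m) (Hs m i j l)))^2)
   \<le> dt m * (\<Sum>l<n. \<Sum>i j. IP (h m) (Hs m i j l) (Hs m i j l))"
  using less_imp_le[OF dt_pos[of m]] by (intro mult_left_mono)
 moreover have "dt m / M * (\<Sum>l<n. \<Sum>i j. IP (h m) (Hs m i j l) (Hs m i j l)) \<le> CE"
  using energy[OF NT_pos[of m], of "N m" n] CE(2)[of m] EN_nonneg[OF NT_pos[of m], of "N m" n] by linarith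
 hence "dt m * (\<Sum>l<n. \<Sum>i j. IP (h m) (Hs m i j l) (Hs m i j l)) \<le> M * CE"
  using M_pos by (simp add: field_simps)
 ultimately show ?thesis by linarith
qed

lemma Hs_increment: "st (h m) (cp i j (Qs m (Suc n))) x = st (h m) (cp i j (Qs m n)) x + dt m * st (h m) (Hs m i j n) x"
 using less_imp_neq[OF dt_pos[of m]] by (simp add: st_def HS_def)

text \<open>An increment is a sum of discrete time derivatives; Cauchy-Schwarz in time against the
  dissipation bound gives Hoelder continuity of exponent 1/2 with values in
  \<open>L2\<close>.\<close>

lemma nrm_time_increment:
 "nrmL (\<lambda>x. st (h m) (cp i j (Qs m (n + p))) x - st (h m) (cp i j (Qs m n)) x) \<le> sqrt (real p * dt m) * sqrt (M * CE)"
proof -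
 have e: "st (h m) (cp i j (Qs m (n + p))) x - st (h m) (cp i j (Qs m n)) x = (\<Sum>l<p. dt m * st (h m) (Hs m i j (n + l)) x)" for x
  by (induction p) (simp_all add: Hs_increment)
 have "nrmL (\<lambda>x. \<Sum>l<p. dt m * st (h m) (Hs m i j (n + l)) x) \<le> (\<Sum>l<p. nrmL (\<lambda>x. dt m * st (h m) (Hs m i j (n + l)) x))"
  by (intro nrm_sum_le l2_cmult st_Hs_l2)
 also have "\<dots> = dt m * (\<Sum>l<p. nrmL (st (h m) (Hs m i j (n + l))))"
  using less_imp_le[OF dt_pos[of m]] by (simp add: nrm_cmult sum_distrib_left)
 also have "\<dots> \<le> sqrt (real p * dt m) * sqrt (M * CE)"
 proof (rule power2_le_imp_le)
  have "(\<Sum>l<p. nrmL (st (h m) (Hs m i j (n + l))))^2 \<le> (\<Sum>l<p. (nrmL (st (h m) (Hs m i j (n + l))))^2) * real p"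
   using sum_squared_le_sum_of_squares[of "\<lambda>l. nrmL (st (h m) (Hs m i j (n + l)))" "{..<p}"] by simp
  also have "(\<Sum>l<p. (nrmL (st (h m) (Hs m i j (n + l))))^2) \<le> (\<Sum>l<n+p. (nrmL (st (h m) (Hs m i j l)))^2)"
  proof -
   have "(\<Sum>l<p. (nrmL (st (h m) (Hs m i j (n + l))))^2) = (\<Sum>l\<in>(+) n ` {..<p}. (nrmL (st (h m) (Hs m i j l)))^2)"
    by (subst sum.reindex) auto
   also have "\<dots> \<le> (\<Sum>l<n+p. (nrmL (st (h m) (Hs m i j l)))^2)" by (rule sum_mono2) auto
   finally show ?thesis .
  qed
  finally have "(\<Sum>l<p. nrmL (st (h m) (Hs m i j (n + l))))^2 \<le> (\<Sum>l<n+p. (nrmL (st (h m) (Hs m i j l)))^2) * real p"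
   by (simp add: mult_right_mono)
  from mult_left_mono[OF this, of "(dt m)^2"]
  have "(dt m * (\<Sum>l<p. nrmL (st (h m) (Hs m i j (n + l)))))^2
    \<le> (real p * dt m) * (dt m * (\<Sum>l<n+p. (nrmL (st (h m) (Hs m i j l)))^2))"
   by (simp add: power_mult_distrib power2_eq_square mult_ac)
  also have "\<dots> \<le> (real p * dt m) * (M * CE)"
   using less_imp_le[OF dt_pos[of m]] by (intro mult_left_mono sum_Hs_le) auto
  also have "\<dots> = (sqrt (real p * dt m) * sqrt (M * CE))^2"
   using less_imp_le[OF dt_pos[of m]] M_pos CE(1) by (simp add: power_mult_distrib)
  finally show "(dt m * (\<Sum>l<p. nrmL (st (h m) (Hs m i j (n + l)))))^2 \<le> (sqrt (real p * dt m) * sqrt (M * CE))^2" .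
 qed (use less_imp_le[OF dt_pos[of m]] M_pos CE(1) in auto)
 finally show ?thesis unfolding e .
qed

text \<open>The largest norm of the initial components plus the growth that
  \<open>nrm_time_increment\<close> permits over the time \<open>3 T\<close>.\<close>

definition "CQ = Max (range (\<lambda>(i, j). nrmL (q0 i j))) + sqrt (3 * T) * sqrt (M * CE)"

lemma CQ_nonneg: "0 \<le> CQ"
proof -
 have "nrmL (q0 1 1) \<le> Max (range (\<lambda>(i, j). nrmL (q0 i j)))" by (rule Max_ge) auto
 hence "0 \<le> Max (range (\<lambda>(i, j). nrmL (q0 i j)))" using nrm_nonneg order_trans by blast
 thus ?thesis unfolding CQ_def using T_pos M_pos CE(1) by (intro add_nonneg_nonneg) auto
qed

lemma nrm_Qs_le: assumes "n \<le> nn m" shows "nrmL (st (h m) (cp i j (Qs m n))) \<le> CQ"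
proof -
 have cpQ: "cp i j (Qs m 0) = cavg (N m) (q0 i j)" by (rule ext) (simp add: QS_0 Q_init_cp)
 have "nrmL (\<lambda>x. (st (h m) (cp i j (Qs m (0 + n))) x - st (h m) (cp i j (Qs m 0)) x) + st (h m) (cp i j (Qs m 0)) x)
   \<le> nrmL (\<lambda>x. st (h m) (cp i j (Qs m (0 + n))) x - st (h m) (cp i j (Qs m 0)) x) + nrmL (st (h m) (cp i j (Qs m 0)))"
  by (intro nrm_add_le l2_diff st_Qs_l2)
 also have "\<dots> \<le> sqrt (real n * dt m) * sqrt (M * CE) + nrmL (q0 i j)"
  by (intro add_mono nrm_time_increment) (simp add: cpQ nrm_cavg_le[OF q0_l2] q0_def)
 also have "real n * dt m \<le> 3 * T"
  unfolding nn_dt[of m, symmetric] using assms less_imp_le[OF dt_pos[of m]] by (intro mult_right_mono) simp_all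
 also have "nrmL (q0 i j) \<le> Max (range (\<lambda>(i, j). nrmL (q0 i j)))" by (rule Max_ge) auto
 finally show ?thesis using M_pos CE(1) by (simp add: CQ_def mult_right_mono)
qed

section \<open>Space-time interpolants, extraction of limits and strong convergence of
  \<open>Q\<close>\<close>

definition "Qf i j m = tsf (dt m) (nn m) (\<lambda>n. st (h m) (cp i j (Qs m n)))"
definition "Df i j \<alpha> m = tsf (dt m) (nn m) (\<lambda>n. st (h m) (Dplus (h m) \<alpha> (cp i j (Qs m n))))"
definition "Hf i j m = tsf (dt m) (nn m) (\<lambda>n. st (h m) (Hs m i j n))"
definition "Rf m = tsf (dt m) (nn m) (\<lambda>n. st (h m) (Rs m n))"

lemma Qf_l2: "l2L (Qf i j m)" and Df_l2: "l2L (Df i j \<alpha> m)"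
 and Hf_l2: "l2L (Hf i j m)" and Rf_l2: "l2L (Rf m)"
 unfolding Qf_def Df_def Hf_def Rf_def
 by (intro tsf_l2 dt_pos st_Qs_l2 st_Dp_l2 st_Hs_l2 st_Rs_l2)+

lemma Qf_bound: "nrmL (Qf i j m) \<le> sqrt (3 * T) * CQ"
 unfolding Qf_def nn_dt[of m, symmetric]
 by (rule nrm_tsf_le[OF dt_pos st_Qs_l2 _ CQ_nonneg]) (simp add: nrm_Qs_le)

lemma Df_bound: "nrmL (Df i j \<alpha> m) \<le> sqrt (3 * T) * sqrt (2 * CE / L1)"
 unfolding Df_def nn_dt[of m, symmetric]
 by (rule nrm_tsf_le[OF dt_pos st_Dp_l2 nrm_Dp_le]) (use CE(1) L1_pos in simp)

lemma Rf_bound: "nrmL (Rf m) \<le> sqrt (3 * T) * sqrt (2 * CE)"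
 unfolding Rf_def nn_dt[of m, symmetric]
 by (rule nrm_tsf_le[OF dt_pos st_Rs_l2 nrm_Rs_le]) (use CE(1) in simp)

lemma Hf_bound: "nrmL (Hf i j m) \<le> sqrt (M * CE)"
proof (rule real_le_rsqrt)
 have "(nrmL (Hf i j m))^2 = dt m * (\<Sum>l<nn m. (nrmL (st (h m) (Hs m i j l)))^2)"
  unfolding Hf_def by (rule tsf_l2(2)[OF dt_pos st_Hs_l2])
 thus "(nrmL (Hf i j m))^2 \<le> M * CE" using sum_Hs_le by simp
qed

text \<open>Subsequences are refined one after another. The levels at time \<open>T\<close> need
  extractions of their own, because weak convergence in space-time carries no information about a
  single time.\<close>

lemma extraction:
 "\<exists>s q d g r qT rT. strict_mono (s :: nat \<Rightarrow> nat) \<and> (\<forall>i j. wlimL (\<lambda>m. Qf i j (s m)) (q i j)) \<and>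
   (\<forall>i j \<alpha>. wlimL (\<lambda>m. Df i j \<alpha> (s m)) (d i j \<alpha>)) \<and> (\<forall>i j. wlimL (\<lambda>m. Hf i j (s m)) (g i j)) \<and>
   wlimL (\<lambda>m. Rf (s m)) r \<and>
   (\<forall>i j. wlimL (\<lambda>m. st (h (s m)) (cp i j (Qs (s m) (NT (s m))))) (qT i j)) \<and>
   wlimL (\<lambda>m. st (h (s m)) (Rs (s m) (NT (s m)))) rT"
proof -
 have fin: "finite (UNIV :: (3 \<times> 3) set)" "finite (UNIV :: (3 \<times> 3 \<times> 3) set)" by simp_all
 obtain s1 q where s1: "strict_mono s1" "\<forall>p\<in>UNIV. wlimL (\<lambda>m. (\<lambda>(i, j). Qf i j) p (s1 m)) (q p)"
  using weak_compactness_family[OF fin(1), of lborel "\<lambda>(i, j). Qf i j" "sqrt (3 * T) * CQ"] Qf_l2 Qf_bound by (auto split: prod.splits)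
 obtain s2 d where s2: "strict_mono s2" "\<forall>p\<in>UNIV. wlimL (\<lambda>m. (\<lambda>(i, j, \<alpha>) m. Df i j \<alpha> (s1 m)) p (s2 m)) (d p)"
  using weak_compactness_family[OF fin(2), of lborel "\<lambda>(i, j, \<alpha>) m. Df i j \<alpha> (s1 m)" "sqrt (3 * T) * sqrt (2 * CE / L1)"] Df_l2 Df_bound
  by (auto split: prod.splits)
 obtain s3 g where s3: "strict_mono s3" "\<forall>p\<in>UNIV. wlimL (\<lambda>m. (\<lambda>(i, j) m. Hf i j (s1 (s2 m))) p (s3 m)) (g p)"
  using weak_compactness_family[OF fin(1), of lborel "\<lambda>(i, j) m. Hf i j (s1 (s2 m))" "sqrt (M * CE)"] Hf_l2 Hf_bound by (auto split: prod.splits)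
 obtain s4 r where s4: "strict_mono s4" "wlimL (\<lambda>m. Rf (s1 (s2 (s3 (s4 m))))) r"
  using weak_compactness[of lborel "\<lambda>m. Rf (s1 (s2 (s3 m)))" "sqrt (3 * T) * sqrt (2 * CE)"] Rf_l2 Rf_bound by auto
 define u where "u = s1 \<circ> s2 \<circ> s3 \<circ> s4"
 have NTn: "NT m \<le> nn m" for m by simp
 obtain s5 qT where s5: "strict_mono s5"
   "\<forall>p\<in>UNIV. wlimL (\<lambda>m. (\<lambda>(i, j) m. st (h (u m)) (cp i j (Qs (u m) (NT (u m))))) p (s5 m)) (qT p)"
  using weak_compactness_family[OF fin(1), of lborel "\<lambda>(i, j) m. st (h (u m)) (cp i j (Qs (u m) (NT (u m))))" CQ]
   st_Qs_l2 nrm_Qs_le[OF NTn] by (auto split: prod.splits)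
 obtain s6 rT where s6: "strict_mono s6"
   "wlimL (\<lambda>m. st (h (u (s5 (s6 m)))) (Rs (u (s5 (s6 m))) (NT (u (s5 (s6 m)))))) rT"
  using weak_compactness[of lborel "\<lambda>m. st (h (u (s5 m))) (Rs (u (s5 m)) (NT (u (s5 m))))" "sqrt (2 * CE)"]
   st_Rs_l2 nrm_Rs_le by auto
 define s where "s = s1 \<circ> s2 \<circ> s3 \<circ> s4 \<circ> s5 \<circ> s6"
 have m6: "strict_mono s6" and m56: "strict_mono (s5 \<circ> s6)" and m456: "strict_mono (s4 \<circ> s5 \<circ> s6)"
  and m36: "strict_mono (s3 \<circ> s4 \<circ> s5 \<circ> s6)" and m26: "strict_mono (s2 \<circ> s3 \<circ> s4 \<circ> s5 \<circ> s6)" and m16: "strict_mono s"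
  unfolding s_def by (intro strict_mono_o s1(1) s2(1) s3(1) s4(1) s5(1) s6(1))+
 have "wlimL (\<lambda>m. Qf i j (s m)) (q (i, j))" "wlimL (\<lambda>m. Df i j \<alpha> (s m)) (d (i, j, \<alpha>))"
  "wlimL (\<lambda>m. Hf i j (s m)) (g (i, j))" "wlimL (\<lambda>m. Rf (s m)) r"
  "wlimL (\<lambda>m. st (h (s m)) (cp i j (Qs (s m) (NT (s m))))) (qT (i, j))"
  "wlimL (\<lambda>m. st (h (s m)) (Rs (s m) (NT (s m)))) rT" for i j \<alpha>
  using wlim_subseq[OF bspec[OF s1(2), of "(i, j)"] m26] wlim_subseq[OF bspec[OF s2(2), of "(i, j, \<alpha>)"] m36]
   wlim_subseq[OF bspec[OF s3(2), of "(i, j)"] m456] wlim_subseq[OF s4(2) m56]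
   wlim_subseq[OF bspec[OF s5(2), of "(i, j)"] m6] s6(2) by (simp_all add: s_def u_def comp_def)
 with m16 show ?thesis
  by (intro exI[of _ s] exI[of _ "\<lambda>i j. q (i, j)"] exI[of _ "\<lambda>i j \<alpha>. d (i, j, \<alpha>)"] exI[of _ "\<lambda>i j. g (i, j)"] exI[of _ r]
    exI[of _ "\<lambda>i j. qT (i, j)"] exI[of _ rT]) blast
qed

definition "W = {0..T} \<times> Omega"

lemma W_sets [measurable]: "W \<in> sets borel"
 unfolding W_def Omega_def by (intro borel_closed closed_Times) auto

lemma W_finite: "emeasure lborel W < \<infinity>"
 by (rule emeasure_bounded_finite) (auto simp: W_def Omega_def intro: bounded_Times)

text \<open>For fixed \<open>t\<close> the shift is split into a spatial translation at the later
  level and a time increment between the levels of \<open>t\<close> and \<open>t + s0\<close>.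
  Rounding to cells and to time levels costs terms in \<open>h m\<close> and \<open>dt m\<close>,
  the part of the bound that does not vanish with \<epsilon>.\<close>

lemma nrm_translate_Qf:
 assumes e: "0 < \<epsilon>" "\<epsilon> < T" and s: "s \<in> ecube \<epsilon>"
 shows "nrmL (\<lambda>z. ind W z * (Qf i j m (z + s) - Qf i j m z))
  \<le> sqrt T * (3 * \<epsilon> * sqrt (2 * CE / L1) + sqrt \<epsilon> * sqrt (M * CE)) + sqrt T * (3 * h m * sqrt (2 * CE / L1) + sqrt (dt m) * sqrt (M * CE))"
proof -
 obtain s0 s' where s_eq: "s = (s0, s')" by (cases s)
 have s0: "0 \<le> s0" "s0 \<le> \<epsilon>" and s': "\<And>\<alpha>. 0 \<le> s' $ \<alpha> \<and> s' $ \<alpha> \<le> \<epsilon>"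
  using s unfolding s_eq ecube_def zero_prod_def cbox_Pair_eq by (auto simp: mem_box_cart)
 define \<delta> where "\<delta> = 3 * (\<epsilon> + h m) * sqrt (2 * CE / L1) + sqrt (s0 + dt m) * sqrt (M * CE)"
 have \<delta>0: "0 \<le> \<delta>" unfolding \<delta>_def using e less_imp_le[OF mesh_pos[of "N m"]] CE(1) L1_pos M_pos s0 less_imp_le[OF dt_pos[of m]]
  by (intro add_nonneg_nonneg mult_nonneg_nonneg) auto
 define f where "f z = ind W z * (Qf i j m (z + s) - Qf i j m z)" for z
 have fl: "l2L f"
  unfolding f_def[abs_def] by (intro l2_indicator) (simp, rule l2_diff[OF l2_translate[OF Qf_l2] Qf_l2])
 have slice: "(LBINT x. (f (t, x))^2) \<le> ind {0..T} t * \<delta>^2" for t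
 proof (cases "0 \<le> t \<and> t \<le> T")
  case False
  hence "f (t, x) = 0" for x by (auto simp: f_def W_def)
  thus ?thesis using False by simp
 next
  case True
  define n n' where "n = nat \<lfloor>t / dt m\<rfloor>" and "n' = nat \<lfloor>(t + s0) / dt m\<rfloor>"
  have ts: "t < real (nn m) * dt m" "t + s0 < real (nn m) * dt m" "0 \<le> t + s0"
   using True s0 e T_pos unfolding nn_dt by linarith+
  have f1: "real n \<le> t / dt m" "t / dt m < real n + 1" "real n' \<le> (t + s0) / dt m" "(t + s0) / dt m < real n' + 1"
   using True s0 less_imp_le[OF dt_pos[of m]] by (simp_all add: n_def n'_def)
  have nn': "n \<le> n'"
   unfolding n_def n'_def using s0 less_imp_le[OF dt_pos[of m]] by (intro nat_mono floor_mono divide_right_mono) auto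
  have pd: "real (n' - n) * dt m \<le> s0 + dt m"
  proof -
   have "real n' * dt m \<le> t + s0" using f1(3) dt_pos[of m] by (simp add: pos_le_divide_eq)
   moreover have "t < (real n + 1) * dt m" using f1(2) dt_pos[of m] by (simp add: pos_divide_less_eq)
   ultimately show ?thesis using nn' by (simp add: of_nat_diff algebra_simps)
  qed
  define F where "F k = st (h m) (cp i j (Qs m k))" for k
  have Fl: "l2L (F k)" for k unfolding F_def by (rule st_Qs_l2)
  have fx: "f (t, x) = ind W (t, x) * (F n' (x + s') - F n x)" for x
   using True ts by (simp add: f_def Qf_def tsf_def s_eq n_def n'_def F_def)
  have dl: "l2L (\<lambda>x. F n' (x + s') - F n x)" by (rule l2_diff[OF l2_translate[OF Fl] Fl])
  have tr: "nrmL (\<lambda>x. F n' (x + s') - F n x) \<le> \<delta>"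
  proof -
   have "nrmL (\<lambda>x. F n' (x + s') - F n x) \<le> nrmL (\<lambda>x. F n' (x + s') - F n' x) + nrmL (\<lambda>x. F n' x - F n x)"
    by (rule nrm_triangle[OF l2_translate[OF Fl] Fl Fl])
   also have "nrmL (\<lambda>x. F n' (x + s') - F n' x) \<le> 3 * (\<epsilon> + h m) * sqrt (2 * CE / L1)"
    unfolding F_def by (rule nrm_st_translate_vec[OF mesh_pos QS_fs[OF NT_pos] s' nrm_Dp_le])
   also have "nrmL (\<lambda>x. F n' x - F n x) \<le> sqrt (real (n' - n) * dt m) * sqrt (M * CE)"
    using nrm_time_increment[where m = m and i = i and j = j and n = n and p = "n' - n"] nn' by (simp add: F_def)
   also have "\<dots> \<le> sqrt (s0 + dt m) * sqrt (M * CE)" using pd M_pos CE(1) by (intro mult_right_mono) auto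
   finally show ?thesis by (simp add: \<delta>_def)
  qed
  have "(LBINT x. (f (t, x))^2) \<le> (LBINT x. (F n' (x + s') - F n x)^2)"
  proof (rule integral_mono_AE)
   have e: "(ind Omega x * (F n' (x + s') - F n x))^2 = (f (t, x))^2" for x
    using True by (simp add: fx W_def indicator_def)
   have "l2L (\<lambda>x. ind Omega x * (F n' (x + s') - F n x))"
    by (rule l2_indicator[OF _ dl]) (simp add: Omega_def)
   from l2_int[OF this] show "integrable lborel (\<lambda>x. (f (t, x))^2)" unfolding e .
  qed (use l2_int[OF dl] in \<open>auto simp: fx split: split_indicator\<close>)
  also have "\<dots> \<le> \<delta>^2" unfolding nrm_sq[symmetric] by (intro power_mono tr) simp
  finally show ?thesis using True by simp
 qed
 have "(nrmL f)^2 = (LBINT t. \<integral>x. (f (t, x))^2 \<partial>lborel)"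
  unfolding nrm_sq by (rule integral_lborel_pair(1)[OF l2_int[OF fl]])
 also have "\<dots> \<le> (LBINT t. ind {0..T} t * \<delta>^2)"
  by (rule integral_mono) (use integral_lborel_pair(3)[OF l2_int[OF fl]] slice in \<open>auto intro!: integrable_real_indicator emeasure_bounded_finite\<close>)
 also have "\<dots> = (sqrt T * \<delta>)^2" using T_pos by (simp add: power_mult_distrib)
 finally have "nrmL f \<le> sqrt T * \<delta>" by (rule power2_le_imp_le) (use T_pos \<delta>0 in simp)
 also have "\<delta> \<le> (3 * \<epsilon> * sqrt (2 * CE / L1) + sqrt \<epsilon> * sqrt (M * CE)) + (3 * h m * sqrt (2 * CE / L1) + sqrt (dt m) * sqrt (M * CE))"
 proof -
  have "sqrt (s0 + dt m) \<le> sqrt \<epsilon> + sqrt (dt m)"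
   using sqrt_add_le_add_sqrt[of s0 "dt m"] s0 less_imp_le[OF dt_pos[of m]] real_sqrt_le_mono[OF s0(2)] by linarith
  hence "sqrt (s0 + dt m) * sqrt (M * CE) \<le> (sqrt \<epsilon> + sqrt (dt m)) * sqrt (M * CE)"
   using M_pos CE(1) by (intro mult_right_mono) auto
  thus ?thesis by (simp add: \<delta>_def algebra_simps)
 qed
 finally show ?thesis unfolding f_def[abs_def] using T_pos by (simp add: distrib_left mult_left_mono)
qed

lemma Qf_strong:
 assumes "wlimL (Qf i j) q"
 shows "slimL (\<lambda>m z. ind W z * Qf i j m z) (\<lambda>z. ind W z * q z)"
proof (rule strong_of_weak[OF assms W_sets W_finite nrm_translate_Qf])
 have "(\<lambda>m. sqrt T * (3 * h m * sqrt (2 * CE / L1) + sqrt (dt m) * sqrt (M * CE)))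
   \<longlonglongrightarrow> sqrt T * (3 * 0 * sqrt (2 * CE / L1) + sqrt 0 * sqrt (M * CE))"
  by (intro tendsto_intros h_lim dt_lim')
 thus "(\<lambda>m. sqrt T * (3 * h m * sqrt (2 * CE / L1) + sqrt (dt m) * sqrt (M * CE))) \<longlonglongrightarrow> 0" by simp
 fix e :: real assume e: "e > 0"
 define \<omega> where "\<omega> \<epsilon> = sqrt T * (3 * \<epsilon> * sqrt (2 * CE / L1) + sqrt \<epsilon> * sqrt (M * CE))" for \<epsilon>
 have "(\<lambda>n. \<omega> (1 / real (Suc n))) \<longlonglongrightarrow> sqrt T * (3 * 0 * sqrt (2 * CE / L1) + sqrt 0 * sqrt (M * CE))"
  unfolding \<omega>_def by (intro tendsto_intros lim_inverse_n'[THEN LIMSEQ_Suc])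
 hence "(\<lambda>n. \<omega> (1 / real (Suc n))) \<longlonglongrightarrow> 0" by simp
 hence "\<forall>\<^sub>F n in sequentially. \<omega> (1 / real (Suc n)) < e" using e by (intro order_tendstoD) auto
 moreover have "\<forall>\<^sub>F n in sequentially. 1 / real (Suc n) < T"
  using T_pos by (intro order_tendstoD(2)[OF lim_inverse_n'[THEN LIMSEQ_Suc]])
 ultimately have "\<forall>\<^sub>F n in sequentially. \<omega> (1 / real (Suc n)) < e \<and> 1 / real (Suc n) < T" by (rule eventually_conj)
 then obtain n where "\<omega> (1 / real (Suc n)) < e" "1 / real (Suc n) < T" by (auto simp: eventually_sequentially)
 thus "\<exists>\<epsilon>>0. \<epsilon> < T \<and> \<omega> \<epsilon> < e" by (intro exI[of _ "1 / real (Suc n)"]) auto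
qed

lemma Qf_support: assumes "x \<notin> box 0 1" shows "Qf i j m (t, x) = 0" and "Rf m (t, x) = 0"
proof -
 have "\<not> in_grid (N m) (cell_index (h m) x)"
  using grid_cell_subset in_cell_index[OF mesh_pos, of x "N m"] assms by blast
 hence "st (h m) (cp i j (Qs m n)) x = 0" "st (h m) (Rs m n) x = 0" for n
  using scheme_step(2,3)[OF NT_pos[of m], of "N m" n] by (auto simp: st_def bc_def)
 thus "Qf i j m (t, x) = 0" "Rf m (t, x) = 0" by (simp_all add: Qf_def Rf_def tsf_def)
qed

lemma TI_Qf: "ind W z * Qf i j m z = TI T z * Qf i j m z"
proof (cases z)
 case (Pair t x)
 thus ?thesis
  using Qf_support(1)[of x i j m t] box_subset_cbox[of 0 "1::pt"]
  by (cases "x \<in> box 0 1") (auto simp: W_def TI_def Omega_def indicator_def)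
qed

end

section \<open>Sampled test functions\<close>

lemma frechet_mvt:
 fixes f :: "'a::euclidean_space \<Rightarrow> real"
 assumes f: "\<And>z. f differentiable (at z)" and \<tau>: "\<tau> > 0"
 shows "\<exists>\<theta>. 0 \<le> \<theta> \<and> \<theta> \<le> \<tau> \<and> f (z + \<tau> *\<^sub>R v) - f z = \<tau> * frechet_derivative f (at (z + \<theta> *\<^sub>R v)) v"
proof -
 have D: "((\<lambda>s. f (z + s *\<^sub>R v)) has_real_derivative frechet_derivative f (at (z + s *\<^sub>R v)) v) (at s)" for s
 proof -
  have 1: "((\<lambda>s. z + s *\<^sub>R v) has_derivative (\<lambda>t. t *\<^sub>R v)) (at s)" by (auto intro!: derivative_eq_intros)
  have 2: "(f has_derivative frechet_derivative f (at (z + s *\<^sub>R v))) (at (z + s *\<^sub>R v))"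
   using f by (simp add: frechet_derivative_works)
  have "(\<lambda>t. frechet_derivative f (at (z + s *\<^sub>R v)) (t *\<^sub>R v)) = (*) (frechet_derivative f (at (z + s *\<^sub>R v)) v)"
   using has_derivative_linear[OF 2] by (auto simp: linear_cmul)
  with has_derivative_compose[OF 1 2] show ?thesis by (simp add: has_field_derivative_def)
 qed
 obtain \<theta> where "0 < \<theta>" "\<theta> < \<tau>" "f (z + \<tau> *\<^sub>R v) - f (z + 0 *\<^sub>R v) = (\<tau> - 0) * frechet_derivative f (at (z + \<theta> *\<^sub>R v)) v"
  using MVT2[OF \<tau>, of "\<lambda>s. f (z + s *\<^sub>R v)", OF D] by blast
 thus ?thesis by (intro exI[of _ \<theta>]) auto
qed

definition gp :: "real \<Rightarrow> idx \<Rightarrow> pt" where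
 "gp h k = (\<chi> \<alpha>. h * real_of_int (k$\<alpha>))"

lemma gp_plus: "gp h (k + axis \<alpha> 1) = gp h k + h *\<^sub>R axis \<alpha> 1"
 by (simp add: gp_def vec_eq_iff axis_def distrib_left)

lemma gp_dist: assumes "h > 0" shows "norm (gp h (cell_index h x) - x) \<le> 3 * h"
 by (rule cell_dist[OF assms in_cell_index[OF assms]]) (use assms in \<open>simp add: cell_def gp_def mult.commute\<close>)

lemma gp_box: assumes "gp (mesh N) k \<in> box 0 1" shows "in_grid N k"
proof -
 have "1 \<le> k$\<alpha> \<and> k$\<alpha> \<le> int N" for \<alpha>
 proof -
  have "0 < mesh N * real_of_int (k$\<alpha>)" "mesh N * real_of_int (k$\<alpha>) < 1"
   using assms by (auto simp: mem_box_cart gp_def)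
  hence "0 < real_of_int (k$\<alpha>)" "real_of_int (k$\<alpha>) < real N + 1"
   using mesh_pos[of N] by (auto simp: zero_less_mult_iff mesh_def divide_simps)
  thus ?thesis by linarith
 qed
 thus ?thesis by (simp add: in_grid_def)
qed

lemma mesh_le_1: "mesh N \<le> 1" by (simp add: mesh_def)

lemma norm_gp_le: assumes "y \<in> cbox (vec (-1)) (vec 2)" shows "norm (y::pt) \<le> 6"
proof -
 have "\<bar>y$\<alpha>\<bar> \<le> 2" for \<alpha> using assms by (auto simp: mem_box_cart abs_le_iff intro: order_trans[of _ 1])
 hence "(\<Sum>\<alpha>. \<bar>y$\<alpha>\<bar>) \<le> (\<Sum>\<alpha>\<in>(UNIV::3 set). 2)" by (intro sum_mono)
 thus ?thesis using norm_le_l1_cart[of y] by simp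
qed

text \<open>The properties shared by both kinds of space-time test functions and inherited by the
  components of matrix valued ones.\<close>

definition tst :: "real \<Rightarrow> (real \<times> pt \<Rightarrow> real) \<Rightarrow> bool" where
 "tst T \<phi> \<longleftrightarrow> (\<forall>z. \<phi> differentiable (at z)) \<and>
   (\<forall>v\<in>Basis. continuous_on UNIV (\<lambda>z. frechet_derivative \<phi> (at z) v)) \<and>
   (\<forall>t x. 0 \<le> t \<longrightarrow> t \<le> T \<longrightarrow> x \<notin> box 0 1 \<longrightarrow> \<phi> (t, x) = 0)"

lemma tstD:
 assumes "tst T \<phi>"
 shows "\<phi> differentiable (at z)" "continuous_on UNIV \<phi>" "continuous_on UNIV (pd_x \<alpha> \<phi>)" (is ?g3) "continuous_on UNIV (pd_t \<phi>)" (is ?g4)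
  "0 \<le> t \<Longrightarrow> t \<le> T \<Longrightarrow> x \<notin> box 0 1 \<Longrightarrow> \<phi> (t, x) = 0"
proof -
 have d: "\<phi> differentiable (at z)" for z using assms unfolding tst_def by blast
 show "\<phi> differentiable (at z)" by (rule d)
 show "continuous_on UNIV \<phi>"
  by (intro continuous_at_imp_continuous_on ballI differentiable_imp_continuous_within d)
 have c: "\<And>v. v \<in> Basis \<Longrightarrow> continuous_on UNIV (\<lambda>z. frechet_derivative \<phi> (at z) v)"
  using assms unfolding tst_def by blast
 have "(0, axis \<alpha> 1) \<in> (Basis :: (real \<times> pt) set)" "(1, 0) \<in> (Basis :: (real \<times> pt) set)"
  by (simp_all add: Basis_prod_def axis_in_Basis_iff)
 from this[THEN c] show ?g3 ?g4
  by (simp_all add: pd_x_def[abs_def] pd_t_def[abs_def])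
 show "0 \<le> t \<Longrightarrow> t \<le> T \<Longrightarrow> x \<notin> box 0 1 \<Longrightarrow> \<phi> (t, x) = 0"
  using assms by (simp add: tst_def)
qed

text \<open>The slice \<open>t = T\<close> is invisible to space-time integrals. There half-open
  time steps and closed time intervals disagree, and there the solution is redefined.\<close>

lemma AE_time_neq: "AE z in lborel. fst (z :: real \<times> pt) \<noteq> T"
proof -
 have "negligible {z :: real \<times> pt. z \<bullet> (1, 0) = T}"
  by (rule negligible_standard_hyperplane) (simp add: Basis_prod_def)
 hence "{z :: real \<times> pt. fst z = T} \<in> null_sets lebesgue" by (simp add: negligible_iff_null_sets inner_prod_def)
 moreover have "{z :: real \<times> pt. fst z = T} \<in> sets borel" by (intro borel_closed closed_Collect_eq continuous_intros)
 ultimately have "{z :: real \<times> pt. fst z = T} \<in> null_sets lborel"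
  by (simp add: null_sets_def)
 thus ?thesis by (rule AE_I'[of _ lborel]) auto
qed

context scheme_seq
begin

definition "smp \<phi> m n k = \<phi> (real n * dt m, gp (h m) k)"

lemma dt_le: "dt m \<le> T"
 using NT_pos[of m] T_pos by (simp add: dT_def divide_le_eq)

lemma time_le: "n \<le> NT m \<Longrightarrow> real n * dt m \<le> T"
 using mult_right_mono[of "real n" "real (NT m)" "dt m"] less_imp_le[OF dt_pos[of m]] NT_dt[of m] by simp

lemma smp_bc: assumes "tst T \<phi>" "n \<le> NT m" shows "bc (N m) (smp \<phi> m n)"
 unfolding bc_def smp_def
 using tstD(5)[OF assms(1) _ time_le[OF assms(2)]] gp_box[of "N m"] less_imp_le[OF dt_pos[of m]] by auto

text \<open>\<open>near\<close> covers sampled values and, through the mean value theorem,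
  difference quotients in space and time. The box in \<open>supp\<close> is larger than the cube
  because a forward difference can be nonzero one cell before the support of the test
  function.\<close>

lemma sampling:
 assumes c: "continuous_on UNIV \<psi>"
  and near: "\<And>m n k. n < NT m \<Longrightarrow> \<exists>\<zeta>. norm (\<zeta> - (real n * dt m, gp (h m) k)) \<le> dt m + h m \<and> K m n k = \<psi> \<zeta>"
  and supp: "\<And>m n k. n < NT m \<Longrightarrow> K m n k \<noteq> 0 \<Longrightarrow> gp (h m) k \<in> cbox (vec (-1)) (vec 2)"
 shows "slimL (\<lambda>m. tsf (dt m) (NT m) (\<lambda>n. st (h m) (K m n))) (\<lambda>z. TI T z * \<psi> z)" (is ?S)
  and "AE z in lborel. (\<lambda>m. tsf (dt m) (NT m) (\<lambda>n. st (h m) (K m n)) z) \<longlonglongrightarrow> TI T z * \<psi> z" (is ?A)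
  and "\<exists>B. \<forall>m z. \<bar>tsf (dt m) (NT m) (\<lambda>n. st (h m) (K m n)) z\<bar> \<le> B" (is ?B)
proof -
 define F where "F m = tsf (dt m) (NT m) (\<lambda>n. st (h m) (K m n))" for m
 have F0: "F m z = 0" if "\<not> (0 \<le> fst z \<and> fst z < T)" for m z
  using that NT_dt[of m] by (auto simp: F_def tsf_def)
 have np: "norm (u :: real \<times> pt) \<le> \<bar>fst u\<bar> + norm (snd u)" for u
  using norm_Pair_le[of "fst u" "snd u"] by simp
 have FK: "\<exists>\<zeta>. F m z = \<psi> \<zeta> \<and> norm (\<zeta> - z) \<le> 2 * dt m + 4 * h m \<and> (F m z \<noteq> 0 \<longrightarrow> norm z \<le> T + 10)" if z: "0 \<le> fst z" "fst z < T" for m z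
 proof -
  define n k where "n = nat \<lfloor>fst z / dt m\<rfloor>" and "k = cell_index (h m) (snd z)"
  define g where "g = (real n * dt m, gp (h m) k)"
  have n: "n < NT m" unfolding n_def using time_index_less[OF dt_pos z(1)] z(2) NT_dt by simp
  have "real n * dt m \<le> fst z" "fst z < (real n + 1) * dt m"
   using time_index[OF dt_pos[of m], of "fst z" n] z by (simp_all add: n_def)
  hence t: "\<bar>real n * dt m - fst z\<bar> \<le> dt m" by (simp add: algebra_simps abs_le_iff)
  have x: "norm (gp (h m) k - snd z) \<le> 3 * h m" unfolding k_def by (rule gp_dist[OF mesh_pos])
  have F: "F m z = K m n k" using z NT_dt[of m] by (simp add: F_def tsf_def n_def k_def st_def)
  obtain \<zeta> where \<zeta>: "norm (\<zeta> - g) \<le> dt m + h m" "K m n k = \<psi> \<zeta>" using near[OF n] unfolding g_def by blast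
  have "norm (\<zeta> - z) \<le> 2 * dt m + 4 * h m"
   using norm_triangle_ineq[of "\<zeta> - g" "g - z"] np[of "g - z"] \<zeta>(1) t x by (simp add: g_def)
  moreover have "norm z \<le> T + 10" if "F m z \<noteq> 0"
   using norm_gp_le[OF supp[OF n, of k]] that F np[of z] norm_triangle_ineq2[of "snd z" "gp (h m) k"] x z mesh_le_1[of "N m"]
   by (simp add: norm_minus_commute)
  ultimately show ?thesis using F \<zeta>(2) by (intro exI[of _ \<zeta>]) simp
 qed
 have ptw: "(\<lambda>m. F m z) \<longlonglongrightarrow> TI T z * \<psi> z" if z: "fst z \<noteq> T" for z
 proof (cases "0 \<le> fst z \<and> fst z < T")
  case False
  thus ?thesis using z by (auto simp: F0 TI_def indicator_def)
 next
  case True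
  then obtain Z where Z: "\<And>m. F m z = \<psi> (Z m)" "\<And>m. norm (Z m - z) \<le> 2 * dt m + 4 * h m" using FK[of z] by metis
  have "(\<lambda>m. 2 * dt m + 4 * h m) \<longlonglongrightarrow> 2 * 0 + 4 * 0" by (intro tendsto_intros dt_lim' h_lim)
  hence "(\<lambda>m. Z m - z) \<longlonglongrightarrow> 0" by (intro Lim_null_comparison[OF always_eventually[OF allI[OF Z(2)]]]) simp
  hence "Z \<longlonglongrightarrow> z" by (simp add: LIM_zero_iff)
  hence "(\<lambda>m. \<psi> (Z m)) \<longlonglongrightarrow> \<psi> z" by (rule continuous_on_tendsto_compose[OF c]) auto
  thus ?thesis using True by (simp add: Z TI_def)
 qed
 have "compact (\<psi> ` cball 0 (3 * T + 14))"
  by (intro compact_continuous_image continuous_on_subset[OF c]) auto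
 from compact_imp_bounded[OF this] obtain B where B: "\<And>\<zeta>. norm \<zeta> \<le> 3 * T + 14 \<Longrightarrow> \<bar>\<psi> \<zeta>\<bar> \<le> B"
  unfolding bounded_iff by force
 have B0: "0 \<le> B" using B[of 0] T_pos by force
 have dom: "\<bar>F m z\<bar> \<le> B * ind (cball 0 (T + 10)) z" for m z
 proof (cases "F m z = 0")
  case False
  hence z: "0 \<le> fst z" "fst z < T" using F0 by blast+
  obtain \<zeta> where *: "F m z = \<psi> \<zeta>" "norm (\<zeta> - z) \<le> 2 * dt m + 4 * h m" "norm z \<le> T + 10" using FK[OF z, of m] False by blast
  have "norm \<zeta> \<le> 3 * T + 14"
   using *(2,3) norm_triangle_ineq2[of \<zeta> z] dt_le[of m] mesh_le_1[of "N m"] by linarith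
  thus ?thesis using B * by simp
 qed (use B0 in simp)
 have Fm: "F m \<in> bm" for m
  unfolding F_def by (rule tsf_measurable[OF dt_pos]) measurable
 have A: "AE z in lborel. (\<lambda>m. F m z) \<longlonglongrightarrow> TI T z * \<psi> z" using AE_time_neq[of T] by eventually_elim (rule ptw)
 have "slimL F (\<lambda>z. TI T z * \<psi> z)"
  by (rule slim_dominated[OF _ _ l2_cball_const A AE_I2[OF dom]]) (use Fm borel_measurable_continuous_onI[OF c] in auto)
 thus ?S by (simp add: F_def[abs_def])
 show ?A using A by (simp add: F_def)
 have "\<bar>F m z\<bar> \<le> B" for m z using dom[of m z] B0 by (cases "z \<in> cball 0 (T + 10)") auto
 thus ?B unfolding F_def by blast
qed

lemma smp_support: assumes "tst T \<phi>" "n \<le> NT m" "smp \<phi> m n k \<noteq> 0" shows "gp (h m) k \<in> box 0 1"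
 using tstD(5)[OF assms(1) _ time_le[OF assms(2)]] assms(3) less_imp_le[OF dt_pos[of m]] by (auto simp: smp_def)

lemma box_enlarged: "y \<in> box 0 (1::pt) \<Longrightarrow> y \<in> cbox (vec (-1)) (vec 2)"
 unfolding mem_box_cart by (auto simp: less_eq_real_def) (smt (verit))+

lemma smp_limits:
 assumes p: "tst T \<phi>"
 shows "slimL (\<lambda>m. tsf (dt m) (NT m) (\<lambda>n. st (h m) (smp \<phi> m n))) (\<lambda>z. TI T z * \<phi> z)" (is ?g1)
  and "AE z in lborel. (\<lambda>m. tsf (dt m) (NT m) (\<lambda>n. st (h m) (smp \<phi> m n)) z) \<longlonglongrightarrow> TI T z * \<phi> z" (is ?g2)
  and "\<exists>B. \<forall>m z. \<bar>tsf (dt m) (NT m) (\<lambda>n. st (h m) (smp \<phi> m n)) z\<bar> \<le> B" (is ?g3)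
  and "slimL (\<lambda>m. tsf (dt m) (NT m) (\<lambda>n. st (h m) (Dplus (h m) \<alpha> (smp \<phi> m n)))) (\<lambda>z. TI T z * pd_x \<alpha> \<phi> z)" (is ?g4)
  and "slimL (\<lambda>m. tsf (dt m) (NT m) (\<lambda>n. st (h m) (\<lambda>k. (smp \<phi> m (Suc n) k - smp \<phi> m n k) / dt m))) (\<lambda>z. TI T z * pd_t \<phi> z)" (is ?g5)
proof -
 have pos: "0 \<le> dt m + h m" for m using less_imp_le[OF dt_pos[of m]] less_imp_le[OF mesh_pos[of "N m"]] by linarith
 have n1: "\<exists>\<zeta>. norm (\<zeta> - (real n * dt m, gp (h m) k)) \<le> dt m + h m \<and> smp \<phi> m n k = \<phi> \<zeta>" for m n k
  by (rule exI[of _ "(real n * dt m, gp (h m) k)"]) (use pos in \<open>simp add: smp_def\<close>)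
 note s1 = smp_support[OF p less_imp_le, THEN box_enlarged]
 show ?g1
  ?g2
  ?g3
  by (rule sampling[OF tstD(2)[OF p] n1 s1], assumption+)+
 show ?g4
 proof (rule sampling(1)[OF tstD(3)[OF p]])
  fix m n k
  obtain \<theta> where \<theta>: "0 \<le> \<theta>" "\<theta> \<le> h m" "\<phi> ((real n * dt m, gp (h m) k) + h m *\<^sub>R (0, axis \<alpha> 1)) - \<phi> (real n * dt m, gp (h m) k)
    = h m * frechet_derivative \<phi> (at ((real n * dt m, gp (h m) k) + \<theta> *\<^sub>R (0, axis \<alpha> 1))) (0, axis \<alpha> 1)"
   using frechet_mvt[OF tstD(1)[OF p] mesh_pos] by blast
  hence "Dplus (h m) \<alpha> (smp \<phi> m n) k = pd_x \<alpha> \<phi> ((real n * dt m, gp (h m) k) + \<theta> *\<^sub>R (0, axis \<alpha> 1))"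
   using less_imp_neq[OF mesh_pos[of "N m"]] by (simp add: Dplus_def smp_def gp_plus pd_x_def)
  thus "\<exists>\<zeta>. norm (\<zeta> - (real n * dt m, gp (h m) k)) \<le> dt m + h m \<and> Dplus (h m) \<alpha> (smp \<phi> m n) k = pd_x \<alpha> \<phi> \<zeta>"
   using \<theta> less_imp_le[OF dt_pos[of m]] by (intro exI[of _ "(real n * dt m, gp (h m) k) + \<theta> *\<^sub>R (0, axis \<alpha> 1)"]) (simp add: norm_Pair)
  assume n: "n < NT m" and nz: "Dplus (h m) \<alpha> (smp \<phi> m n) k \<noteq> 0"
  hence "smp \<phi> m n k \<noteq> 0 \<or> smp \<phi> m n (k + axis \<alpha> 1) \<noteq> 0" by (auto simp: Dplus_def)
  hence b: "gp (h m) k \<in> box 0 1 \<or> gp (h m) k + h m *\<^sub>R axis \<alpha> 1 \<in> box 0 1"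
   using smp_support[OF p less_imp_le[OF n]] by (metis gp_plus)
  show "gp (h m) k \<in> cbox (vec (-1)) (vec 2)"
  proof (cases "gp (h m) k \<in> box 0 1")
   case True
   thus ?thesis by (rule box_enlarged)
  next
   case False
   hence b: "0 < gp (h m) k $ \<beta> + h m * axis \<alpha> 1 $ \<beta> \<and> gp (h m) k $ \<beta> + h m * axis \<alpha> 1 $ \<beta> < 1" for \<beta>
    using b unfolding mem_box_cart by auto
   have "0 \<le> h m * axis \<alpha> 1 $ \<beta> \<and> h m * axis \<alpha> 1 $ \<beta> \<le> 1" for \<beta>
    using mesh_le_1[of "N m"] less_imp_le[OF mesh_pos[of "N m"]] by (simp add: axis_def)
   hence "- 1 \<le> gp (h m) k $ \<beta> \<and> gp (h m) k $ \<beta> \<le> 2" for \<beta> using b[of \<beta>] by (smt (verit))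
   thus ?thesis by (simp add: mem_box_cart)
  qed
 qed
 show ?g5
 proof (rule sampling(1)[OF tstD(4)[OF p]])
  fix m n k
  obtain \<theta> where \<theta>: "0 \<le> \<theta>" "\<theta> \<le> dt m" "\<phi> ((real n * dt m, gp (h m) k) + dt m *\<^sub>R (1, 0)) - \<phi> (real n * dt m, gp (h m) k)
    = dt m * frechet_derivative \<phi> (at ((real n * dt m, gp (h m) k) + \<theta> *\<^sub>R (1, 0))) (1, 0)"
   using frechet_mvt[OF tstD(1)[OF p] dt_pos] by blast
  hence "(smp \<phi> m (Suc n) k - smp \<phi> m n k) / dt m = pd_t \<phi> ((real n * dt m, gp (h m) k) + \<theta> *\<^sub>R (1, 0))"
   using less_imp_neq[OF dt_pos[of m]] by (simp add: smp_def pd_t_def distrib_right add.commute)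
  thus "\<exists>\<zeta>. norm (\<zeta> - (real n * dt m, gp (h m) k)) \<le> dt m + h m \<and> (smp \<phi> m (Suc n) k - smp \<phi> m n k) / dt m = pd_t \<phi> \<zeta>"
   using \<theta> less_imp_le[OF mesh_pos[of "N m"]] by (intro exI[of _ "(real n * dt m, gp (h m) k) + \<theta> *\<^sub>R (1, 0)"]) (simp add: norm_Pair)
  assume "n < NT m" "(smp \<phi> m (Suc n) k - smp \<phi> m n k) / dt m \<noteq> 0"
  hence "smp \<phi> m n k \<noteq> 0 \<or> smp \<phi> m (Suc n) k \<noteq> 0" "n \<le> NT m" "Suc n \<le> NT m" by auto
  thus "gp (h m) k \<in> cbox (vec (-1)) (vec 2)" using smp_support[OF p] box_enlarged by blast
 qed
qed

lemma slim_smp_Dcent: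
 assumes p: "tst T \<phi>"
 shows "slimL (\<lambda>m. tsf (dt m) (NT m) (\<lambda>n. st (h m) (Dcent (h m) \<alpha> (smp \<phi> m n)))) (\<lambda>z. TI T z * pd_x \<alpha> \<phi> z)"
proof -
 have "(\<lambda>m. (0::real, - (h m *\<^sub>R axis \<alpha> (1::real)))) \<longlonglongrightarrow> (0, - (0 *\<^sub>R axis \<alpha> 1))" by (intro tendsto_intros h_lim)
 hence a: "(\<lambda>m. (0::real, - (h m *\<^sub>R axis \<alpha> (1::real)))) \<longlonglongrightarrow> 0" by (simp add: zero_prod_def)
 note s = smp_limits(4)[OF p, of \<alpha>]
 have e: "tsf (dt m) (NT m) (\<lambda>n. st (h m) (Dcent (h m) \<alpha> (smp \<phi> m n))) z =
  1/2 * tsf (dt m) (NT m) (\<lambda>n. st (h m) (Dplus (h m) \<alpha> (smp \<phi> m n))) z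
  + 1/2 * tsf (dt m) (NT m) (\<lambda>n. st (h m) (Dplus (h m) \<alpha> (smp \<phi> m n))) (z + (0, - (h m *\<^sub>R axis \<alpha> 1)))" for m z
  by (simp add: tsf_def st_Dcent)
 show ?thesis unfolding e[abs_def] using slim_add[OF slim_cmult[OF s] slim_cmult[OF slim_translate[OF s a]], of "1/2" "1/2"] by simp
qed

lemma slim_smp_slice:
 assumes p: "tst T \<phi>" and n: "\<And>m. n m \<le> NT m" "\<And>m. real (n m) * dt m = t"
 shows "slimL (\<lambda>m. st (h m) (smp \<phi> m (n m))) (\<lambda>x. \<phi> (t, x))"
proof (rule slim_local[where R = 4 and \<rho> = "\<lambda>m. 3 * h m"])
 show "continuous_on UNIV (\<lambda>x. \<phi> (t, x))"
  by (rule continuous_on_compose2[OF tstD(2)[OF p]]) (auto intro!: continuous_intros)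
 have t: "0 \<le> t" "t \<le> T" using time_le[OF n(1), of 0] n(2)[of 0] less_imp_le[OF dt_pos[of 0]] by (metis mult_nonneg_nonneg of_nat_0_le_iff)+
 show "\<phi> (t, x) = 0" if "norm x \<ge> 4" for x by (rule tstD(5)[OF p t box_norm[OF that]])
 show "(\<lambda>m. 3 * h m) \<longlonglongrightarrow> 0" using tendsto_mult[OF tendsto_const h_lim, of 3] by simp
 show "\<bar>st (h m) (smp \<phi> m (n m)) x - c\<bar> \<le> \<eta>" if "\<And>y. norm (y - x) \<le> 3 * h m \<Longrightarrow> \<bar>\<phi> (t, y) - c\<bar> \<le> \<eta>" for m x c \<eta>
  using that[OF gp_dist[OF mesh_pos]] by (simp add: st_def smp_def n)
qed simp

end

section \<open>Passage to the limit in the equations\<close>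

lemma norm_mat3_le: "norm (A::mat3) \<le> (\<Sum>i j. \<bar>A$i$j\<bar>)"
proof -
 have "norm A = norm (\<Sum>i j. A$i$j *\<^sub>R (axis i (axis j 1) :: mat3))" by (subst mat3_expand) simp
 also have "\<dots> \<le> (\<Sum>i j. norm (A$i$j *\<^sub>R (axis i (axis j 1) :: mat3)))"
  by (intro order_trans[OF norm_sum sum_mono] norm_sum)
 finally show ?thesis by (simp add: norm_Basis axis_in_Basis_iff)
qed

context scheme_seq
begin

text \<open>The weights \<kappa> and \<mu> cover the new level, the old level and their mean. The
  weak factor runs over \<open>[0, 3 T)\<close> and the test factor over \<open>[0, T)\<close>,
  which leaves room for the index shift.\<close>

lemma pair_limit:
 assumes u: "wlimL (\<lambda>m. tsf (dt m) (nn m) (\<lambda>n. st (h m) (F m n))) u"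
  and G: "slimL (\<lambda>m. tsf (dt m) (NT m) (\<lambda>n. st (h m) (G m n))) \<gamma>" "\<And>z. TI T z * \<gamma> z = \<gamma> z"
  and F: "\<And>m n. fs (F m n)"
 shows "(\<lambda>m. dt m * (\<Sum>n<NT m. IP (h m) (\<lambda>k. \<kappa> * F m (Suc n) k + \<mu> * F m n k) (G m n))) \<longlonglongrightarrow> (\<kappa> + \<mu>) * (LBINT z. u z * \<gamma> z)"
proof -
 have i: "dt m * (\<Sum>n<NT m. IP (h m) (K m n) (G m n)) = (LBINT z. tsf (dt m) (nn m) (\<lambda>n. st (h m) (K m n)) z * tsf (dt m) (NT m) (\<lambda>n. st (h m) (G m n)) z)"
  if K: "\<And>m n. fs (K m n)" for K :: "nat \<Rightarrow> nat \<Rightarrow> idx \<Rightarrow> real" and m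
 proof -
  have "dt m * (\<Sum>n<NT m. IP (h m) (K m n) (G m n)) = (LBINT z. tsf (dt m) (NT m) (\<lambda>n x. st (h m) (K m n) x * st (h m) (G m n) x) z)"
   unfolding IP_def by (rule tsf_integral(2)[OF dt_pos, symmetric]) (use IP_int[OF mesh_pos] K in blast)
  also have "tsf (dt m) (NT m) (\<lambda>n x. st (h m) (K m n) x * st (h m) (G m n) x) =
   (\<lambda>z. tsf (dt m) (nn m) (\<lambda>n. st (h m) (K m n)) z * tsf (dt m) (NT m) (\<lambda>n. st (h m) (G m n)) z)"
   using NT_dt[of m] nn_dt[of m] T_pos by (auto simp: tsf_def fun_eq_iff)
  finally show ?thesis .
 qed
 have "(\<lambda>m. dt m * (\<Sum>n<NT m. IP (h m) (F m n) (G m n))) \<longlonglongrightarrow> (LBINT z. u z * \<gamma> z)"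
  unfolding i[of F, OF F] by (rule wlim_slim[OF u G(1)])
 moreover have "(\<lambda>m. dt m * (\<Sum>n<NT m. IP (h m) (F m (Suc n)) (G m n))) \<longlonglongrightarrow> (LBINT z. u z * \<gamma> z)"
 proof -
  have "T + dt m < real (nn m) * dt m" "nn m > 0" for m
   using dt_le[of m] T_pos NT_pos[of m] unfolding nn_dt by auto
  hence w: "wlimL (\<lambda>m z. TI T z * tsf (dt m) (nn m) (\<lambda>n. st (h m) (F m (Suc n))) z) (\<lambda>z. TI T z * u z)"
   by (intro wlim_time_shift[OF u dt_lim' dt_pos]) (auto intro: st_l2[OF mesh_pos F])
  have e: "tsf (dt m) (nn m) (\<lambda>n. st (h m) (F m (Suc n))) z * tsf (dt m) (NT m) (\<lambda>n. st (h m) (G m n)) z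
   = (TI T z * tsf (dt m) (nn m) (\<lambda>n. st (h m) (F m (Suc n))) z) * tsf (dt m) (NT m) (\<lambda>n. st (h m) (G m n)) z" for m z
   using NT_dt[of m] by (auto simp: tsf_def TI_def indicator_def)
  have "(\<lambda>m. dt m * (\<Sum>n<NT m. IP (h m) (F m (Suc n)) (G m n))) \<longlonglongrightarrow> (LBINT z. (TI T z * u z) * \<gamma> z)"
   unfolding i[of "\<lambda>m n. F m (Suc n)", OF F] e by (rule wlim_slim[OF w G(1)])
  also have "(LBINT z. (TI T z * u z) * \<gamma> z) = (LBINT z. u z * (TI T z * \<gamma> z))" by (simp add: mult_ac)
  finally show ?thesis by (simp add: G(2))
 qed
 ultimately have "(\<lambda>m. \<kappa> * (dt m * (\<Sum>n<NT m. IP (h m) (F m (Suc n)) (G m n))) + \<mu> * (dt m * (\<Sum>n<NT m. IP (h m) (F m n) (G m n))))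
   \<longlonglongrightarrow> \<kappa> * (LBINT z. u z * \<gamma> z) + \<mu> * (LBINT z. u z * \<gamma> z)" by (intro tendsto_intros)
 moreover have "IP (h m) (\<lambda>k. \<kappa> * F m (Suc n) k + \<mu> * F m n k) (G m n) = \<kappa> * IP (h m) (F m (Suc n)) (G m n) + \<mu> * IP (h m) (F m n) (G m n)" for m n
  by (simp add: IP_add_left[OF mesh_pos fs_mult2[OF F] fs_mult2[OF F]] IP_cmult_left)
 ultimately show ?thesis by (simp add: sum.distrib distrib_left distrib_right sum_distrib_left mult_ac)
qed

text \<open>Abel summation in time. It pairs the new level of \<open>F\<close> with the difference
  quotient of the test function, the case \<open>\<kappa> = 1\<close>, \<open>\<mu> = 0\<close> of
  \<open>pair_limit\<close>; the end terms converge by the separate limits at the levels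
  \<open>0\<close> and \<open>NT m\<close>.\<close>

lemma time_by_parts:
 assumes u: "wlimL (\<lambda>m. tsf (dt m) (nn m) (\<lambda>n. st (h m) (F m n))) u"
  and uT: "wlimL (\<lambda>m. st (h m) (F m (NT m))) uT" and u0: "wlimL (\<lambda>m. st (h m) (F m 0)) u0"
  and F: "\<And>m n. fs (F m n)" and p: "tst T \<phi>"
  and S: "(\<lambda>m. dt m * (\<Sum>n<NT m. IP (h m) (\<lambda>k. (F m (Suc n) k - F m n k) / dt m) (smp \<phi> m n))) \<longlonglongrightarrow> S"
 shows "S = (LBINT x. uT x * \<phi> (T, x)) - (LBINT x. u0 x * \<phi> (0, x)) - (LBINT z. u z * (TI T z * pd_t \<phi> z))"
proof (rule LIMSEQ_unique[OF S])
 have s: "dt m * (\<Sum>n<NT m. IP (h m) (\<lambda>k. (F m (Suc n) k - F m n k) / dt m) (smp \<phi> m n)) =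
  (LBINT x. st (h m) (F m (NT m)) x * st (h m) (smp \<phi> m (NT m)) x) - (LBINT x. st (h m) (F m 0) x * st (h m) (smp \<phi> m 0) x)
  - dt m * (\<Sum>n<NT m. IP (h m) (\<lambda>k. 1 * F m (Suc n) k + 0 * F m n k) (\<lambda>k. (smp \<phi> m (Suc n) k - smp \<phi> m n k) / dt m))" for m
 proof -
  have fp: "fs (smp \<phi> m n)" if "n \<le> NT m" for n by (rule bc_fs[OF smp_bc[OF p that]])
  have "dt m * IP (h m) (\<lambda>k. (F m (Suc n) k - F m n k) / dt m) (smp \<phi> m n)
    + dt m * IP (h m) (F m (Suc n)) (\<lambda>k. (smp \<phi> m (Suc n) k - smp \<phi> m n k) / dt m)
   = IP (h m) (F m (Suc n)) (smp \<phi> m (Suc n)) - IP (h m) (F m n) (smp \<phi> m n)" if "n < NT m" for n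
   using that IP_diff_left[OF mesh_pos F F, of "N m" m "Suc n" m n "smp \<phi> m n"] IP_diff_right[OF mesh_pos fp fp, of "Suc n" n "N m" "F m (Suc n)"]
    IP_cmult_left[of "h m" "dt m" "\<lambda>k. (F m (Suc n) k - F m n k) / dt m" "smp \<phi> m n"]
    IP_cmult_right[of "h m" "F m (Suc n)" "dt m" "\<lambda>k. (smp \<phi> m (Suc n) k - smp \<phi> m n k) / dt m"]
    less_imp_neq[OF dt_pos[of m]] by simp
  hence "(\<Sum>n<NT m. dt m * IP (h m) (\<lambda>k. (F m (Suc n) k - F m n k) / dt m) (smp \<phi> m n)
    + dt m * IP (h m) (F m (Suc n)) (\<lambda>k. (smp \<phi> m (Suc n) k - smp \<phi> m n k) / dt m))
   = IP (h m) (F m (NT m)) (smp \<phi> m (NT m)) - IP (h m) (F m 0) (smp \<phi> m 0)"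
   unfolding sum_lessThan_telescope[of "\<lambda>n. IP (h m) (F m n) (smp \<phi> m n)", symmetric] by (intro sum.cong) auto
  thus ?thesis by (simp add: IP_def[symmetric] sum.distrib sum_distrib_left)
 qed
 have t: "NT m \<le> NT m" "real (NT m) * dt m = T" "0 \<le> NT m" "real 0 * dt m = 0" for m by (simp_all add: NT_dt)
 have g: "TI T z * (TI T z * pd_t \<phi> z) = TI T z * pd_t \<phi> z" for z by (simp add: TI_def indicator_def)
 have "(\<lambda>m. dt m * (\<Sum>n<NT m. IP (h m) (\<lambda>k. (F m (Suc n) k - F m n k) / dt m) (smp \<phi> m n))) \<longlonglongrightarrow>
  (LBINT x. uT x * \<phi> (T, x)) - (LBINT x. u0 x * \<phi> (0, x)) - (1 + 0) * (LBINT z. u z * (TI T z * pd_t \<phi> z))"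
  unfolding s
  by (intro tendsto_diff wlim_slim[OF uT slim_smp_slice[OF p t(1,2)]] wlim_slim[OF u0 slim_smp_slice[OF p t(3,4)]]
    pair_limit[where \<kappa> = 1 and \<mu> = 0, OF u smp_limits(5)[OF p] g F])
 thus "(\<lambda>m. dt m * (\<Sum>n<NT m. IP (h m) (\<lambda>k. (F m (Suc n) k - F m n k) / dt m) (smp \<phi> m n))) \<longlonglongrightarrow>
  (LBINT x. uT x * \<phi> (T, x)) - (LBINT x. u0 x * \<phi> (0, x)) - (LBINT z. u z * (TI T z * pd_t \<phi> z))" by simp
qed

end

text \<open>The symmetry assumptions are made at every point, because \<open>weak_sol\<close> asks
  for symmetric trace-free values everywhere; \<open>wlim_sym_tf\<close> provides such
  representatives of the limits.\<close>

locale scheme_limit = scheme_seq +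
 fixes q :: "3 \<Rightarrow> 3 \<Rightarrow> real \<times> pt \<Rightarrow> real" and d :: "3 \<Rightarrow> 3 \<Rightarrow> 3 \<Rightarrow> real \<times> pt \<Rightarrow> real" and g :: "3 \<Rightarrow> 3 \<Rightarrow> real \<times> pt \<Rightarrow> real"
  and r :: "real \<times> pt \<Rightarrow> real" and qT :: "3 \<Rightarrow> 3 \<Rightarrow> pt \<Rightarrow> real" and rT :: "pt \<Rightarrow> real"
 assumes q_lim: "\<And>i j. wlimL (Qf i j) (q i j)" and d_lim: "\<And>i j \<alpha>. wlimL (Df i j \<alpha>) (d i j \<alpha>)"
  and g_lim: "\<And>i j. wlimL (Hf i j) (g i j)" and r_lim: "wlimL Rf r"
  and qT_lim: "\<And>i j. wlimL (\<lambda>m. st (h m) (cp i j (Qs m (NT m)))) (qT i j)"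
  and rT_lim: "wlimL (\<lambda>m. st (h m) (Rs m (NT m))) rT"
  and q_sym: "\<And>z. sym_tf (\<chi> i j. q i j z)" and qT_sym: "\<And>x. sym_tf (\<chi> i j. qT i j x)"
begin

definition "Qv z = (\<chi> i j. q i j z)"
definition "pq i j z = ind W z * PF (Qv z) $ i $ j"
abbreviation "Ps m n \<equiv> PB (N m) (NT m) n"

lemma q_l2: "l2L (q i j)" and d_l2: "l2L (d i j \<alpha>)" and g_l2: "l2L (g i j)" and r_l2: "l2L r"
 using wlimD(2)[OF q_lim] wlimD(2)[OF d_lim] wlimD(2)[OF g_lim] wlimD(2)[OF r_lim] by blast+

lemma Qv_measurable [measurable]: "Qv \<in> bm"
 unfolding Qv_def[abs_def] by (rule borel_measurable_mat3) (use l2_meas[OF q_l2] in simp)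

lemma Ps_fs: "fs (cp i j (Ps m n))"
proof -
 have "bc (N m) (Ps m n)"
  using scheme_step(2)[OF NT_pos[of m], of "N m" n] scheme_step(2)[OF NT_pos[of m], of "N m" "n - 1"]
  by (simp add: bc_def PB_def)
 thus ?thesis by (rule bc_cp_fs)
qed

lemma sym_tf_symm: "sym_tf A \<Longrightarrow> symm A" by (simp add: sym_tf_def)

text \<open>The extrapolation is \<open>P(Q^n)\<close> plus half of
  \<open>P(Q^n) - P(Q^(n-1))\<close>. By the Lipschitz bound the first part is controlled by the
  strong convergence of \<open>Q\<close>, the second by a single time increment, of order
  \<open>sqrt (dt m)\<close>.\<close>

lemma Ps_strong: "slimL (\<lambda>m. tsf (dt m) (NT m) (\<lambda>n. st (h m) (cp i j (Ps m n)))) (pq i j)"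
proof -
 obtain L where L: "L \<ge> 0" "\<And>Q R. symm Q \<Longrightarrow> symm R \<Longrightarrow> norm (PF Q - PF R) \<le> L * norm (Q - R)" using P_lipschitz by blast
 define I where "I a b m = tsf (dt m) (NT m) (\<lambda>n x. st (h m) (cp a b (Qs m n)) x - st (h m) (cp a b (Qs m (n - 1))) x)" for a b m
 have Il2: "l2L (I a b m)" for a b m
  unfolding I_def by (intro tsf_l2(1) dt_pos l2_diff st_Qs_l2)
 have "nrmL (I a b m) \<le> sqrt (real (NT m) * dt m) * (sqrt (dt m) * sqrt (M * CE))" for a b m
  unfolding I_def
 proof (rule nrm_tsf_le[OF dt_pos l2_diff[OF st_Qs_l2 st_Qs_l2]])
  fix n show "nrmL (\<lambda>x. st (h m) (cp a b (Qs m n)) x - st (h m) (cp a b (Qs m (n - 1))) x) \<le> sqrt (dt m) * sqrt (M * CE)"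
   using nrm_time_increment[where m = m and i = a and j = b and n = "n - 1" and p = 1] less_imp_le[OF dt_pos[of m]] M_pos CE(1)
   by (cases n) (auto simp: nrm_def)
 qed (use less_imp_le[OF dt_pos[of m]] M_pos CE(1) in auto)
 hence "nrmL (I a b m) \<le> sqrt T * (sqrt (dt m) * sqrt (M * CE))" for a b m by (simp add: NT_dt)
 moreover have "(\<lambda>m. sqrt T * (sqrt (dt m) * sqrt (M * CE))) \<longlonglongrightarrow> sqrt T * (sqrt 0 * sqrt (M * CE))"
  by (intro tendsto_intros dt_lim')
 ultimately have I0: "(\<lambda>m. nrmL (I a b m)) \<longlonglongrightarrow> 0" for a b by (intro nrm_null_comparison) auto
 have S: "slimL (\<lambda>m z. TI T z * Qf a b m z) (\<lambda>z. ind W z * q a b z)" for a b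
  using Qf_strong[OF q_lim] unfolding TI_Qf .
 define E where "E p m z = L * \<bar>TI T z * Qf (fst p) (snd p) m z - ind W z * q (fst p) (snd p) z\<bar> + L / 2 * \<bar>I (fst p) (snd p) m z\<bar>"
  for p :: "3 \<times> 3" and m z
 have abs_l2: "l2L (\<lambda>z. \<bar>f z\<bar>)" if "l2L f" for f :: "real \<times> pt \<Rightarrow> real"
  by (rule l2_bound[OF that]) (use l2_meas[OF that] in auto)
 have na: "nrmL (\<lambda>z. \<bar>f z\<bar>) = nrmL f" for f :: "real \<times> pt \<Rightarrow> real" by (simp add: nrm_def)
 note El = l2_cmult[OF abs_l2[OF slim_diff_l2[OF S]], of L] l2_cmult[OF abs_l2[OF Il2], of "L/2"]
 show ?thesis
 proof (rule slim_dominated_by_sum[where I = UNIV and E = E])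
  show "l2L (tsf (dt m) (NT m) (\<lambda>n. st (h m) (cp i j (Ps m n))))" for m
   by (intro tsf_l2(1) dt_pos st_l2 mesh_pos Ps_fs)
  have "(\<lambda>z. PF (Qv z) $ i $ j) \<in> bm"
   using measurable_compose[OF Qv_measurable PF_measurable] .
  thus "pq i j \<in> bmL" unfolding pq_def[abs_def] by simp
  show "l2L (E p m)" for p m unfolding E_def[abs_def] by (intro l2_add El)
  show "(\<lambda>m. nrmL (E p m)) \<longlonglongrightarrow> 0" for p
  proof (rule nrm_null_comparison)
   show "nrmL (E p m) \<le> L * nrmL (\<lambda>z. TI T z * Qf (fst p) (snd p) m z - ind W z * q (fst p) (snd p) z)
     + L / 2 * nrmL (I (fst p) (snd p) m)" for m
    using nrm_add_le[OF El(1,2), of "fst p" "snd p" m "fst p" "snd p" m] L(1) unfolding E_def[abs_def] nrm_cmult na by simp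
   have "(\<lambda>m. L * nrmL (\<lambda>z. TI T z * Qf (fst p) (snd p) m z - ind W z * q (fst p) (snd p) z)
     + L / 2 * nrmL (I (fst p) (snd p) m)) \<longlonglongrightarrow> L * 0 + L / 2 * 0"
    by (intro tendsto_intros slimD(3)[OF S] I0)
   thus "(\<lambda>m. L * nrmL (\<lambda>z. TI T z * Qf (fst p) (snd p) m z - ind W z * q (fst p) (snd p) z)
     + L / 2 * nrmL (I (fst p) (snd p) m)) \<longlonglongrightarrow> 0" by simp
  qed
  fix m
  show "AE z in lborel. \<bar>tsf (dt m) (NT m) (\<lambda>n. st (h m) (cp i j (Ps m n))) z - pq i j z\<bar> \<le> (\<Sum>p. \<bar>E p m z\<bar>)"
   using AE_time_neq[of T]
  proof eventually_elim
   fix z :: "real \<times> pt" assume z: "fst z \<noteq> T"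
   have E0: "E p m z = \<bar>E p m z\<bar>" for p using L(1) by (simp add: E_def)
   show "\<bar>tsf (dt m) (NT m) (\<lambda>n. st (h m) (cp i j (Ps m n))) z - pq i j z\<bar> \<le> (\<Sum>p. \<bar>E p m z\<bar>)"
   proof (cases "0 \<le> fst z \<and> fst z < T")
    case False
    thus ?thesis using z NT_dt[of m] by (auto simp: tsf_def pq_def W_def indicator_def sum_nonneg)
   next
    case True
    define n k where "n = nat \<lfloor>fst z / dt m\<rfloor>" and "k = cell_index (h m) (snd z)"
    define A B C where "A = Qs m n k" and "B = Qs m (n - 1) k" and "C = ind W z *\<^sub>R Qv z"
    have sy: "symm A" "symm B" "symm C"
     using sym_tf_symm[OF scheme_step(1)[OF NT_pos]] sym_tf_symm[OF q_sym[of z]]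
     by (auto simp: A_def B_def C_def Qv_def transpose_def vec_eq_iff)
    have 1: "tsf (dt m) (NT m) (\<lambda>n. st (h m) (cp i j (Ps m n))) z = ((3/2) *\<^sub>R PF A - (1/2) *\<^sub>R PF B) $ i $ j"
     using True NT_dt[of m] by (simp add: tsf_def st_def PB_def n_def k_def A_def B_def)
    have 2: "pq i j z = PF C $ i $ j" by (cases "z \<in> W") (simp_all add: pq_def C_def)
    have "\<bar>((3/2) *\<^sub>R PF A - (1/2) *\<^sub>R PF B) $ i $ j - PF C $ i $ j\<bar> \<le> norm ((PF A - PF C) + (1/2) *\<^sub>R (PF A - PF B))"
     using order_trans[OF component_le_norm_cart Finite_Cartesian_Product.norm_nth_le, of "(PF A - PF C) + (1/2) *\<^sub>R (PF A - PF B)" i j] by (simp add: algebra_simps)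
    also have "\<dots> \<le> norm (PF A - PF C) + 1/2 * norm (PF A - PF B)"
     using norm_triangle_ineq[of "PF A - PF C" "(1/2) *\<^sub>R (PF A - PF B)"] by simp
    also have "\<dots> \<le> L * norm (A - C) + 1/2 * (L * norm (A - B))" by (intro add_mono mult_left_mono L sy) simp
    also have "\<dots> \<le> L * (\<Sum>a b. \<bar>(A - C) $ a $ b\<bar>) + 1/2 * (L * (\<Sum>a b. \<bar>(A - B) $ a $ b\<bar>))"
     by (intro add_mono mult_left_mono norm_mat3_le L(1)) simp
    also have "\<dots> = (\<Sum>a b. E (a, b) m z)"
     using True NT_dt[of m] nn_dt[of m] T_pos
     by (simp add: E_def I_def Qf_def tsf_def st_def n_def[symmetric] k_def[symmetric] A_def B_def C_def Qv_def TI_def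
       sum.distrib sum_distrib_left)
    also have "\<dots> = (\<Sum>p. \<bar>E p m z\<bar>)"
     using E0 by (simp add: sum.cartesian_product flip: UNIV_Times_UNIV)
    finally show ?thesis unfolding 1 2 .
   qed
  qed
 qed
qed

end

context scheme_limit
begin

lemma TI_idem: "TI T z * (TI T z * y) = TI T z * y"
 by (simp add: TI_def indicator_def)

lemma Hs_fs: "fs (Hs m i j n)" and Qs_fs: "fs (cp i j (Qs m n))" and Rs_fs: "fs (Rs m n)"
 by (rule HS_fs QS_fs RS_fs, rule NT_pos)+

lemma Dc_lim: "wlimL (\<lambda>m. tsf (dt m) (nn m) (\<lambda>n. st (h m) (Dcent (h m) \<alpha> (cp i j (Qs m n))))) (d i j \<alpha>)"
proof -
 have "(\<lambda>m. (0::real, - (h m *\<^sub>R axis \<alpha> (1::real)))) \<longlonglongrightarrow> (0, - (0 *\<^sub>R axis \<alpha> 1))" by (intro tendsto_intros h_lim)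
 hence a: "(\<lambda>m. (0::real, - (h m *\<^sub>R axis \<alpha> (1::real)))) \<longlonglongrightarrow> 0" by (simp add: zero_prod_def)
 have e: "tsf (dt m) (nn m) (\<lambda>n. st (h m) (Dcent (h m) \<alpha> (cp i j (Qs m n)))) z =
  1/2 * Df i j \<alpha> m z + 1/2 * Df i j \<alpha> m (z + (0, - (h m *\<^sub>R axis \<alpha> 1)))" for m z
  by (simp add: tsf_def st_Dcent Df_def)
 show ?thesis unfolding e[abs_def]
  using wlim_add[OF wlim_cmult[OF d_lim] wlim_cmult[OF wlim_translate[OF d_lim a]], of "1/2" i j \<alpha> "1/2" i j \<alpha>] by simp
qed

text \<open>Summation by parts for the central difference, which has the same weak limit as the
  forward one; this identifies the limits \<open>d\<close> as gradients.\<close>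

lemma weak_derivative_x:
 assumes p: "tst T \<phi>"
 shows "(LBINT z. q i j z * (TI T z * pd_x \<alpha> \<phi> z)) = - (LBINT z. d i j \<alpha> z * (TI T z * \<phi> z))"
proof -
 have A: "(\<lambda>m. dt m * (\<Sum>n<NT m. IP (h m) (\<lambda>k. 0 * cp i j (Qs m (Suc n)) k + 1 * cp i j (Qs m n) k) (Dcent (h m) \<alpha> (smp \<phi> m n))))
   \<longlonglongrightarrow> (0 + 1) * (LBINT z. q i j z * (TI T z * pd_x \<alpha> \<phi> z))"
  by (rule pair_limit[OF q_lim[unfolded Qf_def] slim_smp_Dcent[OF p] TI_idem Qs_fs])
 have B: "(\<lambda>m. dt m * (\<Sum>n<NT m. IP (h m) (\<lambda>k. 0 * Dcent (h m) \<alpha> (cp i j (Qs m (Suc n))) k + 1 * Dcent (h m) \<alpha> (cp i j (Qs m n)) k) (smp \<phi> m n)))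
   \<longlonglongrightarrow> (0 + 1) * (LBINT z. d i j \<alpha> z * (TI T z * \<phi> z))"
  by (rule pair_limit[OF Dc_lim smp_limits(1)[OF p] TI_idem fs_Dcent[OF Qs_fs]])
 have C: "(\<Sum>n<NT m. IP (h m) (Dcent (h m) \<alpha> (cp i j (Qs m n))) (smp \<phi> m n)) = - (\<Sum>n<NT m. IP (h m) (cp i j (Qs m n)) (Dcent (h m) \<alpha> (smp \<phi> m n)))" for m
  unfolding sum_negf[symmetric]
  by (intro sum.cong refl IP_Dcent mesh_pos Qs_fs bc_fs[OF smp_bc[OF p]]) simp
 have "(LBINT z. d i j \<alpha> z * (TI T z * \<phi> z)) = - (LBINT z. q i j z * (TI T z * pd_x \<alpha> \<phi> z))"
  by (rule LIMSEQ_unique[OF B[simplified]]) (use tendsto_minus[OF A] in \<open>simp add: C\<close>)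
 thus ?thesis by simp
qed

lemma test_H:
 assumes p: "tst T \<phi>"
 shows "(\<lambda>m. dt m * (\<Sum>n<NT m. IP (h m) (Hs m i j n) (smp \<phi> m n))) \<longlonglongrightarrow> (LBINT z. g i j z * (TI T z * \<phi> z))"
 using pair_limit[OF g_lim[unfolded Hf_def] smp_limits(1)[OF p] TI_idem Hs_fs, of 0 i j 1] by simp

text \<open>Identifies \<open>g\<close> as the time derivative and at the same time records the
  initial value and the value at time \<open>T\<close>.\<close>

lemma weak_derivative_t:
 assumes p: "tst T \<phi>"
 shows "(LBINT z. g i j z * (TI T z * \<phi> z)) = (LBINT x. qT i j x * \<phi> (T, x)) - (LBINT x. q0 i j x * \<phi> (0, x))
   - (LBINT z. q i j z * (TI T z * pd_t \<phi> z))"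
proof (rule time_by_parts[OF q_lim[unfolded Qf_def] qT_lim _ Qs_fs p])
 have "slimL (\<lambda>m. st (h m) (cavg (N m) (q0 i j))) (q0 i j)"
  by (rule slim_cavg[OF q0_l2 _ h_lim]) (simp add: q0_def)
 thus "wlimL (\<lambda>m. st (h m) (cp i j (Qs m 0))) (q0 i j)" by (simp add: QS_0 Q_init_cp slim_imp_wlim)
 show "(\<lambda>m. dt m * (\<Sum>n<NT m. IP (h m) (\<lambda>k. (cp i j (Qs m (Suc n)) k - cp i j (Qs m n) k) / dt m) (smp \<phi> m n)))
   \<longlonglongrightarrow> (LBINT z. g i j z * (TI T z * \<phi> z))"
  using test_H[OF p] unfolding HS_def .
qed

lemma slim_P_smp:
 assumes p: "tst T \<phi>"
 shows "slimL (\<lambda>m. tsf (dt m) (NT m) (\<lambda>n. st (h m) (\<lambda>k. Ps m n k $ i $ j * smp \<phi> m n k))) (\<lambda>z. (TI T z * \<phi> z) * pq i j z)"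
proof -
 have mT: "(\<lambda>z. TI T z * \<phi> z) \<in> bm"
  using borel_measurable_continuous_onI[OF tstD(2)[OF p]] by simp
 have m: "tsf (dt m) (NT m) (\<lambda>n. st (h m) (smp \<phi> m n)) \<in> bm" for m
  by (rule tsf_measurable[OF dt_pos]) measurable
 obtain B where B: "\<And>m z. \<bar>tsf (dt m) (NT m) (\<lambda>n. st (h m) (smp \<phi> m n)) z\<bar> \<le> B" using smp_limits(3)[OF p] by blast
 have "slimL (\<lambda>m z. tsf (dt m) (NT m) (\<lambda>n. st (h m) (smp \<phi> m n)) z * tsf (dt m) (NT m) (\<lambda>n. st (h m) (cp i j (Ps m n))) z)
   (\<lambda>z. (TI T z * \<phi> z) * pq i j z)"
  by (rule slim_mult_conv[OF Ps_strong _ _ B smp_limits(2)[OF p]]) (use m mT in simp_all)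
 moreover have "tsf (dt m) (NT m) (\<lambda>n. st (h m) (smp \<phi> m n)) z * tsf (dt m) (NT m) (\<lambda>n. st (h m) (cp i j (Ps m n))) z
   = tsf (dt m) (NT m) (\<lambda>n. st (h m) (\<lambda>k. Ps m n k $ i $ j * smp \<phi> m n k)) z" for m z
  by (simp add: tsf_def st_def mult.commute)
 ultimately show ?thesis by simp
qed

lemma TI_idem': "TI T z * (TI T z * y * w) = TI T z * y * w"
 by (simp add: TI_def indicator_def)

text \<open>The increment of \<open>r\<close> is \<open>dt\<close> times \<open>P : H\<close>. The
  weakly convergent factor \<open>H\<close> meets the product of \<open>P\<close> with the test
  function, which converges strongly.\<close>

lemma limit_r:
 assumes p: "tst T \<phi>"
 shows "(\<Sum>i j. (LBINT z. g i j z * ((TI T z * \<phi> z) * pq i j z))) =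
   (LBINT x. rT x * \<phi> (T, x)) - (LBINT x. r0 x * \<phi> (0, x)) - (LBINT z. r z * (TI T z * pd_t \<phi> z))"
proof (rule time_by_parts[OF r_lim[unfolded Rf_def] rT_lim _ Rs_fs p])
 have "slimL (\<lambda>m. st (h m) (cavg (N m) r0)) r0" by (rule slim_cavg[OF r0_l2 _ h_lim]) (simp add: r0_def)
 thus "wlimL (\<lambda>m. st (h m) (Rs m 0)) r0" by (simp add: RS_0 slim_imp_wlim)
 have "IP (h m) (\<lambda>k. (Rs m (Suc n) k - Rs m n k) / dt m) (smp \<phi> m n) =
   (\<Sum>i j. IP (h m) (Hs m i j n) (\<lambda>k. Ps m n k $ i $ j * smp \<phi> m n k))" if n: "n < NT m" for m n
 proof -
  have "IP (h m) (\<lambda>k. (Rs m (Suc n) k - Rs m n k) / dt m) (smp \<phi> m n) =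
    IP (h m) (\<lambda>k. \<Sum>i j. Hs m i j n k * Ps m n k $ i $ j) (smp \<phi> m n)"
  proof (rule IP_cong)
   fix k
   show "(Rs m (Suc n) k - Rs m n k) / dt m * smp \<phi> m n k = (\<Sum>i j. Hs m i j n k * Ps m n k $ i $ j) * smp \<phi> m n k"
   proof (cases "in_grid (N m) k")
    case True
    hence "Rs m (Suc n) k - Rs m n k = frob (Ps m n k) (Qs m (Suc n) k - Qs m n k)"
     using scheme_step(4)[OF NT_pos[of m], of "N m" n] by (simp add: gstep_def)
    thus ?thesis by (simp add: frob_def HS_def sum_divide_distrib mult.commute)
   qed (use smp_bc[OF p less_imp_le[OF n]] in \<open>simp add: bc_def\<close>)
  qed
  also have "\<dots> = (\<Sum>i j. IP (h m) (\<lambda>k. Hs m i j n k * Ps m n k $ i $ j) (smp \<phi> m n))"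
   by (simp add: IP_sum_left fs_sum fs_mult1 Hs_fs)
  also have "\<dots> = (\<Sum>i j. IP (h m) (Hs m i j n) (\<lambda>k. Ps m n k $ i $ j * smp \<phi> m n k))"
   by (intro sum.cong refl IP_cong) simp
  finally show ?thesis .
 qed
 hence e: "dt m * (\<Sum>n<NT m. IP (h m) (\<lambda>k. (Rs m (Suc n) k - Rs m n k) / dt m) (smp \<phi> m n)) =
   (\<Sum>i j. dt m * (\<Sum>n<NT m. IP (h m) (\<lambda>k. 0 * Hs m i j (Suc n) k + 1 * Hs m i j n k) (\<lambda>k. Ps m n k $ i $ j * smp \<phi> m n k)))" for m
  by (simp add: sum_distrib_left) (subst sum.swap, intro sum.cong refl, subst sum.swap, rule refl)
 have "(\<lambda>m. dt m * (\<Sum>n<NT m. IP (h m) (\<lambda>k. (Rs m (Suc n) k - Rs m n k) / dt m) (smp \<phi> m n)))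
   \<longlonglongrightarrow> (\<Sum>i j. (0 + 1) * (LBINT z. g i j z * ((TI T z * \<phi> z) * pq i j z)))"
  unfolding e by (intro tendsto_sum pair_limit[OF g_lim[unfolded Hf_def] slim_P_smp[OF p] TI_idem' Hs_fs])
 thus "(\<lambda>m. dt m * (\<Sum>n<NT m. IP (h m) (\<lambda>k. (Rs m (Suc n) k - Rs m n k) / dt m) (smp \<phi> m n)))
   \<longlonglongrightarrow> (\<Sum>i j. (LBINT z. g i j z * ((TI T z * \<phi> z) * pq i j z)))" by simp
qed

text \<open>The scheme is tested at every level with the sampled functions. After summation by parts
  each spatial term pairs a mean of two levels with differences of the test function, so
  \<open>pair_limit\<close> applies with both weights \<open>1/2\<close>.\<close>

lemma limit_Q:
 assumes p: "\<And>i j. tst T (\<phi> i j)"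
 shows "(\<Sum>i j. (LBINT z. g i j z * (TI T z * \<phi> i j z))) =
   - M * (L1 * (\<Sum>i j \<alpha>. (LBINT z. d i j \<alpha> z * (TI T z * pd_x \<alpha> (\<phi> i j) z)))
    + L23 / 2 * (\<Sum>i j k. (LBINT z. d j k k z * (TI T z * pd_x i (\<phi> i j) z))
     + (LBINT z. d i k k z * (TI T z * pd_x j (\<phi> i j) z))
     - 2/3 * (LBINT z. d k i i z * (TI T z * pd_x k (\<phi> j j) z)))
    + (\<Sum>i j. (LBINT z. r z * ((TI T z * \<phi> i j z) * pq i j z))))"
proof -
 define mean where "mean F n = (\<lambda>k. 1/2 * F (Suc n) k + 1/2 * F n k)" for F :: "nat \<Rightarrow> idx \<Rightarrow> real" and n
 define X where "X m F G = dt m * (\<Sum>n<NT m. IP (h m) (mean F n) (G n))" for m F and G :: "nat \<Rightarrow> idx \<Rightarrow> real"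
 define \<Phi> where "\<Phi> m i j n = smp (\<phi> i j) m n" for m i j n
 define D where "D m \<alpha> i j n = Dplus (h m) \<alpha> (cp i j (Qs m n))" for m \<alpha> i j n
 define C where "C m \<alpha> i j n = Dcent (h m) \<alpha> (cp i j (Qs m n))" for m \<alpha> i j n
 have step: "(\<Sum>i j. IP (h m) (Hs m i j n) (\<Phi> m i j n)) =
   - M * (L1 * (\<Sum>i j \<alpha>. IP (h m) (mean (D m \<alpha> i j) n) (Dplus (h m) \<alpha> (\<Phi> m i j n)))
    + L23 / 2 * (\<Sum>i j k. IP (h m) (mean (C m k j k) n) (Dcent (h m) i (\<Phi> m i j n))
     + IP (h m) (mean (C m k i k) n) (Dcent (h m) j (\<Phi> m i j n))
     - 2/3 * IP (h m) (mean (C m i k i) n) (Dcent (h m) k (\<Phi> m j j n)))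
    + (\<Sum>i j. IP (h m) (mean (Rs m) n) (\<lambda>k. Ps m n k $ i $ j * \<Phi> m i j n k)))" if n: "n < NT m" for m n
 proof -
  have b\<Phi>: "bc (N m) (\<Phi> m i j n)" for i j unfolding \<Phi>_def by (rule smp_bc[OF p less_imp_le[OF n]])
  define A where "A = (\<lambda>k. (1/2) *\<^sub>R (Qs m (Suc n) k + Qs m n k))"
  have cA: "cp i j A = (\<lambda>k. 1/2 * (cp i j (Qs m (Suc n)) k + cp i j (Qs m n) k))" for i j by (simp add: A_def)
  have fA: "fs (cp i j A)" for i j unfolding cA by (intro fs_mult2 fs_add Qs_fs)
  have DA: "Dplus (h m) \<alpha> (cp i j A) = mean (D m \<alpha> i j) n" "Dcent (h m) \<alpha> (cp i j A) = mean (C m \<alpha> i j) n" for \<alpha> i j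
   by (simp_all add: fun_eq_iff cA mean_def D_def C_def Dplus_def Dcent_def algebra_simps)
  have rm: "(\<lambda>k. 1/2 * (Rs m (Suc n) k + Rs m n k)) = mean (Rs m) n" by (simp add: mean_def fun_eq_iff)
  have "IP (h m) (Hs m i j n) (\<Phi> m i j n) = M * L1 * IP (h m) (lap_h (h m) (cp i j A)) (\<Phi> m i j n)
    - M * IP (h m) (mean (Rs m) n) (\<lambda>k. Ps m n k $ i $ j * \<Phi> m i j n k) + M * L23 / 2 * IP (h m) (cp i j (alpha_h (h m) A)) (\<Phi> m i j n)" for i j
   unfolding HS_def
   using gstep_test[OF scheme_step(4)[OF NT_pos[of m], of "N m" n] scheme_step(2)[OF NT_pos] scheme_step(3)[OF NT_pos] b\<Phi>, of i j i j]
   unfolding cA rm A_def[symmetric] .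
  hence "(\<Sum>i j. IP (h m) (Hs m i j n) (\<Phi> m i j n)) =
    M * L1 * (\<Sum>i j. IP (h m) (lap_h (h m) (cp i j A)) (\<Phi> m i j n))
    - M * (\<Sum>i j. IP (h m) (mean (Rs m) n) (\<lambda>k. Ps m n k $ i $ j * \<Phi> m i j n k))
    + M * L23 / 2 * (\<Sum>i j. IP (h m) (cp i j (alpha_h (h m) A)) (\<Phi> m i j n))"
   by (simp add: sum.distrib sum_subtractf sum_distrib_left)
  also have "(\<Sum>i j. IP (h m) (lap_h (h m) (cp i j A)) (\<Phi> m i j n))
    = - (\<Sum>i j \<alpha>. IP (h m) (mean (D m \<alpha> i j) n) (Dplus (h m) \<alpha> (\<Phi> m i j n)))"
   by (simp add: IP_lap_h[OF mesh_pos fA bc_fs[OF b\<Phi>]] DA sum_negf)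
  also have "(\<Sum>i j. IP (h m) (cp i j (alpha_h (h m) A)) (\<Phi> m i j n))
    = - (\<Sum>i j k. IP (h m) (mean (C m k j k) n) (Dcent (h m) i (\<Phi> m i j n))
     + IP (h m) (mean (C m k i k) n) (Dcent (h m) j (\<Phi> m i j n))
     - 2/3 * IP (h m) (mean (C m i k i) n) (Dcent (h m) k (\<Phi> m j j n)))"
   using alpha_h_by_parts[OF mesh_pos[of "N m"] fA bc_fs[OF b\<Phi>]] unfolding DA .
  also have "M * L1 * - x - M * y + M * L23 / 2 * - z = - M * (L1 * x + L23 / 2 * z + y)" for x y z
   by (simp add: field_simps)
  finally show ?thesis .
 qed
 \<comment> \<open>\<open>lin\<close>, \<open>pull\<close> and \<open>pull3\<close> only move the
   time sum inside the finite sums over components, so that each summand is one for which the limit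
   is known.\<close>
 have lin: "t * (\<Sum>n<K. - M * (L1 * a n + b * e n + f n)) = - M * (L1 * (t * (\<Sum>n<K. a n)) + b * (t * (\<Sum>n<K. e n)) + t * (\<Sum>n<K. f n))"
  for t b :: real and K and a e f :: "nat \<Rightarrow> real"
  by (induction K) (simp_all add: algebra_simps)
 have pull: "dt m * (\<Sum>n<NT m. \<Sum>i\<in>I. f i n) = (\<Sum>i\<in>I. dt m * (\<Sum>n<NT m. f i n))" for m f and I :: "3 set"
  by (simp add: sum_distrib_left) (rule sum.swap)
 have pull3: "dt m * (\<Sum>n<NT m. (\<Sum>i j k. a i j k n + b i j k n - 2/3 * e i j k n)) =
   (\<Sum>i j k. dt m * (\<Sum>n<NT m. a i j k n) + dt m * (\<Sum>n<NT m. b i j k n) - 2/3 * (dt m * (\<Sum>n<NT m. e i j k n)))"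
  for m and a b e :: "3 \<Rightarrow> 3 \<Rightarrow> 3 \<Rightarrow> nat \<Rightarrow> real"
  unfolding pull by (intro sum.cong refl) (simp add: sum.distrib sum_subtractf sum_distrib_left algebra_simps)
 have e: "(\<Sum>i j. dt m * (\<Sum>n<NT m. IP (h m) (Hs m i j n) (\<Phi> m i j n))) =
   - M * (L1 * (\<Sum>i j \<alpha>. X m (D m \<alpha> i j) (\<lambda>n. Dplus (h m) \<alpha> (\<Phi> m i j n)))
    + L23 / 2 * (\<Sum>i j k. X m (C m k j k) (\<lambda>n. Dcent (h m) i (\<Phi> m i j n))
     + X m (C m k i k) (\<lambda>n. Dcent (h m) j (\<Phi> m i j n)) - 2/3 * X m (C m i k i) (\<lambda>n. Dcent (h m) k (\<Phi> m j j n)))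
    + (\<Sum>i j. X m (Rs m) (\<lambda>n k. Ps m n k $ i $ j * \<Phi> m i j n k)))" for m
 proof -
  have c: "dt m * (\<Sum>n<NT m. \<Sum>i j. IP (h m) (Hs m i j n) (\<Phi> m i j n)) = dt m * (\<Sum>n<NT m. F n)"
   if "\<And>n. n < NT m \<Longrightarrow> (\<Sum>i j. IP (h m) (Hs m i j n) (\<Phi> m i j n)) = F n" for F using that by simp
  from c[OF step] show ?thesis
   unfolding X_def lin pull3 pull .
 qed
 have XD: "(\<lambda>m. X m (D m \<alpha> i j) (\<lambda>n. Dplus (h m) \<alpha> (\<Phi> m i j n))) \<longlonglongrightarrow> (LBINT z. d i j \<alpha> z * (TI T z * pd_x \<alpha> (\<phi> i j) z))" for i j \<alpha>
  using pair_limit[OF d_lim[unfolded Df_def] smp_limits(4)[OF p] TI_idem fs_Dplus[OF Qs_fs], of "1/2" \<alpha> i j "1/2" \<alpha> i j]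
  by (simp add: X_def mean_def D_def \<Phi>_def)
 have XC: "(\<lambda>m. X m (C m \<alpha> i j) (\<lambda>n. Dcent (h m) \<beta> (\<Phi> m i' j' n))) \<longlonglongrightarrow> (LBINT z. d i j \<alpha> z * (TI T z * pd_x \<beta> (\<phi> i' j') z))" for i j i' j' \<alpha> \<beta>
  using pair_limit[OF Dc_lim slim_smp_Dcent[OF p] TI_idem fs_Dcent[OF Qs_fs], of "1/2" \<alpha> i j "1/2" \<beta> i' j']
  by (simp add: X_def mean_def C_def \<Phi>_def)
 have XR: "(\<lambda>m. X m (Rs m) (\<lambda>n k. Ps m n k $ i $ j * \<Phi> m i j n k)) \<longlonglongrightarrow> (LBINT z. r z * ((TI T z * \<phi> i j z) * pq i j z))" for i j
  using pair_limit[OF r_lim[unfolded Rf_def] slim_P_smp[OF p] TI_idem' Rs_fs, of "1/2" "1/2" i j]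
  by (simp add: X_def mean_def \<Phi>_def)
 show ?thesis
 proof (rule LIMSEQ_unique)
  show "(\<lambda>m. \<Sum>i j. dt m * (\<Sum>n<NT m. IP (h m) (Hs m i j n) (\<Phi> m i j n))) \<longlonglongrightarrow>
    (\<Sum>i j. (LBINT z. g i j z * (TI T z * \<phi> i j z)))"
   unfolding \<Phi>_def by (intro tendsto_sum test_H p)
 qed (unfold e, intro tendsto_intros XD XC XR)
qed

end

section \<open>Energy inequality and uniform bounds for the limit\<close>

text \<open>The bound \<open>F^2 \<ge> 2 * F * f - f^2\<close> is linear in \<open>F\<close>, so it
  passes to weak limits, and it is sharp there. Replacing squares by such converging lower bounds
  lets several lower semicontinuous terms, on both sides of an inequality, pass to the limit at
  once.\<close>

definition lowb :: "'a measure \<Rightarrow> (nat \<Rightarrow> 'a \<Rightarrow> real) \<Rightarrow> ('a \<Rightarrow> real) \<Rightarrow> nat \<Rightarrow> real" where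
 "lowb M F f m = 2 * (\<integral>x. F m x * f x \<partial>M) - (\<integral>x. (f x)^2 \<partial>M)"

lemma wlim_lower:
 assumes w: "wlim M F f"
 shows "lowb M F f m \<le> (\<integral>x. (F m x)^2 \<partial>M)" (is ?g1) and "lowb M F f \<longlonglongrightarrow> (\<integral>x. (f x)^2 \<partial>M)" (is ?g2)
proof -
 note l = wlimD(1,2)[OF w]
 show ?g1
  using integral_sq_add[OF l(1) l(2), where t = "-1"] Bochner_Integration.integral_nonneg[of M "\<lambda>x. (F m x + -1 * f x)^2"] by (simp add: lowb_def)
 have "(\<lambda>m. 2 * (\<integral>x. F m x * f x \<partial>M) - (\<integral>x. (f x)^2 \<partial>M)) \<longlonglongrightarrow> 2 * (\<integral>x. f x * f x \<partial>M) - (\<integral>x. (f x)^2 \<partial>M)"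
  by (intro tendsto_intros wlimD(3)[OF w l(2)])
 thus ?g2 by (simp add: lowb_def[abs_def] power2_eq_square)
qed

text \<open>Apply \<open>le\<close> to the set of times in \<open>S\<close> where \<open>f\<close>
  exceeds \<open>c\<close>: the nonnegative excess there has integral zero.\<close>

lemma AE_slice_bound:
 fixes f :: "real \<Rightarrow> real"
 assumes f: "integrable lborel f" and S: "S \<in> sets borel" "bounded S"
  and le: "\<And>A. A \<in> sets borel \<Longrightarrow> A \<subseteq> S \<Longrightarrow> (LBINT t. ind A t * f t) \<le> c * measure lborel A"
 shows "AE t in lborel. t \<in> S \<longrightarrow> f t \<le> c"
proof -
 define A where "A = {t \<in> S. f t > c}"
 have [measurable]: "f \<in> bm" using f by simp
 have A: "A \<in> sets borel" unfolding A_def using S(1) by measurable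
 have Af: "emeasure lborel A < \<infinity>" by (rule emeasure_bounded_finite) (rule bounded_subset[OF S(2)], auto simp: A_def)
 have i1: "integrable lborel (\<lambda>t. ind A t * f t)"
  by (rule Bochner_Integration.integrable_bound[OF f]) (use A in \<open>auto simp: indicator_def\<close>)
 have i2: "integrable lborel (\<lambda>t. ind A t * c)" using A Af by simp
 define g where "g t = ind A t * f t - ind A t * c" for t
 have g0: "0 \<le> g t" for t by (auto simp: g_def A_def indicator_def)
 have gi: "integrable lborel g" unfolding g_def by (rule Bochner_Integration.integrable_diff[OF i1 i2])
 have "(LBINT t. g t) \<le> 0"
  unfolding g_def using le[OF A] i1 i2 A Af by (subst Bochner_Integration.integral_diff) (auto simp: A_def mult.commute)
 hence "(LBINT t. g t) = 0" using Bochner_Integration.integral_nonneg[of lborel g] g0 by (simp add: order_antisym)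
 hence "AE t in lborel. g t = 0" using integral_nonneg_eq_0_iff_AE[OF gi] g0 by simp
 thus ?thesis by eventually_elim (auto simp: g_def A_def indicator_def split: if_splits)
qed

lemma integral_energy_density:
 fixes u :: "3 \<Rightarrow> 3 \<Rightarrow> 3 \<Rightarrow> 'z \<Rightarrow> real" and v :: "3 \<Rightarrow> 'z \<Rightarrow> real"
 assumes "\<And>i j \<alpha>. integrable M (u i j \<alpha>)" "\<And>j. integrable M (v j)" "integrable M w"
 shows "1/2 * (k1 * (\<Sum>i j \<alpha>. (\<integral>t. u i j \<alpha> t \<partial>M)) + k2 * (\<Sum>j. (\<integral>t. v j t \<partial>M)) + (\<integral>t. w t \<partial>M)) =
  (\<integral>t. 1/2 * (k1 * (\<Sum>i j \<alpha>. u i j \<alpha> t) + k2 * (\<Sum>j. v j t) + w t) \<partial>M)"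
 using assms by simp

lemma slab_indicator_measurable:
 assumes "A \<in> sets borel" shows "(\<lambda>z::real \<times> pt. ind A (fst z)) \<in> bmL"
proof -
 have "(fst :: real \<times> pt \<Rightarrow> real) \<in> bm"
  by (intro borel_measurable_continuous_onI continuous_intros)
 thus ?thesis using measurable_compose[of fst borel borel "ind A"] assms by simp
qed

lemma slab_sq:
 assumes dt: "dt > 0" "T < real n * dt" and A: "A \<in> sets borel" "A \<subseteq> {0..T}" and K: "\<And>i. l2L (K i)"
 shows "integrable lborel (\<lambda>t. ind A t * (nrmL (K (nat \<lfloor>t / dt\<rfloor>)))^2)" (is ?g1)
  and "(LBINT z. (ind A (fst z) * tsf dt n K z)^2) = (LBINT t. ind A t * (nrmL (K (nat \<lfloor>t / dt\<rfloor>)))^2)" (is ?g2)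
  and "l2L (\<lambda>z. ind A (fst z) * tsf dt n K z)" (is ?g3)
proof -
 show l: ?g3
  by (rule l2_mult_bounded[OF tsf_l2(1)[OF dt(1) K] slab_indicator_measurable[OF A(1)], of 1]) simp
 have s: "(LBINT x. (ind A (fst (t, x)) * tsf dt n K (t, x))^2) = ind A t * (nrmL (K (nat \<lfloor>t / dt\<rfloor>)))^2" for t
  using A(2) dt by (cases "t \<in> A") (force simp: tsf_def nrm_sq)+
 from integral_lborel_pair(1,3)[OF l2_int[OF l]]
 show ?g1
  ?g2
  unfolding s by blast+
qed

lemma slab_sq_limit:
 assumes f: "l2L (f :: real \<times> pt \<Rightarrow> real)" and A: "A \<in> sets borel"
 shows "(LBINT z. (ind A (fst z) * f z)^2) = (LBINT t. ind A t * (LBINT x. (f (t, x))^2))" (is ?g1)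
  and "integrable lborel (\<lambda>t. ind A t * (LBINT x. (f (t, x))^2))" (is ?g2)
proof -
 have l: "l2L (\<lambda>z. ind A (fst z) * f z)"
  by (rule l2_mult_bounded[OF f slab_indicator_measurable[OF A], of 1]) simp
 have s: "(LBINT x. (ind A (fst (t, x)) * f (t, x))^2) = ind A t * (LBINT x. (f (t, x))^2)" for t
  by (cases "t \<in> A") auto
 from integral_lborel_pair(1,3)[OF l2_int[OF l]]
 show ?g1
  ?g2
  unfolding s by blast+
qed

context scheme_limit
begin

definition "ssq f t = (LBINT x. (f (t, x))^2)" for f :: "real \<times> pt \<Rightarrow> real"
definition "en t = 1/2 * (L1 * (\<Sum>i j \<alpha>. ssq (d i j \<alpha>) t)
  + L23 * (\<Sum>j. ssq (\<lambda>z. \<Sum>i. d i j i z) t) + ssq r t)"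
definition "hh s = (\<Sum>i j. (LBINT z. (ind {0..s} (fst z) * g i j z)^2))"

lemma ssq_integrable: "l2L f \<Longrightarrow> integrable lborel (ssq f)"
 using integral_lborel_pair(3)[OF l2_int] by (simp add: ssq_def[abs_def])

lemma div_l2: "l2L (\<lambda>z. \<Sum>i. d i j i z)"
 by (intro l2_sum d_l2)

lemma en_integrable: "integrable lborel en"
 unfolding en_def[abs_def]
 by (intro integrable_mult_right Bochner_Integration.integrable_add Bochner_Integration.integrable_sum ssq_integrable d_l2 div_l2 r_l2)

lemma slab_wlim:
 assumes w: "wlimL (\<lambda>m. tsf (dt m) (nn m) (\<lambda>n. st (h m) (K m n))) u" and K: "\<And>m n. fs (K m n)"
  and A: "A \<in> sets borel" "A \<subseteq> {0..T}"
 shows "wlimL (\<lambda>m z. ind A (fst z) * tsf (dt m) (nn m) (\<lambda>n. st (h m) (K m (Suc n))) z) (\<lambda>z. ind A (fst z) * u z)"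
proof -
 have "T + dt m < real (nn m) * dt m" "nn m > 0" for m
  using dt_le[of m] T_pos NT_pos[of m] unfolding nn_dt by auto
 hence w: "wlimL (\<lambda>m z. TI T z * tsf (dt m) (nn m) (\<lambda>n. st (h m) (K m (Suc n))) z) (\<lambda>z. TI T z * u z)"
  by (intro wlim_time_shift[OF w dt_lim' dt_pos]) (auto intro: st_l2[OF mesh_pos K])
 have e: "ind A (fst z) * (TI T z * y) = ind A (fst z) * y" for z y
  using A(2) by (auto simp: TI_def indicator_def)
 show ?thesis
  using wlim_mult_bounded[OF w slab_indicator_measurable[OF A(1)], of 1] by (simp add: e)
qed

text \<open>As \<open>A\<close> lies after \<open>s\<close>, the energy balance of every level used
  contains the whole dissipation up to \<open>s\<close>, a quantity that does not depend on the
  times in \<open>A\<close>.\<close>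

lemma slab_energy:
 assumes s: "0 \<le> s" and A: "A \<in> sets borel" "A \<subseteq> {s..T}"
 shows "(LBINT t. ind A t * en t) \<le> (E0 - hh s / M) * measure lborel A"
proof -
 let ?E = "\<lambda>D V R. 1/2 * (L1 * (\<Sum>i j \<alpha>. D i j \<alpha>) + L23 * (\<Sum>j. V j) + R) :: real"
 let ?A = "\<lambda>u z. ind A (fst z) * u z"
 have AT: "A \<subseteq> {0..T}" using A(2) s by auto
 have Af: "emeasure lborel A < \<infinity>" by (rule emeasure_bounded_finite) (rule bounded_subset[of "{0..T}"], use AT in auto)
 define FD where "FD i j \<alpha> m z = ind A (fst z) * tsf (dt m) (nn m) (\<lambda>n. st (h m) (Dplus (h m) \<alpha> (cp i j (Qs m (Suc n))))) z" for i j \<alpha> m z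
 define FV where "FV j m z = ind A (fst z) * tsf (dt m) (nn m) (\<lambda>n. st (h m) (divh (h m) j (Qs m (Suc n)))) z" for j m z
 define FR where "FR m z = ind A (fst z) * tsf (dt m) (nn m) (\<lambda>n. st (h m) (Rs m (Suc n))) z" for m z
 define FH where "FH i j m z = ind {0..s} (fst z) * Hf i j m z" for i j m z
 have fdiv: "fs (divh (h m) j (Qs m n))" for m j n unfolding divh_def by (intro fs_sum fs_Dcent Qs_fs)
 have wD: "wlimL (FD i j \<alpha>) (\<lambda>z. ind A (fst z) * d i j \<alpha> z)" for i j \<alpha>
  unfolding FD_def[abs_def] by (rule slab_wlim[OF d_lim[unfolded Df_def] fs_Dplus[OF Qs_fs] A(1) AT])
 have wV: "wlimL (FV j) (\<lambda>z. ind A (fst z) * (\<Sum>i. d i j i z))" for j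
 proof -
  have e: "tsf (dt m) (nn m) (\<lambda>n. st (h m) (divh (h m) j (Qs m n))) = (\<lambda>z. \<Sum>i. tsf (dt m) (nn m) (\<lambda>n. st (h m) (Dcent (h m) i (cp i j (Qs m n)))) z)" for m
   by (rule ext, unfold tsf_def divh_def st_def, auto)
  have "wlimL (\<lambda>m. tsf (dt m) (nn m) (\<lambda>n. st (h m) (divh (h m) j (Qs m n)))) (\<lambda>z. \<Sum>i. d i j i z)"
   unfolding e by (intro wlim_sum Dc_lim)
  thus ?thesis unfolding FV_def[abs_def] by (rule slab_wlim[OF _ fdiv A(1) AT])
 qed
 have wR: "wlimL FR (\<lambda>z. ind A (fst z) * r z)"
  unfolding FR_def[abs_def] by (rule slab_wlim[OF r_lim[unfolded Rf_def] Rs_fs A(1) AT])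
 have wH: "wlimL (FH i j) (\<lambda>z. ind {0..s} (fst z) * g i j z)" for i j
  unfolding FH_def[abs_def] by (rule wlim_mult_bounded[OF g_lim slab_indicator_measurable, of _ 1]) auto
 have le: "?E (\<lambda>i j \<alpha>. (LBINT z. (FD i j \<alpha> m z)^2)) (\<lambda>j. (LBINT z. (FV j m z)^2)) (LBINT z. (FR m z)^2) \<le> (EN (N m) (NT m) 0 - (\<Sum>i j. (LBINT z. (FH i j m z)^2)) / M) * measure lborel A" (is "?L \<le> ?c * _") for m
 proof -
  \<comment> \<open>The first level after \<open>t\<close>: its balance contains the dissipation on
    all of \<open>[0, t]\<close>, whereas the level of \<open>t\<close> itself would omit the
    current time step. By \<open>slab_wlim\<close> the shifted index leads to the same weak
    limits.\<close>
  define ix where "ix t = Suc (nat \<lfloor>t / dt m\<rfloor>)" for t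
  have Tn: "T < real (nn m) * dt m" using T_pos unfolding nn_dt by simp
  note sl = slab_sq(1,2)[OF dt_pos[of m] Tn A(1) AT]
  note slD = sl[OF st_l2[OF mesh_pos fs_Dplus[OF Qs_fs]]] and slV = sl[OF st_l2[OF mesh_pos fdiv]]
   and slR = sl[OF st_l2[OF mesh_pos Rs_fs]]
  have "?L = (LBINT t. ?E (\<lambda>i j \<alpha>. ind A t * (nrmL (st (h m) (Dplus (h m) \<alpha> (cp i j (Qs m (ix t))))))^2) (\<lambda>j. ind A t * (nrmL (st (h m) (divh (h m) j (Qs m (ix t)))))^2) (ind A t * (nrmL (st (h m) (Rs m (ix t))))^2))"
   unfolding FD_def FV_def FR_def slD(2) slV(2) slR(2) ix_def by (rule integral_energy_density[OF slD(1) slV(1) slR(1)])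
  also have "\<dots> = (LBINT t. ind A t * EN (N m) (NT m) (ix t))"
   by (intro Bochner_Integration.integral_cong refl) (simp add: EN_expand sum_distrib_left algebra_simps)
  also have "\<dots> \<le> (LBINT t. ind A t * ?c)"
  proof (rule integral_mono')
   show "integrable lborel (\<lambda>t. ind A t * ?c)" using A(1) Af by simp
   fix t
   have "EN (N m) (NT m) (ix t) \<le> ?c" if t: "t \<in> A"
   proof -
    have "(LBINT z. (FH i j m z)^2) \<le> dt m * (\<Sum>l<ix t. IP (h m) (Hs m i j l) (Hs m i j l))" for i j
    proof -
     define B where "B = tsf (dt m) (ix t) (\<lambda>n. st (h m) (Hs m i j n))"
     have "(LBINT z. (FH i j m z)^2) \<le> (LBINT z. (B z)^2)"
     proof (rule integral_mono')
      show "integrable lborel (\<lambda>z. (B z)^2)" unfolding B_def by (intro l2_int tsf_l2(1) dt_pos st_Hs_l2)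
      fix z :: "real \<times> pt"
      have "t < real (ix t) * dt m" using time_index_less[OF dt_pos[of m], of t "ix t"] t AT by (auto simp: ix_def)
      hence "FH i j m z \<noteq> 0 \<Longrightarrow> FH i j m z = B z" using t A(2)
       by (auto simp: FH_def Hf_def B_def tsf_def indicator_def split: if_splits)
      thus "(FH i j m z)^2 \<le> (B z)^2" by (cases "FH i j m z = 0") auto
     qed simp
     also have "\<dots> = dt m * (\<Sum>l<ix t. IP (h m) (Hs m i j l) (Hs m i j l))"
      using tsf_l2(2)[OF dt_pos[of m], of "ix t" "\<lambda>l. st (h m) (Hs m i j l)", OF st_Hs_l2] by (simp add: B_def nrm_sq[symmetric] IP_self)
     finally show ?thesis .
    qed
    hence "(\<Sum>i j. (LBINT z. (FH i j m z)^2)) \<le> (\<Sum>i j. dt m * (\<Sum>l<ix t. IP (h m) (Hs m i j l) (Hs m i j l)))"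
     by (intro sum_mono)
    also have "\<dots> = dt m * (\<Sum>l<ix t. \<Sum>i j. IP (h m) (Hs m i j l) (Hs m i j l))"
     unfolding sum_distrib_left by (subst (2) sum.swap) (intro sum.cong refl, rule sum.swap)
    finally have "(\<Sum>i j. (LBINT z. (FH i j m z)^2)) / M \<le> (dt m * (\<Sum>l<ix t. \<Sum>i j. IP (h m) (Hs m i j l) (Hs m i j l))) / M"
     using M_pos by (intro divide_right_mono) auto
    thus ?thesis using energy[OF NT_pos[of m], of "N m" "ix t"] by simp
   qed
   thus "ind A t * EN (N m) (NT m) (ix t) \<le> ind A t * ?c" "0 \<le> ind A t * ?c"
    using EN_nonneg[OF NT_pos[of m], of "N m" "ix t"] by (cases "t \<in> A", simp_all, linarith?)+
  qed
  also have "\<dots> = ?c * measure lborel A" using A(1) Af by simp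
  finally show ?thesis .
 qed
 define bD where "bD i j \<alpha> = lowb lborel (FD i j \<alpha>) (\<lambda>z. ind A (fst z) * d i j \<alpha> z)" for i j \<alpha>
 define bV where "bV j = lowb lborel (FV j) (\<lambda>z. ind A (fst z) * (\<Sum>i. d i j i z))" for j
 define bR where "bR = lowb lborel FR (\<lambda>z. ind A (fst z) * r z)"
 define bH where "bH i j = lowb lborel (FH i j) (\<lambda>z. ind {0..s} (fst z) * g i j z)" for i j
 note bD = wlim_lower[OF wD, folded bD_def] and bV = wlim_lower[OF wV, folded bV_def]
  and bR = wlim_lower[OF wR, folded bR_def] and bH = wlim_lower[OF wH, folded bH_def]
 have "?E (\<lambda>i j \<alpha>. (LBINT z. (ind A (fst z) * d i j \<alpha> z)^2)) (\<lambda>j. (LBINT z. (ind A (fst z) * (\<Sum>i. d i j i z))^2)) (LBINT z. (ind A (fst z) * r z)^2)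
   \<le> (E0 - hh s / M) * measure lborel A"
 proof (rule LIMSEQ_le)
  show "(\<lambda>m. ?E (\<lambda>i j \<alpha>. bD i j \<alpha> m) (\<lambda>j. bV j m) (bR m)) \<longlonglongrightarrow>
   ?E (\<lambda>i j \<alpha>. (LBINT z. (ind A (fst z) * d i j \<alpha> z)^2)) (\<lambda>j. (LBINT z. (ind A (fst z) * (\<Sum>i. d i j i z))^2)) (LBINT z. (ind A (fst z) * r z)^2)"
   by (intro tendsto_intros bD bV bR)
  show "(\<lambda>m. (EN (N m) (NT m) 0 - (\<Sum>i j. bH i j m) / M) * measure lborel A) \<longlonglongrightarrow> (E0 - hh s / M) * measure lborel A"
   unfolding hh_def by (intro tendsto_intros EN0_tendsto bH) (use M_pos in simp)
  have "?E (\<lambda>i j \<alpha>. bD i j \<alpha> m) (\<lambda>j. bV j m) (bR m)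
   \<le> ?E (\<lambda>i j \<alpha>. (LBINT z. (FD i j \<alpha> m z)^2)) (\<lambda>j. (LBINT z. (FV j m z)^2)) (LBINT z. (FR m z)^2)" for m
   using L1_pos L2_pos L3_pos by (intro mult_left_mono add_mono sum_mono bD bV bR) auto
  moreover have "(EN (N m) (NT m) 0 - (\<Sum>i j. (LBINT z. (FH i j m z)^2)) / M) * measure lborel A
   \<le> (EN (N m) (NT m) 0 - (\<Sum>i j. bH i j m) / M) * measure lborel A" for m
   using M_pos by (intro mult_right_mono diff_left_mono divide_right_mono sum_mono bH) auto
  ultimately show "\<exists>k. \<forall>m\<ge>k. ?E (\<lambda>i j \<alpha>. bD i j \<alpha> m) (\<lambda>j. bV j m) (bR m)
    \<le> (EN (N m) (NT m) 0 - (\<Sum>i j. bH i j m) / M) * measure lborel A"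
   using le order_trans by meson
 qed
 moreover have "(LBINT t. ind A t * en t) = ?E (\<lambda>i j \<alpha>. (LBINT t. ind A t * ssq (d i j \<alpha>) t)) (\<lambda>j. (LBINT t. ind A t * ssq (\<lambda>z. \<Sum>i. d i j i z) t)) (LBINT t. ind A t * ssq r t)"
 proof -
  note sl = slab_sq_limit(2)[OF d_l2 A(1), folded ssq_def] slab_sq_limit(2)[OF div_l2 A(1)] slab_sq_limit(2)[OF r_l2 A(1), folded ssq_def]
  have "(LBINT t. ind A t * en t) = (LBINT t. ?E (\<lambda>i j \<alpha>. ind A t * ssq (d i j \<alpha>) t) (\<lambda>j. ind A t * ssq (\<lambda>z. \<Sum>i. d i j i z) t) (ind A t * ssq r t))"
   by (intro Bochner_Integration.integral_cong refl) (simp add: en_def sum_distrib_left algebra_simps)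
  also have "\<dots> = ?E (\<lambda>i j \<alpha>. (LBINT t. ind A t * ssq (d i j \<alpha>) t)) (\<lambda>j. (LBINT t. ind A t * ssq (\<lambda>z. \<Sum>i. d i j i z) t)) (LBINT t. ind A t * ssq r t)"
   by (rule integral_energy_density[symmetric]) (use sl in \<open>simp_all add: ssq_def\<close>)
  finally show ?thesis .
 qed
 ultimately show ?thesis
  unfolding slab_sq_limit(1)[OF d_l2 A(1)] slab_sq_limit(1)[OF div_l2 A(1)] slab_sq_limit(1)[OF r_l2 A(1)] unfolding ssq_def by linarith
qed

text \<open>The exceptional null set must not depend on \<open>s\<close>. Only rational
  \<open>s\<close> are used at first, and \<open>hh\<close> is then carried to \<open>t\<close>
  along rationals below \<open>t\<close> by dominated convergence.\<close>

lemma energy_limit: "AE t in lborel. t \<in> {0..T} \<longrightarrow> en t + hh t / M \<le> E0"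
proof -
 have "AE t in lborel. t \<in> {s..T} \<longrightarrow> en t \<le> E0 - hh s / M" if "0 \<le> s" for s
  by (rule AE_slice_bound[OF en_integrable _ _ slab_energy[OF that]]) auto
 hence "\<forall>s\<in>\<rat>. AE t in lborel. 0 \<le> s \<longrightarrow> t \<in> {s..T} \<longrightarrow> en t \<le> E0 - hh s / M" by auto
 hence "AE t in lborel. \<forall>s\<in>\<rat>. 0 \<le> s \<longrightarrow> t \<in> {s..T} \<longrightarrow> en t \<le> E0 - hh s / M"
  by (subst AE_ball_countable[OF countable_rat])
 thus ?thesis
 proof eventually_elim
  fix t assume H: "\<forall>s\<in>\<rat>. 0 \<le> s \<longrightarrow> t \<in> {s..T} \<longrightarrow> en t \<le> E0 - hh s / M"
  show "t \<in> {0..T} \<longrightarrow> en t + hh t / M \<le> E0"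
  proof
   assume t: "t \<in> {0..T}"
   define s where "s k = real_of_int \<lfloor>t * real (Suc k)\<rfloor> / real (Suc k)" for k
   have s0: "0 \<le> s k" "s k \<in> \<rat>" for k using t by (auto simp: s_def)
   have s1: "s k \<le> t" "t - s k \<le> 1 / real (Suc k)" for k
   proof -
    have "real_of_int \<lfloor>t * real (Suc k)\<rfloor> \<le> t * real (Suc k)" "t * real (Suc k) \<le> real_of_int \<lfloor>t * real (Suc k)\<rfloor> + 1" by linarith+
    thus "s k \<le> t" "t - s k \<le> 1 / real (Suc k)"
     unfolding s_def by (simp_all add: divide_le_eq field_simps del: of_nat_Suc)
   qed
   have "(\<lambda>k. t - s k) \<longlonglongrightarrow> 0"
    by (rule tendsto_sandwich[OF _ _ tendsto_const LIMSEQ_Suc[OF lim_inverse_n']]) (use s1 in \<open>auto intro!: always_eventually\<close>)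
   hence st: "s \<longlonglongrightarrow> t" using LIM_zero_iff[of "\<lambda>k. s k" t] tendsto_minus[of "\<lambda>k. t - s k" 0] by simp
   have "(\<lambda>k. \<integral>z. (ind {0..s k} (fst z) * g i j z)^2 \<partial>lborel) \<longlonglongrightarrow> (LBINT z. (ind {0..t} (fst z) * g i j z)^2)" for i j
   proof (rule integral_dominated_convergence[where w = "\<lambda>z. (g i j z)^2"])
    have m: "(\<lambda>z. ind {0..u} (fst z) * g i j z) \<in> bmL" for u
     using slab_indicator_measurable[of "{0..u}"] l2_meas[OF g_l2[of i j]] by simp
    show "(\<lambda>z. (ind {0..t} (fst z) * g i j z)^2) \<in> bmL"
     "(\<lambda>z. (ind {0..s k} (fst z) * g i j z)^2) \<in> bmL" for k using m by simp_all
    show "integrable lborel (\<lambda>z. (g i j z)^2)" by (rule l2_int[OF g_l2])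
    show "AE z in lborel. (\<lambda>k. (ind {0..s k} (fst z) * g i j z)^2) \<longlonglongrightarrow> (ind {0..t} (fst z) * g i j z)^2"
     using AE_time_neq[of t]
    proof eventually_elim
     fix z :: "real \<times> pt" assume z: "fst z \<noteq> t"
     have "\<forall>\<^sub>F k in sequentially. ind {0..s k} (fst z) = ind {0..t} (fst z)"
     proof (cases "fst z < t")
      case True
      from order_tendstoD(1)[OF st this] show ?thesis by eventually_elim (use True in \<open>simp add: indicator_def\<close>)
     next
      case False
      hence "\<not> fst z \<le> s k" "\<not> fst z \<le> t" for k using s1(1)[of k] z by linarith+
      thus ?thesis by (simp add: indicator_def)
     qed
     hence "(\<lambda>k. ind {0..s k} (fst z)) \<longlonglongrightarrow> ind {0..t} (fst z)" by (rule tendsto_eventually)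
     thus "(\<lambda>k. (ind {0..s k} (fst z) * g i j z)^2) \<longlonglongrightarrow> (ind {0..t} (fst z) * g i j z)^2"
      by (intro tendsto_intros)
    qed
    show "AE z in lborel. norm ((ind {0..s k} (fst z) * g i j z)^2) \<le> (g i j z)^2" for k by (simp add: indicator_def)
   qed
   hence "(\<lambda>k. E0 - hh (s k) / M) \<longlonglongrightarrow> E0 - hh t / M" unfolding hh_def using M_pos by (intro tendsto_intros) auto
   moreover have "en t \<le> E0 - hh (s k) / M" for k using H s0 s1(1) t by auto
   ultimately have "en t \<le> E0 - hh t / M" by (intro LIMSEQ_le_const) auto
   thus "en t + hh t / M \<le> E0" by simp
  qed
 qed
qed

lemma q_slice_bound: "AE t in lborel. t \<in> {0..T} \<longrightarrow> ssq (q i j) t \<le> CQ^2"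
proof (rule AE_slice_bound[OF ssq_integrable[OF q_l2]])
 fix A :: "real set" assume A: "A \<in> sets borel" "A \<subseteq> {0..T}"
 have Af: "emeasure lborel A < \<infinity>" by (rule emeasure_bounded_finite) (rule bounded_subset[of "{0..T}"], use A in auto)
 have "wlimL (\<lambda>m z. ind A (fst z) * Qf i j m z) (\<lambda>z. ind A (fst z) * q i j z)"
  by (rule wlim_mult_bounded[OF q_lim slab_indicator_measurable[OF A(1)], of 1]) simp
 note b = wlim_lower[OF this]
 have "lowb lborel (\<lambda>m z. ind A (fst z) * Qf i j m z) (\<lambda>z. ind A (fst z) * q i j z) m \<le> CQ^2 * measure lborel A" for m
 proof -
  have Tn: "T < real (nn m) * dt m" using T_pos unfolding nn_dt by simp
  have "(LBINT z. (ind A (fst z) * Qf i j m z)^2) = (LBINT t. ind A t * (nrmL (st (h m) (cp i j (Qs m (nat \<lfloor>t / dt m\<rfloor>)))))^2)"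
   unfolding Qf_def by (rule slab_sq(2)[OF dt_pos Tn A st_Qs_l2])
  also have "\<dots> \<le> (LBINT t. ind A t * CQ^2)"
  proof (rule integral_mono')
   show "integrable lborel (\<lambda>t. ind A t * CQ^2)" using A(1) Af by simp
   fix t
   show "ind A t * (nrmL (st (h m) (cp i j (Qs m (nat \<lfloor>t / dt m\<rfloor>)))))^2 \<le> ind A t * CQ^2"
   proof (cases "t \<in> A")
    case True
    hence "nat \<lfloor>t / dt m\<rfloor> < nn m" using A(2) Tn time_index_less[OF dt_pos[of m], of t "nn m"] by auto
    thus ?thesis by (intro mult_left_mono power_mono nrm_Qs_le) auto
   qed simp
  qed simp
  also have "\<dots> = CQ^2 * measure lborel A" using A(1) Af by simp
  finally show ?thesis using b(1) order_trans by blast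
 qed
 hence "(LBINT z. (ind A (fst z) * q i j z)^2) \<le> CQ^2 * measure lborel A" by (intro LIMSEQ_le_const2[OF b(2)]) auto
 thus "(LBINT t. ind A t * ssq (q i j) t) \<le> CQ^2 * measure lborel A"
  unfolding slab_sq_limit(1)[OF q_l2 A(1)] ssq_def .
qed auto

end

section \<open>The limit is a weak solution\<close>

text \<open>The mean value theorem yields zeros of the derivative in direction \<open>v\<close>
  arbitrarily close to \<open>z\<close>, and that derivative is continuous. Vanishing on one side of
  \<open>z\<close> is enough, which matters where a test function is controlled only for times in
  \<open>[0, T]\<close>.\<close>

lemma frechet_derivative_vanishes:
 fixes f :: "'a::euclidean_space \<Rightarrow> real"
 assumes f: "\<And>z. f differentiable (at z)" and c: "continuous_on UNIV (\<lambda>z. frechet_derivative f (at z) v)"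
  and \<delta>: "\<delta> > 0" "\<And>\<tau>. 0 \<le> \<tau> \<Longrightarrow> \<tau> < \<delta> \<Longrightarrow> f (z + \<tau> *\<^sub>R v) = 0"
 shows "frechet_derivative f (at z) v = 0"
proof -
 have "\<exists>\<theta>. \<bar>\<theta>\<bar> \<le> \<delta> / real (n + 2) \<and> frechet_derivative f (at (z + \<theta> *\<^sub>R v)) v = 0" for n :: nat
 proof -
  have t: "0 < \<delta> / real (n + 2)" "\<delta> / real (n + 2) < \<delta>" using \<delta>(1) by (simp_all add: divide_less_eq)
  obtain \<theta> where "0 \<le> \<theta>" "\<theta> \<le> \<delta> / real (n + 2)"
   "f (z + (\<delta> / real (n + 2)) *\<^sub>R v) - f z = \<delta> / real (n + 2) * frechet_derivative f (at (z + \<theta> *\<^sub>R v)) v"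
   using frechet_mvt[OF f t(1)] by blast
  thus ?thesis using \<delta>(2)[of 0] \<delta>(2)[of "\<delta> / real (n + 2)"] t \<delta>(1) by (intro exI[of _ \<theta>]) auto
 qed
 then obtain \<theta> where \<theta>: "\<And>n::nat. \<bar>\<theta> n\<bar> \<le> \<delta> / real (n + 2)" "\<And>n. frechet_derivative f (at (z + \<theta> n *\<^sub>R v)) v = 0" by metis
 have "(\<lambda>n. \<delta> / real (n + 2)) \<longlonglongrightarrow> 0" by real_asymp
 hence "\<theta> \<longlonglongrightarrow> 0" by (rule Lim_null_comparison[rotated]) (use \<theta>(1) in auto)
 hence "(\<lambda>n. z + \<theta> n *\<^sub>R v) \<longlonglongrightarrow> z + 0 *\<^sub>R v" by (intro tendsto_intros)
 hence "(\<lambda>n. frechet_derivative f (at (z + \<theta> n *\<^sub>R v)) v) \<longlonglongrightarrow> frechet_derivative f (at z) v"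
  by (intro continuous_on_tendsto_compose[OF c]) auto
 thus ?thesis by (simp add: \<theta>(2) LIMSEQ_const_iff)
qed

text \<open>Off the open cube a test function is known to vanish only for times in
  \<open>[0, T]\<close>; the time derivative is therefore reached through later times, which
  excludes \<open>t = T\<close>.\<close>

lemma tst_vanish:
 assumes p: "tst T \<phi>" and t: "0 \<le> t" "t \<le> T"
 shows "x \<notin> Omega \<Longrightarrow> pd_x \<alpha> \<phi> (t, x) = 0" and "x \<notin> box 0 1 \<Longrightarrow> t < T \<Longrightarrow> pd_t \<phi> (t, x) = 0"
proof -
 assume x: "x \<notin> Omega"
 have "open (- Omega)" unfolding Omega_def by (intro open_Compl closed_cbox)
 then obtain e where e: "e > 0" "ball x e \<subseteq> - Omega" using x by (auto simp: open_contains_ball)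
 show "pd_x \<alpha> \<phi> (t, x) = 0"
  unfolding pd_x_def
 proof (rule frechet_derivative_vanishes[OF tstD(1)[OF p] tstD(3)[OF p, unfolded pd_x_def[abs_def]] e(1)])
  fix \<tau> assume "0 \<le> \<tau>" "\<tau> < e"
  hence "x + \<tau> *\<^sub>R axis \<alpha> 1 \<in> ball x e" by (simp add: dist_norm)
  hence "x + \<tau> *\<^sub>R axis \<alpha> 1 \<notin> box 0 1" using e(2) box_subset_cbox[of 0 "1::pt"] by (auto simp: Omega_def)
  thus "\<phi> ((t, x) + \<tau> *\<^sub>R (0, axis \<alpha> 1)) = 0" using tstD(5)[OF p t] by simp
 qed
next
 assume x: "x \<notin> box 0 1" and tT: "t < T"
 show "pd_t \<phi> (t, x) = 0"
  unfolding pd_t_def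
  by (rule frechet_derivative_vanishes[OF tstD(1)[OF p] tstD(4)[OF p, unfolded pd_t_def[abs_def]], of "T - t"])
   (use tT t tstD(5)[OF p _ _ x] in auto)
qed

lemma smooth_tst:
 assumes s: "smooth \<phi>" and z: "\<And>t x. 0 \<le> t \<Longrightarrow> t \<le> T \<Longrightarrow> x \<notin> box 0 1 \<Longrightarrow> \<phi> (t, x) = 0"
 shows "tst T \<phi>"
 unfolding tst_def using smooth_C1[OF s] z by blast

lemma test_fun_tst:
 assumes "test_fun T \<phi>" shows "tst T \<phi>"
 by (rule smooth_tst) (use assms in \<open>fastforce simp: test_fun_def\<close>)+

lemma test_fun_mat3_tst:
 fixes \<phi> :: "real \<times> pt \<Rightarrow> mat3"
 assumes "test_fun T \<phi>"
 shows "tst T (\<lambda>z. \<phi> z $ i $ j)" (is ?g1) "pd_x \<alpha> (\<lambda>z. \<phi> z $ i $ j) z = pd_x \<alpha> \<phi> z $ i $ j" (is ?g2) "pd_t (\<lambda>z. \<phi> z $ i $ j) z = pd_t \<phi> z $ i $ j" (is ?g3)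
proof -
 have s: "smooth \<phi>" and z: "\<And>t x. 0 \<le> t \<Longrightarrow> t \<le> T \<Longrightarrow> x \<notin> box 0 1 \<Longrightarrow> \<phi> (t, x) = 0"
  using assms by (fastforce simp: test_fun_def)+
 note d = smooth_C1(1)[OF s]
 show ?g2 ?g3
  unfolding pd_x_def pd_t_def by (rule frechet_derivative_cp(2)[OF d])+
 show ?g1
  unfolding tst_def frechet_derivative_cp(2)[OF d]
  using frechet_derivative_cp(1)[OF d] z by (auto intro!: continuous_intros smooth_C1(2)[OF s])
qed

lemma cc_test_ST:
 assumes p: "cc_test_ST T \<psi>"
 shows "tst T \<psi>" "z \<notin> {0<..<T} \<times> box 0 1 \<Longrightarrow> \<psi> z = 0" "z \<notin> {0<..<T} \<times> box 0 1 \<Longrightarrow> pd_x \<alpha> \<psi> z = 0"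
  "z \<notin> {0<..<T} \<times> box 0 1 \<Longrightarrow> pd_t \<psi> z = 0"
proof -
 obtain K where K: "compact K" "K \<subseteq> {0<..<T} \<times> box 0 1" "\<And>z. z \<notin> K \<Longrightarrow> \<psi> z = 0" and s: "smooth \<psi>"
  using p by (auto simp: cc_test_ST_def)
 show t: "tst T \<psi>" by (rule smooth_tst[OF s]) (use K in blast)
 show "z \<notin> {0<..<T} \<times> box 0 1 \<Longrightarrow> \<psi> z = 0" using K by blast
 have van: "frechet_derivative \<psi> (at z) v = 0" if z: "z \<notin> {0<..<T} \<times> box 0 1" and v: "v \<in> Basis" for v
 proof -
  have "open (- K)" "z \<in> - K" using open_Compl[OF compact_imp_closed[OF K(1)]] K(2) z by blast+
  then obtain e where e: "e > 0" "ball z e \<subseteq> - K" by (auto simp: open_contains_ball)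
  show ?thesis
  proof (rule frechet_derivative_vanishes[OF tstD(1)[OF t] smooth_C1(2)[OF s v] e(1)])
   fix \<tau> assume "0 \<le> \<tau>" "\<tau> < e"
   hence "z + \<tau> *\<^sub>R v \<in> ball z e" using v by (simp add: dist_norm)
   thus "\<psi> (z + \<tau> *\<^sub>R v) = 0" using e(2) K(3) by blast
  qed
 qed
 show "z \<notin> {0<..<T} \<times> box 0 1 \<Longrightarrow> pd_x \<alpha> \<psi> z = 0" "z \<notin> {0<..<T} \<times> box 0 1 \<Longrightarrow> pd_t \<psi> z = 0"
  unfolding pd_x_def pd_t_def by (auto intro!: van simp: Basis_prod_def axis_in_Basis_iff)
qed

lemma sum_fnorm_sq:
 "(\<Sum>m. (fnorm (\<chi> i j. u i j m))^2) = (\<Sum>i j. \<Sum>m\<in>(UNIV :: 3 set). (u i j m)^2)"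
 by (simp add: fnorm_norm norm_sq_components sum_3)

context scheme_limit
begin

text \<open>On the null slice \<open>t = T\<close> the space-time limits are arbitrary; the values
  put there are the ones that \<open>time_by_parts\<close> produces as end terms.\<close>

definition "qz i j z = (if fst z = T then qT i j (snd z) else q i j z)"
definition "Qsol t x = (\<chi> i j. qz i j (t, x))"
definition "rsol t x = (if t = T then rT x else r (t, x))"

lemma fst_snd_measurable [measurable]: "(fst :: real \<times> pt \<Rightarrow> real) \<in> bm" "(snd :: real \<times> pt \<Rightarrow> pt) \<in> bm"
 by (intro borel_measurable_continuous_onI continuous_intros)+

lemma sol_measurable [measurable]:
 "qz i j \<in> bm" (is ?g1) "q i j \<in> bm" (is ?g2) "d i j \<alpha> \<in> bm" (is ?g3) "g i j \<in> bm" (is ?g4)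
 "(\<lambda>z. rsol (fst z) (snd z)) \<in> bm" (is ?g5)
proof -
 have [measurable]: "qT i j \<in> bm" "rT \<in> bm" "r \<in> bm"
  using l2_meas[OF wlimD(2)[OF qT_lim[of i j]]] l2_meas[OF wlimD(2)[OF rT_lim]] l2_meas[OF r_l2] by simp_all
 show [measurable]: ?g2 ?g3 ?g4
  using l2_meas[OF q_l2[of i j]] l2_meas[OF d_l2[of i j]] l2_meas[OF g_l2[of i j]] by simp_all
 show ?g1 unfolding qz_def[abs_def] by measurable
 show ?g5 unfolding rsol_def by simp
qed

lemma Qsol_measurable [measurable]: "(\<lambda>z. Qsol (fst z) (snd z)) \<in> bm"
 by (rule borel_measurable_mat3) (simp add: Qsol_def)

lemma Qsol_cp: "Qsol (fst z) (snd z) $ i $ j = qz i j z"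
 by (simp add: Qsol_def)

lemma Qsol_sym_tf: "sym_tf (Qsol t x)"
 using q_sym[of "(t, x)"] qT_sym[of x] by (cases "t = T") (simp_all add: Qsol_def qz_def)

lemma TI_W:
 assumes p: "tst T \<phi>"
 shows "ind W z * \<phi> z = TI T z * \<phi> z" "ind W z * pd_x \<alpha> \<phi> z = TI T z * pd_x \<alpha> \<phi> z"
  "fst z \<noteq> T \<Longrightarrow> ind W z * pd_t \<phi> z = TI T z * pd_t \<phi> z"
 using tstD(5)[OF p, of "fst z" "snd z"] tst_vanish[OF p, of "fst z" "snd z"] box_subset_cbox[of 0 "1::pt"]
 by (cases z, auto simp: W_def TI_def indicator_def Omega_def)+

lemma test_l2:
 assumes p: "tst T \<phi>"
 shows "l2L (\<lambda>z. TI T z * \<phi> z)" (is ?g1) "l2L (\<lambda>z. TI T z * pd_x \<alpha> \<phi> z)" (is ?g2) "l2L (\<lambda>z. TI T z * pd_t \<phi> z)" (is ?g3)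
  "l2L (\<lambda>z. (TI T z * \<phi> z) * pq i j z)" (is ?g4) "\<And>t. t \<in> {0, T} \<Longrightarrow> l2L (\<lambda>x. \<phi> (t, x))"
proof -
 show ?g1 ?g2 ?g3
  by (rule slimD(2)[OF smp_limits(1)[OF p]] slimD(2)[OF smp_limits(4)[OF p]] slimD(2)[OF smp_limits(5)[OF p]])+
 show ?g4 by (rule slimD(2)[OF slim_P_smp[OF p]])
 show "l2L (\<lambda>x. \<phi> (t, x))" if "t \<in> {0, T}" for t
  using that slimD(2)[OF slim_smp_slice[OF p, of "\<lambda>m. NT m" T]] slimD(2)[OF slim_smp_slice[OF p, of "\<lambda>m. 0" 0]] by (auto simp: NT_dt)
qed

lemma ST_lborel: "ST = (lborel :: (real \<times> pt) measure)"
 by (rule lborel_prod)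

lemma set_integral_AE:
 assumes e: "AE z in \<mu>. ind A z * f z = F z" and m: "(\<lambda>z. ind A z * f z) \<in> borel_measurable \<mu>" "F \<in> borel_measurable \<mu>"
 shows "set_lebesgue_integral \<mu> A f = (\<integral>z. F z \<partial>\<mu>)"
 unfolding set_lebesgue_integral_def using integral_cong_AE[OF m e] by simp

lemma test_measurable:
 assumes "tst T \<phi>"
 shows "\<phi> \<in> bm" "pd_x \<alpha> \<phi> \<in> bm" "pd_t \<phi> \<in> bm"
 using tstD(2-4)[OF assms] by (auto intro: borel_measurable_continuous_onI)

lemma slice_integral:
 fixes f :: "3 \<Rightarrow> 3 \<Rightarrow> pt \<Rightarrow> real"
 assumes f: "\<And>i j. l2L (f i j)" and p: "\<And>i j. l2L (\<phi> i j)" "\<And>i j x. x \<notin> box 0 1 \<Longrightarrow> \<phi> i j x = 0"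
  and F: "AE x in lborel. x \<in> box 0 1 \<longrightarrow> (\<forall>i j. F x $ i $ j = f i j x)" and e: "\<And>x i j. \<Phi> x $ i $ j = \<phi> i j x"
  and m: "\<And>i j. (\<lambda>x. ind Omega x * F x $ i $ j) \<in> bmL"
 shows "(LINT x:Omega|lborel. frob (F x) (\<Phi> x)) = (\<Sum>i j. (LBINT x. f i j x * \<phi> i j x))"
proof -
 have "(LINT x:Omega|lborel. frob (F x) (\<Phi> x)) = (LBINT x. (\<Sum>i j. f i j x * \<phi> i j x))"
 proof (rule set_integral_AE)
  show "AE x in lborel. ind Omega x * frob (F x) (\<Phi> x) = (\<Sum>i j. f i j x * \<phi> i j x)"
   using F
  proof eventually_elim
   fix x assume "x \<in> box 0 1 \<longrightarrow> (\<forall>i j. F x $ i $ j = f i j x)"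
   thus "ind Omega x * frob (F x) (\<Phi> x) = (\<Sum>i j. f i j x * \<phi> i j x)"
    using box_subset_cbox[of 0 "1::pt"] by (cases "x \<in> box 0 1") (auto simp: frob_def e p Omega_def)
  qed
  have "ind Omega x * frob (F x) (\<Phi> x) = (\<Sum>i j. (ind Omega x * F x $ i $ j) * \<phi> i j x)" for x
   by (simp add: frob_def e sum_distrib_left mult.assoc)
  thus "(\<lambda>x. ind Omega x * frob (F x) (\<Phi> x)) \<in> bmL"
   using l2_meas[OF p(1)] m by simp
  show "(\<lambda>x. \<Sum>i j. f i j x * \<phi> i j x) \<in> bmL"
   using l2_meas[OF p(1)] l2_meas[OF f] by simp
 qed
 also have "\<dots> = (\<Sum>i j. (LBINT x. f i j x * \<phi> i j x))"
  by (simp add: l2_mult_int[OF f p(1)])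
 finally show ?thesis .
qed

lemma Q0_measurable: "(\<lambda>x. ind Omega x * Q0 x $ i $ j) \<in> bmL"
 and DQ0_measurable: "(\<lambda>x. ind Omega x * DQ0 \<alpha> x $ i $ j) \<in> bmL"
 using DQ0[unfolded H1_def set_borel_measurable_def]
  measurable_compose[OF _ mat3_entry_measurable, of "\<lambda>x. ind Omega x *\<^sub>R Q0 x" lborel i j]
  measurable_compose[OF _ mat3_entry_measurable, of "\<lambda>x. ind Omega x *\<^sub>R DQ0 \<alpha> x" lborel i j] by simp_all

lemma weak_dx_sol: "weak_dx T (\<lambda>z. Qsol (fst z) (snd z)) \<alpha> (\<lambda>z. \<chi> i j. d i j \<alpha> z)" (is ?g1)
 and weak_dt_sol: "weak_dt T (\<lambda>z. Qsol (fst z) (snd z)) (\<lambda>z. \<chi> i j. g i j z)" (is ?g2)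
proof -
 let ?S = "{0<..<T} \<times> box 0 (1::pt)"
 \<comment> \<open>Reduction of the matrix valued integral to its entries. The test function
   vanishes off \<open>?S\<close>, so the domain of integration may be enlarged to the whole
   space.\<close>
 have cp: "(set_lebesgue_integral ST ?S (\<lambda>z. w z *\<^sub>R F z)) $ i $ j = (LBINT z. f i j z * (TI T z * w z))"
  if f: "\<And>i j. l2L (f i j)" and w: "l2L (\<lambda>z. TI T z * w z)" "w \<in> bm" "\<And>z. z \<notin> ?S \<Longrightarrow> w z = 0"
   and F: "\<And>z i j. fst z \<noteq> T \<Longrightarrow> F z $ i $ j = f i j z" "\<And>i j. (\<lambda>z. F z $ i $ j) \<in> bm"
  for f w i j and F :: "real \<times> pt \<Rightarrow> mat3"
 proof -
  have i1: "ind ?S z *\<^sub>R (w z *\<^sub>R F z) = w z *\<^sub>R F z" for z using w(3)[of z] by (cases "z \<in> ?S") auto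
  have i2: "TI T z * w z = w z" for z using w(3)[of z] by (cases "z \<in> ?S") (auto simp: TI_def)
  have e: "AE z in lborel. f i j z * (TI T z * w z) = (w z *\<^sub>R F z) $ i $ j" for i j
   using AE_time_neq[of T] by eventually_elim (simp add: F i2)
  have m: "(\<lambda>z. (w z *\<^sub>R F z) $ i $ j) \<in> bmL" for i j using w(2) F(2)[of i j] by simp
  have "integrable lborel (\<lambda>z. (w z *\<^sub>R F z) $ i $ j)" for i j
   by (rule integrable_cong_AE_imp[OF l2_mult_int[OF f w(1)] m e])
  hence I: "integrable lborel (\<lambda>z. w z *\<^sub>R F z)" by (rule integrable_mat3)
  have "(set_lebesgue_integral ST ?S (\<lambda>z. w z *\<^sub>R F z)) $ i $ j = (LBINT z. (w z *\<^sub>R F z) $ i $ j)"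
   unfolding set_lebesgue_integral_def i1 ST_lborel by (rule integral_mat3[OF I])
  also have "\<dots> = (LBINT z. f i j z * (TI T z * w z))"
   by (rule integral_cong_AE[OF m borel_measurable_integrable[OF l2_mult_int[OF f w(1)]] AE_symmetric[OF e]])
  finally show ?thesis .
 qed
 have Qm: "(\<lambda>z. Qsol (fst z) (snd z) $ i $ j) \<in> bm" for i j by (simp add: Qsol_cp)
 have Qe: "fst z \<noteq> T \<Longrightarrow> Qsol (fst z) (snd z) $ i $ j = q i j z" for z i j by (simp add: Qsol_cp qz_def)
 show ?g1
  unfolding weak_dx_def
 proof (intro allI impI)
  fix \<psi> assume c: "cc_test_ST T \<psi>"
  note p = cc_test_ST(1)[OF c]
  show "set_lebesgue_integral ST ?S (\<lambda>z. pd_x \<alpha> \<psi> z *\<^sub>R Qsol (fst z) (snd z)) = - set_lebesgue_integral ST ?S (\<lambda>z. \<psi> z *\<^sub>R (\<chi> i j. d i j \<alpha> z))"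
   unfolding vec_eq_iff
   using cp[OF q_l2 test_l2(2)[OF p] test_measurable(2)[OF p] cc_test_ST(3)[OF c] Qe Qm]
    cp[of "\<lambda>i j. d i j \<alpha>" \<psi> "\<lambda>z. \<chi> i j. d i j \<alpha> z", OF d_l2 test_l2(1)[OF p] test_measurable(1)[OF p] cc_test_ST(2)[OF c]] weak_derivative_x[OF p] by simp
 qed
 show ?g2
  unfolding weak_dt_def
 proof (intro allI impI)
  fix \<psi> assume c: "cc_test_ST T \<psi>"
  note p = cc_test_ST(1)[OF c]
  have z: "\<psi> (T, x) = 0" "\<psi> (0, x) = 0" for x by (auto intro!: cc_test_ST(2)[OF c])
  show "set_lebesgue_integral ST ?S (\<lambda>z. pd_t \<psi> z *\<^sub>R Qsol (fst z) (snd z)) = - set_lebesgue_integral ST ?S (\<lambda>z. \<psi> z *\<^sub>R (\<chi> i j. g i j z))"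
   unfolding vec_eq_iff
   using cp[OF q_l2 test_l2(3)[OF p] test_measurable(3)[OF p] cc_test_ST(4)[OF c] Qe Qm]
    cp[of g \<psi> "\<lambda>z. \<chi> i j. g i j z", OF g_l2 test_l2(1)[OF p] test_measurable(1)[OF p] cc_test_ST(2)[OF c]] weak_derivative_t[OF p] by (simp add: z)
 qed
qed

end

context scheme_limit
begin

lemma PF_Qsol_measurable [measurable]: "(\<lambda>z. PF (Qsol (fst z) (snd z)) $ i $ j) \<in> bm"
 by (rule measurable_compose[OF Qsol_measurable PF_measurable])

lemma Qsol_Qv: "fst z \<noteq> T \<Longrightarrow> Qsol (fst z) (snd z) = Qv z" and rsol_r: "fst z \<noteq> T \<Longrightarrow> rsol (fst z) (snd z) = r z"
 by (simp_all add: Qsol_def qz_def Qv_def rsol_def)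

lemma W_integral1:
 assumes m: "F \<in> bmL" "G \<in> bm" and e: "\<And>z. fst z \<noteq> T \<Longrightarrow> ind W z * G z = F z"
 shows "set_lebesgue_integral ST W G = (LBINT z. F z)"
 unfolding ST_lborel
proof (rule set_integral_AE)
 show "AE z in lborel. ind W z * G z = F z" using AE_time_neq[of T] by eventually_elim (rule e)
qed (use m in simp_all)

lemma W_integral:
 assumes f: "\<And>i j. l2L (f i j)" and w: "\<And>i j. l2L (w i j)" and m: "G \<in> bm"
  and e: "\<And>z. fst z \<noteq> T \<Longrightarrow> ind W z * G z = (\<Sum>i j. f i j z * w i j z)"
 shows "set_lebesgue_integral ST W G = (\<Sum>i\<in>(UNIV :: 3 set). \<Sum>j\<in>(UNIV :: 3 set). (LBINT z. f i j z * w i j z))"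
 by (subst W_integral1[OF _ m e]) (use l2_meas[OF f] l2_meas[OF w] in \<open>simp_all add: l2_mult_int[OF f w]\<close>)

lemma sol_equation_Q:
 fixes \<phi> :: "real \<times> pt \<Rightarrow> mat3"
 assumes t: "test_fun T \<phi>"
 shows "(LINT z:W|ST. frob (Qsol (fst z) (snd z)) (pd_t \<phi> z)) - (LINT x:Omega|lborel. frob (Qsol T x) (\<phi> (T, x)))
   + (LINT x:Omega|lborel. frob (Q0 x) (\<phi> (0, x)))
  = M * (LINT z:W|ST. L1 * (\<Sum>i j m. (\<chi> i j. d i j m z) $ i $ j * pd_x m \<phi> z $ i $ j)
     + L23 / 2 * (\<Sum>i j k. (\<chi> i j. d i j k z) $ j $ k * pd_x i \<phi> z $ i $ j
       + (\<chi> i j. d i j k z) $ i $ k * pd_x j \<phi> z $ i $ j - 2/3 * (\<chi> a b. d a b i z) $ k $ i * pd_x k \<phi> z $ j $ j))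
   + M * (LINT z:W|ST. rsol (fst z) (snd z) * frob (PF (Qsol (fst z) (snd z))) (\<phi> z))"
proof -
 define f where "f i j = (\<lambda>z. \<phi> z $ i $ j)" for i j
 have p: "tst T (f i j)" for i j unfolding f_def by (rule test_fun_mat3_tst[OF t])
 have px: "pd_x \<alpha> \<phi> z $ i $ j = pd_x \<alpha> (f i j) z" and pt: "pd_t \<phi> z $ i $ j = pd_t (f i j) z" for \<alpha> z i j
  using test_fun_mat3_tst(2,3)[OF t] by (simp_all add: f_def)
 note [measurable] = test_measurable[OF p]
 have I1: "(LINT z:W|ST. frob (Qsol (fst z) (snd z)) (pd_t \<phi> z)) = (\<Sum>i j. (LBINT z. q i j z * (TI T z * pd_t (f i j) z)))"
  by (rule W_integral[OF q_l2 test_l2(3)[OF p]], simp add: frob_def pt Qsol_cp)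
   (simp add: frob_def pt Qsol_cp qz_def TI_W(3)[OF p, symmetric] sum_distrib_left mult_ac)
 have I2: "(LINT x:Omega|lborel. frob (Qsol T x) (\<phi> (T, x))) = (\<Sum>i j. (LBINT x. qT i j x * f i j (T, x)))"
  by (rule slice_integral[OF wlimD(2)[OF qT_lim] test_l2(5)[OF p]])
   (use tstD(5)[OF p] T_pos l2_meas[OF wlimD(2)[OF qT_lim]] in \<open>auto simp: Qsol_def qz_def f_def Omega_def\<close>)
 have I3: "(LINT x:Omega|lborel. frob (Q0 x) (\<phi> (0, x))) = (\<Sum>i j. (LBINT x. q0 i j x * f i j (0, x)))"
  by (rule slice_integral[OF q0_l2 test_l2(5)[OF p] _ _ _ Q0_measurable])
   (use tstD(5)[OF p] T_pos in \<open>auto simp: q0_def f_def\<close>)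
 have I4: "(LINT z:W|ST. rsol (fst z) (snd z) * frob (PF (Qsol (fst z) (snd z))) (\<phi> z)) =
   (\<Sum>i j. (LBINT z. r z * ((TI T z * f i j z) * pq i j z)))"
 proof (rule W_integral[OF r_l2 test_l2(4)[OF p]])
  have [measurable]: "(\<lambda>z. \<phi> z $ i $ j) \<in> bm" for i j using test_measurable(1)[OF p] by (simp add: f_def)
  show "(\<lambda>z. rsol (fst z) (snd z) * frob (PF (Qsol (fst z) (snd z))) (\<phi> z)) \<in> bm"
   unfolding frob_def by measurable
  fix z :: "real \<times> pt" assume z: "fst z \<noteq> T"
  show "ind W z * (rsol (fst z) (snd z) * frob (PF (Qsol (fst z) (snd z))) (\<phi> z)) = (\<Sum>i j. r z * ((TI T z * f i j z) * pq i j z))"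
   unfolding TI_W(1)[OF p, symmetric] by (simp add: frob_def Qsol_Qv[OF z] rsol_r[OF z] f_def pq_def sum_distrib_left indicator_def mult_ac)
 qed
 have I5: "(LINT z:W|ST. L1 * (\<Sum>i j m. (\<chi> i j. d i j m z) $ i $ j * pd_x m \<phi> z $ i $ j)
     + L23 / 2 * (\<Sum>i j k. (\<chi> i j. d i j k z) $ j $ k * pd_x i \<phi> z $ i $ j
       + (\<chi> i j. d i j k z) $ i $ k * pd_x j \<phi> z $ i $ j - 2/3 * (\<chi> a b. d a b i z) $ k $ i * pd_x k \<phi> z $ j $ j))
   = L1 * (\<Sum>i j \<alpha>. (LBINT z. d i j \<alpha> z * (TI T z * pd_x \<alpha> (f i j) z)))
    + L23 / 2 * (\<Sum>i j k. (LBINT z. d j k k z * (TI T z * pd_x i (f i j) z))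
     + (LBINT z. d i k k z * (TI T z * pd_x j (f i j) z))
     - 2/3 * (LBINT z. d k i i z * (TI T z * pd_x k (f j j) z)))" (is "set_lebesgue_integral _ _ ?G = ?R")
 proof -
  define F where "F z = L1 * (\<Sum>i j \<alpha>. d i j \<alpha> z * (TI T z * pd_x \<alpha> (f i j) z))
    + L23 / 2 * (\<Sum>i j k. d j k k z * (TI T z * pd_x i (f i j) z)
     + d i k k z * (TI T z * pd_x j (f i j) z) - 2/3 * (d k i i z * (TI T z * pd_x k (f j j) z)))" for z
  have F: "ind W z *\<^sub>R ?G z = F z" for z
   unfolding F_def px TI_W(2)[OF p, symmetric] by (cases "z \<in> W") (simp_all add: mult.assoc)
  have "(LBINT z. F z) = ?R"
   unfolding F_def using l2_mult_int[OF d_l2 test_l2(2)[OF p]] by simp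
  thus ?thesis unfolding set_lebesgue_integral_def F ST_lborel .
 qed
 have "(\<Sum>i j. (LBINT z. g i j z * (TI T z * f i j z))) =
   (\<Sum>i j. (LBINT x. qT i j x * f i j (T, x))) - (\<Sum>i j. (LBINT x. q0 i j x * f i j (0, x)))
   - (\<Sum>i j. (LBINT z. q i j z * (TI T z * pd_t (f i j) z)))"
  by (simp only: weak_derivative_t[OF p] sum_subtractf)
 thus ?thesis
  using limit_Q[of f, OF p] unfolding I1 I2 I3 I4 I5 by (simp only: distrib_left)
qed

lemma sol_equation_r:
 assumes t: "test_fun T \<phi>"
 shows "(LINT z:W|ST. rsol (fst z) (snd z) * pd_t \<phi> z) - (LINT x:Omega|lborel. rsol T x * \<phi> (T, x)) + (LINT x:Omega|lborel. rF (Q0 x) * \<phi> (0, x))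
  = - (LINT z:W|ST. frob (PF (Qsol (fst z) (snd z))) (\<chi> i j. g i j z) * \<phi> z)"
proof -
 note p = test_fun_tst[OF t]
 note [measurable] = test_measurable[OF p]
 have bO: "x \<in> box 0 1 \<Longrightarrow> x \<in> Omega" for x using box_subset_cbox[of 0 "1::pt"] by (auto simp: Omega_def)
 have I1: "(LINT z:W|ST. rsol (fst z) (snd z) * pd_t \<phi> z) = (LBINT z. r z * (TI T z * pd_t \<phi> z))"
  by (rule W_integral1[OF borel_measurable_integrable[OF l2_mult_int[OF r_l2 test_l2(3)[OF p]]]], simp)
   (simp add: TI_W(3)[OF p, symmetric] rsol_r)
 have I2: "(LINT x:Omega|lborel. rsol T x * \<phi> (T, x)) = (LBINT x. rT x * \<phi> (T, x))"
 proof -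
  have "ind Omega x *\<^sub>R (rsol T x * \<phi> (T, x)) = rT x * \<phi> (T, x)" for x
   using tstD(5)[OF p, of T x] T_pos bO[of x] by (cases "x \<in> box 0 1") (auto simp: rsol_def)
  thus ?thesis unfolding set_lebesgue_integral_def by (simp only:)
 qed
 have I3: "(LINT x:Omega|lborel. rF (Q0 x) * \<phi> (0, x)) = (LBINT x. r0 x * \<phi> (0, x))"
 proof -
  have "ind Omega x *\<^sub>R (rF (Q0 x) * \<phi> (0, x)) = r0 x * \<phi> (0, x)" for x
   using tstD(5)[OF p, of 0 x] T_pos bO[of x] by (cases "x \<in> box 0 1") (auto simp: r0_def)
  thus ?thesis unfolding set_lebesgue_integral_def by (simp only:)
 qed
 have I4: "(LINT z:W|ST. frob (PF (Qsol (fst z) (snd z))) (\<chi> i j. g i j z) * \<phi> z) = (\<Sum>i j. (LBINT z. g i j z * ((TI T z * \<phi> z) * pq i j z)))"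
 proof (rule W_integral[OF g_l2 test_l2(4)[OF p]])
  show "(\<lambda>z. frob (PF (Qsol (fst z) (snd z))) (\<chi> i j. g i j z) * \<phi> z) \<in> bm" by (simp add: frob_def)
  fix z :: "real \<times> pt" assume z: "fst z \<noteq> T"
  show "ind W z * (frob (PF (Qsol (fst z) (snd z))) (\<chi> i j. g i j z) * \<phi> z) = (\<Sum>i j. g i j z * ((TI T z * \<phi> z) * pq i j z))"
   unfolding TI_W(1)[OF p, symmetric] by (simp add: frob_def Qsol_Qv[OF z] pq_def sum_distrib_left sum_distrib_right indicator_def mult_ac)
 qed
 show ?thesis using limit_r[OF p] unfolding I1 I2 I3 I4 by simp
qed

text \<open>\<open>Omega\<close> and its interior differ by a null set, and the extended data agree
  with \<open>Q0\<close>, its gradient and \<open>r(Q0)\<close> on the interior.\<close>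

lemma E0_eq: "E0 = 1/2 * (LINT x:Omega|lborel. L1 * (\<Sum>m. (fnorm (DQ0 m x))^2)
  + L23 * (\<Sum>j. (\<Sum>i. DQ0 i x $ i $ j)^2) + (rF (Q0 x))^2)"
proof -
 define F where "F x = L1 * (\<Sum>i j m. (d0 i j m x)^2) + L23 * (\<Sum>j. (\<Sum>i. d0 i j i x)^2) + (r0 x)^2" for x
 define G where "G x = L1 * (\<Sum>m. (fnorm (DQ0 m x))^2) + L23 * (\<Sum>j. (\<Sum>i. DQ0 i x $ i $ j)^2) + (rF (Q0 x))^2" for x
 have G: "G x = L1 * (\<Sum>i j m. (DQ0 m x $ i $ j)^2) + L23 * (\<Sum>j. (\<Sum>i. DQ0 i x $ i $ j)^2) + (rF (Q0 x))^2" for x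
  using sum_fnorm_sq[of "\<lambda>i j m. DQ0 m x $ i $ j"] by (simp add: G_def)
 have "set_lebesgue_integral lborel Omega G = (LBINT x. F x)"
 proof (rule set_integral_AE)
  show "AE x in lborel. ind Omega x * G x = F x"
   using AE_Omega_box by eventually_elim (simp add: G F_def d0_def r0_def indicator_def)
  show "F \<in> bmL"
   unfolding F_def[abs_def] using l2_meas[OF d0_l2] l2_meas[OF r0_l2] by simp
  have m: "(\<lambda>x. \<chi> i j. ind Omega x * Q0 x $ i $ j) \<in> bmL"
   using borel_measurable_mat3[of "\<lambda>x. \<chi> i j. ind Omega x * Q0 x $ i $ j" lborel] Q0_measurable by simp
  have m2: "(\<lambda>x. ind Omega x * (rF (\<chi> i j. ind Omega x * Q0 x $ i $ j))^2) \<in> bmL"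
   using measurable_compose[OF m rF_measurable] by (simp add: Omega_def)
  define v where "v i j m x = ind Omega x * DQ0 m x $ i $ j" for i j m x
  have v: "v i j m \<in> bmL" for i j m unfolding v_def[abs_def] by (rule DQ0_measurable)
  have "ind Omega x * G x = L1 * (\<Sum>i j m. (v i j m x)^2)
    + L23 * (\<Sum>j. (\<Sum>i. v i j i x)^2)
    + ind Omega x * (rF (\<chi> i j. ind Omega x * Q0 x $ i $ j))^2" for x
   by (cases "x \<in> Omega") (simp_all add: v_def G)
  thus "(\<lambda>x. ind Omega x * G x) \<in> bmL" using m2 v by simp
 qed
 moreover have "integrable lborel (\<lambda>x. (\<Sum>i. d0 i j i x)^2)" for j by (intro l2_int l2_sum d0_l2)
 hence "(LBINT x. F x) = 2 * E0"
  unfolding F_def using l2_int[OF d0_l2] l2_int[OF r0_l2] by (simp add: E0_def nrm_sq)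
 ultimately show ?thesis unfolding G_def by linarith
qed

end

text \<open>\<open>S\<close> is the projection onto symmetric trace-free matrices. Being linear and
  the identity on \<open>F\<close>, it maps the weak limit to a weak limit of the same sequence,
  which now satisfies the constraint at every point.\<close>

lemma wlim_sym_tf:
 fixes F :: "3 \<Rightarrow> 3 \<Rightarrow> nat \<Rightarrow> 'a \<Rightarrow> real"
 assumes w: "\<And>i j. wlim M (F i j) (q i j)" and s: "\<And>m z. sym_tf (\<chi> i j. F i j m z)"
 shows "\<exists>q'. (\<forall>i j. wlim M (F i j) (q' i j)) \<and> (\<forall>z. sym_tf (\<chi> i j. q' i j z))"
proof -
 define S where "S u i j z = 1/2 * (u i j z + u j i z) + (if i = j then - 1/3 else 0) * (\<Sum>k. u k k z)" for u :: "3 \<Rightarrow> 3 \<Rightarrow> 'a \<Rightarrow> real" and i j z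
 have FS: "S (\<lambda>i j. F i j m) i j z = F i j m z" for i j m z
  using s[of m z] by (simp add: sym_tf_iff S_def)
 have "wlim M (\<lambda>m z. S (\<lambda>i j. F i j m) i j z) (S q i j)" for i j
  unfolding S_def by (intro wlim_add wlim_cmult wlim_sum w)
 moreover have "sym_tf (\<chi> i j. S q i j z)" for z
  by (simp add: sym_tf_iff S_def sum_3 add.commute) (simp add: field_simps)
 ultimately show ?thesis unfolding FS by blast
qed

text \<open>Cauchy-Schwarz on each time slice, then integration in time: the pairing of functions
  bounded in time with functions integrable in time, both with values in \<open>L2\<close>.\<close>

lemma slice_duality:
 fixes f G :: "real \<times> pt \<Rightarrow> real"
 assumes f: "f \<in> bm" "AE t in lborel. l2L (\<lambda>x. f (t, x)) \<and> nrmL (\<lambda>x. f (t, x)) \<le> C"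
  and G: "G \<in> bm" "AE t in lborel. l2L (\<lambda>x. G (t, x))" "integrable lborel (\<lambda>t. nrmL (\<lambda>x. G (t, x)))"
  and C: "0 \<le> C"
 shows "integrable lborel (\<lambda>z. f z * G z)" (is ?g1) and "\<bar>\<integral>z. f z * G z \<partial>lborel\<bar> \<le> C * (LBINT t. nrmL (\<lambda>x. G (t, x)))"
proof -
 let ?n = "\<lambda>t. nrmL (\<lambda>x. G (t, x))"
 have "(NN z. ennreal \<bar>f z * G z\<bar>) = (NN t x. ennreal \<bar>f (t, x) * G (t, x)\<bar>)"
  by (rule nn_integral_lborel_pair) (use f(1) G(1) in simp)
 also have "\<dots> \<le> (NN t. ennreal (C * ?n t))"
 proof (rule nn_integral_mono_AE)
  show "AE t in lborel. (NN x. ennreal \<bar>f (t, x) * G (t, x)\<bar>) \<le> ennreal (C * ?n t)"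
   using f(2) G(2)
  proof eventually_elim
   case (elim t)
   have a: "l2L (\<lambda>x. \<bar>u x\<bar>)" "nrmL (\<lambda>x. \<bar>u x\<bar>) = nrmL u" if "l2L u" for u :: "pt \<Rightarrow> real"
    by (rule l2_bound[OF that]) (use l2_meas[OF that] in \<open>auto simp: nrm_def\<close>)
   note ab = a[OF conjunct1[OF elim(1)]] a[OF elim(2)]
   have "(LBINT x. \<bar>f (t, x)\<bar> * \<bar>G (t, x)\<bar>) \<le> C * ?n t"
    using l2_cauchy_schwarz[OF ab(1,3)] mult_right_mono[OF conjunct2[OF elim(1)], of "?n t"] unfolding ab(2,4) by simp
   thus ?case
    unfolding abs_mult by (subst nn_integral_eq_integral[OF l2_mult_int[OF ab(1,3)]]) (simp_all add: ennreal_leI)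
  qed
 qed
 also have "\<dots> = ennreal (C * (LBINT t. ?n t))"
  using nn_integral_eq_integral[of lborel "\<lambda>t. C * ?n t"] G(3) C by simp
 finally have le: "(NN z. ennreal \<bar>f z * G z\<bar>) \<le> ennreal (C * (LBINT t. ?n t))" .
 show i: ?g1
  by (rule integrableI_bounded) (use f(1) G(1) le_less_trans[OF le] in auto)
 have "(LBINT z. \<bar>f z * G z\<bar>) \<le> C * (LBINT t. ?n t)"
  using le C unfolding nn_integral_eq_integral[OF integrable_abs[OF i] AE_I2[OF abs_ge_zero]]
  by (subst (asm) ennreal_le_iff) (auto intro!: mult_nonneg_nonneg)
 thus "\<bar>\<integral>z. f z * G z \<partial>lborel\<bar> \<le> C * (LBINT t. ?n t)"
  using integral_abs_bound[of lborel "\<lambda>z. f z * G z"] by linarith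
qed

lemma uniform_approximation_limit:
 fixes X :: "nat \<Rightarrow> real"
 assumes "\<And>K m. \<bar>X m - Y K m\<bar> \<le> \<delta> K" "\<And>K. \<bar>x - y K\<bar> \<le> \<delta> K" "\<And>K. Y K \<longlonglongrightarrow> y K" "\<delta> \<longlonglongrightarrow> (0 :: real)"
 shows "X \<longlonglongrightarrow> x"
proof (rule LIMSEQ_I)
 fix e :: real assume e: "e > 0"
 have "\<forall>\<^sub>F K in sequentially. \<delta> K < e / 3" by (rule order_tendstoD(2)[OF assms(4)]) (use e in simp)
 then obtain K where K: "\<delta> K < e / 3" by (auto simp: eventually_sequentially)
 have "e / 3 > 0" using e by simp
 from LIMSEQ_D[OF assms(3)[of K] this] obtain m0 where m0: "\<And>m. m \<ge> m0 \<Longrightarrow> \<bar>Y K m - y K\<bar> < e / 3" by auto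
 have "\<bar>X m - x\<bar> < e" if "m \<ge> m0" for m using assms(1)[of m K] assms(2)[of K] K m0[OF that] by linarith
 thus "\<exists>m0. \<forall>m\<ge>m0. norm (X m - x) < e" by auto
qed

context scheme_limit
begin

lemma ssq_AE: "l2L f \<Longrightarrow> AE t in lborel. integrable lborel (\<lambda>x. (f (t, x))^2)"
 using integral_lborel_pair(2)[OF l2_int] .

lemma slices_AE:
 "AE t in lborel. t \<noteq> T \<and> (\<forall>i j. integrable lborel (\<lambda>x. (q i j (t, x))^2)) \<and> (\<forall>i j \<alpha>. integrable lborel (\<lambda>x. (d i j \<alpha> (t, x))^2))
   \<and> (\<forall>j. integrable lborel (\<lambda>x. (\<Sum>i. d i j i (t, x))^2)) \<and> integrable lborel (\<lambda>x. (r (t, x))^2)"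
 using ssq_AE[OF q_l2] ssq_AE[OF d_l2] ssq_AE[OF div_l2] ssq_AE[OF r_l2] AE_lborel_singleton[of T]
 by (simp add: AE_all_countable)

lemma hh_nonneg: "0 \<le> hh t"
 unfolding hh_def by (intro sum_nonneg Bochner_Integration.integral_nonneg) simp

lemma en_parts: "L1 * (\<Sum>i j \<alpha>. ssq (d i j \<alpha>) t) \<le> 2 * en t" (is ?g1) "ssq r t \<le> 2 * en t"
proof -
 have "0 \<le> ssq f t" for f unfolding ssq_def by (rule Bochner_Integration.integral_nonneg) simp
 hence "0 \<le> L1 * (\<Sum>i j \<alpha>. ssq (d i j \<alpha>) t)" "0 \<le> L23 * (\<Sum>j. ssq (\<lambda>z. \<Sum>i. d i j i z) t)" "0 \<le> ssq r t"
  using L1_pos L2_pos L3_pos by (auto intro!: mult_nonneg_nonneg sum_nonneg)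
 thus ?g1 "ssq r t \<le> 2 * en t"
  unfolding en_def by simp_all
qed

lemma r_slice_bound: "AE t in lborel. t \<in> {0..T} \<longrightarrow> ssq r t \<le> 2 * E0"
 using energy_limit
proof eventually_elim
 case (elim t)
 have "0 \<le> hh t / M" using hh_nonneg[of t] M_pos by simp
 thus ?case using elim en_parts(2)[of t] by auto
qed

lemma Linf_L2_sol: "Linf_L2 T (\<lambda>z. rsol (fst z) (snd z))"
 unfolding Linf_L2_def set_borel_measurable_def ST_lborel
proof (intro conjI exI[of _ "2 * E0"])
 show "(\<lambda>z. ind ({0..T} \<times> Omega) z *\<^sub>R rsol (fst z) (snd z)) \<in> bmL"
  using W_sets unfolding W_def by simp
 show "AE t in lborel. t \<in> {0..T} \<longrightarrow> (\<integral>\<^sup>+x\<in>Omega. ennreal ((rsol (fst (t, x)) (snd (t, x)))^2) \<partial>lborel) \<le> ennreal (2 * E0)" (is "AE t in _. _ \<longrightarrow> ?P t")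
  using r_slice_bound slices_AE
 proof eventually_elim
  case (elim t)
  show ?case
  proof
   assume t: "t \<in> {0..T}"
   have "(\<integral>\<^sup>+x\<in>Omega. ennreal ((rsol (fst (t, x)) (snd (t, x)))^2) \<partial>lborel) \<le> (NN x. ennreal ((r (t, x))^2))"
    using elim by (intro nn_integral_mono) (auto simp: rsol_def indicator_def)
   also have "\<dots> = ennreal (ssq r t)" unfolding ssq_def using elim by (intro nn_integral_eq_integral) auto
   also have "\<dots> \<le> ennreal (2 * E0)" using elim t by (intro ennreal_leI) auto
   finally show "?P t" .
  qed
 qed
qed

lemma Q_H1_bound:
 "AE t in lborel. t \<in> {0..T} \<longrightarrow> (\<integral>\<^sup>+x\<in>Omega. ennreal ((fnorm (Qsol t x))^2 + (\<Sum>\<alpha>. (fnorm (\<chi> i j. d i j \<alpha> (t, x)))^2)) \<partial>lborel)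
   \<le> ennreal (9 * CQ^2 + 2 * E0 / L1)" (is "AE t in _. _ \<longrightarrow> ?P t")
proof -
 have "AE t in lborel. \<forall>i j. t \<in> {0..T} \<longrightarrow> ssq (q i j) t \<le> CQ^2" unfolding AE_all_countable by (intro allI q_slice_bound)
 with energy_limit slices_AE show ?thesis
 proof eventually_elim
  case (elim t)
  show ?case
  proof
   assume t: "t \<in> {0..T}"
   define F where "F x = (\<Sum>i j. (q i j (t, x))^2) + (\<Sum>i j \<alpha>. (d i j \<alpha> (t, x))^2)" for x
   have F: "(fnorm (Qsol t x))^2 + (\<Sum>\<alpha>. (fnorm (\<chi> i j. d i j \<alpha> (t, x)))^2) = F x" for x
    using elim unfolding sum_fnorm_sq F_def by (simp add: fnorm_norm norm_sq_components Qsol_def qz_def)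
   have "(\<integral>\<^sup>+x\<in>Omega. ennreal (F x) \<partial>lborel) \<le> (NN x. ennreal (F x))"
    by (intro nn_integral_mono) (auto simp: indicator_def)
   also have "\<dots> = ennreal (LBINT x. F x)"
    unfolding F_def using elim by (intro nn_integral_eq_integral) (auto intro!: add_nonneg_nonneg sum_nonneg)
   also have "\<dots> \<le> ennreal (9 * CQ^2 + 2 * E0 / L1)"
   proof (rule ennreal_leI)
    have "(LBINT x. F x) = (\<Sum>i j. ssq (q i j) t) + (\<Sum>i j \<alpha>. ssq (d i j \<alpha>) t)"
     unfolding F_def ssq_def using elim by simp
    also have "(\<Sum>i j. ssq (q i j) t) \<le> (\<Sum>i\<in>(UNIV::3 set). \<Sum>j\<in>(UNIV::3 set). CQ^2)" using elim t by (intro sum_mono) auto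
    also have "(\<Sum>i j \<alpha>. ssq (d i j \<alpha>) t) \<le> 2 * E0 / L1"
    proof -
     have "0 \<le> hh t / M" using hh_nonneg[of t] M_pos by simp
     hence "en t \<le> E0" using elim t by linarith
     thus ?thesis using en_parts(1)[of t] L1_pos by (simp add: pos_le_divide_eq mult.commute)
    qed
    finally show "(LBINT x. F x) \<le> 9 * CQ^2 + 2 * E0 / L1" by simp
   qed
   finally show "?P t" unfolding F .
  qed
 qed
qed

lemma Omega_integral_le:
 fixes F :: "pt \<Rightarrow> real"
 assumes "integrable lborel F" "\<And>x. 0 \<le> F x" shows "(LINT x:Omega|lborel. F x) \<le> (LBINT x. F x)"
 unfolding set_lebesgue_integral_def by (rule integral_mono') (use assms in \<open>auto simp: indicator_def\<close>)

lemma sol_energy: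
 "AE t in lborel. t \<in> {0..T} \<longrightarrow>
  1/2 * (LINT x:Omega|lborel. L1 * (\<Sum>m. (fnorm (\<chi> i j. d i j m (t, x)))^2)
    + L23 * (\<Sum>j. (\<Sum>i. (\<chi> i' j. d i' j i (t, x)) $ i $ j)^2) + (rsol t x)^2)
  \<le> 1/2 * (LINT x:Omega|lborel. L1 * (\<Sum>m. (fnorm (DQ0 m x))^2)
    + L23 * (\<Sum>j. (\<Sum>i. DQ0 i x $ i $ j)^2) + (rF (Q0 x))^2)
   - M * (LINT z:{0..t} \<times> Omega|ST. (fnorm ((1/M) *\<^sub>R (\<chi> i j. g i j z)))^2)" (is "AE t in _. _ \<longrightarrow> ?P t")
 using energy_limit slices_AE
proof eventually_elim
 case (elim t)
 show ?case
 proof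
  assume t: "t \<in> {0..T}"
  define F where "F x = L1 * (\<Sum>i j m. (d i j m (t, x))^2) + L23 * (\<Sum>j. (\<Sum>i. d i j i (t, x))^2) + (r (t, x))^2" for x
  have F0: "0 \<le> F x" for x unfolding F_def using L1_pos L2_pos L3_pos by (intro add_nonneg_nonneg mult_nonneg_nonneg sum_nonneg) auto
  have "(LINT x:Omega|lborel. F x) \<le> (LBINT x. F x)"
   by (rule Omega_integral_le[OF _ F0]) (use elim in \<open>simp add: F_def\<close>)
  also have "\<dots> = 2 * en t" unfolding F_def en_def ssq_def using elim by simp
  finally have 1: "1/2 * (LINT x:Omega|lborel. F x) \<le> en t" by simp
  define G where "G z = (\<Sum>i j. (ind {0..t} (fst z) * g i j z)^2)" for z
  let ?H = "LINT z:{0..t} \<times> Omega|ST. (fnorm ((1/M) *\<^sub>R (\<chi> i j. g i j z)))^2"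
  have gi: "integrable lborel (\<lambda>z. (ind {0..t} (fst z) * g i j z)^2)" for i j
   by (intro l2_int l2_mult_bounded[OF g_l2 slab_indicator_measurable, of _ 1]) auto
  have "?H \<le> (LBINT z. (1/M)^2 * G z)"
   unfolding set_lebesgue_integral_def ST_lborel
  proof (rule integral_mono')
   show "integrable lborel (\<lambda>z. (1/M)^2 * G z)" unfolding G_def using gi by simp
   fix z :: "real \<times> pt"
   show "0 \<le> (1/M)^2 * G z" by (simp add: G_def sum_nonneg)
   show "ind ({0..t} \<times> Omega) z *\<^sub>R (fnorm ((1/M) *\<^sub>R (\<chi> i j. g i j z)))^2 \<le> (1/M)^2 * G z"
    by (auto simp: G_def fnorm_norm norm_sq_components power_divide indicator_def sum_nonneg mem_Times_iff divide_right_mono simp flip: sum_divide_distrib)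
  qed
  also have "\<dots> = (1/M)^2 * hh t" unfolding G_def hh_def using gi by simp
  finally have "M * ?H \<le> M * ((1/M)^2 * hh t)"
   using M_pos by (intro mult_left_mono) auto
  hence 2: "M * ?H \<le> hh t / M"
   using M_pos by (simp add: power2_eq_square)
  have eF: "L1 * (\<Sum>m. (fnorm (\<chi> i j. d i j m (t, x)))^2)
    + L23 * (\<Sum>j. (\<Sum>i. (\<chi> i' j. d i' j i (t, x)) $ i $ j)^2) + (rsol t x)^2 = F x" for x
   using elim unfolding sum_fnorm_sq by (simp add: F_def rsol_def)
  have "en t + hh t / M \<le> E0" using elim t by blast
  thus "?P t"
   using 1 2 unfolding eF E0_eq[symmetric] by linarith
 qed
qed

lemma limit_weak_sol: "weak_sol a b c A0 L1 L2 L3 M T Q0 Qsol rsol"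
 unfolding weak_sol_def Let_def
proof (intro conjI exI[of _ "\<lambda>\<alpha> z. \<chi> i j. d i j \<alpha> z"] exI[of _ "\<lambda>z. \<chi> i j. g i j z"] exI[of _ DQ0] ballI allI impI)
 have mW: "(\<lambda>z. ind ({0..T} \<times> Omega) z *\<^sub>R F z) \<in> bmL" if "\<And>i j. (\<lambda>z. F z $ i $ j) \<in> bm" for F :: "real \<times> pt \<Rightarrow> mat3"
  using borel_measurable_mat3[of F lborel] that W_sets unfolding W_def by simp
 show "sym_tf (Qsol t x)" for t x by (rule Qsol_sym_tf)
 show "set_borel_measurable ST ({0..T} \<times> Omega) (\<lambda>z. Qsol (fst z) (snd z))"
  "set_borel_measurable ST ({0..T} \<times> Omega) (\<lambda>z. \<chi> i j. d i j \<alpha> z)" "set_borel_measurable ST ({0..T} \<times> Omega) (\<lambda>z. \<chi> i j. g i j z)" for \<alpha>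
  unfolding set_borel_measurable_def ST_lborel by (rule mW, simp add: Qsol_cp)+
 show "weak_dx T (\<lambda>z. Qsol (fst z) (snd z)) \<alpha> (\<lambda>z. \<chi> i j. d i j \<alpha> z)" for \<alpha> by (rule weak_dx_sol)
 show "\<exists>C. AE t in lborel. t \<in> {0..T} \<longrightarrow> (\<integral>\<^sup>+x\<in>Omega. ennreal ((fnorm (Qsol t x))^2 + (\<Sum>\<alpha>. (fnorm (\<chi> i j. d i j \<alpha> (t, x)))^2)) \<partial>lborel) \<le> ennreal C"
  using Q_H1_bound by blast
 show "weak_dt T (\<lambda>z. Qsol (fst z) (snd z)) (\<lambda>z. \<chi> i j. g i j z)" by (rule weak_dt_sol)
 show "(\<integral>\<^sup>+z\<in>{0..T} \<times> Omega. ennreal ((fnorm (\<chi> i j. g i j z))^2) \<partial>ST) < \<infinity>"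
 proof -
  have "(\<integral>\<^sup>+z\<in>{0..T} \<times> Omega. ennreal ((fnorm (\<chi> i j. g i j z))^2) \<partial>ST) \<le> (NN z. ennreal (\<Sum>i j. (g i j z)^2))"
   unfolding ST_lborel by (intro nn_integral_mono) (auto simp: indicator_def fnorm_norm norm_sq_components)
  also have "\<dots> = ennreal (LBINT z. (\<Sum>i j. (g i j z)^2))"
   using l2_int[OF g_l2] by (intro nn_integral_eq_integral) (auto intro!: sum_nonneg)
  finally show ?thesis by (rule le_less_trans) simp
 qed
 show "Linf_L2 T (\<lambda>z. rsol (fst z) (snd z))" by (rule Linf_L2_sol)
 show "weak_d Q0 \<alpha> (DQ0 \<alpha>)" for \<alpha> using DQ0 by (auto simp: H1_def)
qed (use sol_equation_Q sol_equation_r sol_energy in \<open>(simp only: W_def)+\<close>)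

section \<open>Convergence of the interpolations\<close>

abbreviation "QI m \<equiv> Q_interp a b c A0 L1 L2 L3 M T Q0 (N m) (NT m)"
abbreviation "RI m \<equiv> r_interp a b c A0 L1 L2 L3 M T Q0 (N m) (NT m)"

lemma interp_eq:
 assumes t: "0 \<le> t" "t \<le> T"
 shows "QI m t x $ i $ j = Qf i j m (t, x)" (is ?g1)
  and "RI m t x = Rf m (t, x)"
proof -
 have "t < real (nn m) * dt m" using t T_pos unfolding nn_dt by linarith
 thus ?g1
  "RI m t x = Rf m (t, x)"
  using t by (simp_all add: Q_interp_def r_interp_def Qf_def Rf_def tsf_def st_def QS_def RS_def dT_def)
qed

lemma Q_convergence:
 "(\<lambda>m. \<integral>\<^sup>+z\<in>{0..T} \<times> Omega. ennreal ((fnorm (QI m (fst z) (snd z) - Qsol (fst z) (snd z)))^2) \<partial>ST) \<longlonglongrightarrow> 0" (is "?X \<longlonglongrightarrow> 0")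
proof -
 define E where "E i j m z = ind W z * Qf i j m z - ind W z * q i j z" for i j m z
 have S: "slimL (\<lambda>m z. ind W z * Qf i j m z) (\<lambda>z. ind W z * q i j z)" for i j by (rule Qf_strong[OF q_lim])
 note El = slim_diff_l2[OF S, folded E_def]
 have "?X m = (NN z. ennreal (\<Sum>i j. (E i j m z)^2))" for m
  unfolding ST_lborel
 proof (rule nn_integral_cong_AE)
  show "AE z in lborel. ennreal ((fnorm (QI m (fst z) (snd z) - Qsol (fst z) (snd z)))^2) * indicator ({0..T} \<times> Omega) z
   = ennreal (\<Sum>i j. (E i j m z)^2)"
   using AE_time_neq[of T]
  proof eventually_elim
   case (elim z)
   show ?case
   proof (cases "z \<in> W")
    case True
    hence "0 \<le> fst z" "fst z \<le> T" by (auto simp: W_def)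
    thus ?thesis using True elim by (simp add: fnorm_norm norm_sq_components interp_eq Qsol_cp qz_def E_def flip: W_def)
   qed (simp add: E_def flip: W_def)
  qed
 qed
 also have "(NN z. ennreal (\<Sum>i j. (E i j m z)^2)) = ennreal (\<Sum>i j. (nrmL (E i j m))^2)" for m
  using l2_int[OF El] by (subst nn_integral_eq_integral) (auto intro!: sum_nonneg simp: nrm_sq)
 finally have e: "?X m = ennreal (\<Sum>i j. (nrmL (E i j m))^2)" for m .
 have "(\<lambda>m. \<Sum>i j. (nrmL (E i j m))^2) \<longlonglongrightarrow> (\<Sum>i\<in>(UNIV::3 set). \<Sum>j\<in>(UNIV::3 set). 0^2)"
  unfolding E_def[abs_def] by (intro tendsto_intros slimD(3)[OF S])
 thus ?thesis unfolding e using tendsto_ennrealI by fastforce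
qed

text \<open>The test function is only integrable in time, while weak convergence of
  \<open>Rf\<close> is tested with square integrable functions of space-time. Removing the times at
  which its slice norm \<nu> exceeds \<open>k\<close> makes it square integrable; by
  \<open>slice_duality\<close> the removed part costs at most \<open>C\<close> times the tail
  integral of \<nu>, uniformly in \<open>m\<close>.\<close>

lemma r_convergence: "weak_star_Linf_L2 T RI rsol"
 unfolding weak_star_Linf_L2_def
proof (intro allI impI)
 fix \<gamma> assume L: "L1_L2 T \<gamma>"
 define G where "G z = ind W z * \<gamma> z" for z
 define \<nu> where "\<nu> t = nrmL (\<lambda>x. G (t, x))" for t
 let ?\<nu> = "\<lambda>k t. ind {t. \<nu> t > real k} t * \<nu> t"
 define B where "B k z = ind {t. \<nu> t \<le> real k} (fst z) * G z" for k z
 have Gm [measurable]: "G \<in> bm"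
  using L by (simp add: L1_L2_def set_borel_measurable_def ST_lborel G_def[abs_def] W_def)
 have Gx [measurable]: "(\<lambda>x. G (t, x)) \<in> bm" for t by simp
 have Gt: "G (t, x) = ind {0..T} t * (ind Omega x * \<gamma> (t, x))" for t x by (simp add: G_def W_def indicator_def)
 have "AE t in lborel. t \<in> {0..T} \<longrightarrow> set_integrable lborel Omega (\<lambda>x. (\<gamma> (t, x))^2)" using L by (simp add: L1_L2_def)
 hence Gl: "AE t in lborel. l2L (\<lambda>x. G (t, x))"
 proof eventually_elim
  case (elim t)
  have "(G (t, x))^2 = ind {0..T} t * (ind Omega x *\<^sub>R (\<gamma> (t, x))^2)" for x by (simp add: Gt indicator_def)
  thus ?case using elim Gx[of t] by (cases "t \<in> {0..T}") (simp_all add: l2_def set_integrable_def)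
 qed
 have \<nu>e: "\<nu> t = ind {0..T} t *\<^sub>R sqrt (LINT x:Omega|lborel. (\<gamma> (t, x))^2)" for t
  by (auto simp: \<nu>_def nrm_def Gt set_lebesgue_integral_def indicator_def power_mult_distrib if_distrib intro!: Bochner_Integration.integral_cong)
 hence \<nu>i: "integrable lborel \<nu>" using L unfolding L1_L2_def set_integrable_def \<nu>e[abs_def] by blast
 have \<nu>0: "0 \<le> \<nu> t" for t by (simp add: \<nu>_def)
 have km: "{t. \<nu> t \<le> real k} \<in> sets borel" for k using borel_measurable_integrable[OF \<nu>i] by simp
 have Bm: "B k \<in> bm" for k unfolding B_def[abs_def] using slab_indicator_measurable[OF km[of k]] Gm by simp
 \<comment> \<open>At the retained times \<open>\<nu>^2 \<le> k * \<nu>\<close>, so the squared norm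
   is at most \<open>k\<close> times the integral of \<nu>.\<close>
 have Bl: "l2L (B k)" for k
 proof (rule nn_integral_sq_le_imp(1))
  show "B k \<in> bmL" using Bm by simp
  define C where "C = real k * (LBINT t. \<nu> t)"
  have C0: "0 \<le> C" using \<nu>0 by (simp add: C_def)
  have "(NN z. ennreal ((B k z)^2)) = (NN t x. ennreal ((B k (t, x))^2))"
   by (rule nn_integral_lborel_pair) (use Bm in simp)
  also have "\<dots> \<le> (NN t. ennreal (real k * \<nu> t))"
  proof (rule nn_integral_mono_AE)
   show "AE t in lborel. (NN x. ennreal ((B k (t, x))^2)) \<le> ennreal (real k * \<nu> t)"
    using Gl
   proof eventually_elim
    case (elim t)
    show ?case
    proof (cases "\<nu> t \<le> real k")
     case True
     hence "(NN x. ennreal ((B k (t, x))^2)) = ennreal ((\<nu> t)^2)"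
      using nn_integral_sq_eq[OF elim] by (simp add: B_def \<nu>_def)
     also have "\<dots> \<le> ennreal (real k * \<nu> t)" unfolding power2_eq_square using True \<nu>0 by (intro ennreal_leI mult_right_mono)
     finally show ?thesis .
    qed (simp add: B_def)
   qed
  qed
  also have "\<dots> = ennreal ((sqrt C)^2)" using nn_integral_eq_integral[of lborel "\<lambda>t. real k * \<nu> t"] \<nu>i \<nu>0 C0 by (simp add: C_def)
  finally show "(NN z. ennreal ((B k z)^2)) \<le> ennreal ((sqrt C)^2)" .
  show "0 \<le> sqrt C" using C0 by simp
 qed
 \<comment> \<open>A bound for the slice norms common to all \<open>Rf m\<close>, by
   \<open>nrm_Rs_le\<close>, and to the limit, by \<open>r_slice_bound\<close>.\<close>
 define C where "C = sqrt (2 * CE) + sqrt (2 * E0)"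
 have E00: "0 \<le> 2 * E0" using LIMSEQ_le_const[OF EN0_tendsto, of 0] EN_nonneg[OF NT_pos] by simp
 hence C0: "0 \<le> C" using CE(1) by (simp add: C_def)
 define \<delta> where "\<delta> k = C * (LBINT t. ?\<nu> k t)" for k
 have key: "\<bar>(LBINT z. f z * G z) - (LBINT z. f z * B k z)\<bar> \<le> \<delta> k"
  if f: "f \<in> bm" "AE t in lborel. l2L (\<lambda>x. f (t, x)) \<and> nrmL (\<lambda>x. f (t, x)) \<le> C" for f k
 proof -
  have s: "G (t, x) - B k (t, x) = ind {t. \<nu> t > real k} t * G (t, x)" for t x by (auto simp: B_def indicator_def)
  have n: "nrmL (\<lambda>x. G (t, x) - B k (t, x)) = ?\<nu> k t" for t
   unfolding s nrm_cmult \<nu>_def by simp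
  have km': "{t. \<nu> t > real k} \<in> sets borel" using borel_measurable_integrable[OF \<nu>i] by simp
  have i: "integrable lborel (?\<nu> k)"
   by (rule Bochner_Integration.integrable_bound[OF \<nu>i]) (use km' borel_measurable_integrable[OF \<nu>i] in \<open>auto simp: indicator_def\<close>)
  have il: "AE t in lborel. l2L (\<lambda>x. G (t, x) - B k (t, x))"
   unfolding s using Gl by eventually_elim (rule l2_cmult)
  have Bs: "l2L (\<lambda>x. B k (t, x))" "nrmL (\<lambda>x. B k (t, x)) \<le> \<nu> t" if "l2L (\<lambda>x. G (t, x))" for t
   using l2_cmult[OF that] \<nu>0 by (auto simp: B_def nrm_cmult \<nu>_def indicator_def)
  have "integrable lborel (\<lambda>z. f z * G z)"
   by (rule slice_duality(1)[OF f Gm Gl _ C0]) (use \<nu>i in \<open>simp add: \<nu>_def[abs_def]\<close>)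
  moreover have d: "integrable lborel (\<lambda>z. f z * (G z - B k z))" "\<bar>\<integral>z. f z * (G z - B k z) \<partial>lborel\<bar> \<le> \<delta> k"
   using slice_duality[OF f _ il _ C0] i Bm[of k] unfolding n \<delta>_def by auto
  ultimately have "integrable lborel (\<lambda>z. f z * G z - f z * (G z - B k z))" by (intro Bochner_Integration.integrable_diff)
  hence "integrable lborel (\<lambda>z. f z * B k z)" by (simp add: algebra_simps)
  thus ?thesis
   using d(2) Bochner_Integration.integral_diff[OF \<open>integrable lborel (\<lambda>z. f z * G z)\<close>, of "\<lambda>z. f z * B k z"] by (simp add: right_diff_distrib)
 qed
 \<comment> \<open>The slice bound of \<open>r\<close> is known on \<open>[0, T]\<close> only, and
   \<open>G\<close> is supported in these times.\<close>
 define r' where "r' z = TI T z * r z" for z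
 have r'l: "l2L r'" unfolding r'_def[abs_def] by (rule l2_mult_bounded[OF r_l2 _ TI_bound]) simp
 have "(\<lambda>m. \<integral>z. Rf m z * G z \<partial>lborel) \<longlonglongrightarrow> (LBINT z. r' z * G z)"
 proof (rule uniform_approximation_limit)
  have "AE t in lborel. l2L (\<lambda>x. Rf m (t, x)) \<and> nrmL (\<lambda>x. Rf m (t, x)) \<le> C" for m
  proof (rule AE_I2)
   fix t
   have "sqrt (2 * CE) \<le> C" using E00 by (simp add: C_def)
   hence n: "nrmL (st (h m) (Rs m n)) \<le> C" for n using nrm_Rs_le order_trans by blast
   show "l2L (\<lambda>x. Rf m (t, x)) \<and> nrmL (\<lambda>x. Rf m (t, x)) \<le> C"
   proof (cases "0 \<le> t \<and> t < real (nn m) * dt m")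
    case True
    hence "(\<lambda>x. Rf m (t, x)) = st (h m) (Rs m (nat \<lfloor>t / dt m\<rfloor>))" by (simp add: Rf_def tsf_def)
    thus ?thesis using st_Rs_l2 n by simp
   next
    case False
    hence "(\<lambda>x. Rf m (t, x)) = (\<lambda>x. 0)" unfolding Rf_def tsf_def by auto
    thus ?thesis using C0 by (simp add: nrm_def)
   qed
  qed
  thus "\<bar>(LBINT z. Rf m z * G z) - (LBINT z. Rf m z * B k z)\<bar> \<le> \<delta> k" for k m
   using l2_meas[OF Rf_l2[of m]] by (intro key) simp_all
  have "AE t in lborel. l2L (\<lambda>x. r' (t, x)) \<and> nrmL (\<lambda>x. r' (t, x)) \<le> C"
   using r_slice_bound slices_AE
  proof eventually_elim
   case (elim t)
   have m: "(\<lambda>x. r (t, x)) \<in> bm" using l2_meas[OF r_l2] by simp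
   show ?case
   proof (cases "t \<in> {0..T}")
    case True
    hence "nrmL (\<lambda>x. r (t, x)) \<le> sqrt (2 * E0)" using elim by (auto simp: nrm_def ssq_def)
    thus ?thesis using True elim m CE(1) by (simp add: r'_def TI_def l2_def C_def add_increasing)
   qed (use C0 in \<open>simp add: r'_def TI_def nrm_def\<close>)
  qed
  thus "\<bar>(LBINT z. r' z * G z) - (LBINT z. r' z * B k z)\<bar> \<le> \<delta> k" for k
   using l2_meas[OF r'l] by (intro key) simp_all
  have TB: "TI T z * B k z = B k z" for k z by (auto simp: B_def G_def W_def TI_def indicator_def)
  hence "(LBINT z. r' z * B k z) = (LBINT z. r z * B k z)" for k
   by (intro Bochner_Integration.integral_cong refl) (metis r'_def mult.assoc mult.commute)
  thus "(\<lambda>m. \<integral>z. Rf m z * B k z \<partial>lborel) \<longlonglongrightarrow> (LBINT z. r' z * B k z)" for k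
   using wlimD(3)[OF r_lim Bl[of k]] by simp
  have "(\<lambda>k. \<integral>t. ?\<nu> k t \<partial>lborel) \<longlonglongrightarrow> (\<integral>t. 0 \<partial>(lborel :: real measure))"
  proof (rule integral_dominated_convergence[OF _ _ \<nu>i])
   show "AE t in lborel. (\<lambda>k. ?\<nu> k t) \<longlonglongrightarrow> 0"
   proof (rule AE_I2)
    fix t
    obtain k0 where "\<nu> t \<le> real k0" using real_arch_simple by blast
    hence "\<forall>k\<ge>k0. ?\<nu> k t = 0" by (auto simp: indicator_def)
    thus "(\<lambda>k. ?\<nu> k t) \<longlonglongrightarrow> 0"
     by (intro tendsto_eventually) (auto simp: eventually_sequentially)
   qed
   show "(?\<nu> k) \<in> bmL" for k
    using borel_measurable_integrable[OF \<nu>i] by simp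
   show "AE t in lborel. norm (?\<nu> k t) \<le> \<nu> t" for k using \<nu>0 by (simp add: indicator_def)
  qed simp
  from tendsto_mult[OF tendsto_const this, of C] show "\<delta> \<longlonglongrightarrow> 0" by (simp add: \<delta>_def[abs_def])
 qed
 moreover have "(LINT z:{0..T} \<times> Omega|ST. RI m (fst z) (snd z) * \<gamma> z) = (LBINT z. Rf m z * G z)" for m
  unfolding set_lebesgue_integral_def ST_lborel W_def[symmetric]
  by (intro Bochner_Integration.integral_cong refl) (auto simp: G_def W_def interp_eq indicator_def)
 moreover have "(LINT z:{0..T} \<times> Omega|ST. rsol (fst z) (snd z) * \<gamma> z) = (LBINT z. r' z * G z)"
  unfolding ST_lborel
 proof (rule set_integral_AE)
  show "AE z in lborel. ind ({0..T} \<times> Omega) z * (rsol (fst z) (snd z) * \<gamma> z) = r' z * G z"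
   using AE_time_neq[of T] by eventually_elim (auto simp: G_def W_def r'_def TI_def rsol_r indicator_def)
  have e: "ind ({0..T} \<times> Omega) z * (rsol (fst z) (snd z) * \<gamma> z) = rsol (fst z) (snd z) * G z" for z by (simp add: G_def W_def)
  show "(\<lambda>z. ind ({0..T} \<times> Omega) z * (rsol (fst z) (snd z) * \<gamma> z)) \<in> bmL"
   unfolding e by simp
  show "(\<lambda>z. r' z * G z) \<in> bmL" using l2_meas[OF r'l] by simp
 qed
 ultimately show "(\<lambda>m. LINT z:{0..T} \<times> Omega|ST. RI m (fst z) (snd z) * \<gamma> z)
   \<longlonglongrightarrow> (LINT z:{0..T} \<times> Omega|ST. rsol (fst z) (snd z) * \<gamma> z)" by simp
qed

end

theorem theorem5p1:
 fixes a b c L1 L2 L3 M A0 T :: real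
  and Q0 :: "pt \<Rightarrow> mat3"
  and N NT :: "nat \<Rightarrow> nat"
 assumes "c > 0" and "L1 > 0" and "L2 > 0" and "L3 > 0" and "M > 0" and "A0 > 0"
  and "\<exists>\<delta>>0. \<forall>Q::mat3. transpose Q = Q \<longrightarrow> bulk a b c A0 Q \<ge> \<delta>"
  and "H1_0 Q0"
  and "AE x in lborel. x \<in> Omega \<longrightarrow> sym_tf (Q0 x)"
  and "T > 0"
  and "\<forall>m. NT m > 0"
  and "(\<lambda>m. mesh (N m)) \<longlonglongrightarrow> 0"
  and "(\<lambda>m. T / real (NT m)) \<longlonglongrightarrow> 0"
 shows "\<exists>\<sigma> Q r. strict_mono \<sigma> \<and> weak_sol a b c A0 L1 L2 L3 M T Q0 Q r \<and>
  (\<lambda>m. \<integral>\<^sup>+z\<in>{0..T} \<times> Omega.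
    ennreal ((fnorm (Q_interp a b c A0 L1 L2 L3 M T Q0 (N (\<sigma> m)) (NT (\<sigma> m)) (fst z) (snd z)
             - Q (fst z) (snd z)))^2) \<partial>ST) \<longlonglongrightarrow> 0 \<and>
  weak_star_Linf_L2 T (\<lambda>m. r_interp a b c A0 L1 L2 L3 M T Q0 (N (\<sigma> m)) (NT (\<sigma> m))) r"
proof -
 interpret S: scheme_seq a b c A0 L1 L2 L3 M T Q0 N NT
  by unfold_locales (use assms in auto)
 obtain s q d g r qT rT where s: "strict_mono s" and w: "\<And>i j. wlimL (\<lambda>m. S.Qf i j (s m)) (q i j)"
  "\<And>i j \<alpha>. wlimL (\<lambda>m. S.Df i j \<alpha> (s m)) (d i j \<alpha>)" "\<And>i j. wlimL (\<lambda>m. S.Hf i j (s m)) (g i j)"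
  "wlimL (\<lambda>m. S.Rf (s m)) r"
  "\<And>i j. wlimL (\<lambda>m. st (S.h (s m)) (cp i j (S.Qs (s m) (NT (s m))))) (qT i j)"
  "wlimL (\<lambda>m. st (S.h (s m)) (S.Rs (s m) (NT (s m)))) rT"
  using S.extraction by blast
 have sy2: "sym_tf (\<chi> i j. st (S.h m) (cp i j (S.Qs m n)) x)" for m x n
  using S.scheme_step(1)[OF S.NT_pos] by (simp add: st_def sym_tf_iff)
 have sy1: "sym_tf (\<chi> i j. S.Qf i j m z)" for m z
  using sy2[of m "nat \<lfloor>fst z / S.dt m\<rfloor>" "snd z"]
  by (cases "0 \<le> fst z \<and> fst z < real (3 * NT m) * S.dt m") (auto simp: S.Qf_def tsf_def sym_tf_iff)
 \<comment> \<open>The limits, in space-time and at time \<open>T\<close>, are replaced by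
   representatives that satisfy the constraints at every point.\<close>
 obtain q' where q': "\<And>i j. wlimL (\<lambda>m. S.Qf i j (s m)) (q' i j)" "\<And>z. sym_tf (\<chi> i j. q' i j z)"
  using wlim_sym_tf[of lborel "\<lambda>i j m. S.Qf i j (s m)", OF w(1) sy1] by blast
 obtain qT' where qT': "\<And>i j. wlimL (\<lambda>m. st (S.h (s m)) (cp i j (S.Qs (s m) (NT (s m))))) (qT' i j)" "\<And>x. sym_tf (\<chi> i j. qT' i j x)"
  using wlim_sym_tf[of lborel "\<lambda>i j m. st (S.h (s m)) (cp i j (S.Qs (s m) (NT (s m))))", OF w(5) sy2] by blast
 \<comment> \<open>The subsequence is itself an admissible sequence of meshes, so everything proved
   in \<open>scheme_seq\<close> holds along it.\<close>
 interpret S': scheme_seq a b c A0 L1 L2 L3 M T Q0 "\<lambda>m. N (s m)" "\<lambda>m. NT (s m)"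
  by unfold_locales (use assms LIMSEQ_subseq_LIMSEQ[OF _ s] in \<open>auto simp: comp_def\<close>)
 interpret L: scheme_limit a b c A0 L1 L2 L3 M T Q0 "\<lambda>m. N (s m)" "\<lambda>m. NT (s m)" q' d g r qT' rT
  by unfold_locales (use w q' qT' in \<open>simp_all add: S.Qf_def S'.Qf_def[abs_def] S.Df_def S'.Df_def[abs_def] S.Hf_def S'.Hf_def[abs_def] S.Rf_def S'.Rf_def[abs_def]\<close>)
 show ?thesis
  by (intro exI[of _ s] exI[of _ L.Qsol] exI[of _ L.rsol] conjI s L.limit_weak_sol L.Q_convergence L.r_convergence)
qed

end
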